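(* Let $r\ge4$, let $\check g_r=2\prod_{j=1}^{r-1}(q^j+1)$, and let $\mathcal Z_{\check g_r}$ be the ring $\mathbb Z[q,q^{-1}]$ with $\check g_r$ inverted. For any commutative $\mathcal Z_{\check g_r}$-algebra $\mathcal Z'$, the algebras $\mathcal S_q^{2.5}(r,r;\mathcal Z')$ and $\mathcal S_q^{1_D}(r,r;\mathcal Z')$ are both Morita equivalent to the algebra $\mathcal S_q^{1.5}(r,r;\mathcal Z')$.
   Context: Let $W$ be the Weyl group of type $B_r$ with Coxeter generators $s_0,\dots,s_{r-1}$ ($s_0s_1$ of order $4$; $s_is_{i+1}$ of order $3$ for $i\ge1$; other pairs commute), $\bar W=\langle s_1,\dots,s_{r-1}\rangle\cong\mathfrak S_r$, $t_1=s_0$, $t_i=s_{i-1}t_{i-1}s_{i-1}$, $u_i=t_1t_i$ ($i\ge2$), $u=s_0s_1s_0$. $\check W=\langle u,s_1,\dots,s_{r-1}\rangle$ is the Weyl group of type $D_r$ with these Coxeter generators. $\check{\mathcal H}'$ is its Hecke algebra over $\mathcal Z'$ with parameter $q$ and standard basis $\{T_w\}_{w\in\check W}$ ($T_s^2=(q-1)T_s+q$). Let $f:\check W\to\check W$, $f(w)=s_0ws_0$ (the flip automorphism interchanging $u$ and $s_1$ and fixing the other generators), and let $\check f$ be the induced algebra automorphism $T_w\mapsto T_{f(w)}$ of $\check{\mathcal H}'$. $\Lambda(r,k)$ is the set of compositions of $k$ with $r$ parts (zeros allowed). $\Pi_2=\Pi_2(r,r)=\bigcup_{r_1+r_2=r}\Lambda(r,r_1)\times\Lambda(r,r_2)$,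 with elements $\lambda=(\lambda^{(1)},\lambda^{(2)})$. $\Pi_{1.5}=\{\lambda\in\Pi_2:|\lambda^{(1)}|\ge|\lambda^{(2)}|\}$; $\Pi_{1_B}=\{\lambda\in\Pi_2:|\lambda^{(1)}|=0\}$. $\bar W_\lambda$ is the Young subgroup of $\bar W$ of the juxtaposition of $\lambda^{(1)},\lambda^{(2)}$, $\bar x_\lambda=\sum_{w\in\bar W_\lambda}T_w$, $\check\pi_0=\check\pi_1=1$, $\check\pi_a=\prod_{i=2}^a(q^{i-1}+T_{u_i})$ and $\check x_\lambda=\check\pi_{|\lambda^{(1)}|}\bar x_\lambda$. For $\lambda\in\Pi_{1_B}$ let $f(\lambda)$ be the index with associated subgroup $f(\bar W_\lambda)$ and $\check x_{f(\lambda)}=\check f(\check x_\lambda)=\sum_{w\in f(\bar W_\lambda)}T_w$. Put $\Pi_{2.5}=\Pi_2\cup f\Pi_{1_B}$ and $\Pi_{1_D}=\Pi_{1_B}\sqcup f(\Pi_{1_B})$ (whether repeated summands are listed once or twice does not affect Morita equivalence classes). For $\kappa\in\{1.5,\,2.5,\,1_D\}$: $\mathcal S_q^{\kappa}(r,r;\mathcal Z')=\mathrm{End}_{\check{\mathcal H}'}\big(\bigoplus_{\lambda\in\Pi_\kappa}\check x_\lambda\check{\mathcal H}'\big)$ (right modules). *)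

theory Defs
  imports
    "HOL-Algebra.Module"
    "HOL-Combinatorics.Perm"
    "HOL-Computational_Algebra.Polynomial_Factorial"
begin

section \<open>Right modules and Morita equivalence\<close>

text \<open>
  Algebras over a commutative ring (a type \<^typ>\<open>'c\<close>) and right modules over them are both
  represented by the record type of \<^theory>\<open>HOL-Algebra.Module\<close>; the library locales
  \<^locale>\<open>module\<close> and \<^locale>\<open>algebra\<close> themselves are confined to commutative rings.
  For a right module \<open>M\<close> over \<open>A\<close>, the expression \<open>a \<odot>\<^bsub>M\<^esub> x\<close> stands for the right action
  \<open>x \<cdot> a\<close>; the multiplicative fields of \<open>M\<close> are irrelevant.
\<close>

locale right_module = abelian_group M
  for A :: "('c, 'a) module" and M :: "('a, 'm) module" (structure) +
  assumes act_closed: "\<lbrakk>a \<in> carrier A; x \<in> carrier M\<rbrakk> \<Longrightarrow> a \<odot> x \<in> carrier M"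
    and act_add_left: "\<lbrakk>a \<in> carrier A; b \<in> carrier A; x \<in> carrier M\<rbrakk>
      \<Longrightarrow> (a \<oplus>\<^bsub>A\<^esub> b) \<odot> x = a \<odot> x \<oplus> b \<odot> x"
    and act_add_right: "\<lbrakk>a \<in> carrier A; x \<in> carrier M; y \<in> carrier M\<rbrakk>
      \<Longrightarrow> a \<odot> (x \<oplus> y) = a \<odot> x \<oplus> a \<odot> y"
    and act_mult: "\<lbrakk>a \<in> carrier A; b \<in> carrier A; x \<in> carrier M\<rbrakk>
      \<Longrightarrow> (a \<otimes>\<^bsub>A\<^esub> b) \<odot> x = b \<odot> (a \<odot> x)"
    and act_one: "x \<in> carrier M \<Longrightarrow> \<one>\<^bsub>A\<^esub> \<odot> x = x"

text \<open>Homomorphisms are extensional functions, so that equality of morphisms is equality in HOL.\<close>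

definition rmod_hom :: "('c, 'a) module \<Rightarrow> ('a, 'm) module \<Rightarrow> ('a, 'n) module \<Rightarrow> ('m \<Rightarrow> 'n) set" where
  "rmod_hom A M N = {f \<in> carrier M \<rightarrow>\<^sub>E carrier N.
     (\<forall>x\<in>carrier M. \<forall>y\<in>carrier M. f (x \<oplus>\<^bsub>M\<^esub> y) = f x \<oplus>\<^bsub>N\<^esub> f y) \<and>
     (\<forall>a\<in>carrier A. \<forall>x\<in>carrier M. f (a \<odot>\<^bsub>M\<^esub> x) = a \<odot>\<^bsub>N\<^esub> f x)}"

definition rmod_iso :: "('c, 'a) module \<Rightarrow> ('a, 'm) module \<Rightarrow> ('a, 'n) module \<Rightarrow> ('m \<Rightarrow> 'n) set" where
  "rmod_iso A M N = {f \<in> rmod_hom A M N. bij_betw f (carrier M) (carrier N)}"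

definition hom_id :: "('a, 'm) module \<Rightarrow> 'm \<Rightarrow> 'm" where
  "hom_id M = (\<lambda>x\<in>carrier M. x)"

definition hom_zero :: "('a, 'm) module \<Rightarrow> ('a, 'n) module \<Rightarrow> 'm \<Rightarrow> 'n" where
  "hom_zero M N = (\<lambda>x\<in>carrier M. \<zero>\<^bsub>N\<^esub>)"

definition hom_add :: "('a, 'm) module \<Rightarrow> ('a, 'n) module \<Rightarrow> ('m \<Rightarrow> 'n) \<Rightarrow> ('m \<Rightarrow> 'n) \<Rightarrow> 'm \<Rightarrow> 'n" where
  "hom_add M N f g = (\<lambda>x\<in>carrier M. f x \<oplus>\<^bsub>N\<^esub> g x)"

text \<open>A scalar \<open>c\<close> acts on a right \<open>A\<close>-module as the element \<open>c \<cdot> 1\<close> of \<open>A\<close>.\<close>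

definition hom_smult ::
    "('c, 'a) module \<Rightarrow> ('a, 'm) module \<Rightarrow> ('a, 'n) module \<Rightarrow> 'c \<Rightarrow> ('m \<Rightarrow> 'n) \<Rightarrow> 'm \<Rightarrow> 'n" where
  "hom_smult A M N c f = (\<lambda>x\<in>carrier M. (c \<odot>\<^bsub>A\<^esub> \<one>\<^bsub>A\<^esub>) \<odot>\<^bsub>N\<^esub> f x)"

definition End_algebra :: "('c, 'a) module \<Rightarrow> ('a, 'm) module \<Rightarrow> ('c, 'm \<Rightarrow> 'm) module" where
  "End_algebra A M = \<lparr>carrier = rmod_hom A M M,
     monoid.mult = compose (carrier M), one = hom_id M,
     zero = hom_zero M M, add = hom_add M M, module.smult = hom_smult A M M\<rparr>"

text \<open>Direct sum of a family of modules indexed by a \<^emph>\<open>finite\<close> set \<open>I\<close>.\<close>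

definition fin_direct_sum :: "'i set \<Rightarrow> ('i \<Rightarrow> ('a, 'm) module) \<Rightarrow> ('a, 'i \<Rightarrow> 'm) module" where
  "fin_direct_sum I M = \<lparr>carrier = (\<Pi>\<^sub>E i\<in>I. carrier (M i)),
     monoid.mult = undefined, one = undefined,
     zero = (\<lambda>i\<in>I. \<zero>\<^bsub>M i\<^esub>), add = (\<lambda>f g. \<lambda>i\<in>I. f i \<oplus>\<^bsub>M i\<^esub> g i),
     module.smult = (\<lambda>a f. \<lambda>i\<in>I. a \<odot>\<^bsub>M i\<^esub> f i)\<rparr>"

text \<open>
  The category of right \<open>A\<close>-modules whose carrier is a subset of the type \<^typ>\<open>'u\<close>, which plays
  the role of a universe. \<open>Fo\<close> and \<open>Fm\<close> are the object and morphism parts of a functor, linear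
  over the common coefficient ring \<^typ>\<open>'c\<close>.
\<close>

locale linear_functor =
  fixes A :: "('c, 'a) module" and B :: "('c, 'b) module"
    and Fo :: "('a, 'u) module \<Rightarrow> ('b, 'u) module"
    and Fm :: "('a, 'u) module \<Rightarrow> ('a, 'u) module \<Rightarrow> ('u \<Rightarrow> 'u) \<Rightarrow> 'u \<Rightarrow> 'u"
  assumes ob: "right_module A M \<Longrightarrow> right_module B (Fo M)"
    and mor: "\<lbrakk>right_module A M; right_module A N; f \<in> rmod_hom A M N\<rbrakk>
      \<Longrightarrow> Fm M N f \<in> rmod_hom B (Fo M) (Fo N)"
    and pres_id: "right_module A M \<Longrightarrow> Fm M M (hom_id M) = hom_id (Fo M)"
    and pres_comp: "\<lbrakk>right_module A M; right_module A N; right_module A P;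
        f \<in> rmod_hom A M N; g \<in> rmod_hom A N P\<rbrakk>
      \<Longrightarrow> Fm M P (compose (carrier M) g f) = compose (carrier (Fo M)) (Fm N P g) (Fm M N f)"
    and pres_add: "\<lbrakk>right_module A M; right_module A N; f \<in> rmod_hom A M N; g \<in> rmod_hom A M N\<rbrakk>
      \<Longrightarrow> Fm M N (hom_add M N f g) = hom_add (Fo M) (Fo N) (Fm M N f) (Fm M N g)"
    and pres_smult: "\<lbrakk>right_module A M; right_module A N; f \<in> rmod_hom A M N\<rbrakk>
      \<Longrightarrow> Fm M N (hom_smult A M N c f) = hom_smult B (Fo M) (Fo N) c (Fm M N f)"

text \<open>A natural isomorphism from the identity functor to an endofunctor \<open>(Fo, Fm)\<close>.\<close>

definition nat_iso_from_id :: "('c, 'a) module \<Rightarrow> (('a, 'u) module \<Rightarrow> ('a, 'u) module) \<Rightarrow>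
    (('a, 'u) module \<Rightarrow> ('a, 'u) module \<Rightarrow> ('u \<Rightarrow> 'u) \<Rightarrow> 'u \<Rightarrow> 'u) \<Rightarrow>
    (('a, 'u) module \<Rightarrow> 'u \<Rightarrow> 'u) \<Rightarrow> bool" where
  "nat_iso_from_id A Fo Fm \<eta> \<longleftrightarrow>
     (\<forall>M. right_module A M \<longrightarrow> \<eta> M \<in> rmod_iso A M (Fo M)) \<and>
     (\<forall>M N. right_module A M \<longrightarrow> right_module A N \<longrightarrow> (\<forall>f\<in>rmod_hom A M N.
        compose (carrier M) (\<eta> N) f = compose (carrier M) (Fm M N f) (\<eta> M)))"

text \<open>
  Morita equivalence of algebras over \<^typ>\<open>'c\<close>: their categories of right modules are equivalent,
  as \<^typ>\<open>'c\<close>-linear categories. HOL cannot quantify over types inside a formula, so the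
  universe \<^typ>\<open>'u\<close> is a parameter; the notion is meant to be used with \<^typ>\<open>'u\<close> an
  \<^emph>\<open>arbitrary infinite\<close> type (infinite, so that with \<open>M\<close> every summand of \<open>M\<^sup>n\<close> has a copy with
  carrier in \<^typ>\<open>'u\<close>; arbitrary, so that it can be as large as one likes).
\<close>

definition morita_equivalent :: "'u itself \<Rightarrow> ('c, 'a) module \<Rightarrow> ('c, 'b) module \<Rightarrow> bool" where
  "morita_equivalent U A B \<longleftrightarrow>
     (\<exists>(Fo :: ('a, 'u) module \<Rightarrow> ('b, 'u) module) Fm (Go :: ('b, 'u) module \<Rightarrow> ('a, 'u) module) Gm.
        linear_functor A B Fo Fm \<and> linear_functor B A Go Gm \<and>
        (\<exists>\<eta>. nat_iso_from_id A (Go \<circ> Fo) (\<lambda>M N f. Gm (Fo M) (Fo N) (Fm M N f)) \<eta>) \<and>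
        (\<exists>\<epsilon>. nat_iso_from_id B (Fo \<circ> Go) (\<lambda>M N f. Fm (Go M) (Go N) (Gm M N f)) \<epsilon>))"


section \<open>The coefficient ring\<close>

text \<open>
  \<open>qv\<close> is the indeterminate, and \<open>gpoly r\<close> is the polynomial \<open>2 (q + 1) (q\<^sup>2 + 1) \<dots>\<close> with last
  factor \<open>q ^ (r - 1) + 1\<close>. \<open>Zloc r\<close> is the ring of Laurent polynomials over the integers with
  \<open>gpoly r\<close> inverted, as a subring of the field of rational functions.
\<close>

abbreviation qv :: "int poly" where "qv \<equiv> [:0, 1:]"

definition gpoly :: "nat \<Rightarrow> int poly" where
  "gpoly r = 2 * (\<Prod>j = 1..r - 1. qv ^ j + 1)"

definition Zloc :: "nat \<Rightarrow> int poly fract set" where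
  "Zloc r = {to_fract p / to_fract (qv ^ m * gpoly r ^ n) | p m n. True}"

text \<open>
  A commutative algebra over \<open>Zloc r\<close> is a commutative ring with a unital ring homomorphism from
  \<open>Zloc r\<close>. The sort \<open>{comm_ring, comm_monoid_mult}\<close>, rather than \<open>comm_ring_1\<close>, is used
  so as not to exclude the zero ring.
\<close>

definition Zloc_algebra :: "nat \<Rightarrow> (int poly fract \<Rightarrow> 'c::{comm_ring,comm_monoid_mult}) \<Rightarrow> bool" where
  "Zloc_algebra r \<phi> \<longleftrightarrow> \<phi> 1 = 1 \<and>
     (\<forall>x\<in>Zloc r. \<forall>y\<in>Zloc r. \<phi> (x + y) = \<phi> x + \<phi> y \<and> \<phi> (x * y) = \<phi> x * \<phi> y)"


section \<open>Hecke algebras\<close>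

text \<open>
  The generators below are involutions, so the submonoid they generate is a subgroup.
\<close>

definition generated :: "'g::monoid_mult set \<Rightarrow> 'g set" where
  "generated S = prod_list ` lists S"

definition word_length :: "'g::monoid_mult set \<Rightarrow> 'g \<Rightarrow> nat" where
  "word_length S w = (LEAST n. \<exists>ws\<in>lists S. length ws = n \<and> prod_list ws = w)"

text \<open>
  \<^typ>\<open>'h\<close> with scalar multiplication \<open>sc\<close> is the Hecke algebra with parameter \<open>q\<close> of the finite
  Coxeter group with generators \<open>S\<close>, and \<open>T\<close> is its standard basis.
\<close>

locale hecke_algebra =
  fixes S :: "'g::monoid_mult set"
    and q :: "'c::{comm_ring,comm_monoid_mult}"
    and sc :: "'c \<Rightarrow> 'h::{ring,monoid_mult} \<Rightarrow> 'h"
    and T :: "'g \<Rightarrow> 'h"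
  assumes sc_add_left: "sc (a + b) x = sc a x + sc b x"
    and sc_add_right: "sc a (x + y) = sc a x + sc a y"
    and sc_sc: "sc a (sc b x) = sc (a * b) x"
    and sc_one: "sc 1 x = x"
    and sc_mult_left: "sc a x * y = sc a (x * y)"
    and sc_mult_right: "x * sc a y = sc a (x * y)"
    and basis: "\<exists>!c. (\<forall>w. w \<notin> generated S \<longrightarrow> c w = 0) \<and> x = (\<Sum>w\<in>generated S. sc (c w) (T w))"
    and T_one: "T 1 = 1"
    and T_mult: "\<lbrakk>s \<in> S; w \<in> generated S; word_length S w < word_length S (s * w)\<rbrakk>
      \<Longrightarrow> T s * T w = T (s * w)"
    and T_square: "s \<in> S \<Longrightarrow> T s * T s = sc (q - 1) (T s) + sc q 1"

definition algebra_of :: "('c \<Rightarrow> 'h::{ring,monoid_mult} \<Rightarrow> 'h) \<Rightarrow> ('c, 'h) module" where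
  "algebra_of sc = \<lparr>carrier = UNIV, monoid.mult = (*), one = 1, zero = 0, add = (+), module.smult = sc\<rparr>"

text \<open>The right ideal \<open>x H\<close> as a right module.\<close>

definition principal_right_ideal :: "'h::{ring,monoid_mult} \<Rightarrow> ('h, 'h) module" where
  "principal_right_ideal x = \<lparr>carrier = range (\<lambda>h. x * h), monoid.mult = undefined, one = undefined,
     zero = 0, add = (+), module.smult = (\<lambda>a y. y * a)\<rparr>"


section \<open>Weyl groups of types B and D\<close>

text \<open>
  The Weyl group of type \<open>B\<^sub>r\<close> is realized as the group of signed permutations of
  \<open>{- r..r} - {0}\<close>: \<open>gen_s 0\<close> exchanges \<open>1\<close> and \<open>- 1\<close>, and \<open>gen_s i\<close> exchanges \<open>i\<close> and \<open>i + 1\<close> (and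
  accordingly \<open>- i\<close> and \<open>- i - 1\<close>).
\<close>

definition gen_s :: "nat \<Rightarrow> int perm" where
  "gen_s i = (if i = 0 then Perm.swap 1 (- 1)
          else Perm.swap (int i) (int i + 1) * Perm.swap (- int i) (- int i - 1))"

text \<open>Indexing starts at 1: \<open>refl_t 1 = gen_s 0\<close>, with a dummy value at 0.\<close>

fun refl_t :: "nat \<Rightarrow> int perm" where
  "refl_t 0 = 1"
| "refl_t (Suc 0) = gen_s 0"
| "refl_t (Suc (Suc i)) = gen_s (Suc i) * refl_t (Suc i) * gen_s (Suc i)"

definition elt_u :: "nat \<Rightarrow> int perm" where
  "elt_u i = refl_t 1 * refl_t i"

definition gens_A :: "nat \<Rightarrow> int perm set" where
  "gens_A r = gen_s ` {1..<r}"

definition gens_D :: "nat \<Rightarrow> int perm set" where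
  "gens_D r = insert (gen_s 0 * gen_s 1 * gen_s 0) (gens_A r)"

definition flip_D :: "int perm \<Rightarrow> int perm" where
  "flip_D w = gen_s 0 * w * gen_s 0"

definition block :: "nat list \<Rightarrow> nat \<Rightarrow> int set" where
  "block \<mu> j = {int (sum_list (take j \<mu>)) <.. int (sum_list (take (Suc j) \<mu>))}"

definition young :: "nat \<Rightarrow> nat list \<Rightarrow> int perm set" where
  "young r \<mu> = {w \<in> generated (gens_A r).
     \<forall>j<length \<mu>. Perm.apply w ` block \<mu> j = block \<mu> j}"


section \<open>The endomorphism algebras\<close>

definition compositions :: "nat \<Rightarrow> nat \<Rightarrow> nat list set" where
  "compositions r k = {l. length l = r \<and> sum_list l = k}"

type_synonym bicomp = "nat list \<times> nat list"

definition Pi2 :: "nat \<Rightarrow> bicomp set" where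
  "Pi2 r = (\<Union>(r1, r2) \<in> {(r1, r2). r1 + r2 = r}. compositions r r1 \<times> compositions r r2)"

definition Pi1B :: "nat \<Rightarrow> bicomp set" where
  "Pi1B r = {bc \<in> Pi2 r. sum_list (fst bc) = 0}"

text \<open>In the index sets, \<open>Inl bc\<close> stands for \<open>bc\<close> and \<open>Inr bc\<close> for the formal symbol \<open>f(bc)\<close>.\<close>

definition Ix15 :: "nat \<Rightarrow> (bicomp + bicomp) set" where
  "Ix15 r = Inl ` {bc \<in> Pi2 r. sum_list (fst bc) \<ge> sum_list (snd bc)}"

definition Ix25 :: "nat \<Rightarrow> (bicomp + bicomp) set" where
  "Ix25 r = Inl ` Pi2 r \<union> Inr ` Pi1B r"

definition Ix1D :: "nat \<Rightarrow> (bicomp + bicomp) set" where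
  "Ix1D r = Inl ` Pi1B r \<union> Inr ` Pi1B r"

definition pi_elt :: "'c::{comm_ring,comm_monoid_mult} \<Rightarrow> ('c \<Rightarrow> 'h \<Rightarrow> 'h) \<Rightarrow>
    (int perm \<Rightarrow> 'h::{ring,monoid_mult}) \<Rightarrow> nat \<Rightarrow> 'h" where
  "pi_elt q sc T a = prod_list (map (\<lambda>i. sc (q ^ (i - 1)) 1 + T (elt_u i)) [2..<Suc a])"

fun x_elt :: "nat \<Rightarrow> 'c::{comm_ring,comm_monoid_mult} \<Rightarrow> ('c \<Rightarrow> 'h \<Rightarrow> 'h) \<Rightarrow>
    (int perm \<Rightarrow> 'h::{ring,monoid_mult}) \<Rightarrow> bicomp + bicomp \<Rightarrow> 'h" where
  "x_elt r q sc T (Inl bc) =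
     pi_elt q sc T (sum_list (fst bc)) * (\<Sum>w\<in>young r (fst bc @ snd bc). T w)"
| "x_elt r q sc T (Inr bc) = (\<Sum>w\<in>flip_D ` young r (fst bc @ snd bc). T w)"

definition q_schur :: "(bicomp + bicomp) set \<Rightarrow> nat \<Rightarrow> 'c::{comm_ring,comm_monoid_mult} \<Rightarrow>
    ('c \<Rightarrow> 'h \<Rightarrow> 'h) \<Rightarrow> (int perm \<Rightarrow> 'h::{ring,monoid_mult}) \<Rightarrow>
    ('c, (bicomp + bicomp \<Rightarrow> 'h) \<Rightarrow> (bicomp + bicomp \<Rightarrow> 'h)) module" where
  "q_schur I r q sc T = End_algebra (algebra_of sc)
     (fin_direct_sum I (\<lambda>\<kappa>. principal_right_ideal (x_elt r q sc T \<kappa>)))"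

end

theory Submission
  imports Defs
begin


section \<open>Bicommutants and spectra of commuting elements\<close>

definition bicommutant :: "'a::{ring,monoid_mult} set \<Rightarrow> 'a set" where
  "bicommutant S = {x. \<forall>y. (\<forall>s\<in>S. s * y = y * s) \<longrightarrow> x * y = y * x}"

definition is_unit_elt :: "'a::{ring,monoid_mult} \<Rightarrow> bool" where
  "is_unit_elt x \<longleftrightarrow> (\<exists>y. y * x = 1 \<and> x * y = 1)"

lemma is_unit_elt_mult: "is_unit_elt x \<Longrightarrow> is_unit_elt y \<Longrightarrow> is_unit_elt (x * y)"
proof -
  assume "is_unit_elt x" "is_unit_elt y"
  then obtain a b where a: "a * x = 1" "x * a = 1" and b: "b * y = 1" "y * b = 1"
    unfolding is_unit_elt_def by blast
  have "(b * a) * (x * y) = b * (a * x) * y" by (simp only: mult.assoc)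
  moreover have "(x * y) * (b * a) = x * (y * b) * a" by (simp only: mult.assoc)
  ultimately show ?thesis unfolding is_unit_elt_def using a b by (metis mult_1_right)
qed

lemma is_unit_elt_minus: "is_unit_elt x \<Longrightarrow> is_unit_elt (- x)"
  unfolding is_unit_elt_def by (metis minus_mult_minus)

lemma is_unit_elt_1: "is_unit_elt 1"
  unfolding is_unit_elt_def by (metis mult_1_right)

locale comm_subring =
  fixes C :: "'a::{ring,monoid_mult} set"
  assumes one_closed: "1 \<in> C" and zero_closed: "0 \<in> C"
    and add_closed: "x \<in> C \<Longrightarrow> y \<in> C \<Longrightarrow> x + y \<in> C"
    and mult_closed: "x \<in> C \<Longrightarrow> y \<in> C \<Longrightarrow> x * y \<in> C"
    and minus_closed: "x \<in> C \<Longrightarrow> - x \<in> C"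
    and inverse_closed: "x \<in> C \<Longrightarrow> y * x = 1 \<Longrightarrow> x * y = 1 \<Longrightarrow> y \<in> C"
    and commute: "x \<in> C \<Longrightarrow> y \<in> C \<Longrightarrow> x * y = y * x"
begin

lemma left_commute: "x \<in> C \<Longrightarrow> y \<in> C \<Longrightarrow> x * (y * z) = y * (x * z)"
  by (metis commute mult.assoc)

lemma diff_closed: "x \<in> C \<Longrightarrow> y \<in> C \<Longrightarrow> x - y \<in> C"
  using add_closed minus_closed by (metis diff_conv_add_uminus)

lemma power_closed: "x \<in> C \<Longrightarrow> x ^ n \<in> C"
  by (induction n) (auto intro: one_closed mult_closed)

lemmas closed = one_closed zero_closed add_closed mult_closed minus_closed diff_closed power_closed

lemmas ac = commute left_commute mult.assoc

lemma prod_list_closed: "set xs \<subseteq> C \<Longrightarrow> prod_list xs \<in> C"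
  by (induction xs) (auto intro: closed)

lemma power_mult: "x \<in> C \<Longrightarrow> y \<in> C \<Longrightarrow> (x * y) ^ n = x ^ n * y ^ n"
  by (induction n) (simp_all add: ac closed)

text \<open>
  Congruence modulo the ideal of \<open>C\<close> generated by \<open>d\<close>.
\<close>

definition cong_mod :: "'a \<Rightarrow> 'a \<Rightarrow> 'a \<Rightarrow> bool" where
  "cong_mod d x y \<longleftrightarrow> (\<exists>w\<in>C. x = d * w + y)"

lemma cong_mod_refl: "cong_mod d x x"
  unfolding cong_mod_def by (rule bexI[of _ 0]) (auto intro: closed)

lemma cong_mod_mult:
  assumes "d \<in> C" "x \<in> C" "y \<in> C" "x' \<in> C" "y' \<in> C" "cong_mod d x x'" "cong_mod d y y'"
  shows "cong_mod d (x * y) (x' * y')"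
proof -
  obtain v w where v: "v \<in> C" "x = d * v + x'" and w: "w \<in> C" "y = d * w + y'"
    using assms unfolding cong_mod_def by blast
  have "x * y = d * (v * y + x' * w) + x' * y'"
    using v(1) w(1) assms(1-5) unfolding v(2) w(2)
    by (simp add: algebra_simps ac closed)
  moreover have "v * y + x' * w \<in> C" using v w assms by (auto intro: closed)
  ultimately show ?thesis unfolding cong_mod_def by blast
qed

lemma cong_mod_power:
  assumes "d \<in> C" "x \<in> C" "x' \<in> C" "cong_mod d x x'"
  shows "cong_mod d (x ^ n) (x' ^ n)"
  using assms by (induction n) (auto intro: cong_mod_refl cong_mod_mult closed)

lemma cong_mod_prod_list:
  assumes "X \<in> C" "b \<in> C" "set as \<subseteq> C"
  shows "cong_mod (X - b) (\<Prod>a\<leftarrow>as. X - a) (\<Prod>a\<leftarrow>as. b - a)"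
  using assms(3)
proof (induction as)
  case Nil
  show ?case by (simp add: cong_mod_refl)
next
  case (Cons a as)
  have "X - a = (X - b) * 1 + (b - a)" by simp
  then have "cong_mod (X - b) (X - a) (b - a)" unfolding cong_mod_def using one_closed by blast
  moreover have "(\<Prod>a\<leftarrow>as. X - a) \<in> C" "(\<Prod>a\<leftarrow>as. b - a) \<in> C" "X - a \<in> C" "b - a \<in> C" "X - b \<in> C"
    using Cons assms by (auto intro!: prod_list_closed diff_closed)
  ultimately show ?case
    using Cons by (simp add: cong_mod_mult)
qed

definition unit_on :: "'a \<Rightarrow> 'a \<Rightarrow> bool" where
  "unit_on e z \<longleftrightarrow> (\<exists>w\<in>C. z * (w * e) = e)"

lemma unit_on_unit: "z \<in> C \<Longrightarrow> is_unit_elt z \<Longrightarrow> unit_on e z"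
  unfolding unit_on_def is_unit_elt_def
  by (metis inverse_closed mult.assoc mult_1_left)

lemma unit_on_mult:
  assumes "y \<in> C" "z \<in> C" "e \<in> C" "unit_on e y" "unit_on e z"
  shows "unit_on e (y * z)"
proof -
  obtain v w where v: "v \<in> C" "y * (v * e) = e" and w: "w \<in> C" "z * (w * e) = e"
    using assms unfolding unit_on_def by blast
  have "y * z * (w * v * e) = y * (v * (z * (w * e)))"
    using assms(1-3) v(1) w(1) by (simp add: ac closed)
  also have "\<dots> = e" using v w by simp
  finally show ?thesis unfolding unit_on_def using closed(4)[OF w(1) v(1)] by blast
qed

lemma unit_on_power:
  assumes "z \<in> C" "e \<in> C" "unit_on e z"
  shows "unit_on e (z ^ n)"
proof (induction n)
  case 0
  show ?case unfolding unit_on_def by (rule bexI[of _ 1]) (auto intro: closed)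
next
  case (Suc n)
  then show ?case using assms by (auto intro!: unit_on_mult closed)
qed

lemma unit_on_prod_list:
  assumes "set xs \<subseteq> C" "e \<in> C" "\<And>x. x \<in> set xs \<Longrightarrow> unit_on e x"
  shows "unit_on e (prod_list xs)"
  using assms
proof (induction xs)
  case Nil
  show ?case unfolding unit_on_def by (rule bexI[of _ 1]) (auto intro: closed)
next
  case (Cons a xs)
  then show ?case by (auto intro!: unit_on_mult prod_list_closed)
qed

lemma unit_on_minus: "unit_on e z \<Longrightarrow> unit_on e (- z)"
  unfolding unit_on_def by (metis minus_closed minus_mult_minus mult_minus_left)

lemma unit_on_absorb:
  assumes "unit_on e z" "e \<in> C" "d \<in> C" "e * d = d" "z \<in> C"
  shows "unit_on d z"
proof -
  obtain w where w: "w \<in> C" "z * (w * e) = e" using assms unfolding unit_on_def by blast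
  have "z * (w * d) = z * (w * e) * d" by (simp add: mult.assoc assms(4))
  then show ?thesis using w assms(4) unfolding unit_on_def by auto
qed

text \<open>
  If a product of factors \<open>X - a\<close> vanishes on \<open>e\<close>, then \<open>X - b\<close> is a unit on \<open>e\<close> for every
  \<open>b\<close> that differs from all the roots \<open>a\<close> by units: modulo \<open>X - b\<close> the product is the product
  of the \<open>b - a\<close>.
\<close>

lemma unit_on_diff:
  assumes "X \<in> C" "b \<in> C" "e \<in> C" "set as \<subseteq> C"
    and "(\<Prod>a\<leftarrow>as. X - a) ^ n * e = 0"
    and "\<And>a. a \<in> set as \<Longrightarrow> unit_on e (b - a)"
  shows "unit_on e (X - b)"
proof -
  let ?P = "\<lambda>X. (\<Prod>a\<leftarrow>as. X - a)"
  have PC: "?P X \<in> C" "?P b \<in> C" using assms by (auto intro!: prod_list_closed closed)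
  have "cong_mod (X - b) (?P X ^ n) (?P b ^ n)"
    using PC assms by (intro cong_mod_power cong_mod_prod_list closed) auto
  then obtain w where w: "w \<in> C" "?P X ^ n = (X - b) * w + ?P b ^ n" unfolding cong_mod_def by blast
  have "unit_on e (?P b ^ n)"
    using PC assms by (intro unit_on_power unit_on_prod_list) (auto intro: closed)
  then obtain v where v: "v \<in> C" "?P b ^ n * (v * e) = e" unfolding unit_on_def by blast
  have "((X - b) * w + ?P b ^ n) * e * v = 0" using w assms by simp
  then have "(X - b) * w * e * v + ?P b ^ n * (v * e) = 0"
    using v assms by (simp add: distrib_right mult.assoc commute)
  then have "(X - b) * (w * v * e) = - e"
    using v w assms by (simp add: eq_neg_iff_add_eq_0 ac closed)
  then have "(X - b) * (- (w * v) * e) = e" by simp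
  then show ?thesis unfolding unit_on_def using v w by (meson minus_closed mult_closed)
qed

definition comax :: "'a \<Rightarrow> 'a \<Rightarrow> bool" where
  "comax x y \<longleftrightarrow> (\<exists>s\<in>C. \<exists>t\<in>C. s * x + t * y = 1)"

lemma comax_sym: "comax x y \<Longrightarrow> comax y x"
  unfolding comax_def by (metis add.commute)

lemma comax_mult:
  assumes "x \<in> C" "y \<in> C" "z \<in> C" "comax x z" "comax y z"
  shows "comax (x * y) z"
proof -
  obtain s t s' t' where st: "s \<in> C" "t \<in> C" "s * x + t * z = 1" "s' \<in> C" "t' \<in> C" "s' * y + t' * z = 1"
    using assms unfolding comax_def by blast
  have "1 = (s * x + t * z) * (s' * y + t' * z)" using st by simp
  also have "\<dots> = (s * s') * (x * y) + (s * x * t' + t * (s' * y + t' * z)) * z"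
    using st(1,2,4,5) assms(1-3) by (simp add: algebra_simps ac closed)
  finally show ?thesis unfolding comax_def using st assms by (metis closed(3) closed(4))
qed

lemma comax_one: "comax 1 z"
  unfolding comax_def by (rule bexI[of _ 1], rule bexI[of _ 0]) (auto intro: closed)

lemma comax_prod_list:
  assumes "set xs \<subseteq> C" "z \<in> C" "\<And>x. x \<in> set xs \<Longrightarrow> comax x z"
  shows "comax (prod_list xs) z"
  using assms
  by (induction xs) (auto intro!: comax_mult prod_list_closed comax_one)

lemma comax_power: "x \<in> C \<Longrightarrow> z \<in> C \<Longrightarrow> comax x z \<Longrightarrow> comax (x ^ n) z"
  by (induction n) (auto intro!: comax_mult closed comax_one)

lemma comax_unit_sum:
  assumes "x \<in> C" "y \<in> C" "is_unit_elt (x + y)"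
  shows "comax x y"
proof -
  obtain v where v: "v * (x + y) = 1" "(x + y) * v = 1" using assms unfolding is_unit_elt_def by blast
  then have "v \<in> C" using assms inverse_closed add_closed by blast
  moreover have "v * x + v * y = 1" using v by (simp add: distrib_left)
  ultimately show ?thesis unfolding comax_def by blast
qed

end

lemma bicommutant_comm_subring:
  assumes "\<And>s t. s \<in> S \<Longrightarrow> t \<in> S \<Longrightarrow> s * t = t * s"
  shows "comm_subring (bicommutant S)"
proof (rule comm_subring.intro)
  show "1 \<in> bicommutant S" "0 \<in> bicommutant S" unfolding bicommutant_def by simp_all
  fix x y assume x: "x \<in> bicommutant S"
  show "- x \<in> bicommutant S" using x unfolding bicommutant_def by simp
  show "y \<in> bicommutant S" if y: "y * x = 1" "x * y = 1"
    unfolding bicommutant_def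
  proof (intro CollectI allI impI)
    fix z assume "\<forall>s\<in>S. s * z = z * s"
    then have "x * z = z * x" using x unfolding bicommutant_def by blast
    then have "y * (x * z) * y = y * (z * x) * y" by simp
    then have "(y * x) * (z * y) = (y * z) * (x * y)" by (simp only: mult.assoc)
    then show "y * z = z * y" using y by simp
  qed
  assume y: "y \<in> bicommutant S"
  have xz: "x * z = z * x" and yz: "y * z = z * y" if "\<forall>s\<in>S. s * z = z * s" for z
    using x y that unfolding bicommutant_def by blast+
  show "x + y \<in> bicommutant S"
    unfolding bicommutant_def using xz yz by (simp add: distrib_left distrib_right)
  show "x * y \<in> bicommutant S"
    unfolding bicommutant_def
  proof (intro CollectI allI impI)
    fix z assume z: "\<forall>s\<in>S. s * z = z * s"
    have "x * y * z = x * (z * y)" using yz[OF z] by (simp only: mult.assoc)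
    also have "\<dots> = z * (x * y)" using xz[OF z] by (simp only: mult.assoc[symmetric])
    finally show "x * y * z = z * (x * y)" .
  qed
  have "s * x = x * s" if "s \<in> S" for s
    using x that assms unfolding bicommutant_def by force
  then show "x * y = y * x" using yz by fastforce
qed

lemma bicommutant_mono: "S \<subseteq> S' \<Longrightarrow> bicommutant S \<subseteq> bicommutant S'"
  unfolding bicommutant_def by blast

lemma bicommutant_base: "s \<in> S \<Longrightarrow> s \<in> bicommutant S"
  unfolding bicommutant_def by auto

lemma bicommutant_comm: "x \<in> bicommutant S \<Longrightarrow> (\<And>s. s \<in> S \<Longrightarrow> s * y = y * s) \<Longrightarrow> x * y = y * x"
  unfolding bicommutant_def by auto

section \<open>Hecke algebra relations and Jucys-Murphy elements\<close>

locale hecke_A =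
  fixes r :: nat and Q Qi :: "'a::{ring,monoid_mult}" and g :: "nat \<Rightarrow> 'a"
  assumes Qi_Q: "Qi * Q = 1" and Q_Qi: "Q * Qi = 1"
    and Q_g: "i + 1 < r \<Longrightarrow> Q * g i = g i * Q"
    and quad: "i + 1 < r \<Longrightarrow> g i * g i = (Q - 1) * g i + Q"
    and braid: "i + 2 < r \<Longrightarrow> g i * g (i + 1) * g i = g (i + 1) * g i * g (i + 1)"
    and far: "i + 1 < j \<Longrightarrow> j + 1 < r \<Longrightarrow> g i * g j = g j * g i"
begin

lemma Qi_comm: "Q * x = x * Q \<Longrightarrow> Qi * x = x * Qi"
proof -
  assume "Q * x = x * Q"
  then have "Qi * (Q * x) * Qi = Qi * (x * Q) * Qi" by simp
  then have "(Qi * Q) * (x * Qi) = (Qi * x) * (Q * Qi)" by (simp only: mult.assoc)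
  then show ?thesis by (simp add: Qi_Q Q_Qi)
qed

lemma Qi_g: "i + 1 < r \<Longrightarrow> Qi * g i = g i * Qi"
  by (rule Qi_comm) (rule Q_g)

lemma g_comm_far: "i + 1 < j \<or> j + 1 < i \<Longrightarrow> i + 1 < r \<Longrightarrow> j + 1 < r \<Longrightarrow> g i * g j = g j * g i"
  using far[of i j] far[of j i] by auto

end

lemma comm_mult:
  fixes x :: "'a::semigroup_mult"
  shows "x * y = y * x \<Longrightarrow> x * z = z * x \<Longrightarrow> x * (y * z) = y * z * x"
  by (simp add: mult.assoc[symmetric]) (simp add: mult.assoc)

lemma comm_mult':
  fixes x :: "'a::semigroup_mult"
  shows "y * x = x * y \<Longrightarrow> z * x = x * z \<Longrightarrow> y * z * x = x * (y * z)"
  by (metis mult.assoc)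

text \<open>The image of \<open>J\<close> under the transposition of \<open>n\<close> and \<open>Suc n\<close>.\<close>

definition sw :: "nat \<Rightarrow> nat set \<Rightarrow> nat set" where
  "sw n J = {i. (if i = n then Suc n \<in> J else if i = Suc n then n \<in> J else i \<in> J)}"

lemma in_sw: "i \<in> sw n J \<longleftrightarrow> (if i = n then Suc n \<in> J else if i = Suc n then n \<in> J else i \<in> J)"
  by (simp add: sw_def)

lemma sw_sw: "sw n (sw n J) = J"
  by (rule Set.set_eqI) (simp add: in_sw)

lemma sw_subset: "Suc n < r \<Longrightarrow> J \<subseteq> {..<r} \<Longrightarrow> sw n J \<subseteq> {..<r}"
  by (auto simp: in_sw split: if_splits)

lemma sw_same: "(n \<in> J) = (Suc n \<in> J) \<Longrightarrow> sw n J = J"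
  by (rule Set.set_eqI) (auto simp: in_sw)

lemma sw_neq: "(n \<in> J) \<noteq> (Suc n \<in> J) \<Longrightarrow> sw n J \<noteq> J"
  by (metis in_sw)

locale hecke_B = hecke_A r Q Qi g
  for r :: nat and Q Qi :: "'a::{ring,monoid_mult}" and g :: "nat \<Rightarrow> 'a" +
  fixes t0 :: "'a::{ring,monoid_mult}"
  assumes r_pos: "0 < r"
    and Q_t0: "Q * t0 = t0 * Q"
    and t0_sq: "t0 * t0 = 1"
    and t0_far: "0 < i \<Longrightarrow> i + 1 < r \<Longrightarrow> t0 * g i = g i * t0"
    and braid4: "1 < r \<Longrightarrow> t0 * g 0 * t0 * g 0 = g 0 * t0 * g 0 * t0"
    and units: "j < r \<Longrightarrow> is_unit_elt (1 + Q ^ j)"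
begin

text \<open>
  The normalization makes \<open>JM n\<close> satisfy a polynomial whose roots are signed powers of \<open>Q\<close>.
\<close>

fun JM :: "nat \<Rightarrow> 'a" where
  "JM 0 = t0"
| "JM (Suc n) = Qi * (g n * JM n * g n)"

lemma Q_JM: "n < r \<Longrightarrow> Q * JM n = JM n * Q"
proof (induction n)
  case 0
  show ?case by (simp add: Q_t0)
next
  case (Suc n)
  have "Q * (g n * JM n * g n) = (g n * JM n * g n) * Q"
    using Suc Q_g[of n] by (intro comm_mult) auto
  moreover have "Q * Qi = Qi * Q" by (simp add: Qi_Q Q_Qi)
  ultimately show ?case unfolding JM.simps by (rule comm_mult[rotated])
qed

lemma Qi_JM: "n < r \<Longrightarrow> Qi * JM n = JM n * Qi"
  by (rule Qi_comm) (rule Q_JM)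

lemma g_JM_above: "n < i \<Longrightarrow> i + 1 < r \<Longrightarrow> g i * JM n = JM n * g i"
proof (induction n)
  case 0
  then show ?case by (simp add: t0_far)
next
  case (Suc n)
  have "g i * (g n * JM n * g n) = (g n * JM n * g n) * g i"
    using Suc by (intro comm_mult) (auto simp: g_comm_far)
  moreover have "g i * Qi = Qi * g i" using Suc by (simp add: Qi_g)
  ultimately show ?case unfolding JM.simps by (rule comm_mult[rotated])
qed

lemma g_JM_below: "i + 1 < n \<Longrightarrow> n < r \<Longrightarrow> g i * JM n = JM n * g i"
proof (induction n)
  case (Suc m)
  have Qi: "g i * Qi = Qi * g i" using Suc by (simp add: Qi_g)
  show ?case
  proof (cases "i + 1 < m")
    case True
    then have "g i * (g m * JM m * g m) = (g m * JM m * g m) * g i"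
      using Suc by (intro comm_mult) (auto simp: g_comm_far)
    then show ?thesis unfolding JM.simps by (rule comm_mult[OF Qi])
  next
    case False
    then have m: "m = Suc i" using Suc by simp
    have b: "g i * g (Suc i) * g i = g (Suc i) * g i * g (Suc i)" using braid[of i] Suc m by simp
    have c: "g (Suc i) * JM i = JM i * g (Suc i)" using Suc m by (intro g_JM_above) auto
    have "g i * (g (Suc i) * (g i * JM i * g i) * g (Suc i))
        = (g i * g (Suc i) * g i) * JM i * g i * g (Suc i)" by (simp only: mult.assoc)
    also have "\<dots> = g (Suc i) * g i * (g (Suc i) * JM i) * g i * g (Suc i)"
      unfolding b by (simp only: mult.assoc)
    also have "\<dots> = g (Suc i) * g i * JM i * (g (Suc i) * g i * g (Suc i))"
      unfolding c by (simp only: mult.assoc)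
    also have "\<dots> = (g (Suc i) * (g i * JM i * g i) * g (Suc i)) * g i"
      unfolding b[symmetric] by (simp only: mult.assoc)
    finally have "g i * (g (Suc i) * (g i * JM i * g i) * g (Suc i))
      = (g (Suc i) * (g i * JM i * g i) * g (Suc i)) * g i" .
    moreover have "Qi * (g (Suc i) * (Qi * (g i * JM i * g i)) * g (Suc i))
        = Qi * (Qi * (g (Suc i) * (g i * JM i * g i) * g (Suc i)))"
    proof -
      have "g (Suc i) * (Qi * z) = Qi * (g (Suc i) * z)" for z
        using Qi_g[of "Suc i"] Suc m by (simp add: mult.assoc[symmetric])
      then show ?thesis by (simp only: mult.assoc)
    qed
    ultimately show ?thesis unfolding m JM.simps
      using comm_mult[OF Qi comm_mult[OF Qi]] by simp
  qed
qed simp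

lemma t0_JM: "n < r \<Longrightarrow> t0 * JM n = JM n * t0"
proof (induction n)
  case (Suc n)
  have Qi: "t0 * Qi = Qi * t0" using Qi_comm[OF Q_t0] by simp
  have "t0 * (g n * JM n * g n) = (g n * JM n * g n) * t0"
  proof (cases n)
    case 0
    then show ?thesis using braid4 Suc by (simp add: mult.assoc)
  next
    case (Suc m)
    then show ?thesis using Suc.IH Suc.prems by (intro comm_mult) (auto simp del: JM.simps simp: t0_far)
  qed
  then show ?case unfolding JM.simps by (rule comm_mult[OF Qi])
qed simp

lemma JM_commute_less: "m < n \<Longrightarrow> n < r \<Longrightarrow> JM m * JM n = JM n * JM m"
proof (induction m)
  case 0
  then show ?case by (simp add: t0_JM)
next
  case (Suc m)
  have "JM n * (g m * JM m * g m) = (g m * JM m * g m) * JM n"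
    using Suc by (intro comm_mult) (auto simp: g_JM_below)
  moreover have "JM n * Qi = Qi * JM n" using Suc Qi_JM by simp
  ultimately have "JM n * JM (Suc m) = JM (Suc m) * JM n" unfolding JM.simps by (rule comm_mult[rotated])
  then show ?case by simp
qed

lemma JM_commute: "m < r \<Longrightarrow> n < r \<Longrightarrow> JM m * JM n = JM n * JM m"
  using JM_commute_less[of m n] JM_commute_less[of n m] by (cases m n rule: linorder_cases) auto

lemma Qi_cancel: "Q * (Qi * x) = x" "Qi * (Q * x) = x"
  by (simp_all add: mult.assoc[symmetric] Q_Qi Qi_Q)

text \<open>How \<open>g n\<close> moves past the two adjacent Jucys-Murphy elements.\<close>

lemma g_JM: assumes "Suc n < r" shows "g n * JM n = JM (Suc n) * g n - (Q - 1) * JM (Suc n)"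
proof -
  have "JM (Suc n) * g n = Qi * (g n * JM n * (g n * g n))" by (simp add: mult.assoc)
  also have "\<dots> = Qi * (g n * JM n * ((Q - 1) * g n + Q))" using quad[of n] assms by simp
  also have "\<dots> = Qi * (g n * JM n * (Q - 1) * g n) + Qi * (g n * JM n * Q)"
    by (simp add: distrib_left mult.assoc)
  also have "g n * JM n * Q = Q * (g n * JM n)"
    using Q_JM[of n] Q_g[of n] assms by (intro comm_mult') auto
  also have "g n * JM n * (Q - 1) = (Q - 1) * (g n * JM n)"
    using Q_JM[of n] Q_g[of n] assms
    by (intro comm_mult') (auto simp: algebra_simps)
  also have "Qi * ((Q - 1) * (g n * JM n) * g n) = (Q - 1) * JM (Suc n)"
    by (simp add: algebra_simps Qi_cancel)
  also have "Qi * (Q * (g n * JM n)) = g n * JM n" by (rule Qi_cancel)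
  finally show ?thesis by simp
qed

lemma g_JM_Suc: assumes "Suc n < r" shows "g n * JM (Suc n) = JM n * g n + (Q - 1) * JM (Suc n)"
proof -
  have "g n * JM (Suc n) = Qi * ((g n * g n) * JM n * g n)"
  proof -
    have "g n * (Qi * z) = Qi * (g n * z)" for z
      using Qi_g[of n] assms by (simp add: mult.assoc[symmetric])
    then show ?thesis unfolding JM.simps by (simp only: mult.assoc)
  qed
  also have "\<dots> = Qi * (((Q - 1) * g n + Q) * JM n * g n)" using quad[of n] assms by simp
  also have "\<dots> = JM n * g n + (Q - 1) * JM (Suc n)"
    by (simp add: algebra_simps Qi_cancel)
  finally show ?thesis .
qed

definition phi :: "nat \<Rightarrow> 'a" where
  "phi n = g n * (JM n - JM (Suc n)) + (Q - 1) * JM (Suc n)"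

lemma phi_JM: assumes n: "Suc n < r" shows "phi n * JM n = JM (Suc n) * phi n"
proof -
  define X Y T where "X = JM n" "Y = JM (Suc n)" "T = g n"
  have TX: "T * X = Y * T - (Q - 1) * Y" using g_JM[OF n] unfolding X_Y_T_def .
  have XY: "X * Y = Y * X" unfolding X_Y_T_def using n by (intro JM_commute) auto
  have QY: "Q * Y = Y * Q" unfolding X_Y_T_def using n by (intro Q_JM) auto
  have "(T * (X - Y) + (Q - 1) * Y) * X = T * ((X - Y) * X) + (Q - 1) * (Y * X)"
    by (simp only: distrib_right mult.assoc)
  also have "(X - Y) * X = X * (X - Y)" using XY by (simp add: algebra_simps)
  also have "T * (X * (X - Y)) = (Y * T - (Q - 1) * Y) * (X - Y)"
    unfolding TX[symmetric] by (simp only: mult.assoc)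
  also have "(Y * T - (Q - 1) * Y) * (X - Y) + (Q - 1) * (Y * X)
      = Y * (T * (X - Y)) + (Q - 1) * Y * Y" using XY by (simp add: algebra_simps)
  also have "(Q - 1) * Y * Y = Y * ((Q - 1) * Y)" using QY by (simp add: algebra_simps)
  finally have "(T * (X - Y) + (Q - 1) * Y) * X = Y * (T * (X - Y) + (Q - 1) * Y)"
    by (simp add: distrib_left)
  then show ?thesis unfolding phi_def X_Y_T_def .
qed

lemma phi_sq: assumes n: "Suc n < r"
  shows "phi n * phi n = (Q * JM n - JM (Suc n)) * (Q * JM (Suc n) - JM n)"
proof -
  define X Y T c where "X = JM n" "Y = JM (Suc n)" "T = g n" and c: "c = Q - 1"
  define P where "P = phi n"
  have P: "P = T * (X - Y) + c * Y" unfolding P_def phi_def X_Y_T_def c ..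
  have TX: "T * X = Y * T - c * Y" using g_JM[OF n] unfolding X_Y_T_def c .
  have TY: "T * Y = X * T + c * Y" using g_JM_Suc[OF n] unfolding X_Y_T_def c .
  have XY: "Y * X = X * Y" unfolding X_Y_T_def using n by (intro JM_commute) auto
  have QX: "Q * X = X * Q" and QY: "Q * Y = Y * Q" and QT: "T * Q = Q * T"
    unfolding X_Y_T_def using n Q_JM Q_g[of n] by (auto simp del: JM.simps)
  have cT: "T * c = c * T" unfolding c using QT by (simp add: algebra_simps)
  then have cTz: "T * (c * z) = c * (T * z)" for z by (metis mult.assoc)
  have TT: "T * T = c * T + Q" using quad[of n] n unfolding X_Y_T_def c by simp
  \<comment> \<open>Move every \<open>T\<close> to the left.\<close>
  have XT: "X * T = T * Y - c * Y" using TY by simp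
  have YT: "Y * T = T * X + c * Y" using TX by simp
  have dT: "(X - Y) * T = T * (Y - X) - c * Y - c * Y"
    by (simp only: left_diff_distrib XT YT) (simp add: algebra_simps)
  have "P * T = T * ((X - Y) * T) + c * (Y * T)"
    unfolding P by (simp only: distrib_right mult.assoc)
  also have "\<dots> = (T * T) * (Y - X) - c * (T * Y) - c * (T * Y) + c * (T * X) + c * (c * Y)"
    unfolding dT YT by (simp only: right_diff_distrib distrib_left cTz mult.assoc) simp
  also have "\<dots> = Q * (Y - X) + c * (c * Y) - c * (T * Y)"
    unfolding TT by (simp add: distrib_right right_diff_distrib mult.assoc)
  finally have PT: "P * T = Q * (Y - X) + c * (c * Y) - c * (T * Y)" .
  have cX: "X * c = c * X" and cY: "Y * c = c * Y" unfolding c using QX QY by (simp_all add: algebra_simps)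
  have "(X - Y) * c = c * (X - Y)" using cX cY by (simp add: algebra_simps)
  then have "P * c = c * P" unfolding P
    using cTz cY by (simp only: distrib_left distrib_right mult.assoc)
  moreover have "P * P = P * (T * (X - Y) + c * Y)" by (subst (2) P) (rule refl)
  ultimately have "P * P = P * T * (X - Y) + c * (P * Y)"
    by (simp only: distrib_left mult.assoc[symmetric])
  also have "\<dots> = (Q * (Y - X) + c * (c * Y)) * (X - Y) + c * (c * (Y * Y))
      + c * (T * ((X - Y) * Y - Y * (X - Y)))"
    unfolding PT by (subst P)
      (simp only: left_diff_distrib[of _ _ "X - Y"] right_diff_distrib[of T] right_diff_distrib[of c]
        distrib_left[of c] distrib_right[of _ _ Y] mult.assoc,
        simp add: right_diff_distrib left_diff_distrib mult.assoc)
  also have "(X - Y) * Y - Y * (X - Y) = 0"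
    using XY by (simp add: algebra_simps)
  also have "(Q * (Y - X) + c * (c * Y)) * (X - Y) + c * (c * (Y * Y)) + c * (T * 0)
      = (Q * X - Y) * (Q * Y - X)"
  proof -
    have XYz: "Y * (X * z) = X * (Y * z)" and QXz: "X * (Q * z) = Q * (X * z)"
      and QYz: "Y * (Q * z) = Q * (Y * z)" for z
      using XY QX QY by (metis mult.assoc)+
    show ?thesis unfolding c using XY QX[symmetric] QY[symmetric] XYz QXz QYz
      by (simp add: algebra_simps)
  qed
  finally show ?thesis unfolding P_def X_Y_T_def .
qed

end

section \<open>The spectrum of the Jucys-Murphy elements\<close>

context hecke_B
begin

definition ZI :: "nat set \<Rightarrow> 'a set" where
  "ZI I = bicommutant (insert Q (JM ` I))"

abbreviation "Z \<equiv> ZI {..<r}"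

lemma comm_subring_ZI: "I \<subseteq> {..<r} \<Longrightarrow> comm_subring (ZI I)"
  unfolding ZI_def by (intro bicommutant_comm_subring) (auto simp: Q_JM intro!: JM_commute)

sublocale Z: comm_subring Z
  by (rule comm_subring_ZI) simp

lemma ZI_mono: "I \<subseteq> J \<Longrightarrow> ZI I \<subseteq> ZI J"
  unfolding ZI_def by (intro bicommutant_mono) auto

lemma ZI_Z: "x \<in> ZI I \<Longrightarrow> I \<subseteq> {..<r} \<Longrightarrow> x \<in> Z"
  using ZI_mono by blast

lemma Q_ZI: "I \<subseteq> {..<r} \<Longrightarrow> Q \<in> ZI I"
  unfolding ZI_def by (intro bicommutant_base) auto

lemma Qi_ZI: "I \<subseteq> {..<r} \<Longrightarrow> Qi \<in> ZI I"
  using comm_subring.inverse_closed[OF comm_subring_ZI] Q_ZI Qi_Q Q_Qi by blast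

lemma JM_ZI: "I \<subseteq> {..<r} \<Longrightarrow> n \<in> I \<Longrightarrow> JM n \<in> ZI I"
  unfolding ZI_def by (intro bicommutant_base) auto

lemma g_ZI:
  assumes "x \<in> ZI I" "I \<subseteq> {..<r}" "i + 1 < r" "i \<notin> I" "Suc i \<notin> I"
  shows "g i * x = x * g i"
proof -
  have "JM n * g i = g i * JM n" if "n \<in> I" for n
  proof -
    have "n < r" "n < i \<or> i + 1 < n" proof -
        have "n \<noteq> i" "n \<noteq> Suc i" using that assms by auto
        then show "n < i \<or> i + 1 < n" by linarith
      qed (use that assms in auto)
    then show ?thesis using g_JM_above[of n i] g_JM_below[of i n] assms by auto
  qed
  then have "s * g i = g i * s" if "s \<in> insert Q (JM ` I)" for s
    using that Q_g[of i] assms by auto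
  then have "x * g i = g i * x"
    using assms(1) unfolding ZI_def by (rule bicommutant_comm[rotated])
  then show ?thesis by simp
qed

lemma is_unit_Q: "is_unit_elt Q" "is_unit_elt Qi"
  unfolding is_unit_elt_def using Q_Qi Qi_Q by blast+

lemma is_unit_power: "is_unit_elt x \<Longrightarrow> is_unit_elt (x ^ n)"
  by (induction n) (auto intro: is_unit_elt_mult is_unit_elt_1)

fun roots :: "nat \<Rightarrow> 'a list" where
  "roots 0 = [1]"
| "roots (Suc p) = roots p @ [Q ^ Suc p, Qi ^ Suc p]"

lemma in_roots: "a \<in> set (roots p) \<longleftrightarrow> (\<exists>k\<le>p. a = Q ^ k \<or> a = Qi ^ k)"
proof (induction p)
  case (Suc p)
  show ?case using Suc by (auto simp: le_Suc_eq simp del: power_Suc)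
qed simp

lemma Q_power_cancel: "k \<le> l \<Longrightarrow> Q ^ l * Qi ^ k = Q ^ (l - k)" "k \<le> l \<Longrightarrow> Qi ^ l * Q ^ k = Qi ^ (l - k)"
proof -
  have QQ: "Q ^ k * Qi ^ k = 1" "Qi ^ k * Q ^ k = 1" for k
    using left_right_inverse_power[OF Q_Qi] left_right_inverse_power[OF Qi_Q] by simp_all
  show "Q ^ l * Qi ^ k = Q ^ (l - k)" if "k \<le> l"
  proof -
    have "Q ^ l = Q ^ (l - k) * Q ^ k" using that by (simp flip: power_add)
    then show ?thesis using QQ by (simp add: mult.assoc)
  qed
  show "Qi ^ l * Q ^ k = Qi ^ (l - k)" if "k \<le> l"
  proof -
    have "Qi ^ l = Qi ^ (l - k) * Qi ^ k" using that by (simp flip: power_add)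
    then show ?thesis using QQ by (simp add: mult.assoc)
  qed
qed

lemma unit_sum:
  assumes "a \<in> set (roots p)" "b \<in> set (roots m)" "p + m < r"
  shows "is_unit_elt (a + b)"
proof -
  have Q: "is_unit_elt (Q ^ k)" "is_unit_elt (Qi ^ k)" for k
    using is_unit_Q by (auto intro: is_unit_power)
  have le: "is_unit_elt (Q ^ k + Q ^ l) \<and> is_unit_elt (Qi ^ k + Qi ^ l)" if "k \<le> l" "l < r" for k l
  proof -
    have "Q ^ k + Q ^ l = Q ^ k * (1 + Q ^ (l - k))"
      using that by (simp add: distrib_left flip: power_add)
    moreover have "Qi ^ k + Qi ^ l = Qi ^ l * (1 + Q ^ (l - k))"
      using that Q_power_cancel(2)[of "l - k" l] by (simp add: distrib_left add.commute)
    ultimately show ?thesis using Q units[of "l - k"] that by (auto intro: is_unit_elt_mult)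
  qed
  have mixed: "is_unit_elt (Q ^ k + Qi ^ l)" if "k + l < r" for k l
  proof -
    have "Q ^ k + Qi ^ l = (Q ^ (k + l) + 1) * Qi ^ l"
      using Q_power_cancel(1)[of l "k + l"] by (simp add: distrib_right)
    then show ?thesis using Q units[OF that] by (auto intro: is_unit_elt_mult simp: add.commute)
  qed
  obtain k l where "k \<le> p" "l \<le> m" "a = Q ^ k \<or> a = Qi ^ k" "b = Q ^ l \<or> b = Qi ^ l"
    using assms unfolding in_roots by blast
  moreover have "k \<le> l \<or> l \<le> k" by auto
  ultimately show ?thesis
    using le[of k l] le[of l k] mixed[of k l] mixed[of l k] assms(3) by (auto simp: add.commute)
qed

lemma roots_shift: "a \<in> set (roots p) \<Longrightarrow> Q * a \<in> set (roots (Suc p))"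
proof -
  assume "a \<in> set (roots p)"
  then obtain k where k: "k \<le> p" "a = Q ^ k \<or> a = Qi ^ k" unfolding in_roots by blast
  have "Q * Qi ^ k = (case k of 0 \<Rightarrow> Q ^ 1 | Suc j \<Rightarrow> Qi ^ j)"
    by (auto split: nat.split simp: Qi_cancel)
  then have "Q * a = Q ^ Suc k \<or> Q * a = Q ^ 1 \<or> (\<exists>j<k. Q * a = Qi ^ j)"
    using k by (auto split: nat.splits)
  then show ?thesis unfolding in_roots using k
    by (metis Suc_le_mono le_SucI le_trans less_imp_le_nat One_nat_def Suc_le_eq zero_less_Suc)
qed

lemma closed_Z [simp]:
  "Q \<in> Z" "Qi \<in> Z" "n < r \<Longrightarrow> JM n \<in> Z" "1 \<in> Z" "0 \<in> Z"
  "x \<in> Z \<Longrightarrow> - x \<in> Z" "x \<in> Z \<Longrightarrow> x ^ k \<in> Z"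
  "x \<in> Z \<Longrightarrow> y \<in> Z \<Longrightarrow> x + y \<in> Z"
  "x \<in> Z \<Longrightarrow> y \<in> Z \<Longrightarrow> x - y \<in> Z"
  "x \<in> Z \<Longrightarrow> y \<in> Z \<Longrightarrow> x * y \<in> Z"
  by (auto intro: Q_ZI Qi_ZI JM_ZI Z.closed)

lemma roots_ZI: "I \<subseteq> {..<r} \<Longrightarrow> set (roots p) \<subseteq> ZI I"
proof
  fix a assume I: "I \<subseteq> {..<r}" and "a \<in> set (roots p)"
  then show "a \<in> ZI I" unfolding in_roots
    using comm_subring.power_closed[OF comm_subring_ZI[OF I]] Q_ZI[OF I] Qi_ZI[OF I] by auto
qed

definition F :: "nat \<Rightarrow> 'a \<Rightarrow> 'a" where
  "F p X = (\<Prod>a\<leftarrow>roots p. X - a)"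

lemma F_ZI: "I \<subseteq> {..<r} \<Longrightarrow> X \<in> ZI I \<Longrightarrow> F p X \<in> ZI I"
proof -
  assume I: "I \<subseteq> {..<r}" and X: "X \<in> ZI I"
  interpret C: comm_subring "ZI I" by (rule comm_subring_ZI[OF I])
  show ?thesis unfolding F_def
    using roots_ZI[OF I, of p] X by (intro C.prod_list_closed) (auto intro: C.diff_closed)
qed

lemma F_Z [simp]: "X \<in> Z \<Longrightarrow> F p X \<in> Z"
  by (rule F_ZI) auto

lemma F_Suc: "F (Suc p) X = F p X * ((X - Q ^ Suc p) * (X - Qi ^ Suc p))"
  by (simp only: F_def roots.simps map_append prod_list.append list.map prod_list.Cons prod_list.Nil mult_1_right)

text \<open>
  The roots of \<open>F (Suc p)\<close>, divided by \<open>Q\<close> or by \<open>Qi\<close>, include those of \<open>F p\<close>.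
\<close>

lemma F_shift:
  assumes X: "X \<in> Z" and AB: "(A = Q \<and> B = Qi) \<or> (A = Qi \<and> B = Q)"
  shows "\<exists>v\<in>Z. F (Suc p) (A * X) = F p X * v"
proof -
  have AZ: "A \<in> Z" and BZ: "B \<in> Z" and AB1: "A * B = 1" using AB Q_Qi Qi_Q by auto
  have F_AB: "F (Suc p) Y = F p Y * ((Y - A ^ Suc p) * (Y - B ^ Suc p))" if "Y \<in> Z" for p Y
    using AB that by (auto simp: F_Suc Z.ac simp del: power_Suc)
  have A: "A * X - A ^ Suc p = A * (X - A ^ p)" for p
    by (simp add: right_diff_distrib)
  have B: "A * X - B ^ p = A * (X - B ^ Suc p)" for p
    by (simp add: right_diff_distrib mult.assoc[symmetric] AB1)
  have *: "F p (A * X) * (X - A ^ p) = A ^ (2 * p + 1) * (F p X * (X - B ^ Suc p))" for p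
  proof (induction p)
    case 0
    show ?case using B[of 0] by (simp add: F_def) (use X AZ BZ in \<open>simp add: Z.ac\<close>)
  next
    case (Suc p)
    have "F (Suc p) (A * X) * (X - A ^ Suc p)
        = F p (A * X) * ((A * (X - A ^ p)) * (A * (X - B ^ Suc (Suc p)))) * (X - A ^ Suc p)"
      using X AZ by (simp only: F_AB[of "A * X"] closed_Z A B)
    also have "\<dots> = (F p (A * X) * (X - A ^ p)) * (A * (A * ((X - B ^ Suc (Suc p)) * (X - A ^ Suc p))))"
      using X AZ BZ by (simp add: Z.ac del: power_Suc)
    also have "\<dots> = A ^ (2 * p + 1) * A * A * (F p X * ((X - A ^ Suc p) * (X - B ^ Suc p)) * (X - B ^ Suc (Suc p)))"
      unfolding Suc using X AZ BZ by (simp add: Z.ac del: power_Suc)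
    also have "A ^ (2 * p + 1) * A * A = A ^ (2 * Suc p + 1)"
      using AZ by (simp add: Z.ac)
    also have "F p X * ((X - A ^ Suc p) * (X - B ^ Suc p)) = F (Suc p) X"
      using F_AB[OF X] by simp
    finally show ?case .
  qed
  have "F (Suc p) (A * X) = F p (A * X) * (X - A ^ p) * (A * (A * (X - B ^ Suc (Suc p))))"
    unfolding F_AB[OF closed_Z(10)[OF AZ X]] A B using X AZ BZ by (simp add: Z.ac del: power_Suc)
  also have "\<dots> = F p X * (A ^ (2 * p + 1) * (X - B ^ Suc p) * (A * (A * (X - B ^ Suc (Suc p)))))"
    unfolding * using X AZ BZ by (simp add: Z.ac del: power_Suc)
  finally show ?thesis by (rule bexI) (use X AZ BZ in simp)
qed

lemma F_step:
  assumes "X \<in> Z" "Y \<in> Z" "e \<in> Z" and AB: "(A = Q \<and> B = Qi) \<or> (A = Qi \<and> B = Q)"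
    and e: "F p X ^ N * e = 0"
  shows "\<exists>w\<in>Z. F (Suc p) Y ^ N * e = (Y - A * X) * w * e"
proof -
  have A: "A \<in> Z" using AB by auto
  obtain v where v: "v \<in> Z" "F (Suc p) (A * X) = F p X * v" using F_shift[OF assms(1) AB] by blast
  have "Z.cong_mod (Y - A * X) (F (Suc p) Y ^ N) (F (Suc p) (A * X) ^ N)"
    using assms A roots_ZI[of "{..<r}"] unfolding F_def
    by (intro Z.cong_mod_power Z.cong_mod_prod_list) (simp_all add: F_def[symmetric] del: roots.simps)
  then obtain w where w: "w \<in> Z" "F (Suc p) Y ^ N = (Y - A * X) * w + (F p X * v) ^ N"
    unfolding Z.cong_mod_def v by blast
  have "(F p X * v) ^ N * e = v ^ N * (F p X ^ N * e)"
    using assms v by (simp add: Z.power_mult Z.ac)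
  then show ?thesis using w e by (auto simp: distrib_right intro!: bexI[of _ w])
qed

end

section \<open>The sign idempotents\<close>

lemma intertwine_power: "c * x = y * c \<Longrightarrow> c * x ^ n = y ^ n * (c :: 'a::monoid_mult)"
proof (induction n)
  case (Suc n)
  have "c * x ^ Suc n = (c * x) * x ^ n" by (simp add: mult.assoc)
  also have "\<dots> = y * (c * x ^ n)" using Suc by (simp add: mult.assoc)
  also have "\<dots> = y ^ Suc n * c" using Suc by (simp add: mult.assoc)
  finally show ?case .
qed simp

lemma intertwine_prod_list:
  fixes c :: "'a::{ring,monoid_mult}"
  assumes "c * x = y * c" "\<And>a. a \<in> set as \<Longrightarrow> c * a = a * c"
  shows "c * (\<Prod>a\<leftarrow>as. x - a) = (\<Prod>a\<leftarrow>as. y - a) * c"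
  using assms(2)
proof (induction as)
  case (Cons a as)
  have "c * (x - a) = (y - a) * c" using assms(1) Cons.prems[of a] by (simp add: algebra_simps)
  then have "c * ((x - a) * (\<Prod>a\<leftarrow>as. x - a)) = (y - a) * (c * (\<Prod>a\<leftarrow>as. x - a))"
    by (simp add: mult.assoc[symmetric])
  then show ?case using Cons by (simp add: mult.assoc)
qed simp

context hecke_B
begin

definition sg :: "bool \<Rightarrow> 'a \<Rightarrow> 'a" where
  "sg s X = (if s then X else - X)"

lemma sg_Z [simp]: "X \<in> Z \<Longrightarrow> sg s X \<in> Z"
  by (simp add: sg_def)

text \<open>
  The exponent leaves room for the multiplicities that accumulate from one Jucys-Murphy element
  to the next; for \<open>p = 0\<close> it is 1, so that a first box of a sign satisfies its linear equation
  exactly.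
\<close>

definition ff :: "bool \<Rightarrow> nat \<Rightarrow> 'a \<Rightarrow> 'a" where
  "ff s p X = F p (sg s X) ^ (3 ^ p)"

lemma ff_Z [simp]: "X \<in> Z \<Longrightarrow> ff s p X \<in> Z"
  by (simp add: ff_def)

lemma ff_ZI: "I \<subseteq> {..<r} \<Longrightarrow> X \<in> ZI I \<Longrightarrow> ff s p X \<in> ZI I"
  unfolding ff_def sg_def
  by (auto intro!: comm_subring.power_closed[OF comm_subring_ZI] F_ZI
    comm_subring.minus_closed[OF comm_subring_ZI])

lemma intertwine_ff:
  assumes "c * X = Y * c" "c * Q = Q * c"
  shows "c * ff s p X = ff s p Y * c"
proof -
  have Qi: "c * Qi = Qi * c" using Qi_comm[of c] assms(2) by simp
  have "c * a = a * c" if "a \<in> set (roots p)" for a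
    using that intertwine_power[OF assms(2)] intertwine_power[OF Qi] unfolding in_roots by metis
  moreover have "c * sg s X = sg s Y * c" using assms by (simp add: sg_def)
  ultimately show ?thesis unfolding ff_def F_def
    by (intro intertwine_power intertwine_prod_list)
qed

fun cnt :: "bool \<Rightarrow> nat set \<Rightarrow> nat \<Rightarrow> nat" where
  "cnt s J 0 = 0"
| "cnt s J (Suc n) = cnt s J n + (if (n \<in> J) = s then 1 else 0)"

lemma cnt_sum: "cnt s J n + cnt (\<not> s) J n = n"
  by (induction n) auto

lemma cnt_True_False: "cnt True J n + cnt False J n = n"
  using cnt_sum[of True] by simp

lemma cnt_cong: "(\<And>i. i < n \<Longrightarrow> (i \<in> J) = (i \<in> J')) \<Longrightarrow> cnt s J n = cnt s J' n"
  by (induction n) auto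

definition pj_coeffs :: "nat \<Rightarrow> nat \<Rightarrow> 'a \<times> 'a" where
  "pj_coeffs n p = (SOME (u, v). u \<in> ZI {n} \<and> v \<in> ZI {n} \<and>
     u * ff True p (JM n) + v * ff False (n - p) (JM n) = 1)"

definition pj :: "nat \<Rightarrow> nat \<Rightarrow> bool \<Rightarrow> 'a" where
  "pj n p s = (if s then snd (pj_coeffs n p) * ff False (n - p) (JM n)
     else fst (pj_coeffs n p) * ff True p (JM n))"

lemma ff_comax:
  assumes "n < r" "p \<le> n"
  shows "\<exists>u\<in>ZI {n}. \<exists>v\<in>ZI {n}. u * ff True p (JM n) + v * ff False (n - p) (JM n) = 1"
proof -
  have I: "{n} \<subseteq> {..<r}" using assms by simp
  interpret C: comm_subring "ZI {n}" by (rule comm_subring_ZI[OF I])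
  let ?X = "JM n"
  have X: "?X \<in> ZI {n}" using JM_ZI[OF I] by simp
  have R: "a \<in> ZI {n}" if "a \<in> set (roots p)" for a p using roots_ZI[OF I] that by blast
  have "C.comax (\<Prod>a\<leftarrow>roots p. ?X - a) (\<Prod>b\<leftarrow>roots (n - p). - ?X - b)"
  proof (rule C.comax_prod_list)
    show *: "set (map (\<lambda>a. ?X - a) (roots p)) \<subseteq> ZI {n}" using R X by (auto intro: C.closed)
    show **: "(\<Prod>b\<leftarrow>roots (n - p). - ?X - b) \<in> ZI {n}"
      using R X by (intro C.prod_list_closed) (auto intro: C.diff_closed C.minus_closed)
    fix x assume "x \<in> set (map (\<lambda>a. ?X - a) (roots p))"
    then obtain a where a: "a \<in> set (roots p)" "x = ?X - a" by auto
    have xZ: "x \<in> ZI {n}" using a R X by (auto intro: C.closed)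
    have "C.comax (\<Prod>b\<leftarrow>roots (n - p). - ?X - b) x"
    proof (rule C.comax_prod_list[OF _ xZ])
      show "set (map (\<lambda>b. - ?X - b) (roots (n - p))) \<subseteq> ZI {n}"
        using R X by (auto intro: C.diff_closed C.minus_closed)
      fix y assume "y \<in> set (map (\<lambda>b. - ?X - b) (roots (n - p)))"
      then obtain b where b: "b \<in> set (roots (n - p))" "y = - ?X - b" by auto
      have "is_unit_elt (a + b)" using unit_sum[OF a(1) b(1)] assms by simp
      then have "is_unit_elt (- (a + b))" by (rule is_unit_elt_minus)
      moreover have "y + x = - (a + b)" using a b by simp
      ultimately have "is_unit_elt (y + x)" by (simp only:)
      then show "C.comax y x" using R X a b by (intro C.comax_unit_sum) (auto intro: C.diff_closed C.minus_closed)
    qed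
    then show "C.comax x (\<Prod>b\<leftarrow>roots (n - p). - ?X - b)" by (rule C.comax_sym)
  qed
  then have "C.comax (F p ?X) (F (n - p) (- ?X))" unfolding F_def .
  moreover have FZ: "F p ?X \<in> ZI {n}" "F (n - p) (- ?X) \<in> ZI {n}"
    using X by (auto intro!: F_ZI[OF I] C.minus_closed)
  ultimately have "C.comax (F (n - p) (- ?X) ^ 3 ^ (n - p)) (F p ?X ^ 3 ^ p)"
    by (intro C.comax_power C.power_closed) (auto intro!: C.comax_sym[OF C.comax_power])
  then have "C.comax (F p ?X ^ 3 ^ p) (F (n - p) (- ?X) ^ 3 ^ (n - p))" by (rule C.comax_sym)
  then show ?thesis unfolding C.comax_def ff_def sg_def by simp
qed

lemma pj_coeffs:
  assumes "n < r" "p \<le> n"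
  shows "fst (pj_coeffs n p) \<in> ZI {n}" "snd (pj_coeffs n p) \<in> ZI {n}"
    "fst (pj_coeffs n p) * ff True p (JM n) + snd (pj_coeffs n p) * ff False (n - p) (JM n) = 1"
proof -
  have "case pj_coeffs n p of (u, v) \<Rightarrow> u \<in> ZI {n} \<and> v \<in> ZI {n} \<and>
     u * ff True p (JM n) + v * ff False (n - p) (JM n) = 1"
    unfolding pj_coeffs_def by (rule someI_ex) (use ff_comax[OF assms] in auto)
  then show "fst (pj_coeffs n p) \<in> ZI {n}" "snd (pj_coeffs n p) \<in> ZI {n}"
    "fst (pj_coeffs n p) * ff True p (JM n) + snd (pj_coeffs n p) * ff False (n - p) (JM n) = 1"
    by (simp_all add: split_beta)
qed

lemma pj_ZI: "n < r \<Longrightarrow> p \<le> n \<Longrightarrow> pj n p s \<in> ZI {n}"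
  unfolding pj_def using pj_coeffs[of n p]
  by (auto intro!: comm_subring.mult_closed[OF comm_subring_ZI] ff_ZI JM_ZI)

lemma pj_Z [simp]: "n < r \<Longrightarrow> p \<le> n \<Longrightarrow> pj n p s \<in> Z"
  using ZI_Z[OF pj_ZI] by simp

lemma pj_sum: "n < r \<Longrightarrow> p \<le> n \<Longrightarrow> pj n p s + pj n p (\<not> s) = 1"
  using pj_coeffs(3)[of n p] by (cases s) (auto simp: pj_def add.commute)

lemma cnt_le [simp]: "cnt s J n \<le> n"
  using cnt_sum[of s J n] by simp

lemma pj_factor:
  assumes "n < r"
  shows "\<exists>w\<in>Z. pj n (cnt True J n) s = w * ff (\<not> s) (cnt (\<not> s) J n) (JM n)"
proof -
  have "n - cnt True J n = cnt False J n" using cnt_True_False[of J n] by simp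
  then show ?thesis
    using pj_coeffs[OF assms cnt_le, of True J] ZI_Z[of _ "{n}"] assms
    unfolding pj_def by (cases s) auto
qed

fun eps :: "nat \<Rightarrow> nat set \<Rightarrow> 'a" where
  "eps 0 J = 1"
| "eps (Suc n) J = eps n J * pj n (cnt True J n) (n \<in> J)"

lemma eps_ZI: "n \<le> r \<Longrightarrow> eps n J \<in> ZI {..<n}"
proof (induction n)
  case 0
  show ?case using comm_subring.one_closed[OF comm_subring_ZI, of "{}"] by simp
next
  case (Suc n)
  have "ZI {..<n} \<subseteq> ZI {..<Suc n}" "ZI {n} \<subseteq> ZI {..<Suc n}" by (intro ZI_mono; auto)+
  then show ?case using Suc pj_ZI[of n "cnt True J n"]
    by (auto intro!: comm_subring.mult_closed[OF comm_subring_ZI])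
qed

lemma eps_Z [simp]: "n \<le> r \<Longrightarrow> eps n J \<in> Z"
  using ZI_Z[OF eps_ZI] by auto

lemma eps_cong: "(\<And>i. i < n \<Longrightarrow> (i \<in> J) = (i \<in> J')) \<Longrightarrow> eps n J = eps n J'"
  by (induction n) (auto simp: cnt_cong[of _ J J'])

lemma phi_Q: "Suc n < r \<Longrightarrow> phi n * Q = Q * phi n"
proof -
  assume n: "Suc n < r"
  have *: "g n * Q = Q * g n" "JM n * Q = Q * JM n" "JM (Suc n) * Q = Q * JM (Suc n)"
    using n Q_g[of n] Q_JM by (auto simp del: JM.simps)
  then have "(JM n - JM (Suc n)) * Q = Q * (JM n - JM (Suc n))"
    by (simp add: algebra_simps del: JM.simps)
  then have "g n * (JM n - JM (Suc n)) * Q = Q * (g n * (JM n - JM (Suc n)))"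
    using * by (intro comm_mult') auto
  moreover have "(Q - 1) * JM (Suc n) * Q = Q * ((Q - 1) * JM (Suc n))"
    using * by (intro comm_mult') (auto simp: algebra_simps simp del: JM.simps)
  ultimately show ?thesis unfolding phi_def by (simp only: distrib_left distrib_right)
qed

lemma phi_comm:
  assumes x: "x \<in> Z" "g n * x = x * g n" and n: "Suc n < r"
  shows "phi n * x = x * phi n"
proof -
  have "(JM n - JM (Suc n)) * x = x * (JM n - JM (Suc n))"
    using x n by (intro Z.commute) (auto simp del: JM.simps)
  then have "g n * (JM n - JM (Suc n)) * x = x * (g n * (JM n - JM (Suc n)))"
    using x by (intro comm_mult') auto
  moreover have "(Q - 1) * JM (Suc n) * x = x * ((Q - 1) * JM (Suc n))"
    using x n by (intro Z.commute) (auto simp del: JM.simps)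
  ultimately show ?thesis unfolding phi_def by (simp only: distrib_left distrib_right)
qed

lemma g_eps: "n \<le> i \<Longrightarrow> i + 1 < r \<Longrightarrow> g i * eps n J = eps n J * g i"
  using g_ZI[OF eps_ZI[of n J]] by auto

lemma g_pj: "i + 1 < n \<Longrightarrow> n < r \<Longrightarrow> p \<le> n \<Longrightarrow> g i * pj n p s = pj n p s * g i"
  using g_ZI[OF pj_ZI[of n p s]] by auto

lemma eps_vanish_step:
  assumes n: "n < r"
    and S: "ff s (cnt s J n) (JM n) * ff (\<not> s) (cnt (\<not> s) J n) (JM n) * eps n J = 0"
    and s: "(n \<in> J) = s"
  shows "ff s (cnt s J n) (JM n) * eps (Suc n) J = 0"
proof -
  obtain w where w: "w \<in> Z" "pj n (cnt True J n) s = w * ff (\<not> s) (cnt (\<not> s) J n) (JM n)"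
    using pj_factor[OF n] by blast
  have "ff s (cnt s J n) (JM n) * eps (Suc n) J
      = w * (ff s (cnt s J n) (JM n) * ff (\<not> s) (cnt (\<not> s) J n) (JM n) * eps n J)"
    using s w n by (simp add: Z.ac)
  then show ?thesis using S by simp
qed

text \<open>
  Intertwining with \<open>phi n\<close> carries the equation of \<open>JM n\<close> over to \<open>JM (Suc n)\<close>, up to the factor
  \<open>phi n * phi n\<close>; once the sign at \<open>n\<close> is fixed, this factor is accounted for by the roots
  \<open>Q a\<close> and \<open>Qi a\<close> adjacent to those of \<open>JM n\<close>.
\<close>

lemma eps_vanish:
  "n < r \<Longrightarrow> ff s (cnt s J n) (JM n) * ff (\<not> s) (cnt (\<not> s) J n) (JM n) * eps n J = 0"
proof (induction n arbitrary: s)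
  case 0
  have "ff s 0 t0 * ff (\<not> s) 0 t0 = 0"
    using t0_sq by (cases s) (simp_all add: ff_def F_def sg_def algebra_simps)
  then show ?case by simp
next
  case (Suc n)
  have main: "ff s (cnt s J (Suc n)) (JM (Suc n)) * ff (\<not> s) (cnt (\<not> s) J (Suc n)) (JM (Suc n))
      * eps (Suc n) J = 0" if s: "(n \<in> J) = s" for s
  proof -
    define p m where "p = cnt s J n" and "m = cnt (\<not> s) J n"
    define X Y e where "X = JM n" and "Y = JM (Suc n)" and "e = eps (Suc n) J"
    have Z: "X \<in> Z" "Y \<in> Z" "e \<in> Z" "eps n J \<in> Z"
      unfolding X_def Y_def e_def using Suc.prems by (auto simp del: JM.simps eps.simps)
    define H where "H = (\<lambda>X. ff s p X * ff (\<not> s) m X)"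
    have S: "H X * eps n J = 0" using Suc.IH[of s] Suc.prems unfolding H_def X_def p_def m_def by simp
    have "phi n * H X = H Y * phi n"
      unfolding H_def X_def Y_def
      using intertwine_ff[OF phi_JM[OF Suc.prems] phi_Q[OF Suc.prems]]
      by (metis mult.assoc)
    moreover have "phi n * eps n J = eps n J * phi n"
      using Suc.prems by (intro phi_comm g_eps) auto
    moreover have "H Y * (phi n * phi n) * eps n J = (H Y * phi n) * (phi n * eps n J)"
      by (simp only: mult.assoc)
    ultimately have "H Y * (phi n * phi n) * eps n J = (phi n * H X) * (eps n J * phi n)"
      by (simp only:)
    then have "H Y * (phi n * phi n) * eps n J = phi n * (H X * eps n J) * phi n"
      by (simp only: mult.assoc)
    then have HY: "H Y * ((Q * X - Y) * (Q * Y - X)) * eps n J = 0"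
      using S phi_sq[OF Suc.prems] unfolding X_def Y_def by simp
    have "ff s p X * e = 0"
      unfolding X_def e_def p_def using Suc.IH[of s] Suc.prems s by (intro eps_vanish_step) auto
    then have V: "F p (sg s X) ^ 3 ^ p * e = 0" unfolding ff_def .
    obtain w where w: "w \<in> Z" "F (Suc p) (sg s Y) ^ 3 ^ p * e = (sg s Y - Q * sg s X) * w * e"
      using F_step[OF _ _ Z(3) _ V, of "sg s Y" Q Qi] Z by auto
    obtain w' where w': "w' \<in> Z" "F (Suc p) (sg s Y) ^ 3 ^ p * e = (sg s Y - Qi * sg s X) * w' * e"
      using F_step[OF _ _ Z(3) _ V, of "sg s Y" Qi Q] Z by auto
    define P where "P = F (Suc p) (sg s Y) ^ 3 ^ p"
    have P: "P \<in> Z" unfolding P_def using Z by simp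
    have ez: "\<exists>d\<in>Z. e = eps n J * d" unfolding e_def using Suc.prems by auto
    then obtain d where d: "d \<in> Z" "e = eps n J * d" by blast
    have YX: "(sg s Y - Q * sg s X) * (sg s Y - Qi * sg s X) = - (Qi * ((Q * X - Y) * (Q * Y - X)))"
    proof -
      have "(sg s Y - Q * sg s X) * (sg s Y - Qi * sg s X) = (Y - Q * X) * (Y - Qi * X)"
        by (simp add: sg_def) (simp add: algebra_simps)
      also have "Y - Qi * X = Qi * (Q * Y - X)" by (simp add: right_diff_distrib Qi_cancel)
      finally show ?thesis using Z by (simp add: Z.ac minus_diff_eq[of Y "Q * X", symmetric] del: minus_diff_eq)
    qed
    have "P * P * e = P * ((sg s Y - Qi * sg s X) * w' * e)"
      using w' unfolding P_def by (simp add: mult.assoc)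
    also have "\<dots> = (sg s Y - Qi * sg s X) * w' * (P * e)" using Z P w' by (simp add: Z.ac)
    also have "\<dots> = (sg s Y - Q * sg s X) * (sg s Y - Qi * sg s X) * (w * w' * e)"
      using w unfolding P_def[symmetric] using Z w' by (simp add: Z.ac)
    finally have PP: "P * P * e = - (Qi * ((Q * X - Y) * (Q * Y - X))) * (w * w' * e)"
      unfolding YX .
    obtain v where v: "v \<in> Z" "P = F p (sg s Y) ^ 3 ^ p * v"
    proof
      show "P = F p (sg s Y) ^ 3 ^ p * ((sg s Y - Q ^ Suc p) * (sg s Y - Qi ^ Suc p)) ^ 3 ^ p"
        unfolding P_def F_Suc using Z by (intro Z.power_mult) (auto simp del: power_Suc)
    qed (use Z in simp)
    have "3 ^ Suc p = 3 ^ p + (3 ^ p + (3::nat) ^ p)" by simp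
    then have "ff s (Suc p) Y = P * (P * P)"
      unfolding ff_def P_def by (simp only: power_add)
    then have "ff s (Suc p) Y * ff (\<not> s) m Y * e = F p (sg s Y) ^ 3 ^ p * v * ff (\<not> s) m Y * (P * P * e)"
      using Z P v by (simp add: Z.ac)
    also have "\<dots> = ff s p Y * v * ff (\<not> s) m Y * (- (Qi * ((Q * X - Y) * (Q * Y - X))) * (w * w' * e))"
      unfolding PP ff_def ..
    also have "\<dots> = - (Qi * v * w * w' * d * (H Y * ((Q * X - Y) * (Q * Y - X)) * eps n J))"
      unfolding H_def d(2) using Z P v w w' d(1) by (simp add: Z.ac)
    also have "\<dots> = 0" unfolding HY by simp
    finally show ?thesis using s unfolding p_def m_def Y_def e_def by simp
  qed
  show ?case
  proof (cases "(n \<in> J) = s")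
    case False
    then have "(n \<in> J) = (\<not> s)" by simp
    from main[OF this] show ?thesis using Suc.prems by (simp add: Z.ac del: JM.simps)
  qed (rule main)
qed

lemma eps_vanish_sign:
  "n < r \<Longrightarrow> (n \<in> J) = s \<Longrightarrow> ff s (cnt s J n) (JM n) * eps (Suc n) J = 0"
  by (rule eps_vanish_step[OF _ eps_vanish])

end

context hecke_B
begin

lemma eps_mult:
  "n \<le> r \<Longrightarrow> eps n J * eps n J' = (if J \<inter> {..<n} = J' \<inter> {..<n} then eps n J else 0)"
proof (induction n)
  case (Suc n)
  let ?p = "cnt True J n" and ?p' = "cnt True J' n"
  have n: "n < r" using Suc.prems by simp
  have swap: "eps (Suc n) J * eps (Suc n) J'
      = (eps n J * eps n J') * (pj n ?p (n \<in> J) * pj n ?p' (n \<in> J'))"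
  proof -
    have "pj n ?p (n \<in> J) * eps n J' = eps n J' * pj n ?p (n \<in> J)"
      using n by (intro Z.commute) auto
    then have "pj n ?p (n \<in> J) * (eps n J' * z) = eps n J' * (pj n ?p (n \<in> J) * z)" for z
      by (simp flip: mult.assoc)
    then show ?thesis by (simp add: mult.assoc)
  qed
  have restrict: "J \<inter> {..<n} = J' \<inter> {..<n}" if "J \<inter> {..<Suc n} = J' \<inter> {..<Suc n}"
    using that by (auto simp: set_eq_iff less_Suc_eq)
  show ?case
  proof (cases "J \<inter> {..<n} = J' \<inter> {..<n}")
    case False
    then have "J \<inter> {..<Suc n} \<noteq> J' \<inter> {..<Suc n}" using restrict by blast
    then show ?thesis using False Suc unfolding swap by simp
  next
    case True
    then have same: "i < n \<Longrightarrow> (i \<in> J) = (i \<in> J')" for i by blast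
    have p: "?p' = ?p" using cnt_cong[of n J J'] same by metis
    have e: "eps n J * eps n J' = eps n J" using True Suc by simp
    have z: "eps n J * (pj n ?p s * pj n ?p (\<not> s)) = 0" for s
    proof -
      obtain w where w: "w \<in> Z" "pj n ?p s = w * ff (\<not> s) (cnt (\<not> s) J n) (JM n)"
        using pj_factor[OF n] by blast
      obtain w' where w': "w' \<in> Z" "pj n ?p (\<not> s) = w' * ff s (cnt s J n) (JM n)"
        using pj_factor[OF n, of J "\<not> s"] by auto
      have "eps n J * (pj n ?p s * pj n ?p (\<not> s))
          = w * w' * (ff s (cnt s J n) (JM n) * ff (\<not> s) (cnt (\<not> s) J n) (JM n) * eps n J)"
        unfolding w w' using w(1) w'(1) n by (simp add: Z.ac)
      then show ?thesis using eps_vanish[OF n, of s J] by simp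
    qed
    show ?thesis
    proof (cases "(n \<in> J) = (n \<in> J')")
      case False
      then have "J \<inter> {..<Suc n} \<noteq> J' \<inter> {..<Suc n}" by auto
      moreover have "(n \<in> J') = (\<not> n \<in> J)" using False by blast
      ultimately show ?thesis unfolding swap e p using z[of "n \<in> J"] by simp
    next
      case s: True
      then have "i < Suc n \<Longrightarrow> (i \<in> J) = (i \<in> J')" for i using same by (auto simp: less_Suc_eq)
      then have J: "J \<inter> {..<Suc n} = J' \<inter> {..<Suc n}" by blast
      have "eps n J * (pj n ?p (n \<in> J) * pj n ?p (n \<in> J))
          = eps n J * (pj n ?p (n \<in> J) * (pj n ?p (n \<in> J) + pj n ?p (\<not> n \<in> J)))"
        using z[of "n \<in> J"] by (simp add: distrib_left)
      also have "\<dots> = eps (Suc n) J" using pj_sum[OF n, of ?p "n \<in> J"] by simp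
      finally show ?thesis unfolding swap e p s[symmetric] if_P[OF J] .
    qed
  qed
qed simp

lemma sum_eps: "n \<le> r \<Longrightarrow> (\<Sum>J\<in>Pow {..<n}. eps n J) = 1"
proof (induction n)
  case (Suc n)
  have "Pow {..<Suc n} = Pow {..<n} \<union> insert n ` Pow {..<n}"
    by (simp add: lessThan_Suc Pow_insert)
  moreover have "Pow {..<n} \<inter> insert n ` Pow {..<n} = {}" by auto
  moreover have inj: "inj_on (insert n) (Pow {..<n})" by (auto simp: inj_on_def)
  ultimately have "(\<Sum>J\<in>Pow {..<Suc n}. eps (Suc n) J)
      = (\<Sum>J\<in>Pow {..<n}. eps (Suc n) J) + (\<Sum>J\<in>Pow {..<n}. eps (Suc n) (insert n J))"
    by (simp add: sum.union_disjoint sum.reindex del: eps.simps)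
  also have "\<dots> = (\<Sum>J\<in>Pow {..<n}. eps (Suc n) J + eps (Suc n) (insert n J))"
    by (simp add: sum.distrib)
  also have "\<dots> = (\<Sum>J\<in>Pow {..<n}. eps n J)"
  proof (rule sum.cong[OF refl])
    fix J assume "J \<in> Pow {..<n}"
    then have "n \<notin> J" by auto
    moreover have "eps n (insert n J) = eps n J" "cnt True (insert n J) n = cnt True J n"
      by (auto intro!: eps_cong cnt_cong)
    ultimately show "eps (Suc n) J + eps (Suc n) (insert n J) = eps n J"
      using pj_sum[of n "cnt True J n" False] Suc.prems by (simp flip: distrib_left)
  qed
  finally show ?case using Suc by simp
qed simp

lemma eps_absorb: "m \<le> n \<Longrightarrow> n \<le> r \<Longrightarrow> eps m J * eps n J = eps n J"
proof (induction n rule: dec_induct)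
  case base
  then show ?case by (simp add: eps_mult)
next
  case (step n)
  then show ?case by (simp add: mult.assoc[symmetric])
qed

text \<open>On a sign idempotent, expressions that are units at all the roots are units.\<close>

lemma unit_on_root:
  assumes X: "X \<in> Z" and b: "b \<in> Z" and e: "e \<in> Z" and f: "F p X ^ N * e = 0"
    and u: "\<And>a. a \<in> set (roots p) \<Longrightarrow> Z.unit_on e (a + b)"
  shows "Z.unit_on e (X + b)"
proof -
  have "Z.unit_on e (X - (- b))"
  proof (rule Z.unit_on_diff[OF X _ e, of _ "roots p" N])
    fix a assume "a \<in> set (roots p)"
    then have "Z.unit_on e (- (a + b))" using u by (intro Z.unit_on_minus)
    moreover have "- (a + b) = - b - a" by simp
    ultimately show "Z.unit_on e (- b - a)" by (simp only:)
  qed (use b f roots_ZI[of "{..<r}" p] in \<open>simp_all add: F_def\<close>)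
  then show ?thesis by simp
qed

lemma unit_on_root_const:
  assumes "X \<in> Z" "e \<in> Z" "F p X ^ N * e = 0" "b \<in> set (roots m)" "p + m < r"
  shows "Z.unit_on e (X + b)"
proof (rule unit_on_root[OF assms(1) _ assms(2,3)])
  show bZ: "b \<in> Z" using assms(4) roots_ZI[of "{..<r}" m] by auto
  fix a assume a: "a \<in> set (roots p)"
  then have "a \<in> Z" using roots_ZI[of "{..<r}" p] by auto
  then show "Z.unit_on e (a + b)"
    using bZ unit_sum[OF a assms(4,5)] by (intro Z.unit_on_unit) auto
qed

lemma unit_on_ff:
  assumes "X \<in> Z" "e \<in> Z" "ff s p X * e = 0" "p + m < r"
  shows "Z.unit_on e (ff (\<not> s) m X)"
proof -
  have "Z.unit_on e (F m (- sg s X))"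
    unfolding F_def
  proof (rule Z.unit_on_prod_list)
    show "set (map (\<lambda>a. - sg s X - a) (roots m)) \<subseteq> Z"
      using assms roots_ZI[of "{..<r}" m] by auto
    fix x assume "x \<in> set (map (\<lambda>a. - sg s X - a) (roots m))"
    then obtain a where a: "a \<in> set (roots m)" "x = - (sg s X + a)" by auto
    then show "Z.unit_on e x"
      using assms unit_on_root_const[of "sg s X" e p "3 ^ p" a m] unfolding ff_def
      by (auto simp only: sg_Z intro!: Z.unit_on_minus)
  qed (use assms in simp)
  moreover have "sg (\<not> s) X = - sg s X" by (simp add: sg_def)
  ultimately show ?thesis unfolding ff_def using assms by (intro Z.unit_on_power) auto
qed

lemma unit_on_two_roots:
  assumes X: "X \<in> Z" and Y: "Y \<in> Z" and e: "e \<in> Z"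
    and fX: "F p X ^ N * e = 0" and fY: "F m Y ^ M * e = 0" and pm: "p + m + 1 < r"
  shows "Z.unit_on e (X + Y)" "Z.unit_on e (Q * X + Y)"
proof -
  have RZ: "a \<in> Z" if "a \<in> set (roots p)" for a p using that roots_ZI[of "{..<r}" p] by auto
  have *: "Z.unit_on e (a + Y)" if "a \<in> set (roots (Suc p))" for a
    using unit_on_root_const[OF Y e fY that] pm by (simp add: add.commute)
  show "Z.unit_on e (X + Y)"
  proof (rule unit_on_root[OF X Y e fX])
    fix a assume "a \<in> set (roots p)"
    then have "a \<in> set (roots (Suc p))" by simp
    then show "Z.unit_on e (a + Y)" by (rule *)
  qed
  have "Z.unit_on e (X + Qi * Y)"
  proof (rule unit_on_root[OF X _ e fX])
    fix a assume a: "a \<in> set (roots p)"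
    have "Z.unit_on e (Qi * (Q * a + Y))"
      using e Y RZ[OF a] is_unit_Q
      by (intro Z.unit_on_mult[OF _ _ _ Z.unit_on_unit *[OF roots_shift[OF a]]]) auto
    then show "Z.unit_on e (a + Qi * Y)" by (simp add: distrib_left Qi_cancel)
  qed (use Y in simp)
  then have "Z.unit_on e (Q * (X + Qi * Y))"
    by (rule Z.unit_on_mult[OF _ _ e Z.unit_on_unit, rotated 4]) (use X Y is_unit_Q in auto)
  then show "Z.unit_on e (Q * X + Y)" by (simp add: distrib_left Qi_cancel)
qed

lemma g_symmetric:
  assumes n: "Suc n < r"
  shows "g n * (ff s m (JM n) * ff s m (JM (Suc n))) = ff s m (JM n) * ff s m (JM (Suc n)) * g n"
proof -
  define X Y T where "X = JM n" "Y = JM (Suc n)" "T = g n"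
  have Z: "X \<in> Z" "Y \<in> Z" unfolding X_Y_T_def using n by (auto simp del: JM.simps)
  have TX: "T * X = Y * T - (Q - 1) * Y" using g_JM[OF n] unfolding X_Y_T_def .
  have TY: "T * Y = X * T + (Q - 1) * Y" using g_JM_Suc[OF n] unfolding X_Y_T_def .
  have TQ: "T * Q = Q * T" unfolding X_Y_T_def using Q_g[of n] n by simp
  have sum: "T * (X + Y) = (X + Y) * T" using TX TY by (simp add: distrib_left distrib_right)
  have XY: "X * Y = Y * X" using Z by (rule Z.commute)
  have prod: "T * (X * Y) = X * Y * T"
  proof -
    have "T * X * Y = Y * (T * Y) - (Q - 1) * Y * Y"
      unfolding TX by (simp add: left_diff_distrib mult.assoc)
    also have "\<dots> = Y * X * T + (Y * ((Q - 1) * Y) - (Q - 1) * Y * Y)"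
      unfolding TY by (simp add: distrib_left mult.assoc)
    also have "Y * ((Q - 1) * Y) = (Q - 1) * Y * Y" using Z by (simp add: Z.ac)
    finally show ?thesis using XY by (simp add: mult.assoc)
  qed
  have "F m (sg s X) * F m (sg s Y) = (\<Prod>a\<leftarrow>roots m. (sg s X - a) * (sg s Y - a))"
  proof -
    have RZ: "set (roots m) \<subseteq> Z" using roots_ZI[of "{..<r}" m] by auto
    have "(\<Prod>a\<leftarrow>as. sg s X - a) * (\<Prod>a\<leftarrow>as. sg s Y - a) = (\<Prod>a\<leftarrow>as. (sg s X - a) * (sg s Y - a))"
      if "set as \<subseteq> Z" for as
      using that
    proof (induction as)
      case (Cons a as)
      have C: "(\<Prod>a\<leftarrow>as. sg s X - a) \<in> Z" "(\<Prod>a\<leftarrow>as. sg s Y - a) \<in> Z" "a \<in> Z"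
        using Cons.prems Z by (auto intro!: Z.prod_list_closed Z.diff_closed sg_Z)
      have "(\<Prod>a\<leftarrow>a # as. sg s X - a) * (\<Prod>a\<leftarrow>a # as. sg s Y - a)
          = (sg s X - a) * (sg s Y - a) * ((\<Prod>a\<leftarrow>as. sg s X - a) * (\<Prod>a\<leftarrow>as. sg s Y - a))"
        using C Z by (simp add: Z.ac)
      then show ?case using Cons by simp
    qed simp
    then show ?thesis unfolding F_def using RZ by blast
  qed
  moreover have "T * (\<Prod>a\<leftarrow>roots m. (sg s X - a) * (sg s Y - a))
      = (\<Prod>a\<leftarrow>roots m. (sg s X - a) * (sg s Y - a)) * T"
  proof -
    have Ta: "T * a = a * T" if "a \<in> set (roots m)" for a
      using that intertwine_power[OF TQ] intertwine_power[OF Qi_comm[OF TQ[symmetric], symmetric]]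
      unfolding in_roots by metis
    have factor: "T * ((sg s X - a) * (sg s Y - a)) = (sg s X - a) * (sg s Y - a) * T"
      if a: "a \<in> set (roots m)" for a
    proof -
      have aZ: "a \<in> Z" using a roots_ZI[of "{..<r}" m] by auto
      have eq: "(sg s X - a) * (sg s Y - a) = X * Y - sg s (a * (X + Y)) + a * a"
        using aZ Z by (cases s) (simp_all add: sg_def algebra_simps Z.ac)
      have "T * (a * (X + Y)) = a * (X + Y) * T"
        using sum Ta[OF a] by (intro comm_mult) auto
      then have "T * sg s (a * (X + Y)) = sg s (a * (X + Y)) * T" by (simp add: sg_def)
      moreover have "T * (a * a) = a * a * T" using Ta[OF a] by (intro comm_mult)
      ultimately show ?thesis unfolding eq
        by (simp only: distrib_left distrib_right left_diff_distrib right_diff_distrib prod)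
    qed
    have "T * (\<Prod>a\<leftarrow>as. (sg s X - a) * (sg s Y - a)) = (\<Prod>a\<leftarrow>as. (sg s X - a) * (sg s Y - a)) * T"
      if "set as \<subseteq> set (roots m)" for as
      using that
    proof (induction as)
      case (Cons a as)
      then show ?case using factor[of a] by (simp only: list.map prod_list.Cons) (rule comm_mult, auto)
    qed simp
    then show ?thesis by blast
  qed
  ultimately have "T * (F m (sg s X) * F m (sg s Y)) = F m (sg s X) * F m (sg s Y) * T" by simp
  then have "T * (F m (sg s X) * F m (sg s Y)) ^ N = (F m (sg s X) * F m (sg s Y)) ^ N * T" for N
    by (rule intertwine_power)
  then show ?thesis unfolding ff_def X_Y_T_def[symmetric] using Z by (simp add: Z.power_mult)
qed

lemma cnt_sw: "n + 2 \<le> k \<Longrightarrow> cnt s (sw n J) k = cnt s J k"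
proof (induction k rule: dec_induct)
  case base
  have "cnt s (sw n J) n = cnt s J n" by (rule cnt_cong) (auto simp: in_sw)
  then show ?case by (auto simp: in_sw)
next
  case (step k)
  then show ?case by (auto simp: in_sw)
qed

text \<open>
  If \<open>n\<close> and \<open>Suc n\<close> have the same sign in \<open>J\<close>, then the product \<open>S\<close> of the polynomials of the
  opposite sign at \<open>JM n\<close> and \<open>JM (Suc n)\<close> is symmetric, hence commutes with \<open>g n\<close>; it is a unit
  on \<open>eps (n + 2) J\<close> and vanishes on the complement of \<open>eps (n + 2) J\<close> in \<open>eps n J\<close>.
\<close>

lemma g_eps_same_base:
  assumes n: "Suc n < r" and s: "(n \<in> J) = s" "(Suc n \<in> J) = s"
  shows "g n * eps (n + 2) J = eps (n + 2) J * g n"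
proof -
  define X Y T where "X = JM n" "Y = JM (Suc n)" "T = g n"
  define e e' where "e = eps (n + 2) J" and "e' = eps n J"
  define m where "m = cnt (\<not> s) J n"
  define S where "S = ff (\<not> s) m X * ff (\<not> s) m Y"
  have Z: "X \<in> Z" "Y \<in> Z" "e \<in> Z" "e' \<in> Z" "S \<in> Z"
    unfolding X_Y_T_def S_def e_def e'_def using n by (auto simp del: JM.simps eps.simps)
  have TS: "T * S = S * T" unfolding S_def X_Y_T_def using n by (rule g_symmetric)
  have Te': "T * e' = e' * T" unfolding X_Y_T_def e'_def using n by (intro g_eps) auto
  have e'e: "e' * e = e" "e * e' = e"
    using eps_absorb[of n "n + 2" J] n Z Z.commute[of e e'] unfolding e_def e'_def by auto
  have "Z.unit_on (eps (Suc n) J) (ff (\<not> s) m X)"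
    unfolding m_def X_Y_T_def using n eps_vanish_sign[of n J s] s cnt_sum[of s J n]
    by (intro unit_on_ff) (auto simp del: JM.simps eps.simps)
  then have uX: "Z.unit_on e (ff (\<not> s) m X)"
    by (rule Z.unit_on_absorb) (use n Z eps_absorb[of "Suc n" "n + 2" J] in \<open>auto simp: e_def simp del: eps.simps\<close>)
  have uY: "Z.unit_on e (ff (\<not> s) m Y)"
    using n eps_vanish_sign[of "Suc n" J s] s cnt_sum[of s J n]
    unfolding m_def X_Y_T_def e_def
    by (intro unit_on_ff[where p = "cnt s J (Suc n)"]) (auto simp del: JM.simps eps.simps(2) simp: numeral_2_eq_2)
  have "Z.unit_on e S" unfolding S_def using Z uX uY by (intro Z.unit_on_mult) auto
  then obtain w where w: "w \<in> Z" "S * (w * e) = e" unfolding Z.unit_on_def by blast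
  have S0: "S * (e' - e) = 0"
  proof -
    define J1 where "J1 = (if s then J - {n} else insert n J)"
    define J2 where "J2 = (if s then J - {Suc n} else insert (Suc n) J)"
    have J1: "(n \<in> J1) = (\<not> s)" "eps n J1 = eps n J" "cnt s' J1 n = cnt s' J n" for s'
      unfolding J1_def by (auto intro!: eps_cong cnt_cong)
    have J2a: "(Suc n \<in> J2) = (\<not> s)" unfolding J2_def by auto
    have J2b: "eps (Suc n) J2 = eps (Suc n) J" by (rule eps_cong) (auto simp: J2_def)
    have J2c: "cnt s' J2 (Suc n) = cnt s' J (Suc n)" for s' by (rule cnt_cong) (auto simp: J2_def)
    note J2 = J2a J2b J2c
    have p1: "eps (Suc n) J1 + eps (Suc n) J = e'"
      using J1 s pj_sum[of n "cnt True J n" s] n by (simp add: e'_def add.commute flip: distrib_left)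
    have "eps (n + 2) J2 + e = eps (Suc n) J * (pj (Suc n) (cnt True J (Suc n)) (\<not> s) + pj (Suc n) (cnt True J (Suc n)) s)"
      using J2 s(2) by (simp add: e_def distrib_left numeral_2_eq_2 del: cnt.simps eps.simps(2) add: eps.simps(2)[of "Suc n"])
    then have p2: "eps (n + 2) J2 + e = eps (Suc n) J"
      using pj_sum[of "Suc n" "cnt True J (Suc n)" s] n by (simp add: add.commute del: cnt.simps eps.simps)
    have "e' - e = eps (Suc n) J1 + eps (n + 2) J2" using p1 p2 by (metis add_diff_cancel_right' add.assoc)
    moreover have "ff (\<not> s) m X * eps (Suc n) J1 = 0"
      using eps_vanish_sign[of n J1 "\<not> s"] J1 n unfolding m_def X_Y_T_def by simp
    moreover have "ff (\<not> s) m Y * eps (n + 2) J2 = 0"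
      using eps_vanish_sign[of "Suc n" J2 "\<not> s"] J2 n s unfolding m_def X_Y_T_def
      by (simp add: numeral_2_eq_2 del: JM.simps eps.simps(2))
    moreover have "eps (Suc n) J1 \<in> Z" "eps (n + 2) J2 \<in> Z" using n by (auto simp del: eps.simps)
    moreover have "ff (\<not> s) m X * ff (\<not> s) m Y = ff (\<not> s) m Y * ff (\<not> s) m X"
      using Z by (intro Z.commute) auto
    ultimately show ?thesis unfolding S_def
      by (metis (no_types, lifting) distrib_left mult.assoc mult_zero_right add_0)
  qed
  have eS: "e = w * e * S" using w Z by (simp add: Z.ac)
  have Se: "e = S * (w * e)" using w by simp
  have S0': "(e' - e) * S = 0" using S0 Z by (simp add: Z.commute)
  have "(e' - e) * T * e = (e' - e) * T * S * (w * e)" by (subst Se) (simp only: mult.assoc)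
  also have "\<dots> = ((e' - e) * S) * T * (w * e)" using TS by (simp add: mult.assoc)
  also have "\<dots> = 0" using S0' by simp
  finally have 1: "e' * T * e = e * T * e" by (simp add: left_diff_distrib)
  have "e * T * (e' - e) = w * e * S * T * (e' - e)" by (subst eS) (simp only: mult.assoc)
  also have "\<dots> = w * e * (T * S) * (e' - e)" unfolding TS by (simp only: mult.assoc)
  also have "\<dots> = w * e * T * (S * (e' - e))" by (simp only: mult.assoc)
  also have "\<dots> = 0" using S0 by simp
  finally have 2: "e * T * e' = e * T * e" by (simp add: right_diff_distrib)
  have "T * e = T * e' * e" using e'e by (simp add: mult.assoc)
  then have "T * e = e * T * e" using Te' 1 by simp
  moreover have "e * T = e * T * e"
  proof -
    have "e * T = (e * e') * T" using e'e by simp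
    also have "\<dots> = e * T * e'" unfolding mult.assoc Te' ..
    finally show ?thesis using 2 by simp
  qed
  ultimately show ?thesis unfolding X_Y_T_def e_def by simp
qed

end

context hecke_B
begin

lemma eps_opposite_sum:
  assumes n: "Suc n < r" and d: "(n \<in> J) \<noteq> (Suc n \<in> J)"
  shows "g n * (eps (n + 2) J + eps (n + 2) (sw n J)) = (eps (n + 2) J + eps (n + 2) (sw n J)) * g n"
proof -
  define J1 J2 where "J1 = J - {n, Suc n}" and "J2 = insert n (insert (Suc n) J)"
  have agree: "i \<in> J1 \<longleftrightarrow> i \<in> J" "i \<in> J2 \<longleftrightarrow> i \<in> J" "i \<in> sw n J \<longleftrightarrow> i \<in> J" if "i < n" for i
    using that unfolding J1_def J2_def by (auto simp: in_sw)
  have e: "eps n J1 = eps n J" "eps n J2 = eps n J" "eps n (sw n J) = eps n J"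
    by (rule eps_cong, simp add: agree)+
  have c: "cnt s J1 n = cnt s J n" "cnt s J2 n = cnt s J n" "cnt s (sw n J) n = cnt s J n" for s
    by (rule cnt_cong, simp add: agree)+
  have mem: "n \<notin> J1" "Suc n \<notin> J1" "n \<in> J2" "Suc n \<in> J2"
    "n \<in> sw n J \<longleftrightarrow> Suc n \<in> J" "Suc n \<in> sw n J \<longleftrightarrow> n \<in> J"
    unfolding J1_def J2_def by (auto simp: in_sw)
  define p where "p = cnt True J n"
  have pj: "pj n p True + pj n p False = 1" "pj (Suc n) p True + pj (Suc n) p False = 1"
    "pj (Suc n) (Suc p) True + pj (Suc n) (Suc p) False = 1"
    using pj_sum[of n p True] pj_sum[of "Suc n" p True] pj_sum[of "Suc n" "Suc p" True] n cnt_le[of True J n]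
    unfolding p_def by simp_all
  have four: "eps n J = eps (n + 2) J1 + eps (n + 2) J2 + (eps (n + 2) J + eps (n + 2) (sw n J))"
  proof -
    have "eps (n + 2) J1 = eps n J * pj n p False * pj (Suc n) p False"
      "eps (n + 2) J2 = eps n J * pj n p True * pj (Suc n) (Suc p) True"
      using mem e c by (simp_all add: p_def numeral_2_eq_2)
    moreover have "eps (n + 2) J + eps (n + 2) (sw n J)
        = eps n J * pj n p True * pj (Suc n) (Suc p) False + eps n J * pj n p False * pj (Suc n) p True"
      using mem e c d by (cases "n \<in> J") (simp_all add: p_def numeral_2_eq_2 add.commute)
    ultimately have "eps (n + 2) J1 + eps (n + 2) J2 + (eps (n + 2) J + eps (n + 2) (sw n J))
      = eps n J * pj n p True * (pj (Suc n) (Suc p) True + pj (Suc n) (Suc p) False)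
        + eps n J * pj n p False * (pj (Suc n) p True + pj (Suc n) p False)"
      by (simp only: distrib_left) (simp add: add_ac)
    also have "\<dots> = eps n J * pj n p True + eps n J * pj n p False"
      unfolding pj by simp
    also have "\<dots> = eps n J * (pj n p True + pj n p False)"
      by (rule distrib_left[symmetric])
    also have "\<dots> = eps n J" unfolding pj by simp
    finally show ?thesis by (rule sym)
  qed
  have "g n * eps n J = eps n J * g n" using n by (intro g_eps) auto
  moreover have "g n * eps (n + 2) J1 = eps (n + 2) J1 * g n"
    using n mem by (intro g_eps_same_base[of _ _ False]) auto
  moreover have "g n * eps (n + 2) J2 = eps (n + 2) J2 * g n"
    using n mem by (intro g_eps_same_base[of _ _ True]) auto
  moreover have "eps (n + 2) J + eps (n + 2) (sw n J) = eps n J - eps (n + 2) J1 - eps (n + 2) J2"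
    unfolding four by simp
  ultimately show ?thesis by (simp only: left_diff_distrib right_diff_distrib)
qed

lemma g_eps_same:
  assumes n: "Suc n < r" and s: "(n \<in> J) = (Suc n \<in> J)" and k: "n + 2 \<le> k" "k \<le> r"
  shows "g n * eps k J = eps k J * g n"
  using k
proof (induction k rule: dec_induct)
  case base
  then show ?case using g_eps_same_base[OF n] s by blast
next
  case (step k)
  then have "g n * pj k (cnt True J k) (k \<in> J) = pj k (cnt True J k) (k \<in> J) * g n"
    by (intro g_pj) auto
  then show ?case using step by (simp only: eps.simps) (rule comm_mult, auto)
qed

lemma g_eps_opposite:
  assumes n: "Suc n < r" and s: "(n \<in> J) \<noteq> (Suc n \<in> J)" and k: "n + 2 \<le> k" "k \<le> r"
  shows "g n * (eps k J + eps k (sw n J)) = (eps k J + eps k (sw n J)) * g n"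
  using k
proof (induction k rule: dec_induct)
  case base
  then show ?case using eps_opposite_sum[OF n s] by simp
next
  case (step k)
  have "eps (Suc k) J + eps (Suc k) (sw n J)
      = (eps k J + eps k (sw n J)) * pj k (cnt True J k) (k \<in> J)"
    using step cnt_sw[of n k True J] by (simp add: in_sw distrib_right)
  moreover have "g n * pj k (cnt True J k) (k \<in> J) = pj k (cnt True J k) (k \<in> J) * g n"
    using step by (intro g_pj) auto
  ultimately show ?case using step by (simp only:) (rule comm_mult, auto)
qed

definition E :: "nat set \<Rightarrow> 'a" where
  "E J = eps r J"

lemma E_Z [simp]: "E J \<in> Z"
  by (simp add: E_def)

lemma E_mult: "J \<subseteq> {..<r} \<Longrightarrow> J' \<subseteq> {..<r} \<Longrightarrow> E J * E J' = (if J = J' then E J else 0)"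
  unfolding E_def using eps_mult[of r J J'] by (simp add: Int_absorb2)

lemma sum_E: "(\<Sum>J\<in>Pow {..<r}. E J) = 1"
  unfolding E_def by (rule sum_eps) simp

lemma g_E_same: "Suc n < r \<Longrightarrow> (n \<in> J) = (Suc n \<in> J) \<Longrightarrow> g n * E J = E J * g n"
  unfolding E_def by (rule g_eps_same) auto

lemma g_E_opposite:
  "Suc n < r \<Longrightarrow> (n \<in> J) \<noteq> (Suc n \<in> J) \<Longrightarrow> g n * (E J + E (sw n J)) = (E J + E (sw n J)) * g n"
  unfolding E_def by (rule g_eps_opposite) auto

lemma E_g_E_vanish:
  assumes n: "Suc n < r" and J: "J \<subseteq> {..<r}" "J' \<subseteq> {..<r}" and ne: "J' \<noteq> J" "J' \<noteq> sw n J"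
  shows "E J' * g n * E J = 0"
proof (cases "(n \<in> J) = (Suc n \<in> J)")
  case True
  have "E J' * g n * E J = E J' * E J * g n"
    using g_E_same[OF n True] by (simp add: mult.assoc)
  then show ?thesis using E_mult J ne by simp
next
  case False
  have sJ: "sw n J \<subseteq> {..<r}" using sw_subset n J by blast
  have "E J' * g n * E J = E J' * (g n * (E J + E (sw n J))) * E J"
    using E_mult[OF J(1) J(1)] E_mult[OF sJ J(1)] sw_neq[OF False] by (simp add: mult.assoc distrib_right)
  also have "\<dots> = E J' * (E J + E (sw n J)) * g n * E J"
    unfolding g_E_opposite[OF n False] by (simp only: mult.assoc)
  also have "E J' * (E J + E (sw n J)) = 0"
    using E_mult J sJ ne by (simp add: distrib_left)
  finally show ?thesis by simp
qed

lemma eps_E: "n \<le> r \<Longrightarrow> eps n J * E J = E J"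
  unfolding E_def by (rule eps_absorb) auto

lemma E_vanish_sign:
  assumes "n < r" "(n \<in> J) = s"
  shows "ff s (cnt s J n) (JM n) * E J = 0"
  using eps_vanish_sign[OF assms] eps_E[of "Suc n" J] assms
  by (metis Suc_leI mult.assoc mult_zero_left)

lemma phi_E:
  assumes n: "Suc n < r" and d: "(n \<in> J) \<noteq> (Suc n \<in> J)" and J: "J \<subseteq> {..<r}"
  shows "phi n * E J = E (sw n J) * phi n * E J"
proof -
  define s p m where "s = (n \<in> J)" and "p = cnt s J n" and "m = cnt (\<not> s) J n"
  have sJ: "sw n J \<subseteq> {..<r}" using sw_subset n J by blast
  have pm: "p + m < r" unfolding p_def m_def using cnt_sum[of s J n] n by simp
  have X0: "ff s p (JM n) * E J = 0"
    unfolding p_def using n s_def by (intro E_vanish_sign) auto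
  have cY: "cnt (\<not> s) J (Suc n) = m" unfolding m_def s_def by simp
  have Y0: "ff (\<not> s) m (JM (Suc n)) * E J = 0"
    using E_vanish_sign[of "Suc n" J "\<not> s"] n d cY unfolding s_def by (simp del: cnt.simps JM.simps)
  have JMZ: "JM (Suc n) \<in> Z" "JM n \<in> Z" using n by (simp_all del: JM.simps)
  have "Z.unit_on (E J) (ff (\<not> \<not> s) p (JM (Suc n)))"
    using JMZ Y0 pm by (intro unit_on_ff) (auto simp: add.commute simp del: JM.simps)
  then obtain w where w: "w \<in> Z" "ff s p (JM (Suc n)) * (w * E J) = E J"
    unfolding Z.unit_on_def by auto
  have i: "phi n * ff s p (JM n) = ff s p (JM (Suc n)) * phi n"
    using phi_JM[OF n] phi_Q[OF n] by (rule intertwine_ff)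
  have "E J = E J * w * ff s p (JM (Suc n))"
    using w JMZ by (simp add: Z.ac del: JM.simps)
  then have "E J * phi n * E J = E J * w * (ff s p (JM (Suc n)) * phi n) * E J"
    by (metis mult.assoc)
  also have "\<dots> = E J * w * phi n * (ff s p (JM n) * E J)"
    unfolding i[symmetric] by (simp only: mult.assoc)
  finally have 0: "E J * phi n * E J = 0" unfolding X0 by simp
  let ?A = "E J + E (sw n J)"
  have "?A \<in> Z" by simp
  then have c: "phi n * ?A = ?A * phi n" using g_E_opposite[OF n d] n by (rule phi_comm)
  have "?A * E J = E J"
    using E_mult[OF J J] E_mult[OF sJ J] sw_neq[OF d] by (simp add: distrib_right)
  then have "phi n * E J = phi n * ?A * E J" by (simp only: mult.assoc)
  also have "\<dots> = E J * phi n * E J + E (sw n J) * phi n * E J"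
    unfolding c by (simp only: distrib_right)
  finally show ?thesis using 0 by simp
qed

lemma unit_on_opposite:
  assumes n: "Suc n < r" and d: "(n \<in> J) \<noteq> (Suc n \<in> J)"
  shows "Z.unit_on (E J) (JM n - JM (Suc n))"
    "Z.unit_on (E J) ((Q * JM n - JM (Suc n)) * (Q * JM (Suc n) - JM n))"
proof -
  define s p m where "s = (n \<in> J)" and "p = cnt s J n" and "m = cnt (\<not> s) J n"
  define X Y where "X = JM n" and "Y = JM (Suc n)"
  have Z: "X \<in> Z" "Y \<in> Z" unfolding X_def Y_def using n by (simp_all del: JM.simps)
  have pm: "p + m + 1 < r" unfolding p_def m_def using cnt_sum[of s J n] n by simp
  have "ff s p X * E J = 0"
    unfolding p_def X_def using n s_def by (intro E_vanish_sign) auto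
  then have X0: "F p (sg s X) ^ 3 ^ p * E J = 0" unfolding ff_def .
  have "cnt (\<not> s) J (Suc n) = m" unfolding m_def s_def by simp
  then have "ff (\<not> s) m Y * E J = 0"
    using E_vanish_sign[of "Suc n" J "\<not> s"] n d unfolding s_def Y_def by (simp del: cnt.simps JM.simps)
  then have Y0: "F m (sg (\<not> s) Y) ^ 3 ^ m * E J = 0" unfolding ff_def .
  have sgs: "sg s X + sg (\<not> s) Y = sg s (X - Y)" "Q * sg s X + sg (\<not> s) Y = sg s (Q * X - Y)"
    "Q * sg (\<not> s) Y + sg s X = sg (\<not> s) (Q * Y - X)"
    by (simp_all add: sg_def)
  have flip: "Z.unit_on (E J) x" if "Z.unit_on (E J) (sg s x)" for s x
    using that Z.unit_on_minus[of "E J" "- x"] by (cases s) (auto simp: sg_def)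
  have "Z.unit_on (E J) (sg s (X - Y))" "Z.unit_on (E J) (sg s (Q * X - Y))"
    using unit_on_two_roots[OF _ _ _ X0 Y0 pm] Z unfolding sgs by auto
  moreover have "Z.unit_on (E J) (sg (\<not> s) (Q * Y - X))"
    using unit_on_two_roots(2)[OF _ _ _ Y0 X0] pm Z unfolding sgs by (auto simp: add.commute)
  ultimately show "Z.unit_on (E J) (JM n - JM (Suc n))"
    "Z.unit_on (E J) ((Q * JM n - JM (Suc n)) * (Q * JM (Suc n) - JM n))"
    using Z flip unfolding X_def[symmetric] Y_def[symmetric] by (auto intro!: Z.unit_on_mult)
qed

lemma E_g_E_inverse:
  assumes n: "Suc n < r" and d: "(n \<in> J) \<noteq> (Suc n \<in> J)" and J: "J \<subseteq> {..<r}"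
  shows "\<exists>w. w * (E (sw n J) * g n * E J) = E J \<and> (E (sw n J) * g n * E J) * w = E (sw n J)"
proof -
  define K where "K = sw n J"
  have K: "K \<subseteq> {..<r}" "(n \<in> K) \<noteq> (Suc n \<in> K)" "sw n K = J" "K \<noteq> J"
    unfolding K_def using sw_subset n J d sw_neq by (auto simp: in_sw sw_sw)
  define X Y T where "X = JM n" "Y = JM (Suc n)" "T = g n"
  have Z: "X \<in> Z" "Y \<in> Z" unfolding X_Y_T_def using n by (simp_all del: JM.simps)
  define U where "U = (Q * X - Y) * (Q * Y - X)"
  have UZ: "U \<in> Z" unfolding U_def using Z by simp
  define P where "P = phi n"
  have PP: "P * P = U" unfolding P_def U_def X_Y_T_def using phi_sq[OF n] .
  have PJ: "P * E J = E K * P * E J" and PK: "P * E K = E J * P * E K"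
    using phi_E[OF n d J] phi_E[OF n K(2) K(1)] unfolding P_def K_def by (auto simp: sw_sw)
  define t where "t = E K * T * E J"
  have EE: "E K * E J = 0" "E J * E J = E J" "E K * E K = E K"
    using E_mult J K by auto
  have tXY: "t * (X - Y) = P * E J"
  proof -
    have "E K * ((Q - 1) * Y) * E J = (Q - 1) * Y * (E K * E J)" using Z by (simp add: Z.ac)
    then have 0: "E K * ((Q - 1) * Y) * E J = 0" using EE by simp
    have "P * E J = E K * (T * (X - Y) + (Q - 1) * Y) * E J"
      unfolding PJ unfolding P_def phi_def X_Y_T_def ..
    also have "\<dots> = E K * (T * (X - Y)) * E J"
      using 0 by (simp add: distrib_left distrib_right)
    also have "\<dots> = E K * T * ((X - Y) * E J)" by (simp only: mult.assoc)
    also have "(X - Y) * E J = E J * (X - Y)" using Z by (intro Z.commute) auto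
    finally show ?thesis unfolding t_def by (simp only: mult.assoc)
  qed
  obtain dd where dd: "dd \<in> Z" "(X - Y) * (dd * E J) = E J"
    using unit_on_opposite(1)[OF n d] unfolding Z.unit_on_def X_Y_T_def by blast
  obtain u where u: "u \<in> Z" "U * (u * E J) = E J"
    using unit_on_opposite(2)[OF n d] unfolding Z.unit_on_def U_def X_Y_T_def by blast
  obtain v where v: "v \<in> Z" "U * (v * E K) = E K"
    using unit_on_opposite(2)[OF n K(2)] unfolding Z.unit_on_def U_def X_Y_T_def by blast
  have tt: "t * E J = t" "E K * t = t" unfolding t_def using EE by (simp_all add: mult.assoc[symmetric]) (simp add: mult.assoc)
  have t: "t = P * E J * dd"
  proof -
    have "t = t * ((X - Y) * (dd * E J))" using tt dd by simp
    also have "\<dots> = t * (X - Y) * (E J * dd)" using dd by (simp add: Z.commute mult.assoc)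
    also have "\<dots> = P * (E J * E J) * dd" unfolding tXY by (simp only: mult.assoc)
    finally show ?thesis using EE by simp
  qed
  \<comment> \<open>A left inverse and a right inverse; they coincide.\<close>
  define w where "w = (X - Y) * u * P"
  have "w * t = (X - Y) * u * (P * P) * E J * dd" unfolding w_def t by (simp only: mult.assoc)
  also have "\<dots> = (U * (u * E J)) * (X - Y) * dd" unfolding PP using Z UZ u dd by (simp add: Z.ac)
  also have "\<dots> = (X - Y) * (dd * E J)" unfolding u using Z dd by (simp add: Z.ac)
  finally have wt: "w * t = E J" using dd by simp
  define w' where "w' = (X - Y) * (P * E K) * v"
  have "t * w' = t * (X - Y) * (P * E K) * v" unfolding w'_def by (simp only: mult.assoc)
  also have "\<dots> = P * (E J * P * E K) * v" unfolding tXY by (simp only: mult.assoc)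
  also have "\<dots> = P * P * E K * v" unfolding PK[symmetric] by (simp only: mult.assoc)
  also have "\<dots> = U * (v * E K)" unfolding PP using UZ v by (simp add: Z.ac)
  finally have tw': "t * w' = E K" using v by simp
  have "t * (w * E K) = t * (w * (t * w'))" unfolding tw' ..
  also have "\<dots> = t * (w * t) * w'" by (simp only: mult.assoc)
  also have "\<dots> = E K" unfolding wt tt tw' ..
  finally have "t * (w * E K) = E K" .
  moreover have "w * E K * t = E J" using wt tt by (simp add: mult.assoc)
  ultimately show ?thesis unfolding t_def X_Y_T_def K_def by blast
qed

text \<open>
  The product of the \<open>1 + JM i\<close> (or \<open>1 - JM i\<close>) with \<open>i < a\<close> is, up to a unit, the idempotent of
  the condition that the first \<open>a\<close> signs are positive (negative).
\<close>

definition PP :: "bool \<Rightarrow> nat \<Rightarrow> 'a" where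
  "PP s a = (\<Prod>i\<leftarrow>[0..<a]. 1 + sg s (JM i))"

lemma PP_Suc: "PP s (Suc a) = PP s a * (1 + sg s (JM a))"
  unfolding PP_def by simp

lemma PP_Z [simp]: "a \<le> r \<Longrightarrow> PP s a \<in> Z"
  by (induction a) (auto simp: PP_Suc simp del: JM.simps, simp add: PP_def)

lemma cnt_constant: "(\<And>i. i < a \<Longrightarrow> (i \<in> J) = s) \<Longrightarrow> cnt s J a = a \<and> cnt (\<not> s) J a = 0"
  by (induction a) auto

lemma unit_on_PP:
  assumes a: "a \<le> r" and J: "\<And>i. i < a \<Longrightarrow> (i \<in> J) = s"
  shows "Z.unit_on (eps a J) (PP s a)"
proof -
  have "Z.unit_on (eps a J) (1 + sg s (JM i))" if i: "i < a" for i
  proof -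
    have "cnt s J i = i" using cnt_constant[of i J s] J i by simp
    then have "ff s i (JM i) * eps (Suc i) J = 0"
      using eps_vanish_sign[of i J s] J a i by auto
    then have "Z.unit_on (eps (Suc i) J) (sg s (JM i) + 1)"
      using a i unfolding ff_def
      by (intro unit_on_root_const[of _ _ i _ _ 0]) (auto simp del: eps.simps)
    then have "Z.unit_on (eps a J) (sg s (JM i) + 1)"
      by (rule Z.unit_on_absorb) (use a i in \<open>auto intro!: eps_absorb simp del: eps.simps\<close>)
    then show ?thesis by (simp add: add.commute)
  qed
  then show ?thesis unfolding PP_def using a
    by (intro Z.unit_on_prod_list) (auto simp del: eps.simps)
qed

lemma PP_eps:
  assumes "a \<le> r" and "\<And>i. i < a \<Longrightarrow> (i \<in> J) = s"
  shows "PP s a * eps a J = PP s a"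
  using assms
proof (induction a)
  case (Suc a)
  let ?p = "cnt True J a"
  have a: "a < r" using Suc.prems by simp
  have c: "cnt s J a = a" "cnt (\<not> s) J a = 0" using cnt_constant[of a J s] Suc.prems by auto
  have aJ: "(a \<in> J) = s" using Suc.prems by simp
  obtain w where w: "w \<in> Z" "pj a ?p (\<not> s) = w * ff s a (JM a)"
    using pj_factor[OF a, of J "\<not> s"] c by auto
  have ff0: "ff (\<not> s) 0 (JM a) = - (1 + sg s (JM a))"
    by (cases s) (simp_all add: ff_def F_def sg_def)
  have "- (ff s a (JM a) * (1 + sg s (JM a)) * eps a J) = ff s a (JM a) * ff (\<not> s) 0 (JM a) * eps a J"
    unfolding ff0 by (simp only: mult_minus_right mult_minus_left)
  then have v: "ff s a (JM a) * (1 + sg s (JM a)) * eps a J = 0"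
    using eps_vanish[OF a, of s J] c by simp
  have IH: "PP s a * eps a J = PP s a" using Suc by simp
  have "PP s (Suc a) * pj a ?p (\<not> s) = (PP s a * eps a J) * (1 + sg s (JM a)) * pj a ?p (\<not> s)"
    unfolding PP_Suc IH ..
  also have "\<dots> = PP s a * w * (ff s a (JM a) * (1 + sg s (JM a)) * eps a J)"
    unfolding w using w(1) a by (simp add: Z.ac)
  finally have 0: "PP s (Suc a) * pj a ?p (\<not> s) = 0" unfolding v by simp
  have "PP s (Suc a) * eps (Suc a) J = (PP s a * eps a J) * (1 + sg s (JM a)) * pj a ?p s"
    unfolding PP_Suc using aJ a by (simp add: Z.ac)
  also have "\<dots> = PP s (Suc a) * pj a ?p s" unfolding IH PP_Suc ..
  also have "\<dots> = PP s (Suc a) * (pj a ?p s + pj a ?p (\<not> s))"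
    using 0 by (simp add: distrib_left)
  finally show ?case using pj_sum[OF a, of ?p s] by simp
qed simp

end

section \<open>Symmetrizers of Young subgroups\<close>

lemma sum_atMost_concat:
  fixes f :: "nat \<Rightarrow> 'a::comm_monoid_add"
  shows "(\<Sum>i\<le>l. f i) + (\<Sum>i\<le>j. f (Suc l + i)) = (\<Sum>i\<le>Suc (j + l). f i)"
proof (induction j)
  case (Suc j)
  have "(\<Sum>i\<le>l. f i) + (\<Sum>i\<le>Suc j. f (Suc l + i))
      = ((\<Sum>i\<le>l. f i) + (\<Sum>i\<le>j. f (Suc l + i))) + f (Suc l + Suc j)"
    by (simp only: sum.atMost_Suc add.assoc)
  then show ?case using Suc by (simp add: add.commute[of l])
qed simp

context hecke_A
begin

fun dw :: "nat \<Rightarrow> nat \<Rightarrow> 'a" where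
  "dw b 0 = 1"
| "dw b (Suc i) = dw b i * g (b - Suc i)"

fun uw :: "nat \<Rightarrow> nat \<Rightarrow> 'a" where
  "uw b 0 = 1"
| "uw b (Suc i) = g (b - Suc i) * uw b i"

definition Zd :: "nat \<Rightarrow> nat \<Rightarrow> 'a" where
  "Zd k m = (\<Sum>i\<le>m. dw (k + m) i)"

definition Zu :: "nat \<Rightarrow> nat \<Rightarrow> 'a" where
  "Zu k m = (\<Sum>i\<le>m. uw (k + m) i)"

text \<open>
  The sum of the standard basis over the symmetric group on the positions \<open>k, \<dots>, k + m - 1\<close>,
  built up along the chain of these groups.
\<close>

fun symz :: "nat \<Rightarrow> nat \<Rightarrow> 'a" where
  "symz k 0 = 1"
| "symz k (Suc m) = symz k m * Zd k m"

lemma dw_add: "i \<le> b \<Longrightarrow> dw b i * dw (b - i) j = dw b (i + j)"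
proof (induction j)
  case (Suc j)
  have "dw b i * dw (b - i) (Suc j) = dw b i * dw (b - i) j * g (b - i - Suc j)"
    by (simp add: mult.assoc)
  also have "\<dots> = dw b (i + Suc j)" using Suc by (simp add: diff_diff_left)
  finally show ?case .
qed simp

lemma uw_add: "i \<le> b \<Longrightarrow> uw (b - i) j * uw b i = uw b (i + j)"
proof (induction j)
  case (Suc j)
  have "uw (b - i) (Suc j) * uw b i = g (b - i - Suc j) * (uw (b - i) j * uw b i)"
    by (simp add: mult.assoc)
  also have "\<dots> = uw b (i + Suc j)" using Suc by (simp add: diff_diff_left)
  finally show ?case .
qed simp

text \<open>Letters that lie in an interval determine what a product of generators commutes with.\<close>

lemma dw_shift:
  assumes "\<And>x. k \<le> x \<Longrightarrow> x + 1 < k + m \<Longrightarrow> c * g x = g (x - k + k') * c" "i \<le> n" "n < m"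
  shows "c * dw (k + n) i = dw (k' + n) i * c"
  using assms(2)
proof (induction i)
  case (Suc i)
  have "c * dw (k + n) (Suc i) = (c * dw (k + n) i) * g (k + n - Suc i)" by (simp add: mult.assoc)
  also have "\<dots> = dw (k' + n) i * (c * g (k + n - Suc i))"
    using Suc by (simp add: mult.assoc)
  also have "c * g (k + n - Suc i) = g (k' + n - Suc i) * c"
    using assms(1)[of "k + n - Suc i"] Suc.prems assms(3)
    by (simp add: add.commute[of k'])
  finally show ?case by (simp add: mult.assoc)
qed simp

lemma symz_shift:
  assumes "\<And>x. k \<le> x \<Longrightarrow> x + 1 < k + m \<Longrightarrow> c * g x = g (x - k + k') * c"
  shows "c * symz k m = symz k' m * c"
proof -
  have "c * symz k n = symz k' n * c" if "n \<le> m" for n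
    using that
  proof (induction n)
    case (Suc n)
    have Z: "c * Zd k n = Zd k' n * c"
      unfolding Zd_def sum_distrib_left sum_distrib_right
      using assms Suc.prems by (intro sum.cong refl dw_shift) auto
    have "c * symz k (Suc n) = (c * symz k n) * Zd k n" by (simp add: mult.assoc)
    also have "\<dots> = symz k' n * (c * Zd k n)" using Suc by (simp add: mult.assoc)
    finally show ?case unfolding Z by (simp add: mult.assoc)
  qed simp
  then show ?thesis by simp
qed

lemma symz_commute:
  assumes "\<And>x. k \<le> x \<Longrightarrow> x + 1 < k + m \<Longrightarrow> c * g x = g x * c"
  shows "c * symz k m = symz k m * c"
  using assms by (intro symz_shift) auto

lemma dw_commute:
  assumes "\<And>x. b \<le> x + i \<Longrightarrow> x < b \<Longrightarrow> c * g x = g x * c" "i \<le> b"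
  shows "c * dw b i = dw b i * c"
  using assms
proof (induction i)
  case (Suc i)
  then show ?case unfolding dw.simps by (intro comm_mult) auto
qed simp

lemma uw_commute:
  assumes "\<And>x. b \<le> x + i \<Longrightarrow> x < b \<Longrightarrow> c * g x = g x * c" "i \<le> b"
  shows "c * uw b i = uw b i * c"
  using assms
proof (induction i)
  case (Suc i)
  then show ?case unfolding uw.simps by (intro comm_mult) auto
qed simp

lemma dw_g:
  assumes "b < r" "i \<le> b" "b < x + i" "x < b"
  shows "dw b i * g x = g (x - 1) * dw b i"
  using assms(2,3)
proof (induction i)
  case 0
  then show ?case using assms by simp
next
  case (Suc i)
  define a where "a = b - Suc i"
  have a: "b - Suc i = a" "a + Suc i = b" using Suc.prems unfolding a_def by auto
  show ?case
  proof (cases "b < x + i")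
    case True
    have "dw b (Suc i) * g x = dw b i * (g a * g x)" using a by (simp add: mult.assoc)
    also have "g a * g x = g x * g a" using True a assms by (intro far) auto
    also have "dw b i * (g x * g a) = g (x - 1) * dw b i * g a"
      using Suc.IH True Suc.prems by (simp add: mult.assoc[symmetric])
    finally show ?thesis using a by (simp add: mult.assoc)
  next
    case False
    then have x: "x = a + 1" using Suc.prems a by simp
    then obtain h where i: "i = Suc h" using assms a by (cases i) auto
    have bi: "b - Suc h = a + 1" using a i by simp
    have "dw b (Suc i) * g x = dw b h * (g (a + 1) * g a * g (a + 1))"
      using a i bi x by (simp add: mult.assoc)
    also have "g (a + 1) * g a * g (a + 1) = g a * g (a + 1) * g a"
      using braid[of a] x assms by simp
    also have "dw b h * (g a * g (a + 1) * g a) = (dw b h * g a) * g (a + 1) * g a"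
      by (simp only: mult.assoc)
    also have "dw b h * g a = g a * dw b h"
      using a i assms by (intro dw_commute[symmetric] far) auto
    finally show ?thesis using a i bi x by (simp add: mult.assoc)
  qed
qed

lemma g_uw:
  assumes "b < r" "i \<le> b" "b < x + i" "x < b"
  shows "g x * uw b i = uw b i * g (x - 1)"
  using assms(2,3)
proof (induction i)
  case 0
  then show ?case using assms by simp
next
  case (Suc i)
  define a where "a = b - Suc i"
  have a: "b - Suc i = a" "a + Suc i = b" using Suc.prems unfolding a_def by auto
  show ?case
  proof (cases "b < x + i")
    case True
    have "g x * uw b (Suc i) = (g x * g a) * uw b i" using a by (simp add: mult.assoc)
    also have "g x * g a = g a * g x" using True a assms by (intro far[symmetric]) auto
    also have "g a * g x * uw b i = g a * (uw b i * g (x - 1))"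
      using Suc.IH True Suc.prems by (simp add: mult.assoc)
    finally show ?thesis using a by (simp add: mult.assoc)
  next
    case False
    then have x: "x = a + 1" using Suc.prems a by simp
    then obtain h where i: "i = Suc h" using assms a by (cases i) auto
    have bi: "b - Suc h = a + 1" using a i by simp
    have "g x * uw b (Suc i) = g (a + 1) * g a * g (a + 1) * uw b h"
      using a i bi x by (simp add: mult.assoc)
    also have "g (a + 1) * g a * g (a + 1) = g a * g (a + 1) * g a"
      using braid[of a] x assms by simp
    also have "g a * g (a + 1) * g a * uw b h = g a * g (a + 1) * (g a * uw b h)"
      by (simp only: mult.assoc)
    also have "g a * uw b h = uw b h * g a"
      using a i assms by (intro uw_commute far) auto
    finally show ?thesis using a i bi x by (simp add: mult.assoc)
  qed
qed

text \<open>
  \<open>shuf k j l\<close> is the sum of the standard basis over the shuffles, the shortest representatives of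
  the left cosets of the Young subgroup with blocks \<open>j\<close> and \<open>l\<close>; the two summands are distinguished
  by the block that contains the preimage of the last position.
\<close>

fun shuf :: "nat \<Rightarrow> nat \<Rightarrow> nat \<Rightarrow> 'a" where
  "shuf k 0 l = 1"
| "shuf k (Suc j) 0 = 1"
| "shuf k (Suc j) (Suc l) = shuf k (Suc j) l + shuf k j (Suc l) * dw (k + j + Suc l) (Suc l)"

lemma symz_symz_commute:
  "k + j \<le> k' \<Longrightarrow> k' + l \<le> r \<Longrightarrow> symz k j * symz k' l = symz k' l * symz k j"
  by (intro symz_commute symz_commute[symmetric] far) auto

lemma symz_shuf: "k + j + l \<le> r \<Longrightarrow> symz k (j + l) = shuf k j l * (symz k j * symz (k + j) l)"
proof (induction k j l rule: shuf.induct)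
  case (3 k j l)
  define b where "b = k + j + Suc l"
  have b: "b < r" "b - Suc l = k + j" using 3(3) unfolding b_def by auto
  have dsym: "dw b (Suc l) * symz (k + Suc j) (Suc l) = symz (k + j) (Suc l) * dw b (Suc l)"
  proof (rule symz_shift)
    fix x assume "k + Suc j \<le> x" "x + 1 < k + Suc j + Suc l"
    then show "dw b (Suc l) * g x = g (x - (k + Suc j) + (k + j)) * dw b (Suc l)"
      using dw_g[of b "Suc l" x] b unfolding b_def by auto
  qed
  have dsym': "dw b (Suc l) * symz k j = symz k j * dw b (Suc l)"
    using b by (intro symz_commute dw_commute[symmetric] far) (auto simp: b_def)
  have c1: "symz k (Suc j) * symz (k + Suc j) (Suc l) = symz (k + Suc j) (Suc l) * symz k (Suc j)"
    using 3(3) by (intro symz_symz_commute) auto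
  have c2: "symz (k + j) (Suc l) * symz k j = symz k j * symz (k + j) (Suc l)"
    using 3(3) by (intro symz_symz_commute[symmetric]) auto
  have "shuf k (Suc j) l * (symz k (Suc j) * symz (k + Suc j) (Suc l))
      = shuf k (Suc j) l * (symz k (Suc j) * symz (k + Suc j) l) * Zd (k + Suc j) l"
    by (simp add: mult.assoc)
  also have "\<dots> = symz k (Suc j + l) * Zd (k + Suc j) l"
    using 3 by simp
  finally have 1: "shuf k (Suc j) l * (symz k (Suc j) * symz (k + Suc j) (Suc l))
      = symz k (Suc j + l) * Zd (k + Suc j) l" .
  have "shuf k j (Suc l) * dw b (Suc l) * (symz k (Suc j) * symz (k + Suc j) (Suc l))
      = shuf k j (Suc l) * (dw b (Suc l) * symz (k + Suc j) (Suc l)) * (symz k j * Zd k j)"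
    unfolding c1 by (simp only: mult.assoc symz.simps(2)[of k j])
  also have "\<dots> = shuf k j (Suc l) * symz (k + j) (Suc l) * (dw b (Suc l) * symz k j) * Zd k j"
    unfolding dsym by (simp only: mult.assoc)
  also have "\<dots> = shuf k j (Suc l) * (symz (k + j) (Suc l) * symz k j) * (dw b (Suc l) * Zd k j)"
    unfolding dsym' by (simp only: mult.assoc)
  also have "\<dots> = symz k (j + Suc l) * (dw b (Suc l) * Zd k j)"
    unfolding c2 using 3 by simp
  also have "dw b (Suc l) * Zd k j = (\<Sum>i\<le>j. dw b (Suc l + i))"
    unfolding Zd_def sum_distrib_left using dw_add[of "Suc l" b] b
    by (intro sum.cong) (auto simp: b_def simp del: dw.simps)
  finally have 2: "shuf k j (Suc l) * dw b (Suc l) * (symz k (Suc j) * symz (k + Suc j) (Suc l))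
      = symz k (Suc j + l) * (\<Sum>i\<le>j. dw b (Suc l + i))" by simp
  have 3: "Zd (k + Suc j) l + (\<Sum>i\<le>j. dw b (Suc l + i)) = Zd k (Suc j + l)"
    using sum_atMost_concat[of "dw b" l j] unfolding Zd_def b_def by (simp add: add_ac del: dw.simps)
  have "shuf k (Suc j) (Suc l) * (symz k (Suc j) * symz (k + Suc j) (Suc l))
      = symz k (Suc j + l) * Zd k (Suc j + l)"
    unfolding shuf.simps b_def[symmetric] distrib_right 1 2 3[symmetric] by (simp only: distrib_left)
  also have "\<dots> = symz k (Suc j + Suc l)" by simp
  finally show ?case by (rule HOL.sym)
qed simp_all

lemma symz_1: "symz k (Suc 0) = 1"
  by (simp add: Zd_def)

lemma shuf_1: "shuf k j (Suc 0) = Zu k j"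
proof (induction j)
  case (Suc j)
  have "shuf k (Suc j) (Suc 0) = 1 + Zu k j * g (k + j)"
    using Suc by (cases j) simp_all
  also have "Zu k j * g (k + j) = (\<Sum>i\<le>j. uw (k + Suc j) (Suc i))"
    unfolding Zu_def sum_distrib_right
  proof (rule sum.cong[OF refl])
    fix i assume "i \<in> {..j}"
    then show "uw (k + j) i * g (k + j) = uw (k + Suc j) (Suc i)"
      using uw_add[of 1 "k + Suc j" i] by simp
  qed
  also have "1 + (\<Sum>i\<le>j. uw (k + Suc j) (Suc i)) = Zu k (Suc j)"
    unfolding Zu_def by (simp add: sum.atMost_Suc_shift del: sum.atMost_Suc uw.simps(2))
  finally show ?case .
qed (simp add: Zu_def)

lemma symz_Suc_left: "k + Suc m \<le> r \<Longrightarrow> symz k (Suc m) = Zu k m * symz k m"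
  using symz_shuf[of k m "Suc 0"] by (simp add: shuf_1 symz_1 del: symz.simps shuf.simps)

text \<open>The mirror image: the symmetrizer is also divisible from the left.\<close>

lemma symz_split: "k + j + l \<le> r \<Longrightarrow> \<exists>D. symz k (j + l) = symz k j * symz (k + j) l * D"
proof (induction k j l rule: shuf.induct)
  case (1 k l)
  show ?case by (rule exI[of _ 1]) simp
next
  case (2 k j)
  show ?case by (rule exI[of _ 1]) simp
next
  case (3 k j l)
  define b where "b = k + j + Suc l"
  have b: "b < r" "b - Suc l = k + j" using 3(3) unfolding b_def by auto
  obtain D1 where D1: "symz k (Suc j + l) = symz k (Suc j) * symz (k + Suc j) l * D1" using 3 by auto
  obtain D2 where D2: "symz k (j + Suc l) = symz k j * symz (k + j) (Suc l) * D2" using 3 by auto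
  have usym: "uw b (Suc l) * symz (k + j) (Suc l) = symz (k + Suc j) (Suc l) * uw b (Suc l)"
  proof (rule symz_shift)
    fix x assume "k + j \<le> x" "x + 1 < k + j + Suc l"
    then show "uw b (Suc l) * g x = g (x - (k + j) + (k + Suc j)) * uw b (Suc l)"
      using g_uw[of b "Suc l" "Suc x"] b unfolding b_def by auto
  qed
  have usym': "uw b (Suc l) * symz k j = symz k j * uw b (Suc l)"
    using b by (intro symz_commute uw_commute[symmetric] far) (auto simp: b_def)
  have uc: "symz k (Suc j) * Zu (k + Suc j) l = Zu (k + Suc j) l * symz k (Suc j)"
    unfolding Zu_def sum_distrib_left sum_distrib_right
    using b by (intro sum.cong refl uw_commute symz_commute[symmetric] g_comm_far) (auto simp: b_def)
  have "symz k (Suc j) * symz (k + Suc j) (Suc l) * D1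
      = (symz k (Suc j) * Zu (k + Suc j) l) * symz (k + Suc j) l * D1"
    using 3(3) by (subst symz_Suc_left) (simp_all add: mult.assoc del: symz.simps)
  also have "\<dots> = Zu (k + Suc j) l * symz k (Suc j + l)"
    unfolding uc D1 by (simp only: mult.assoc)
  finally have 1: "symz k (Suc j) * symz (k + Suc j) (Suc l) * D1 = Zu (k + Suc j) l * symz k (Suc j + l)" .
  have "symz k (Suc j) * symz (k + Suc j) (Suc l) * (uw b (Suc l) * D2)
      = symz k (Suc j) * (uw b (Suc l) * symz (k + j) (Suc l)) * D2"
    unfolding usym by (simp only: mult.assoc)
  also have "\<dots> = Zu k j * symz k j * (uw b (Suc l) * symz (k + j) (Suc l)) * D2"
    using 3(3) by (subst symz_Suc_left) simp_all
  also have "Zu k j * symz k j * (uw b (Suc l) * symz (k + j) (Suc l)) * D2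
      = Zu k j * (uw b (Suc l) * symz k j) * symz (k + j) (Suc l) * D2"
    unfolding usym' by (simp only: mult.assoc)
  also have "\<dots> = Zu k j * uw b (Suc l) * symz k (j + Suc l)"
    unfolding D2 by (simp only: mult.assoc)
  also have "Zu k j * uw b (Suc l) = (\<Sum>i\<le>j. uw b (Suc l + i))"
    unfolding Zu_def sum_distrib_right using uw_add[of "Suc l" b] b
    by (intro sum.cong) (auto simp: b_def simp del: uw.simps)
  finally have 2: "symz k (Suc j) * symz (k + Suc j) (Suc l) * (uw b (Suc l) * D2)
      = (\<Sum>i\<le>j. uw b (Suc l + i)) * symz k (Suc j + l)" by simp
  have "Zu (k + Suc j) l + (\<Sum>i\<le>j. uw b (Suc l + i)) = Zu k (Suc j + l)"
    using sum_atMost_concat[of "uw b" l j] unfolding Zu_def b_def by (simp add: add_ac del: uw.simps)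
  then have "symz k (Suc j) * symz (k + Suc j) (Suc l) * (D1 + uw b (Suc l) * D2)
      = Zu k (Suc j + l) * symz k (Suc j + l)"
    using 1 2 by (simp only: distrib_left) (simp flip: distrib_right)
  also have "\<dots> = symz k (Suc j + Suc l)"
    using symz_Suc_left[of k "Suc j + l"] 3(3) by (simp del: symz.simps)
  finally show ?case by metis
qed

lemma g_symz:
  assumes "k \<le> i" "i + 1 < k + m" "k + m \<le> r"
  shows "g i * symz k m = Q * symz k m"
proof -
  obtain a where a: "i = k + a" using assms by (auto simp: le_iff_add)
  define l where "l = m - a - 2"
  have m: "m = a + (2 + l)" using assms a unfolding l_def by simp
  obtain D where D: "symz k m = symz k a * symz i (2 + l) * D"
    using symz_split[of k a "2 + l"] assms a m by auto
  obtain D' where D': "symz i (2 + l) = symz i 2 * symz (i + 2) l * D'"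
    using symz_split[of i 2 l] assms a m by auto
  have s2: "symz i 2 = 1 + g i"
    by (simp add: numeral_2_eq_2 Zd_def)
  have "g i * symz i 2 = Q * symz i 2"
    using quad[of i] assms unfolding s2 by (simp add: algebra_simps)
  then have 1: "g i * symz i (2 + l) = Q * symz i (2 + l)"
    unfolding D' by (simp add: mult.assoc[symmetric])
  have 2: "g i * symz k a = symz k a * g i" "Q * symz k a = symz k a * Q"
    using a assms by (auto intro!: symz_commute g_comm_far Q_g)
  have "g i * symz k m = symz k a * (g i * symz i (2 + l)) * D"
    unfolding D using 2 by (simp add: mult.assoc[symmetric])
  also have "\<dots> = Q * symz k m"
    unfolding 1 D using 2 by (simp add: mult.assoc[symmetric])
  finally show ?thesis .
qed

end

lemma comm_past: "c * x = x * c \<Longrightarrow> c * (x * y) = x * (c * (y::'a::semigroup_mult))"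
  by (simp flip: mult.assoc)

context hecke_A
begin

subsection \<open>Words\<close>

definition gw :: "nat list \<Rightarrow> 'a" where
  "gw ws = (\<Prod>i\<leftarrow>ws. g i)"

lemma gw_simps [simp]: "gw [] = 1" "gw (i # ws) = g i * gw ws" "gw (vs @ ws) = gw vs * gw ws"
  by (simp_all add: gw_def)

text \<open>The additive span of the words of length less than \<open>n\<close> with letters in \<open>I\<close>.\<close>

inductive_set short :: "nat set \<Rightarrow> nat \<Rightarrow> 'a set" for I n where
  zero: "0 \<in> short I n"
| add: "x \<in> short I n \<Longrightarrow> y \<in> short I n \<Longrightarrow> x + y \<in> short I n"
| word: "set ws \<subseteq> I \<Longrightarrow> length ws < n \<Longrightarrow> gw ws \<in> short I n"

lemma short_mono: "x \<in> short I n \<Longrightarrow> I \<subseteq> I' \<Longrightarrow> n \<le> n' \<Longrightarrow> x \<in> short I' n'"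
proof (induction rule: short.induct)
  case (word ws)
  then show ?case by (intro short.word) auto
qed (auto intro: short.intros)

lemma short_mult_word: "x \<in> short I n \<Longrightarrow> set ws \<subseteq> I \<Longrightarrow> x * gw ws \<in> short I (n + length ws)"
proof (induction rule: short.induct)
  case (word vs)
  then show ?case using short.word[of "vs @ ws" I "n + length ws"] by simp
qed (auto intro: short.intros simp: distrib_right)

lemma word_mult_short: "x \<in> short I n \<Longrightarrow> set ws \<subseteq> I \<Longrightarrow> gw ws * x \<in> short I (length ws + n)"
proof (induction rule: short.induct)
  case (word vs)
  then show ?case using short.word[of "ws @ vs" I "length ws + n"] by simp
qed (auto intro: short.intros simp: distrib_left)

lemma short_mult_short: "y \<in> short I m \<Longrightarrow> x \<in> short I n \<Longrightarrow> x * y \<in> short I (n + m)"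
proof (induction rule: short.induct)
  case (word ws)
  then show ?case using short_mono[OF short_mult_word[OF word(3), of ws], of I "n + m"] by auto
qed (auto intro: short.intros simp: distrib_left)

text \<open>An element equal to a word of length \<open>length ws\<close> up to shorter ones.\<close>

definition top_word :: "nat set \<Rightarrow> nat list \<Rightarrow> 'a \<Rightarrow> bool" where
  "top_word I ws x \<longleftrightarrow> set ws \<subseteq> I \<and> x - gw ws \<in> short I (length ws)"

lemma top_word_mult:
  assumes "top_word I vs x" "top_word I ws y"
  shows "top_word I (vs @ ws) (x * y)"
proof -
  have "x * y - gw (vs @ ws) = (x - gw vs) * gw ws + gw vs * (y - gw ws) + (x - gw vs) * (y - gw ws)"
    by (simp add: algebra_simps)
  also have "\<dots> \<in> short I (length vs + length ws)"
    using assms unfolding top_word_def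
    by (intro short.add short_mult_word word_mult_short short_mult_short) auto
  finally show ?thesis using assms unfolding top_word_def by simp
qed

lemma top_word_add_short: "top_word I ws x \<Longrightarrow> y \<in> short I (length ws) \<Longrightarrow> top_word I ws (y + x)"
  unfolding top_word_def by (metis add_diff_eq short.add)

lemma top_word_word: "set ws \<subseteq> I \<Longrightarrow> top_word I ws (gw ws)"
  unfolding top_word_def by (simp add: short.zero)

lemma top_word_mono: "top_word I ws x \<Longrightarrow> I \<subseteq> I' \<Longrightarrow> top_word I' ws x"
  unfolding top_word_def using short_mono[of "x - gw ws" I "length ws" I' "length ws"] by auto

lemma top_word_short: "top_word I ws x \<Longrightarrow> length ws < n \<Longrightarrow> x \<in> short I n"
proof -
  assume a: "top_word I ws x" "length ws < n"
  then have "x - gw ws \<in> short I n" "gw ws \<in> short I n"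
    unfolding top_word_def
    using short_mono[of "x - gw ws" I "length ws" I n] short.word[of ws I n] by auto
  then have "(x - gw ws) + gw ws \<in> short I n" by (rule short.add)
  then show ?thesis by simp
qed

fun dwl :: "nat \<Rightarrow> nat \<Rightarrow> nat list" where
  "dwl b 0 = []"
| "dwl b (Suc i) = dwl b i @ [b - Suc i]"

lemma gw_dwl: "gw (dwl b i) = dw b i"
  by (induction i) auto

lemma length_dwl [simp]: "length (dwl b i) = i"
  by (induction i) auto

lemma set_dwl: "i \<le> b \<Longrightarrow> set (dwl b i) = {b - i..<b}"
proof (induction i)
  case (Suc i)
  then obtain a where "b = a + Suc i" by (metis add.commute le_Suc_ex)
  then have "b - Suc i = a" "b - i = Suc a" "{a..<b} = insert a {Suc a..<b}" by auto
  then show ?case using Suc by simp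
qed simp

text \<open>
  \<open>bsw k j l\<close> moves the block of length \<open>j\<close> that begins at \<open>k\<close> past the next block, of
  length \<open>l\<close>.
\<close>

fun bsw :: "nat \<Rightarrow> nat \<Rightarrow> nat \<Rightarrow> nat list" where
  "bsw k 0 l = []"
| "bsw k (Suc j) l = bsw k j l @ dwl (k + j + l) l"

lemma length_bsw [simp]: "length (bsw k j l) = j * l"
  by (induction j) auto

lemma set_bsw: "set (bsw k j l) \<subseteq> {i. k \<le> i \<and> i + 1 < k + j + l}"
proof (induction j)
  case (Suc j)
  then show ?case using set_dwl[of l "k + j + l"] by auto
qed simp

lemma bsw_0 [simp]: "bsw k j 0 = []"
  by (induction j) auto

lemma gw_commute:
  assumes "\<And>x. x \<in> set ws \<Longrightarrow> c * g x = g x * c"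
  shows "c * gw ws = gw ws * c"
  using assms
proof (induction ws)
  case (Cons x ws)
  then show ?case by (simp only: gw_simps) (intro comm_mult, auto)
qed simp

lemma top_word_shuf: "top_word {i. k \<le> i \<and> i + 1 < k + j + l} (bsw k j l) (shuf k j l)"
proof (induction k j l rule: shuf.induct)
  case (3 k j l)
  let ?I = "{i. k \<le> i \<and> i + 1 < k + Suc j + Suc l}"
  have "shuf k (Suc j) l \<in> short ?I (length (bsw k (Suc j) (Suc l)))"
    using 3(1) by (rule top_word_short[OF top_word_mono]) auto
  moreover have "top_word ?I (dwl (k + j + Suc l) (Suc l)) (dw (k + j + Suc l) (Suc l))"
    unfolding gw_dwl[symmetric]
    using set_dwl[of "Suc l" "k + j + Suc l"] by (intro top_word_word) (auto simp del: dwl.simps)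
  then have "top_word ?I (bsw k (Suc j) (Suc l)) (shuf k j (Suc l) * dw (k + j + Suc l) (Suc l))"
    unfolding bsw.simps using 3(2) by (intro top_word_mult top_word_mono[OF 3(2)]) auto
  ultimately show ?case unfolding shuf.simps by (intro top_word_add_short)
qed (use top_word_word[of "[]"] in simp_all)

lemma uw_snoc: "i < b \<Longrightarrow> uw b (Suc i) = uw (b - 1) i * g (b - 1)"
  using uw_add[of 1 b i] by simp

text \<open>The array of letters of \<open>bsw\<close> may be read by columns as well as by rows.\<close>

lemma bsw_columns:
  "k + j + Suc l \<le> r \<Longrightarrow> gw (bsw k j (Suc l)) = uw (k + l + j) j * gw (bsw k j l)"
proof (induction j)
  case (Suc j)
  have "gw (bsw k (Suc j) (Suc l)) = uw (k + l + j) j * (gw (bsw k j l) * dw (Suc (k + j + l)) (Suc l))"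
    using Suc by (simp add: gw_dwl mult.assoc del: dw.simps dwl.simps)
  also have "dw (Suc (k + j + l)) (Suc l) = g (k + j + l) * dw (k + j + l) l"
    using dw_add[of 1 "Suc (k + j + l)" l] by simp
  also have "gw (bsw k j l) * (g (k + j + l) * dw (k + j + l) l)
      = (g (k + j + l) * gw (bsw k j l)) * dw (k + j + l) l"
  proof -
    have "g (k + j + l) * gw (bsw k j l) = gw (bsw k j l) * g (k + j + l)"
      using set_bsw[of k j l] Suc.prems by (intro gw_commute g_comm_far) fastforce+
    then show ?thesis by (simp add: mult.assoc)
  qed
  also have "\<dots> = g (k + j + l) * gw (bsw k (Suc j) l)"
    by (simp add: gw_dwl mult.assoc)
  also have "uw (k + l + j) j * (g (k + j + l) * gw (bsw k (Suc j) l))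
      = uw (k + l + Suc j) (Suc j) * gw (bsw k (Suc j) l)"
    using uw_snoc[of j "k + l + Suc j"] by (simp add: mult.assoc add_ac del: uw.simps bsw.simps)
  finally show ?case .
qed simp

lemma bsw_right: 
  "k + j + l \<le> r \<Longrightarrow> k + j \<le> x \<Longrightarrow> x + 1 < k + j + l \<Longrightarrow>
    gw (bsw k j l) * g x = g (x - j) * gw (bsw k j l)"
proof (induction j arbitrary: x)
  case (Suc j)
  have "gw (bsw k (Suc j) l) * g x = gw (bsw k j l) * (dw (k + j + l) l * g x)"
    by (simp add: gw_dwl mult.assoc)
  also have "dw (k + j + l) l * g x = g (x - 1) * dw (k + j + l) l"
    using Suc.prems by (intro dw_g) auto
  also have "gw (bsw k j l) * (g (x - 1) * dw (k + j + l) l)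
      = g (x - 1 - j) * gw (bsw k j l) * dw (k + j + l) l"
    using Suc.prems by (subst Suc.IH[symmetric]) (auto simp: mult.assoc)
  finally show ?case by (simp add: gw_dwl mult.assoc)
qed simp

lemma bsw_left:
  "k + j + l \<le> r \<Longrightarrow> k \<le> x \<Longrightarrow> x + 1 < k + j \<Longrightarrow>
    gw (bsw k j l) * g x = g (x + l) * gw (bsw k j l)"
proof (induction l)
  case (Suc l)
  have "gw (bsw k j (Suc l)) * g x = uw (k + l + j) j * (gw (bsw k j l) * g x)"
    using Suc.prems by (subst bsw_columns) (simp_all add: mult.assoc)
  also have "\<dots> = (uw (k + l + j) j * g (x + l)) * gw (bsw k j l)"
    using Suc by (simp add: mult.assoc)
  also have "uw (k + l + j) j * g (x + l) = g (x + Suc l) * uw (k + l + j) j"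
    using g_uw[of "k + l + j" j "x + Suc l"] Suc.prems by simp
  also have "g (x + Suc l) * uw (k + l + j) j * gw (bsw k j l) = g (x + Suc l) * gw (bsw k j (Suc l))"
    using Suc.prems by (subst bsw_columns) (simp_all add: mult.assoc)
  finally show ?case .
qed simp

subsection \<open>Products of symmetrizers\<close>

fun sfac :: "nat \<Rightarrow> nat list \<Rightarrow> 'a" where
  "sfac k [] = 1"
| "sfac k (m # ms) = symz k m * sfac (k + m) ms"

lemma sfac_append: "sfac k (ms @ ns) = sfac k ms * sfac (k + sum_list ms) ns"
  by (induction ms arbitrary: k) (auto simp: mult.assoc add.assoc)

lemma sfac_shift:
  assumes "\<And>x. k \<le> x \<Longrightarrow> x + 1 < k + sum_list ms \<Longrightarrow> c * g x = g (x - k + k') * c"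
  shows "c * sfac k ms = sfac k' ms * c"
  using assms
proof (induction ms arbitrary: k k')
  case (Cons m ms)
  have 1: "c * symz k m = symz k' m * c"
    using Cons.prems by (intro symz_shift) auto
  have 2: "c * sfac (k + m) ms = sfac (k' + m) ms * c"
  proof (rule Cons.IH)
    fix x assume x: "k + m \<le> x" "x + 1 < k + m + sum_list ms"
    then have "x - (k + m) + (k' + m) = x - k + k'" by simp
    then show "c * g x = g (x - (k + m) + (k' + m)) * c" using Cons.prems[of x] x by simp
  qed
  have "c * sfac k (m # ms) = (c * symz k m) * sfac (k + m) ms" by (simp add: mult.assoc)
  also have "\<dots> = symz k' m * (c * sfac (k + m) ms)" unfolding 1 by (simp add: mult.assoc)
  finally show ?case unfolding 2 by (simp add: mult.assoc)
qed simp

lemma sfac_commute: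
  assumes "\<And>x. k \<le> x \<Longrightarrow> x + 1 < k + sum_list ms \<Longrightarrow> c * g x = g x * c"
  shows "c * sfac k ms = sfac k ms * c"
  using assms by (intro sfac_shift) auto

text \<open>The letters that preserve the blocks.\<close>

fun inner :: "nat \<Rightarrow> nat list \<Rightarrow> nat set" where
  "inner k [] = {}"
| "inner k (m # ms) = {i. k \<le> i \<and> i + 1 < k + m} \<union> inner (k + m) ms"

lemma inner_bounds: "i \<in> inner k ms \<Longrightarrow> k \<le> i \<and> i + 1 < k + sum_list ms"
  by (induction ms arbitrary: k) fastforce+

lemma sfac_commute_inner:
  assumes "\<And>x. x \<in> inner k ms \<Longrightarrow> c * g x = g x * c"
  shows "c * sfac k ms = sfac k ms * c"
  using assms
proof (induction ms arbitrary: k)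
  case (Cons m ms)
  have "c * symz k m = symz k m * c" using Cons.prems by (intro symz_commute) auto
  moreover have "c * sfac (k + m) ms = sfac (k + m) ms * c" using Cons by auto
  ultimately show ?case by (simp add: comm_mult)
qed simp

lemma g_sfac: "i \<in> inner k ms \<Longrightarrow> k + sum_list ms \<le> r \<Longrightarrow> g i * sfac k ms = Q * sfac k ms"
proof (induction ms arbitrary: k)
  case (Cons m ms)
  show ?case
  proof (cases "i \<in> inner (k + m) ms")
    case False
    then have "g i * symz k m = Q * symz k m" using Cons.prems by (intro g_symz) auto
    then show ?thesis by (simp add: mult.assoc[symmetric])
  next
    case True
    then have "g i * sfac (k + m) ms = Q * sfac (k + m) ms" using Cons by simp
    moreover have "g i * symz k m = symz k m * g i"
      using inner_bounds[OF True] Cons.prems by (intro symz_commute g_comm_far) auto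
    moreover have "Q * symz k m = symz k m * Q"
      using Cons.prems by (intro symz_commute Q_g) auto
    ultimately show ?thesis
      using comm_past[of "g i" "symz k m" "sfac (k + m) ms"] comm_past[of Q "symz k m" "sfac (k + m) ms"]
      by simp
  qed
qed simp

lemma sfac_filter: "sfac k (filter (\<lambda>m. m \<noteq> 0) ms @ replicate n 0) = sfac k ms"
proof (induction ms arbitrary: k)
  case Nil
  have "sfac k (replicate n 0) = 1" for k by (induction n arbitrary: k) auto
  then show ?case by simp
qed auto

text \<open>
  A list of pairs \<open>(j, l)\<close> records how each block of length \<open>j + l\<close> is divided.
\<close>

fun il :: "(nat \<times> nat) list \<Rightarrow> nat list" where
  "il [] = []"
| "il ((j, l) # ps) = j # l # il ps"

fun li :: "(nat \<times> nat) list \<Rightarrow> nat list" where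
  "li [] = []"
| "li ((j, l) # ps) = l # j # li ps"

abbreviation totals :: "(nat \<times> nat) list \<Rightarrow> nat list" where
  "totals ps \<equiv> map (\<lambda>(j, l). j + l) ps"

lemma sum_il: "sum_list (il ps) = sum_list (totals ps)" "sum_list (li ps) = sum_list (totals ps)"
  "sum_list (totals ps) = sum_list (map fst ps) + sum_list (map snd ps)"
  by (induction ps) auto

fun gather :: "nat \<Rightarrow> (nat \<times> nat) list \<Rightarrow> nat list" where
  "gather k [] = []"
| "gather k ((j, l) # ps) = gather (k + j + l) ps @ bsw (k + j) (sum_list (map fst ps)) l"

fun flips :: "nat \<Rightarrow> (nat \<times> nat) list \<Rightarrow> nat list" where
  "flips k [] = []"
| "flips k ((j, l) # ps) = bsw k j l @ flips (k + j + l) ps"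

fun shufs :: "nat \<Rightarrow> (nat \<times> nat) list \<Rightarrow> 'a" where
  "shufs k [] = 1"
| "shufs k ((j, l) # ps) = shuf k j l * shufs (k + j + l) ps"

lemma set_gather: "set (gather k ps) \<subseteq> {i. k \<le> i \<and> i + 1 < k + sum_list (totals ps)}"
proof (induction k ps rule: gather.induct)
  case (2 k j l ps)
  then show ?case
    using set_bsw[of "k + j" "sum_list (map fst ps)" l] by (force simp: sum_il(3))
qed simp

lemma set_flips: "set (flips k ps) \<subseteq> inner k (totals ps)"
proof (induction k ps rule: flips.induct)
  case (2 k j l ps)
  then show ?case using set_bsw[of k j l] by (auto simp: add.assoc)
qed simp

lemma top_word_shufs: "top_word (inner k (totals ps)) (flips k ps) (shufs k ps)"
proof (induction k ps rule: flips.induct)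
  case (2 k j l ps)
  then show ?case unfolding flips.simps shufs.simps
    by (intro top_word_mult top_word_mono[OF 2] top_word_mono[OF top_word_shuf]) (auto simp: add.assoc)
qed (use top_word_word[of "[]"] in simp)

lemma gather_sfac:
  "k + sum_list (totals ps) \<le> r \<Longrightarrow>
    gw (gather k ps) * sfac k (map fst ps @ map snd ps) = sfac k (il ps) * gw (gather k ps)"
proof (induction k ps rule: gather.induct)
  case (2 k j l ps)
  let ?a = "sum_list (map fst ps)" and ?b = "sum_list (map snd ps)"
  let ?W = "gw (gather (k + j + l) ps)" and ?B = "gw (bsw (k + j) ?a l)"
  have le: "k + j + l + ?a + ?b \<le> r" using 2(2) sum_il(3)[of ps] by simp
  have W1: "?W * symz k j = symz k j * ?W"
    using set_gather[of "k + j + l" ps] le sum_il(3)[of ps]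
    by (intro gw_commute[symmetric] symz_commute[symmetric] g_comm_far) fastforce+
  have W2: "?W * symz (k + j) l = symz (k + j) l * ?W"
    using set_gather[of "k + j + l" ps] le sum_il(3)[of ps]
    by (intro gw_commute[symmetric] symz_commute[symmetric] g_comm_far) fastforce+
  have B1: "?B * symz k j = symz k j * ?B"
    using set_bsw[of "k + j" ?a l] le
    by (intro gw_commute[symmetric] symz_commute[symmetric] g_comm_far) fastforce+
  have B2: "?B * sfac (k + j) (map fst ps) = sfac (k + j + l) (map fst ps) * ?B"
    using le by (intro sfac_shift) (auto simp: bsw_left add_ac)
  have B3: "?B * symz (k + j + ?a) l = symz (k + j) l * ?B"
    using le by (intro symz_shift) (auto simp: bsw_right)
  have B4: "?B * sfac (k + j + ?a + l) (map snd ps) = sfac (k + j + ?a + l) (map snd ps) * ?B"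
    using set_bsw[of "k + j" ?a l] le
    by (intro gw_commute[symmetric] sfac_commute[symmetric] g_comm_far) fastforce+
  have C: "sfac (k + j + l) (map fst ps) * symz (k + j) l = symz (k + j) l * sfac (k + j + l) (map fst ps)"
    using le by (intro sfac_commute[symmetric] symz_commute[symmetric] g_comm_far) auto
  have "?B * sfac k (map fst ((j, l) # ps) @ map snd ((j, l) # ps))
      = ?B * symz k j * sfac (k + j) (map fst ps) * symz (k + j + ?a) l * sfac (k + j + ?a + l) (map snd ps)"
    by (simp add: sfac_append mult.assoc add_ac)
  also have "\<dots> = symz k j * (?B * sfac (k + j) (map fst ps)) * symz (k + j + ?a) l * sfac (k + j + ?a + l) (map snd ps)"
    unfolding B1 by (simp only: mult.assoc)
  also have "\<dots> = symz k j * sfac (k + j + l) (map fst ps) * (?B * symz (k + j + ?a) l) * sfac (k + j + ?a + l) (map snd ps)"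
    unfolding B2 by (simp only: mult.assoc)
  also have "\<dots> = symz k j * (sfac (k + j + l) (map fst ps) * symz (k + j) l) * (?B * sfac (k + j + ?a + l) (map snd ps))"
    unfolding B3 by (simp only: mult.assoc)
  also have "\<dots> = symz k j * symz (k + j) l * sfac (k + j + l) (map fst ps @ map snd ps) * ?B"
    unfolding B4 C sfac_append by (simp add: mult.assoc add_ac)
  finally have B: "?B * sfac k (map fst ((j, l) # ps) @ map snd ((j, l) # ps))
      = symz k j * symz (k + j) l * sfac (k + j + l) (map fst ps @ map snd ps) * ?B" .
  have IH: "?W * sfac (k + j + l) (map fst ps @ map snd ps) = sfac (k + j + l) (il ps) * ?W"
    using 2 by (simp add: add_ac)
  have "gw (gather k ((j, l) # ps)) * sfac k (map fst ((j, l) # ps) @ map snd ((j, l) # ps))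
      = ?W * (symz k j * symz (k + j) l * sfac (k + j + l) (map fst ps @ map snd ps) * ?B)"
    unfolding B[symmetric] by (simp only: gather.simps gw_simps mult.assoc)
  also have "\<dots> = (?W * symz k j) * symz (k + j) l * sfac (k + j + l) (map fst ps @ map snd ps) * ?B"
    by (simp only: mult.assoc)
  also have "\<dots> = symz k j * (?W * symz (k + j) l) * sfac (k + j + l) (map fst ps @ map snd ps) * ?B"
    unfolding W1 by (simp only: mult.assoc)
  also have "\<dots> = symz k j * symz (k + j) l * (?W * sfac (k + j + l) (map fst ps @ map snd ps)) * ?B"
    unfolding W2 by (simp only: mult.assoc)
  also have "\<dots> = sfac k (il ((j, l) # ps)) * gw (gather k ((j, l) # ps))"
    unfolding IH by (simp add: mult.assoc)
  finally show ?case .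
qed simp

lemma inner_totals_far:
  assumes "set ws \<subseteq> {i. k + m \<le> i \<and> i + 1 < r}"
  shows "gw ws * symz k m = symz k m * gw ws"
  using assms by (intro gw_commute[symmetric] symz_commute[symmetric] g_comm_far) fastforce+

lemma inner_bound: "inner k ms \<subseteq> {i. k \<le> i \<and> i + 1 < k + sum_list ms}"
  using inner_bounds by blast

lemma flips_sfac:
  "k + sum_list (totals ps) \<le> r \<Longrightarrow> gw (flips k ps) * sfac k (il ps) = sfac k (li ps) * gw (flips k ps)"
proof (induction k ps rule: flips.induct)
  case (2 k j l ps)
  let ?W = "gw (flips (k + j + l) ps)" and ?B = "gw (bsw k j l)"
  have le: "k + j + l + sum_list (totals ps) \<le> r" using 2(2) by simp
  have letters: "set (flips (k + j + l) ps) \<subseteq> {i. k + j + l \<le> i \<and> i + 1 < r}"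
    using set_flips[of "k + j + l" ps] inner_bound[of "k + j + l" "totals ps"] le by fastforce
  have W1: "?W * symz k j = symz k j * ?W"
    using letters by (intro inner_totals_far) auto
  have W2: "?W * symz (k + j) l = symz (k + j) l * ?W"
    using letters by (intro inner_totals_far) auto
  have B1: "?B * symz k j = symz (k + l) j * ?B"
    using le by (intro symz_shift) (auto simp: bsw_left add_ac)
  have B2: "?B * symz (k + j) l = symz k l * ?B"
    using le by (intro symz_shift) (auto simp: bsw_right)
  have B3: "?B * sfac (k + j + l) (li ps) = sfac (k + j + l) (li ps) * ?B"
    using set_bsw[of k j l] le sum_il(2)[of ps]
    by (intro gw_commute[symmetric] sfac_commute[symmetric] g_comm_far) fastforce+
  have C: "symz (k + l) j * symz k l = symz k l * symz (k + l) j"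
    using le by (intro symz_symz_commute[symmetric]) auto
  have IH: "?W * sfac (k + j + l) (il ps) = sfac (k + j + l) (li ps) * ?W"
    using 2 by (simp add: add_ac)
  have "gw (flips k ((j, l) # ps)) * sfac k (il ((j, l) # ps))
      = ?B * (?W * symz k j) * symz (k + j) l * sfac (k + j + l) (il ps)"
    by (simp add: mult.assoc)
  also have "\<dots> = ?B * symz k j * (?W * symz (k + j) l) * sfac (k + j + l) (il ps)"
    unfolding W1 by (simp only: mult.assoc)
  also have "\<dots> = (?B * symz k j) * symz (k + j) l * (?W * sfac (k + j + l) (il ps))"
    unfolding W2 by (simp only: mult.assoc)
  also have "\<dots> = symz (k + l) j * (?B * symz (k + j) l) * sfac (k + j + l) (li ps) * ?W"
    unfolding IH B1 by (simp only: mult.assoc)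
  also have "\<dots> = (symz (k + l) j * symz k l) * (?B * sfac (k + j + l) (li ps)) * ?W"
    unfolding B2 by (simp only: mult.assoc)
  also have "\<dots> = sfac k (li ((j, l) # ps)) * gw (flips k ((j, l) # ps))"
    unfolding B3 C by (simp add: mult.assoc add_ac)
  finally show ?case .
qed simp

lemma shufs_sfac:
  "k + sum_list (totals ps) \<le> r \<Longrightarrow> shufs k ps * sfac k (il ps) = sfac k (totals ps)"
proof (induction k ps rule: flips.induct)
  case (2 k j l ps)
  have le: "k + j + l + sum_list (totals ps) \<le> r" using 2(2) by simp
  have comm: "c * shufs (k + j + l) ps = shufs (k + j + l) ps * c"
    if c: "\<And>i. i \<in> inner (k + j + l) (totals ps) \<Longrightarrow> c * g i = g i * c" for c
  proof -
    have sh: "c * x = x * c" if "x \<in> short (inner (k + j + l) (totals ps)) n" for x n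
      using that by (induction rule: short.induct)
        (auto simp: distrib_left distrib_right intro!: gw_commute c)
    have "shufs (k + j + l) ps \<in> short (inner (k + j + l) (totals ps)) (Suc (length (flips (k + j + l) ps)))"
      by (rule top_word_short[OF top_word_shufs]) simp
    then show ?thesis by (rule sh)
  qed
  have W1: "symz k j * shufs (k + j + l) ps = shufs (k + j + l) ps * symz k j"
    using inner_bound[of "k + j + l" "totals ps"] le
    by (intro comm symz_commute[symmetric] g_comm_far) fastforce+
  have W2: "symz (k + j) l * shufs (k + j + l) ps = shufs (k + j + l) ps * symz (k + j) l"
    using inner_bound[of "k + j + l" "totals ps"] le
    by (intro comm symz_commute[symmetric] g_comm_far) fastforce+
  have IH: "shufs (k + j + l) ps * sfac (k + j + l) (il ps) = sfac (k + j + l) (totals ps)"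
    using 2 by (simp add: add_ac)
  have "shufs k ((j, l) # ps) * sfac k (il ((j, l) # ps))
      = shuf k j l * (shufs (k + j + l) ps * symz k j) * symz (k + j) l * sfac (k + j + l) (il ps)"
    by (simp add: mult.assoc)
  also have "\<dots> = shuf k j l * symz k j * (shufs (k + j + l) ps * symz (k + j) l) * sfac (k + j + l) (il ps)"
    unfolding W1[symmetric] by (simp only: mult.assoc)
  also have "\<dots> = shuf k j l * (symz k j * symz (k + j) l) * (shufs (k + j + l) ps * sfac (k + j + l) (il ps))"
    unfolding W2[symmetric] by (simp only: mult.assoc)
  also have "shuf k j l * (symz k j * symz (k + j) l) = symz k (j + l)"
    using le by (intro symz_shuf[symmetric]) simp
  finally show ?case unfolding IH by (simp add: add.assoc)
qed simp

lemma sfac_divide: "k + sum_list (totals ps) \<le> r \<Longrightarrow> \<exists>D. sfac k (totals ps) = sfac k (li ps) * D"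
proof (induction k ps rule: flips.induct)
  case (2 k j l ps)
  have le: "k + j + l + sum_list (totals ps) \<le> r" using 2(2) by simp
  obtain D where D: "sfac (k + j + l) (totals ps) = sfac (k + j + l) (li ps) * D"
    using 2 by (auto simp: add_ac)
  obtain S where S: "symz k (l + j) = symz k l * symz (k + l) j * S"
    using symz_split[of k l j] le by auto
  let ?R = "sfac (k + j + l) (li ps)"
  have C: "symz k m * ?R = ?R * symz k m" if "m \<le> j + l" for m
    using le sum_il(2)[of ps] that
    by (intro sfac_commute symz_commute[symmetric] g_comm_far) auto
  have C': "symz (k + l) j * ?R = ?R * symz (k + l) j"
    using le sum_il(2)[of ps]
    by (intro sfac_commute symz_commute[symmetric] g_comm_far) auto
  have "sfac k (totals ((j, l) # ps)) = symz k (j + l) * ?R * D"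
    using D by (simp add: mult.assoc add.assoc)
  also have "\<dots> = ?R * symz k l * symz (k + l) j * S * D"
    using C[of "j + l"] S by (simp add: mult.assoc add.commute[of j])
  also have "\<dots> = symz k l * (?R * symz (k + l) j) * S * D"
    using C[of l] by (simp add: mult.assoc[symmetric])
  also have "\<dots> = sfac k (li ((j, l) # ps)) * (S * D)"
    unfolding C'[symmetric] by (simp add: mult.assoc add_ac)
  finally show ?case by blast
qed simp

end

subsection \<open>Sets of positive positions\<close>

fun act :: "nat list \<Rightarrow> nat set \<Rightarrow> nat set" where
  "act [] J = J"
| "act (i # ws) J = sw i (act ws J)"

lemma act_append [simp]: "act (vs @ ws) J = act vs (act ws J)"
  by (induction vs) auto

definition wt :: "nat set \<Rightarrow> nat" where
  "wt J = \<Sum>J"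

lemma sw_raise: "n \<in> J \<Longrightarrow> Suc n \<notin> J \<Longrightarrow> sw n J = insert (Suc n) (J - {n})"
  by (rule Set.set_eqI) (auto simp: in_sw)

lemma finite_sw: "finite J \<Longrightarrow> finite (sw n J)"
  by (rule finite_subset[of _ "insert n (insert (Suc n) J)"]) (auto simp: in_sw split: if_splits)

lemma wt_sw_raise:
  assumes "finite J" "n \<in> J" "Suc n \<notin> J"
  shows "wt (sw n J) = Suc (wt J)"
  using assms sum.remove[of J n "\<lambda>x. x"] unfolding wt_def sw_raise[OF assms(2,3)] by simp

lemma wt_sw_le: "finite J \<Longrightarrow> wt (sw n J) \<le> Suc (wt J)"
proof -
  assume f: "finite J"
  consider "(n \<in> J) = (Suc n \<in> J)" | "n \<in> J" "Suc n \<notin> J" | "n \<in> sw n J" "Suc n \<notin> sw n J"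
    by (auto simp: in_sw)
  then show ?thesis
  proof cases
    case 3
    then show ?thesis using wt_sw_raise[OF finite_sw[OF f] 3] by (simp add: sw_sw)
  qed (use f in \<open>simp_all add: sw_same wt_sw_raise\<close>)
qed

lemma act_subset: "J \<subseteq> {..<r} \<Longrightarrow> set ws \<subseteq> {i. Suc i < r} \<Longrightarrow> act ws J \<subseteq> {..<r}"
  by (induction ws) (simp_all add: sw_subset)

lemma finite_act: "finite J \<Longrightarrow> finite (act ws J)"
  by (induction ws) (auto intro: finite_sw)

lemma wt_act_le: "finite J \<Longrightarrow> wt (act ws J) \<le> wt J + length ws"
proof (induction ws)
  case (Cons i ws)
  then show ?case using wt_sw_le[OF finite_act[OF Cons.prems], of i ws] by simp
qed simp

fun profile :: "nat \<Rightarrow> nat list \<Rightarrow> nat set \<Rightarrow> nat list" where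
  "profile k [] J = []"
| "profile k (m # ms) J = card (J \<inter> {k..<k + m}) # profile (k + m) ms J"

lemma profile_cong: "J \<inter> {k..<k + sum_list ms} = J' \<inter> {k..<k + sum_list ms} \<Longrightarrow> profile k ms J = profile k ms J'"
proof (induction ms arbitrary: k)
  case (Cons m ms)
  have "J \<inter> {k..<k + m} = (J \<inter> {k..<k + sum_list (m # ms)}) \<inter> {k..<k + m}"
    "J' \<inter> {k..<k + m} = (J' \<inter> {k..<k + sum_list (m # ms)}) \<inter> {k..<k + m}"
    "J \<inter> {k + m..<k + m + sum_list ms} = (J \<inter> {k..<k + sum_list (m # ms)}) \<inter> {k + m..<k + m + sum_list ms}"
    "J' \<inter> {k + m..<k + m + sum_list ms} = (J' \<inter> {k..<k + sum_list (m # ms)}) \<inter> {k + m..<k + m + sum_list ms}"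
    by auto
  then show ?case using Cons by (metis profile.simps(2))
qed simp

lemma card_sw_interval:
  assumes "k \<le> i \<and> i + 1 < k + m \<or> i + 1 < k \<or> k + m \<le> i"
  shows "card (sw i J \<inter> {k..<k + m}) = card (J \<inter> {k..<k + m})"
proof -
  have "bij_betw (\<lambda>x. if x = i then Suc i else if x = Suc i then i else x) (sw i J \<inter> {k..<k + m}) (J \<inter> {k..<k + m})"
    by (rule bij_betw_byWitness[where f' = "\<lambda>x. if x = i then Suc i else if x = Suc i then i else x"])
      (use assms in \<open>auto simp: in_sw\<close>)
  then show ?thesis by (rule bij_betw_same_card)
qed

context hecke_A
begin

lemma profile_sw: "i \<in> inner k ms \<Longrightarrow> profile k ms (sw i J) = profile k ms J"
proof -
  have *: "profile k ms (sw i J) = profile k ms J" if "i \<in> inner k ms \<or> i + 1 < k" for k ms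
    using that
  proof (induction ms arbitrary: k)
    case (Cons m ms)
    have "k \<le> i \<and> i + 1 < k + m \<or> i + 1 < k \<or> k + m \<le> i"
      using Cons.prems inner_bounds[of i "k + m" ms] by auto
    moreover have "i \<in> inner (k + m) ms \<or> i + 1 < k + m" using Cons.prems by auto
    ultimately show ?case using Cons.IH[of "k + m"] card_sw_interval[of k i m J] by simp
  qed simp
  show "i \<in> inner k ms \<Longrightarrow> profile k ms (sw i J) = profile k ms J" by (rule *) simp
qed

fun heads :: "nat \<Rightarrow> (nat \<times> nat) list \<Rightarrow> nat set" where
  "heads k [] = {}"
| "heads k ((j, l) # ps) = {k..<k + j} \<union> heads (k + j + l) ps"

fun tails :: "nat \<Rightarrow> (nat \<times> nat) list \<Rightarrow> nat set" where
  "tails k [] = {}"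
| "tails k ((j, l) # ps) = {k + l..<k + l + j} \<union> tails (k + j + l) ps"

lemma heads_bounds: "heads k ps \<subseteq> {k..<k + sum_list (totals ps)}"
  by (induction k ps rule: heads.induct) fastforce+

lemma tails_bounds: "tails k ps \<subseteq> {k..<k + sum_list (totals ps)}"
  by (induction k ps rule: tails.induct) fastforce+

lemma finite_heads [simp]: "finite (heads k ps)" "finite (tails k ps)"
  using heads_bounds[of k ps] tails_bounds[of k ps] finite_subset by blast+

lemma act_dwl:
  "i \<le> b \<Longrightarrow> {b - i..b} \<inter> J = {} \<Longrightarrow> act (dwl b i) (insert (b - i) J) = insert b J"
proof (induction i)
  case (Suc i)
  then obtain a where b: "b = a + Suc i" by (metis add.commute le_Suc_ex)
  have a: "b - Suc i = a" "b - i = Suc a" using b by auto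
  have "x \<notin> J" if "a \<le> x" "x \<le> b" for x using Suc.prems(2) that unfolding a by auto
  then have J: "a \<notin> J" "Suc a \<notin> J" "{b - i..b} \<inter> J = {}" using b a by auto
  have "sw a (insert a J) = insert (Suc a) J"
    using sw_raise[of a "insert a J"] J by auto
  then show ?case using Suc.IH J a b by simp
qed simp

lemma act_bsw:
  "J \<inter> {k..<k + j + l} = {} \<Longrightarrow> act (bsw k j l) ({k..<k + j} \<union> J) = {k + l..<k + l + j} \<union> J"
proof (induction j arbitrary: J)
  case (Suc j)
  have "{k..<k + Suc j} \<union> J = insert (k + j + l - l) ({k..<k + j} \<union> J)" by auto
  moreover have "{k + j + l - l..k + j + l} \<inter> ({k..<k + j} \<union> J) = {}" using Suc.prems by auto
  ultimately have "act (dwl (k + j + l) l) ({k..<k + Suc j} \<union> J) = insert (k + j + l) ({k..<k + j} \<union> J)"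
    using act_dwl[of l "k + j + l" "{k..<k + j} \<union> J"] by simp
  also have "\<dots> = {k..<k + j} \<union> insert (k + j + l) J" by simp
  finally have "act (bsw k (Suc j) l) ({k..<k + Suc j} \<union> J) = act (bsw k j l) ({k..<k + j} \<union> insert (k + j + l) J)"
    by simp
  also have "\<dots> = {k + l..<k + l + j} \<union> insert (k + j + l) J"
    using Suc.prems by (intro Suc.IH) auto
  also have "\<dots> = {k + l..<k + l + Suc j} \<union> J" by auto
  finally show ?case .
qed simp

lemma act_gather:
  "J \<inter> {k..<k + sum_list (totals ps)} = {} \<Longrightarrow>
    act (gather k ps) ({k..<k + sum_list (map fst ps)} \<union> J) = heads k ps \<union> J"
proof (induction k ps arbitrary: J rule: gather.induct)
  case (2 k j l ps)
  let ?a = "sum_list (map fst ps)"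
  have S: "sum_list (totals ps) = ?a + sum_list (map snd ps)" by (rule sum_il(3))
  have "{k..<k + sum_list (map fst ((j, l) # ps))} \<union> J = {k + j..<k + j + ?a} \<union> ({k..<k + j} \<union> J)" by auto
  moreover have "act (bsw (k + j) ?a l) ({k + j..<k + j + ?a} \<union> ({k..<k + j} \<union> J))
      = {k + j + l..<k + j + l + ?a} \<union> ({k..<k + j} \<union> J)"
    using 2(2) S by (intro act_bsw) auto
  moreover have "act (gather (k + j + l) ps) ({k + j + l..<k + j + l + ?a} \<union> ({k..<k + j} \<union> J))
      = heads (k + j + l) ps \<union> ({k..<k + j} \<union> J)"
    using 2(2) by (intro 2(1)) auto
  ultimately show ?case by auto
qed simp

lemma act_flips:
  "J \<inter> {k..<k + sum_list (totals ps)} = {} \<Longrightarrow> act (flips k ps) (heads k ps \<union> J) = tails k ps \<union> J"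
proof (induction k ps arbitrary: J rule: flips.induct)
  case (2 k j l ps)
  have t: "tails (k + j + l) ps \<subseteq> {k + j + l..<k + j + l + sum_list (totals ps)}" by (rule tails_bounds)
  have "heads k ((j, l) # ps) \<union> J = heads (k + j + l) ps \<union> ({k..<k + j} \<union> J)" by auto
  moreover have "act (flips (k + j + l) ps) (heads (k + j + l) ps \<union> ({k..<k + j} \<union> J))
      = tails (k + j + l) ps \<union> ({k..<k + j} \<union> J)"
    using 2(2) by (intro 2(1)) auto
  moreover have "act (bsw k j l) ({k..<k + j} \<union> (tails (k + j + l) ps \<union> J))
      = {k + l..<k + l + j} \<union> (tails (k + j + l) ps \<union> J)"
    using 2(2) t by (intro act_bsw) auto
  moreover have "tails (k + j + l) ps \<union> ({k..<k + j} \<union> J) = {k..<k + j} \<union> (tails (k + j + l) ps \<union> J)" by auto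
  ultimately show ?case by (simp add: Un_assoc)
qed simp

lemma wt_Un: "finite A \<Longrightarrow> finite B \<Longrightarrow> A \<inter> B = {} \<Longrightarrow> wt (A \<union> B) = wt A + wt B"
  unfolding wt_def by (rule sum.union_disjoint)

lemma wt_interval: "wt {k + l..<k + l + j} = wt {k..<k + j} + j * l"
  by (induction j) (simp_all add: wt_def)

lemma wt_interval': "wt {k..<k + (i + j)} = wt {k..<k + i} + wt {k + i..<k + i + j}"
  by (induction j) (simp_all add: wt_def add.assoc)

lemma wt_heads: "wt (heads k ps) = wt {k..<k + sum_list (map fst ps)} + length (gather k ps)"
proof (induction k ps rule: gather.induct)
  case (2 k j l ps)
  let ?a = "sum_list (map fst ps)"
  have "wt (heads k ((j, l) # ps)) = wt {k..<k + j} + wt (heads (k + j + l) ps)"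
    using heads_bounds[of "k + j + l" ps] unfolding heads.simps by (intro wt_Un) auto
  also have "wt (heads (k + j + l) ps) = wt {k + j..<k + j + ?a} + ?a * l + length (gather (k + j + l) ps)"
    using 2 wt_interval[of "k + j" l ?a] by simp
  also have "wt {k..<k + j} + (wt {k + j..<k + j + ?a} + ?a * l + length (gather (k + j + l) ps))
      = wt {k..<k + sum_list (map fst ((j, l) # ps))} + length (gather k ((j, l) # ps))"
    using wt_interval'[of k j ?a] by simp
  finally show ?case .
qed simp

lemma wt_tails: "wt (tails k ps) = wt (heads k ps) + length (flips k ps)"
proof (induction k ps rule: flips.induct)
  case (2 k j l ps)
  have "wt (heads k ((j, l) # ps)) = wt {k..<k + j} + wt (heads (k + j + l) ps)"
    using heads_bounds[of "k + j + l" ps] unfolding heads.simps by (intro wt_Un) auto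
  moreover have "wt (tails k ((j, l) # ps)) = wt {k + l..<k + l + j} + wt (tails (k + j + l) ps)"
    using tails_bounds[of "k + j + l" ps] unfolding tails.simps by (intro wt_Un) auto
  ultimately show ?case using 2 wt_interval[of k l j] by simp
qed simp

text \<open>The sets that are unions of blocks, as far as adjacent positions can tell.\<close>

lemma inner_heads:
  "i \<in> inner k (il ps) \<Longrightarrow> (i \<in> heads k ps) = (Suc i \<in> heads k ps)"
proof (induction k ps rule: heads.induct)
  case (2 k j l ps)
  have h: "heads (k + j + l) ps \<subseteq> {k + j + l..<k + j + l + sum_list (totals ps)}" by (rule heads_bounds)
  show ?case
  proof (cases "i \<in> inner (k + j + l) (il ps)")
    case True
    then show ?thesis using 2(1) inner_bounds[OF True] by auto
  next
    case False
    then have "k \<le> i \<and> i + 1 < k + j \<or> k + j \<le> i \<and> i + 1 < k + j + l" using 2(2) by auto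
    then show ?thesis using h by auto
  qed
qed simp

lemma inner_tails:
  "i \<in> inner k (li ps) \<Longrightarrow> (i \<in> tails k ps) = (Suc i \<in> tails k ps)"
proof (induction k ps rule: tails.induct)
  case (2 k j l ps)
  have h: "tails (k + j + l) ps \<subseteq> {k + j + l..<k + j + l + sum_list (totals ps)}" by (rule tails_bounds)
  have e: "k + l + j = k + j + l" by simp
  show ?case
  proof (cases "i \<in> inner (k + j + l) (li ps)")
    case True
    then show ?thesis using 2(1) inner_bounds[OF True] by auto
  next
    case False
    then have "k \<le> i \<and> i + 1 < k + l \<or> k + l \<le> i \<and> i + 1 < k + l + j" using 2(2) e by auto
    then show ?thesis using h by auto
  qed
qed simp

lemma inner_append: "inner k (ms @ ns) = inner k ms \<union> inner (k + sum_list ms) ns"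
  by (induction ms arbitrary: k) (auto simp: add.assoc)

lemma inner_initial:
  "i \<in> inner 0 (ms @ ns) \<Longrightarrow> (i \<in> {..<sum_list ms}) = (Suc i \<in> {..<sum_list ms})"
  using inner_bounds[of i 0 ms] inner_bounds[of i "sum_list ms" ns] by (auto simp: inner_append)

text \<open>
  Among the sets with given block counts, \<open>tails\<close> is the only one in which no element can be
  moved up within its block.
\<close>

lemma upper_set_interval:
  assumes S: "S \<subseteq> {k..<k + m}" and up: "\<And>i. i \<in> S \<Longrightarrow> i + 1 < k + m \<Longrightarrow> Suc i \<in> S"
  shows "S = {k + m - card S..<k + m}"
proof (cases "S = {}")
  case False
  have fS: "finite S" using S finite_subset by blast
  define a where "a = Min S"
  have a: "a \<in> S" "\<And>x. x \<in> S \<Longrightarrow> a \<le> x" unfolding a_def using fS False by auto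
  have "a + d < k + m \<Longrightarrow> a + d \<in> S" for d
    by (induction d) (use a up in auto)
  then have "S = {a..<k + m}" using a S by (auto simp: le_iff_add)
  moreover have "a \<le> k + m" using a S by auto
  ultimately show ?thesis by (metis card_atLeastLessThan diff_diff_cancel)
qed simp

lemma profile_tails:
  assumes "profile k (totals ps) J = map fst ps" "J \<subseteq> {k..<k + sum_list (totals ps)}"
    and "\<And>i. i \<in> inner k (totals ps) \<Longrightarrow> i \<in> J \<Longrightarrow> Suc i \<in> J"
  shows "J = tails k ps"
  using assms
proof (induction k ps arbitrary: J rule: tails.induct)
  case (2 k j l ps)
  let ?S = "J \<inter> {k..<k + (j + l)}" and ?R = "J \<inter> {k + j + l..<k + j + l + sum_list (totals ps)}"
  have "?S = {k + (j + l) - card ?S..<k + (j + l)}"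
    using 2(4) by (intro upper_set_interval) auto
  moreover have "card ?S = j" using 2(2) by simp
  ultimately have S: "?S = {k + l..<k + l + j}" by (simp add: add_ac)
  have "?R = tails (k + j + l) ps"
  proof (rule 2(1))
    show "profile (k + j + l) (totals ps) ?R = map fst ps"
      using 2(2) profile_cong[of ?R "k + j + l" "totals ps" J] by (simp add: add.assoc)
    fix i assume i: "i \<in> inner (k + j + l) (totals ps)" "i \<in> ?R"
    then have "Suc i \<in> J" using 2(4)[of i] by (simp add: add.assoc)
    then show "Suc i \<in> ?R" using inner_bounds[OF i(1)] by simp
  qed simp
  moreover have "J = ?S \<union> ?R" using 2(3) by auto
  ultimately show ?case using S by simp
qed simp

lemma profile_heads: "profile k (totals ps) (heads k ps) = map fst ps"
proof (induction k ps rule: heads.induct)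
  case (2 k j l ps)
  have h: "heads (k + j + l) ps \<subseteq> {k + j + l..<k + j + l + sum_list (totals ps)}" by (rule heads_bounds)
  then have "heads k ((j, l) # ps) \<inter> {k..<k + (j + l)} = {k..<k + j}" by auto
  moreover have "profile (k + (j + l)) (totals ps) (heads k ((j, l) # ps)) = profile (k + (j + l)) (totals ps) (heads (k + j + l) ps)"
    by (rule profile_cong) auto
  ultimately show ?case using 2 by (simp add: add.assoc)
qed simp

end

locale sign_idem = hecke_A r Q Qi g
  for r :: nat and Q Qi :: "'a::{ring,monoid_mult}" and g :: "nat \<Rightarrow> 'a" +
  fixes E :: "nat set \<Rightarrow> 'a"
  assumes E_mult: "J \<subseteq> {..<r} \<Longrightarrow> J' \<subseteq> {..<r} \<Longrightarrow> E J * E J' = (if J = J' then E J else 0)"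
    and sum_E: "(\<Sum>J\<in>Pow {..<r}. E J) = 1"
    and Q_E: "J \<subseteq> {..<r} \<Longrightarrow> Q * E J = E J * Q"
    and g_E_same: "Suc n < r \<Longrightarrow> J \<subseteq> {..<r} \<Longrightarrow> (n \<in> J) = (Suc n \<in> J) \<Longrightarrow> g n * E J = E J * g n"
    and E_g_E_vanish: "Suc n < r \<Longrightarrow> J \<subseteq> {..<r} \<Longrightarrow> J' \<subseteq> {..<r} \<Longrightarrow> J' \<noteq> J \<Longrightarrow> J' \<noteq> sw n J \<Longrightarrow>
      E J' * g n * E J = 0"
    and E_g_E_inverse: "Suc n < r \<Longrightarrow> J \<subseteq> {..<r} \<Longrightarrow> (n \<in> J) \<noteq> (Suc n \<in> J) \<Longrightarrow>
      \<exists>w. w * (E (sw n J) * g n * E J) = E J \<and> (E (sw n J) * g n * E J) * w = E (sw n J)"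
begin

lemma E_idem: "J \<subseteq> {..<r} \<Longrightarrow> E J * E J = E J"
  by (simp add: E_mult)

lemma E_eqI:
  assumes "\<And>J. J \<subseteq> {..<r} \<Longrightarrow> E J * x = E J * y"
  shows "x = y"
proof -
  have "x = (\<Sum>J\<in>Pow {..<r}. E J * x)" using sum_E by (simp flip: sum_distrib_right)
  also have "\<dots> = (\<Sum>J\<in>Pow {..<r}. E J * y)" using assms by (intro sum.cong) auto
  also have "\<dots> = y" using sum_E by (simp flip: sum_distrib_right)
  finally show ?thesis .
qed

lemma E_g_insert:
  assumes n: "Suc n < r" and J: "J \<subseteq> {..<r}"
  shows "E J * g n = E J * g n * E J + (if sw n J = J then 0 else E J * g n * E (sw n J))"
proof -
  have sJ: "sw n J \<subseteq> {..<r}" using n J by (rule sw_subset)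
  have "E J * g n = (\<Sum>K\<in>Pow {..<r}. E J * g n * E K)"
    using sum_E by (simp flip: sum_distrib_left)
  also have "\<dots> = (\<Sum>K\<in>{J, sw n J}. E J * g n * E K)"
  proof (rule sum.mono_neutral_right)
    show "\<forall>K\<in>Pow {..<r} - {J, sw n J}. E J * g n * E K = 0"
    proof
      fix K assume "K \<in> Pow {..<r} - {J, sw n J}"
      then have "K \<subseteq> {..<r}" "J \<noteq> K" "J \<noteq> sw n K" by (auto simp: sw_sw)
      then show "E J * g n * E K = 0" using n J by (intro E_g_E_vanish)
    qed
  qed (use J sJ in auto)
  also have "\<dots> = E J * g n * E J + (if sw n J = J then 0 else E J * g n * E (sw n J))"
    by (cases "sw n J = J") auto
  finally show ?thesis .
qed

lemma E_word_vanish_profile: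
  assumes J: "J \<subseteq> {..<r}" and k: "k + sum_list ms \<le> r"
    and "set ws \<subseteq> inner k ms" "J' \<subseteq> {..<r}" "profile k ms J' \<noteq> profile k ms J"
  shows "E J' * gw ws * E J = 0"
  using assms(3-)
proof (induction ws arbitrary: J')
  case Nil
  then show ?case using J by (auto simp: E_mult)
next
  case (Cons n ws)
  have n: "Suc n < r" using inner_bounds[of n k ms] Cons.prems(1) k by auto
  have sJ: "sw n J' \<subseteq> {..<r}" using n Cons.prems by (intro sw_subset)
  have p: "profile k ms (sw n J') = profile k ms J'" using Cons.prems by (intro profile_sw) auto
  have "E J' * gw (n # ws) * E J = (E J' * g n) * (gw ws * E J)" by (simp add: mult.assoc)
  also have "\<dots> = E J' * g n * (E J' * gw ws * E J)
      + (if sw n J' = J' then 0 else E J' * g n * (E (sw n J') * gw ws * E J))"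
    by (subst E_g_insert[OF n Cons.prems(2)]) (simp add: distrib_right mult.assoc)
  also have "\<dots> = 0" using Cons.IH[of J'] Cons.IH[of "sw n J'"] Cons.prems sJ p by simp
  finally show ?case .
qed

lemma E_word_vanish_wt:
  assumes J: "J \<subseteq> {..<r}"
    and "set ws \<subseteq> {i. Suc i < r}" "J' \<subseteq> {..<r}" "wt J + length ws < wt J'"
  shows "E J' * gw ws * E J = 0"
  using assms(2-)
proof (induction ws arbitrary: J')
  case Nil
  then show ?case using J by (auto simp: E_mult)
next
  case (Cons n ws)
  have n: "Suc n < r" using Cons.prems(1) by auto
  have fin: "finite J'" using Cons.prems(2) finite_subset by blast
  have sJ: "sw n J' \<subseteq> {..<r}" using n Cons.prems by (intro sw_subset)
  have p: "wt J' \<le> Suc (wt (sw n J'))"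
    using wt_sw_le[OF finite_sw[OF fin], of n n] by (simp add: sw_sw)
  have "E J' * gw (n # ws) * E J = (E J' * g n) * (gw ws * E J)" by (simp add: mult.assoc)
  also have "\<dots> = E J' * g n * (E J' * gw ws * E J)
      + (if sw n J' = J' then 0 else E J' * g n * (E (sw n J') * gw ws * E J))"
    by (subst E_g_insert[OF n Cons.prems(2)]) (simp add: distrib_right mult.assoc)
  also have "\<dots> = 0" using Cons.IH[of J'] Cons.IH[of "sw n J'"] Cons.prems sJ p by simp
  finally show ?case .
qed

lemma E_short_vanish:
  assumes "x \<in> short I n" "I \<subseteq> {i. Suc i < r}" "J \<subseteq> {..<r}" "J' \<subseteq> {..<r}" "wt J + n \<le> wt J'"
  shows "E J' * x * E J = 0"
  using assms(1)
proof (induction rule: short.induct)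
  case (word ws)
  then show ?case using assms(2-) by (intro E_word_vanish_wt) auto
qed (auto simp: distrib_left distrib_right)

definition invertible_from :: "nat set \<Rightarrow> nat set \<Rightarrow> 'a \<Rightarrow> bool" where
  "invertible_from J J' t \<longleftrightarrow> (\<exists>w. w * t = E J \<and> t * w = E J')"

text \<open>
  A word that raises the weight by its length does so letter by letter; the product of the
  corresponding invertible elements is the only path from \<open>E J\<close> to its image.
\<close>

lemma E_word_invertible:
  assumes J: "J \<subseteq> {..<r}"
    and "set ws \<subseteq> {i. Suc i < r}" "wt (act ws J) = wt J + length ws"
  shows "invertible_from J (act ws J) (E (act ws J) * gw ws * E J)"
  using assms(2-)
proof (induction ws)
  case Nil
  then show ?case unfolding invertible_from_def using J
    by (intro exI[of _ "E J"]) (simp add: E_mult)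
next
  case (Cons n ws)
  let ?K = "act ws J" and ?L = "sw n (act ws J)"
  have fin: "finite J" using J finite_subset by blast
  have n: "Suc n < r" using Cons.prems by simp
  have K: "?K \<subseteq> {..<r}" using J Cons.prems by (intro act_subset) auto
  have L: "?L \<subseteq> {..<r}" using n K by (rule sw_subset)
  have wK: "wt ?K = wt J + length ws" "wt ?L = Suc (wt ?K)"
  proof -
    have "wt ?L = wt J + Suc (length ws)" using Cons.prems(2) by simp
    then show "wt ?K = wt J + length ws" "wt ?L = Suc (wt ?K)"
      using wt_act_le[OF fin, of ws] wt_sw_le[OF finite_act[OF fin], of n ws] by linarith+
  qed
  have d: "(n \<in> ?K) \<noteq> (Suc n \<in> ?K)"
  proof
    assume "(n \<in> ?K) = (Suc n \<in> ?K)"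
    then have "?L = ?K" by (rule sw_same)
    then show False using wK(2) by simp
  qed
  obtain w1 where w1: "w1 * (E ?K * gw ws * E J) = E J" "(E ?K * gw ws * E J) * w1 = E ?K"
    using Cons.IH Cons.prems wK unfolding invertible_from_def by auto
  obtain w2 where w2: "w2 * (E ?L * g n * E ?K) = E ?K" "(E ?L * g n * E ?K) * w2 = E ?L"
    using E_g_E_inverse[OF n K d] by blast
  have "E ?L * gw ws * E J = 0"
    using Cons.prems wK by (intro E_word_vanish_wt J L) auto
  then have z: "E ?L * g n * (E ?L * gw ws * E J) = 0" by simp
  have "E ?L * gw (n # ws) * E J = (E ?L * g n) * (gw ws * E J)" by (simp add: mult.assoc)
  also have "\<dots> = E ?L * g n * (E ?L * gw ws * E J)
      + (if ?K = ?L then 0 else E ?L * g n * (E ?K * gw ws * E J))"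
    by (subst E_g_insert[OF n L]) (simp add: distrib_right mult.assoc sw_sw)
  also have "\<dots> = E ?L * g n * (E ?K * E ?K) * gw ws * E J"
    using z d sw_neq[OF d] by (auto simp: mult.assoc E_idem[OF K])
  finally have e: "E (act (n # ws) J) * gw (n # ws) * E J = (E ?L * g n * E ?K) * (E ?K * gw ws * E J)"
    by (simp add: mult.assoc)
  show ?case unfolding invertible_from_def
  proof (intro exI conjI)
    have "(w1 * w2) * ((E ?L * g n * E ?K) * (E ?K * gw ws * E J))
        = w1 * (w2 * (E ?L * g n * E ?K)) * (E ?K * gw ws * E J)" by (simp only: mult.assoc)
    also have "\<dots> = w1 * ((E ?K * E ?K) * gw ws * E J)" unfolding w2 by (simp only: mult.assoc)
    also have "\<dots> = E J" unfolding E_idem[OF K] by (rule w1)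
    finally show "(w1 * w2) * (E (act (n # ws) J) * gw (n # ws) * E J) = E J" unfolding e .
    have "((E ?L * g n * E ?K) * (E ?K * gw ws * E J)) * (w1 * w2)
        = E ?L * g n * E ?K * ((E ?K * gw ws * E J) * w1) * w2" by (simp only: mult.assoc)
    also have "\<dots> = E ?L * g n * (E ?K * E ?K) * w2" unfolding w1 by (simp only: mult.assoc)
    also have "\<dots> = E ?L" unfolding E_idem[OF K] by (rule w2)
    finally show "(E (act (n # ws) J) * gw (n # ws) * E J) * (w1 * w2) = E (act (n # ws) J)"
      unfolding e by simp
  qed
qed

text \<open>
  An eigenvector of the generators inside the blocks that vanishes at one sign pattern vanishes at
  all patterns with the same block counts: raise the pattern step by step.
\<close>

lemma eigenvector_vanish:
  assumes ps: "sum_list (totals ps) = r"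
    and z: "\<And>i. i \<in> inner 0 (totals ps) \<Longrightarrow> g i * z = Q * z"
    and top: "E (tails 0 ps) * z = 0"
    and "J \<subseteq> {..<r}" "profile 0 (totals ps) J = map fst ps"
  shows "E J * z = 0"
proof -
  have bound: "wt J \<le> wt {..<r}" if "J \<subseteq> {..<r}" for J
    unfolding wt_def using that by (intro sum_mono2) auto
  show ?thesis using assms(4,5)
  proof (induction "wt {..<r} - wt J" arbitrary: J rule: less_induct)
    case less
    show ?case
    proof (cases "J = tails 0 ps")
      case True
      then show ?thesis using top by simp
    next
      case False
      then obtain i where i: "i \<in> inner 0 (totals ps)" "i \<in> J" "Suc i \<notin> J"
        using profile_tails[OF less.prems(2)] less.prems(1) ps by (auto simp: lessThan_atLeast0)
      have n: "Suc i < r" using inner_bounds[OF i(1)] ps by simp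
      let ?K = "sw i J"
      have K: "?K \<subseteq> {..<r}" using n less.prems by (intro sw_subset)
      have fin: "finite J" using less.prems finite_subset by blast
      have "wt ?K = Suc (wt J)" using wt_sw_raise[OF fin] i by simp
      then have "wt {..<r} - wt ?K < wt {..<r} - wt J" using bound[OF K] by simp
      then have Kz: "E ?K * z = 0"
        using less.hyps K profile_sw[OF i(1), of J] less.prems by simp
      have "E ?K * g i * z = E ?K * (Q * z)" using z[OF i(1)] by (simp add: mult.assoc)
      also have "\<dots> = Q * (E ?K * z)" using Q_E[OF K] by (metis mult.assoc)
      finally have 0: "E ?K * g i * z = 0" using Kz by simp
      have d: "(i \<in> J) \<noteq> (Suc i \<in> J)" using i by simp
      have "E ?K * g i * z = E ?K * g i * (E ?K * z) + E ?K * g i * E J * z"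
        using E_g_insert[OF n K] sw_neq[OF d] by (simp add: sw_sw) (metis distrib_right mult.assoc)
      then have "E ?K * g i * E J * z = 0" using 0 Kz by simp
      moreover obtain w where "w * (E ?K * g i * E J) = E J"
        using E_g_E_inverse[OF n less.prems(1) d] by blast
      ultimately show ?thesis by (metis mult.assoc mult_zero_right)
    qed
  qed
qed

lemma E_sfac_commute:
  assumes "J \<subseteq> {..<r}" "k + sum_list ms \<le> r" "\<And>i. i \<in> inner k ms \<Longrightarrow> (i \<in> J) = (Suc i \<in> J)"
  shows "E J * sfac k ms = sfac k ms * E J"
proof (rule sfac_commute_inner)
  fix i assume i: "i \<in> inner k ms"
  then have "Suc i < r" using inner_bounds[OF i] assms by simp
  then show "E J * g i = g i * E J" using g_E_same assms i by metis
qed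

text \<open>
  The part of \<open>sfac 0 ms\<close> with prescribed block counts factors through the pattern in which the
  positive positions come first.
\<close>

lemma factor_profile:
  assumes ps: "sum_list (totals ps) = r"
  defines "x \<equiv> sfac 0 (totals ps)" and "y \<equiv> sfac 0 (map fst ps @ map snd ps)"
    and "e \<equiv> E {..<sum_list (map fst ps)}"
  shows "\<exists>a b. (\<exists>c. a * x = y * e * c) \<and> (\<exists>c. b * y = x * c) \<and> b * e = b \<and>
    (\<forall>J. J \<subseteq> {..<r} \<longrightarrow> profile 0 (totals ps) J \<noteq> map fst ps \<longrightarrow> E J * b = 0) \<and>
    (\<forall>J. J \<subseteq> {..<r} \<longrightarrow> profile 0 (totals ps) J = map fst ps \<longrightarrow> E J * (b * a * x) = E J * x)"
proof -
  let ?I = "{i. Suc i < r}"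
  define W B D where "W = gw (gather 0 ps)" and "B = gw (flips 0 ps)" and "D = shufs 0 ps"
  define J0 J1 J2 where "J0 = {..<sum_list (map fst ps)}" and "J1 = heads 0 ps" and "J2 = tails 0 ps"
  have sums: "sum_list (map fst ps) + sum_list (map snd ps) = r"
    "sum_list (il ps) = r" "sum_list (li ps) = r"
    using sum_il[of ps] ps by auto
  have J: "J0 \<subseteq> {..<r}" "J1 \<subseteq> {..<r}" "J2 \<subseteq> {..<r}"
    unfolding J0_def J1_def J2_def using sums heads_bounds[of 0 ps] tails_bounds[of 0 ps] ps by auto
  have wsI: "set (gather 0 ps) \<subseteq> ?I" "set (flips 0 ps) \<subseteq> ?I" "inner 0 (totals ps) \<subseteq> ?I"
    using set_gather[of 0 ps] set_flips[of 0 ps] inner_bound[of 0 "totals ps"] ps by auto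
  have act1: "act (gather 0 ps) J0 = J1" "act (flips 0 ps) J1 = J2"
    using act_gather[of "{}" 0 ps] act_flips[of "{}" 0 ps]
    unfolding J0_def J1_def J2_def by (auto simp: lessThan_atLeast0)
  have wt1: "wt J1 = wt J0 + length (gather 0 ps)" "wt J2 = wt J1 + length (flips 0 ps)"
    unfolding J0_def J1_def J2_def by (auto simp: wt_heads wt_tails lessThan_atLeast0)
  define t1 t2 where "t1 = E J1 * W * E J0" and "t2 = E J2 * B * E J1"
  have "invertible_from J0 J1 t1" "invertible_from J1 J2 t2"
    using E_word_invertible[OF J(1) wsI(1)] E_word_invertible[OF J(2) wsI(2)] act1 wt1
    unfolding t1_def t2_def W_def B_def by auto
  then obtain w1 w2 where w1: "w1 * t1 = E J0" "t1 * w1 = E J1" and w2: "w2 * t2 = E J1" "t2 * w2 = E J2"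
    unfolding invertible_from_def by blast
  have EE: "E J0 * E J0 = E J0" "E J1 * E J1 = E J1" "E J2 * E J2 = E J2"
    using J by (auto simp: E_idem)
  have t12: "E J1 * t1 = t1" "t1 * E J0 = t1" "E J2 * t2 = t2" "t2 * E J1 = t2"
    unfolding t1_def t2_def using EE by (simp_all add: mult.assoc) (simp_all flip: mult.assoc)
  define th where "th = t2 * t1"
  define a where "a = E J0 * w1 * w2 * E J2"
  define b where "b = D * E J1 * W * E J0"
  have ath: "a * th = E J0"
  proof -
    have "a * th = E J0 * (w1 * ((w2 * (E J2 * t2)) * t1))"
      unfolding a_def th_def by (simp only: mult.assoc)
    then show ?thesis using t12 w1 w2 EE by simp
  qed
  have tha: "th * a = E J2"
  proof -
    have "th * a = t2 * ((t1 * E J0) * w1) * w2 * E J2"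
      unfolding a_def th_def by (simp only: mult.assoc)
    then show ?thesis using t12 w1 w2 EE by simp
  qed
  have aE: "a * E J2 = a" "E J0 * a = a"
    unfolding a_def using EE by (simp_all add: mult.assoc) (simp_all flip: mult.assoc)
  define x1 x2 where "x1 = sfac 0 (il ps)" and "x2 = sfac 0 (li ps)"
  have c0: "E J0 * y = y * E J0"
    unfolding y_def J0_def using sums J(1) inner_initial[of _ "map fst ps" "map snd ps"]
    by (intro E_sfac_commute) (auto simp: J0_def)
  have c1: "E J1 * x1 = x1 * E J1"
    unfolding x1_def using sums J inner_heads[of _ 0 ps] by (intro E_sfac_commute) (auto simp: J1_def)
  have c2: "E J2 * x2 = x2 * E J2"
    unfolding x2_def using sums J inner_tails[of _ 0 ps] by (intro E_sfac_commute) (auto simp: J2_def)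
  have Wy: "W * y = x1 * W" unfolding W_def y_def x1_def using gather_sfac[of 0 ps] ps by simp
  have Bx: "B * x1 = x2 * B" unfolding B_def x1_def x2_def using flips_sfac[of 0 ps] ps by simp
  have Dx: "D * x1 = x" unfolding D_def x1_def x_def using shufs_sfac[of 0 ps] ps by simp
  obtain R where R: "x = x2 * R" unfolding x_def x2_def using sfac_divide[of 0 ps] ps by auto
  have t1y: "t1 * y = x1 * t1"
  proof -
    have "t1 * y = E J1 * W * (E J0 * y)" unfolding t1_def by (simp only: mult.assoc)
    also have "\<dots> = E J1 * (W * y) * E J0" unfolding c0 by (simp only: mult.assoc)
    also have "\<dots> = (E J1 * x1) * W * E J0" unfolding Wy by (simp only: mult.assoc)
    finally show ?thesis unfolding c1 t1_def by (simp only: mult.assoc)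
  qed
  have t2x: "t2 * x1 = x2 * t2"
  proof -
    have "t2 * x1 = E J2 * B * (E J1 * x1)" unfolding t2_def by (simp only: mult.assoc)
    also have "\<dots> = E J2 * (B * x1) * E J1" unfolding c1 by (simp only: mult.assoc)
    also have "\<dots> = (E J2 * x2) * B * E J1" unfolding Bx by (simp only: mult.assoc)
    finally show ?thesis unfolding c2 t2_def by (simp only: mult.assoc)
  qed
  have ax2: "a * x2 = y * E J0 * a"
  proof -
    have "a * x2 = a * (E J2 * x2)" using aE by (simp flip: mult.assoc)
    also have "\<dots> = a * x2 * E J2" unfolding c2 by (simp only: mult.assoc)
    also have "\<dots> = a * x2 * (th * a)" unfolding tha ..
    also have "\<dots> = a * (x2 * t2) * t1 * a" unfolding th_def by (simp only: mult.assoc)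
    also have "\<dots> = a * t2 * (x1 * t1) * a" unfolding t2x[symmetric] by (simp only: mult.assoc)
    also have "\<dots> = (a * th) * y * a" unfolding t1y[symmetric] th_def by (simp only: mult.assoc)
    finally show ?thesis unfolding ath c0 .
  qed
  have "a * x = y * E J0 * (a * R)" unfolding R using ax2 by (simp add: mult.assoc[symmetric])
  then have K1: "\<exists>c. a * x = y * e * c" unfolding e_def J0_def by blast
  have "b * y = D * (t1 * y)" unfolding b_def t1_def by (simp only: mult.assoc)
  also have "\<dots> = x * t1" unfolding t1y Dx[symmetric] by (simp only: mult.assoc)
  finally have by': "b * y = x * t1" .
  then have K2: "\<exists>c. b * y = x * c" by blast
  have K3: "b * e = b" unfolding b_def e_def J0_def[symmetric] using EE by (simp add: mult.assoc)
  have top: "top_word (inner 0 (totals ps)) (flips 0 ps) D" unfolding D_def by (rule top_word_shufs)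
  have K4: "E J' * b = 0" if J': "J' \<subseteq> {..<r}" "profile 0 (totals ps) J' \<noteq> map fst ps" for J'
  proof -
    have "E J' * z * E J1 = 0" if "z \<in> short (inner 0 (totals ps)) n" for z n
      using that
    proof (induction rule: short.induct)
      case (word ws)
      then show ?case using J J' ps profile_heads[of 0 ps]
        by (intro E_word_vanish_profile[of _ 0 "totals ps"]) (auto simp: J1_def)
    qed (auto simp: distrib_left distrib_right)
    then have "E J' * D * E J1 = 0" using top_word_short[OF top, of "Suc (length (flips 0 ps))"] by blast
    moreover have "E J' * b = E J' * D * E J1 * W * E J0" unfolding b_def by (simp only: mult.assoc)
    ultimately show ?thesis by simp
  qed
  have EDE: "E J2 * D * E J1 = t2"
  proof -
    have "E J2 * (D - B) * E J1 = 0"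
      using top wsI(3) J wt1 unfolding top_word_def B_def by (intro E_short_vanish) auto
    then show ?thesis unfolding t2_def by (simp add: left_diff_distrib right_diff_distrib)
  qed
  have E2b: "E J2 * b = th"
  proof -
    have "E J2 * b = (E J2 * D * (E J1 * E J1)) * W * E J0" unfolding b_def EE by (simp only: mult.assoc)
    also have "\<dots> = (E J2 * D * E J1) * (E J1 * W * E J0)" by (simp only: mult.assoc)
    finally show ?thesis unfolding EDE th_def t1_def .
  qed
  have K5: "E J' * (b * a * x) = E J' * x" if J': "J' \<subseteq> {..<r}" "profile 0 (totals ps) J' = map fst ps" for J'
  proof -
    have "E J' * (b * a * x - x) = 0"
    proof (rule eigenvector_vanish[OF ps _ _ J'])
      have bax: "b * a * x = x * (t1 * E J0 * a * R)"
        using \<open>a * x = y * E J0 * (a * R)\<close> by' by (metis mult.assoc)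
      fix i assume i: "i \<in> inner 0 (totals ps)"
      have "g i * x = Q * x" unfolding x_def using i ps by (intro g_sfac) auto
      then show "g i * (b * a * x - x) = Q * (b * a * x - x)"
        unfolding bax right_diff_distrib by (simp flip: mult.assoc)
    next
      have "E J2 * (b * a * x) = (E J2 * b) * a * x" by (simp only: mult.assoc)
      also have "\<dots> = E J2 * x" unfolding E2b tha ..
      finally show "E (tails 0 ps) * (b * a * x - x) = 0" unfolding J2_def by (simp add: right_diff_distrib)
    qed
    then show ?thesis by (simp add: right_diff_distrib)
  qed
  show ?thesis using K1 K2 K3 K4 K5 by blast
qed

end

context hecke_B
begin

lemma sign_idem_E: "sign_idem r Q Qi g E"
proof unfold_locales
  show "E J * E J' = (if J = J' then E J else 0)" if "J \<subseteq> {..<r}" "J' \<subseteq> {..<r}" for J J'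
    using that by (rule E_mult)
  show "(\<Sum>J\<in>Pow {..<r}. E J) = 1" by (rule sum_E)
  show "Q * E J = E J * Q" for J by (rule Z.commute) auto
  show "g n * E J = E J * g n" if "Suc n < r" "(n \<in> J) = (Suc n \<in> J)" for n J
    using that by (rule g_E_same)
  show "E J' * g n * E J = 0"
    if "Suc n < r" "J \<subseteq> {..<r}" "J' \<subseteq> {..<r}" "J' \<noteq> J" "J' \<noteq> sw n J" for n J J'
    using that by (rule E_g_E_vanish)
  show "\<exists>w. w * (E (sw n J) * g n * E J) = E J \<and> E (sw n J) * g n * E J * w = E (sw n J)"
    if "Suc n < r" "J \<subseteq> {..<r}" "(n \<in> J) \<noteq> (Suc n \<in> J)" for n J
    using that(1,3,2) by (rule E_g_E_inverse)
qed

lemma sw_complement: "Suc n < r \<Longrightarrow> {..<r} - sw n J = sw n ({..<r} - J)"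
  by (rule Set.set_eqI) (auto simp: in_sw)

lemma complement_eq: "J \<subseteq> {..<r} \<Longrightarrow> J' \<subseteq> {..<r} \<Longrightarrow> {..<r} - J = {..<r} - J' \<longleftrightarrow> J = J'"
  by blast

text \<open>Exchanging the roles of the two signs.\<close>

lemma sign_idem_E_complement: "sign_idem r Q Qi g (\<lambda>J. E ({..<r} - J))"
proof unfold_locales
  show "E ({..<r} - J) * E ({..<r} - J') = (if J = J' then E ({..<r} - J) else 0)"
    if "J \<subseteq> {..<r}" "J' \<subseteq> {..<r}" for J J'
    using E_mult[of "{..<r} - J" "{..<r} - J'"] complement_eq[OF that] by auto
  have "(\<Sum>J\<in>Pow {..<r}. E ({..<r} - J)) = (\<Sum>J\<in>Pow {..<r}. E J)"
    by (rule sum.reindex_bij_witness[of _ "\<lambda>J. {..<r} - J" "\<lambda>J. {..<r} - J"]) auto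
  then show "(\<Sum>J\<in>Pow {..<r}. E ({..<r} - J)) = 1" using sum_E by simp
  show "Q * E ({..<r} - J) = E ({..<r} - J) * Q" for J by (rule Z.commute) auto
  show "g n * E ({..<r} - J) = E ({..<r} - J) * g n"
    if "Suc n < r" "(n \<in> J) = (Suc n \<in> J)" for n J
    using that by (intro g_E_same) auto
  show "E ({..<r} - J') * g n * E ({..<r} - J) = 0"
    if "Suc n < r" "J \<subseteq> {..<r}" "J' \<subseteq> {..<r}" "J' \<noteq> J" "J' \<noteq> sw n J" for n J J'
    using that complement_eq[OF that(3,2)] complement_eq[OF that(3) sw_subset[OF that(1,2)]]
      sw_complement[OF that(1), of J]
    by (intro E_g_E_vanish) auto
  show "\<exists>w. w * (E ({..<r} - sw n J) * g n * E ({..<r} - J)) = E ({..<r} - J) \<and>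
      E ({..<r} - sw n J) * g n * E ({..<r} - J) * w = E ({..<r} - sw n J)"
    if "Suc n < r" "J \<subseteq> {..<r}" "(n \<in> J) \<noteq> (Suc n \<in> J)" for n J
    unfolding sw_complement[OF that(1)] using that by (intro E_g_E_inverse) auto
qed

lemma PP_ZI: "a \<le> r \<Longrightarrow> PP s a \<in> ZI {..<a}"
proof (induction a)
  case 0
  show ?case using comm_subring.one_closed[OF comm_subring_ZI, of "{}"] by (simp add: PP_def)
next
  case (Suc a)
  have I: "{..<Suc a} \<subseteq> {..<r}" using Suc.prems by auto
  interpret C: comm_subring "ZI {..<Suc a}" by (rule comm_subring_ZI[OF I])
  have "JM a \<in> ZI {..<Suc a}" using I by (intro JM_ZI) auto
  then have "1 + sg s (JM a) \<in> ZI {..<Suc a}"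
    unfolding sg_def by (auto intro: C.add_closed C.one_closed C.diff_closed)
  moreover have "PP s a \<in> ZI {..<Suc a}" using Suc ZI_mono[of "{..<a}" "{..<Suc a}"] by auto
  ultimately show ?case unfolding PP_Suc by (intro C.mult_closed)
qed

lemma g_PP:
  assumes "a \<le> r" "Suc i < r" "Suc i \<noteq> a"
  shows "g i * PP s a = PP s a * g i"
proof (cases "a \<le> i")
  case True
  then show ?thesis using g_ZI[OF PP_ZI[of a s], of i] assms by auto
next
  case False
  then have "Suc (Suc i) \<le> a" using assms by simp
  then show ?thesis using assms(1)
  proof (induction a rule: dec_induct)
    case base
    let ?X = "JM i" and ?Y = "JM (Suc i)"
    have "ff (\<not> s) 0 X = - (1 + sg s X)" for X
      by (cases s) (simp_all add: ff_def F_def sg_def)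
    then have "g i * ((1 + sg s ?X) * (1 + sg s ?Y)) = (1 + sg s ?X) * (1 + sg s ?Y) * g i"
      using g_symmetric[OF assms(2), of "\<not> s" 0] by (simp only: minus_mult_minus)
    moreover have "g i * PP s i = PP s i * g i"
      using g_ZI[OF PP_ZI[of i s], of i] assms by auto
    moreover have "PP s (Suc (Suc i)) = PP s i * ((1 + sg s ?X) * (1 + sg s ?Y))"
      by (simp only: PP_Suc mult.assoc)
    ultimately show ?case by (simp only:) (rule comm_mult)
  next
    case (step a)
    have "g i * JM a = JM a * g i" using step by (intro g_JM_below) auto
    then have "g i * (1 + sg s (JM a)) = (1 + sg s (JM a)) * g i"
      by (simp add: sg_def algebra_simps)
    then show ?case using step unfolding PP_Suc by (intro comm_mult) auto
  qed
qed

lemma inner_split: "i \<in> inner 0 (ms @ ns) \<Longrightarrow> Suc i \<noteq> sum_list ms"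
  using inner_bounds[of i 0 ms] inner_bounds[of i "sum_list ms" ns] by (auto simp: inner_append)

lemma PP_sfac:
  assumes "sum_list ms + sum_list ns \<le> r"
  shows "PP s (sum_list ms) * sfac 0 (ms @ ns) = sfac 0 (ms @ ns) * PP s (sum_list ms)"
proof (rule sfac_commute_inner)
  fix i assume i: "i \<in> inner 0 (ms @ ns)"
  show "PP s (sum_list ms) * g i = g i * PP s (sum_list ms)"
    using inner_bounds[OF i] inner_split[OF i] assms by (intro g_PP[symmetric]) auto
qed

lemma eps_in_PP:
  assumes "a \<le> r" "\<And>i. i < a \<Longrightarrow> (i \<in> J) = s"
  obtains c where "c \<in> Z" "eps a J = PP s a * c"
proof -
  obtain w where "w \<in> Z" "PP s a * (w * eps a J) = eps a J"
    using unit_on_PP[of a J s] assms unfolding Z.unit_on_def by blast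
  then show ?thesis using that[of "w * eps a J"] assms by simp
qed

lemma factor_PP:
  assumes ps: "sum_list (totals ps) = r" and J: "J \<subseteq> {..<r}" "\<And>i. i < sum_list (map fst ps) \<Longrightarrow> (i \<in> J) = s"
    and a: "\<exists>c. a * x = sfac 0 (map fst ps @ map snd ps) * E J * c"
    and b: "\<exists>c. b * sfac 0 (map fst ps @ map snd ps) = x * c"
  defines "y \<equiv> PP s (sum_list (map fst ps)) * sfac 0 (map fst ps @ map snd ps)"
  shows "(\<exists>c. a * x = y * c) \<and> (\<exists>c. b * y = x * c)"
proof -
  let ?a = "sum_list (map fst ps)" and ?y = "sfac 0 (map fst ps @ map snd ps)"
  have le: "?a + sum_list (map snd ps) = r" using ps sum_il(3)[of ps] by simp
  obtain c where c: "c \<in> Z" "eps ?a J = PP s ?a * c" using eps_in_PP[of ?a J s] le J by auto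
  have comm: "PP s ?a * ?y = ?y * PP s ?a" using PP_sfac[of "map fst ps" "map snd ps" s] le by simp
  have E: "E J = PP s ?a * (c * E J)" using eps_E[of ?a J] le c by (simp add: mult.assoc)
  obtain d where "a * x = ?y * E J * d" using a by blast
  also have "\<dots> = ?y * PP s ?a * (c * E J * d)" by (subst E) (simp only: mult.assoc)
  finally have "a * x = y * (c * E J * d)" unfolding y_def comm .
  moreover obtain d where "b * ?y = x * d" using b by blast
  then have "b * y = x * (d * PP s ?a)" unfolding y_def comm by (simp flip: mult.assoc)
  ultimately show ?thesis by blast
qed

lemma finite_pairs: "finite {ps :: (nat \<times> nat) list. totals ps = ms}"
proof (rule finite_subset)
  show "{ps. totals ps = ms} \<subseteq> {ps. set ps \<subseteq> {..sum_list ms} \<times> {..sum_list ms} \<and> length ps = length ms}"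
  proof
    fix ps :: "(nat \<times> nat) list" assume "ps \<in> {ps. totals ps = ms}"
    then have ps: "totals ps = ms" by simp
    have "j \<le> sum_list ms \<and> l \<le> sum_list ms" if "(j, l) \<in> set ps" for j l
    proof -
      have "j + l \<in> set ms" using that unfolding ps[symmetric] by force
      then show ?thesis using member_le_sum_list[of "j + l" ms] by simp
    qed
    then show "ps \<in> {ps. set ps \<subseteq> {..sum_list ms} \<times> {..sum_list ms} \<and> length ps = length ms}"
      using ps by auto
  qed
qed (intro finite_lists_length_eq finite_cartesian_product, auto)

lemma profile_pairs:
  "\<exists>ps. totals ps = ms \<and> map fst ps = profile k ms J \<and> map snd ps = profile k ms ({..<k + sum_list ms} - J)"
proof (induction ms arbitrary: k)
  case (Cons m ms)
  obtain ps where ps: "totals ps = ms" "map fst ps = profile (k + m) ms J"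
    "map snd ps = profile (k + m) ms ({..<k + m + sum_list ms} - J)" using Cons by blast
  have "(J \<inter> {k..<k + m}) \<union> (({..<k + sum_list (m # ms)} - J) \<inter> {k..<k + m}) = {k..<k + m}"
    "(J \<inter> {k..<k + m}) \<inter> (({..<k + sum_list (m # ms)} - J) \<inter> {k..<k + m}) = {}" by auto
  then have "card (J \<inter> {k..<k + m}) + card (({..<k + sum_list (m # ms)} - J) \<inter> {k..<k + m}) = m"
    using card_Un_disjoint[of "J \<inter> {k..<k + m}" "({..<k + sum_list (m # ms)} - J) \<inter> {k..<k + m}"] by simp
  then show ?case
    using ps by (intro exI[of _ "(card (J \<inter> {k..<k + m}), card (({..<k + sum_list (m # ms)} - J) \<inter> {k..<k + m})) # ps"])
      (simp add: add.assoc)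
qed simp

text \<open>
  The symmetrizer of a Young subgroup is a sum of parts, one for each way to distribute the signs
  over the blocks. Each part factors through an element in which the signs that form the
  majority come first.
\<close>

theorem sfac_majority:
  assumes ms: "sum_list ms = r"
  defines "x \<equiv> sfac 0 ms"
  shows "\<exists>a b. \<exists>P :: (nat \<times> nat) list set. finite P \<and> (\<Sum>ps\<in>P. b ps * a ps * x) = x \<and>
    (\<forall>ps\<in>P. \<exists>s qs. totals qs = ms \<and> sum_list (map snd qs) \<le> sum_list (map fst qs) \<and>
      (\<exists>c. a ps * x = PP s (sum_list (map fst qs)) * sfac 0 (map fst qs @ map snd qs) * c) \<and>
      (\<exists>c. b ps * (PP s (sum_list (map fst qs)) * sfac 0 (map fst qs @ map snd qs)) = x * c))"
proof -
  let ?P = "{ps :: (nat \<times> nat) list. totals ps = ms}"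
  define good where "good = (\<lambda>(ps :: (nat \<times> nat) list) a b. (\<exists>s qs. totals qs = ms \<and> sum_list (map snd qs) \<le> sum_list (map fst qs) \<and>
      (\<exists>c. a * x = PP s (sum_list (map fst qs)) * sfac 0 (map fst qs @ map snd qs) * c) \<and>
      (\<exists>c. b * (PP s (sum_list (map fst qs)) * sfac 0 (map fst qs @ map snd qs)) = x * c)) \<and>
      (\<forall>J. J \<subseteq> {..<r} \<longrightarrow> profile 0 ms J \<noteq> map fst ps \<longrightarrow> E J * b = 0) \<and>
      (\<forall>J. J \<subseteq> {..<r} \<longrightarrow> profile 0 ms J = map fst ps \<longrightarrow> E J * (b * a * x) = E J * x))"
  have "\<exists>a b. good ps a b" if ps: "totals ps = ms" for ps
  proof (cases "sum_list (map snd ps) \<le> sum_list (map fst ps)")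
    case True
    have psr: "sum_list (totals ps) = r" using ps ms by simp
    obtain a b where ab: "\<exists>c. a * x = sfac 0 (map fst ps @ map snd ps) * E {..<sum_list (map fst ps)} * c"
      "\<exists>c. b * sfac 0 (map fst ps @ map snd ps) = x * c"
      "\<forall>J. J \<subseteq> {..<r} \<longrightarrow> profile 0 ms J \<noteq> map fst ps \<longrightarrow> E J * b = 0"
      "\<forall>J. J \<subseteq> {..<r} \<longrightarrow> profile 0 ms J = map fst ps \<longrightarrow> E J * (b * a * x) = E J * x"
      using sign_idem.factor_profile[OF sign_idem_E psr] unfolding ps x_def by blast
    have "(\<exists>c. a * x = PP True (sum_list (map fst ps)) * sfac 0 (map fst ps @ map snd ps) * c) \<and>
      (\<exists>c. b * (PP True (sum_list (map fst ps)) * sfac 0 (map fst ps @ map snd ps)) = x * c)"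
      using psr sum_il(3)[of ps] by (intro factor_PP[OF psr _ _ ab(1,2)]) auto
    then show ?thesis unfolding good_def using ab(3,4) ps True by blast
  next
    case False
    define qs where "qs = map prod.swap ps"
    have fs: "map fst qs = map snd ps" "map snd qs = map fst ps" and qs: "totals qs = ms"
      unfolding qs_def ps[symmetric] by (auto simp: case_prod_beta add.commute)
    have qsr: "sum_list (totals qs) = r" using qs ms by simp
    obtain a b where ab: "\<exists>c. a * x = sfac 0 (map fst qs @ map snd qs) * E ({..<r} - {..<sum_list (map fst qs)}) * c"
      "\<exists>c. b * sfac 0 (map fst qs @ map snd qs) = x * c"
      "\<forall>J. J \<subseteq> {..<r} \<longrightarrow> profile 0 ms J \<noteq> map fst qs \<longrightarrow> E ({..<r} - J) * b = 0"
      "\<forall>J. J \<subseteq> {..<r} \<longrightarrow> profile 0 ms J = map fst qs \<longrightarrow> E ({..<r} - J) * (b * a * x) = E ({..<r} - J) * x"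
      using sign_idem.factor_profile[OF sign_idem_E_complement qsr] unfolding qs x_def by blast
    have pp: "(\<exists>c. a * x = PP False (sum_list (map fst qs)) * sfac 0 (map fst qs @ map snd qs) * c) \<and>
      (\<exists>c. b * (PP False (sum_list (map fst qs)) * sfac 0 (map fst qs @ map snd qs)) = x * c)"
      by (intro factor_PP[OF qsr _ _ ab(1,2)]) auto
    have prof: "profile 0 ms ({..<r} - J) = map fst qs \<longleftrightarrow> profile 0 ms J = map fst ps" if "J \<subseteq> {..<r}" for J
    proof -
      obtain rs where rs: "totals rs = ms" "map fst rs = profile 0 ms J" "map snd rs = profile 0 ms ({..<r} - J)"
        using profile_pairs[of ms 0 J] ms by auto
      have len: "length rs = length ps" using rs(1) ps by (metis length_map)
      have tot: "\<forall>i<length ps. fst (rs ! i) + snd (rs ! i) = fst (ps ! i) + snd (ps ! i)"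
        using rs(1) ps len by (metis (no_types, lifting) nth_map case_prod_beta)
      have "map snd rs = map snd ps \<longleftrightarrow> map fst rs = map fst ps"
      proof -
        have "snd (rs ! i) = snd (ps ! i) \<longleftrightarrow> fst (rs ! i) = fst (ps ! i)" if "i < length ps" for i
          using tot[rule_format, OF that] by linarith
        then show ?thesis using len unfolding list_eq_iff_nth_eq by simp
      qed
      then show ?thesis using rs fs by simp
    qed
    have compl: "{..<r} - ({..<r} - J) = J" if "J \<subseteq> {..<r}" for J using that by auto
    have "E J * b = 0" if "J \<subseteq> {..<r}" "profile 0 ms J \<noteq> map fst ps" for J
      using ab(3)[rule_format, of "{..<r} - J"] prof[OF that(1)] that compl[OF that(1)] by auto
    moreover have "E J * (b * a * x) = E J * x" if "J \<subseteq> {..<r}" "profile 0 ms J = map fst ps" for J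
      using ab(4)[rule_format, of "{..<r} - J"] prof[OF that(1)] that compl[OF that(1)] by auto
    ultimately show ?thesis unfolding good_def using pp qs False fs by (metis nat_le_linear)
  qed
  then obtain a b where ab: "\<And>ps. totals ps = ms \<Longrightarrow> good ps (a ps) (b ps)" by metis
  have "(\<Sum>ps\<in>?P. b ps * a ps * x) = x"
  proof (rule sign_idem.E_eqI[OF sign_idem_E])
    fix J assume J: "J \<subseteq> {..<r}"
    obtain rs where rs: "totals rs = ms" "map fst rs = profile 0 ms J"
      using profile_pairs[of ms 0 J] by blast
    have uniq: "ps = rs" if "totals ps = ms" "map fst ps = profile 0 ms J" for ps
    proof -
      have len: "length rs = length ps" using rs(1) that by (metis length_map)
      have "\<forall>i<length ps. fst (rs ! i) + snd (rs ! i) = fst (ps ! i) + snd (ps ! i)"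
        using rs(1) that(1) len by (metis (no_types, lifting) nth_map case_prod_beta)
      moreover have "\<forall>i<length ps. fst (rs ! i) = fst (ps ! i)"
        using rs(2) that(2) len by (metis nth_map)
      ultimately show ?thesis using len by (intro nth_equalityI) (auto simp: prod_eq_iff)
    qed
    have "E J * (\<Sum>ps\<in>?P. b ps * a ps * x) = (\<Sum>ps\<in>?P. if ps = rs then E J * x else 0)"
      unfolding sum_distrib_left
    proof (rule sum.cong[OF refl])
      fix ps assume "ps \<in> ?P"
      then have ps: "totals ps = ms" by simp
      then have g: "good ps (a ps) (b ps)" by (rule ab)
      show "E J * (b ps * a ps * x) = (if ps = rs then E J * x else 0)"
      proof (cases "ps = rs")
        case True
        then show ?thesis using g J rs unfolding good_def by simp
      next
        case False
        then have "E J * b ps = 0" using g J uniq[OF ps] unfolding good_def by metis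
        then show ?thesis using False by (simp flip: mult.assoc)
      qed
    qed
    also have "\<dots> = E J * x" using finite_pairs[of ms] rs by simp
    finally show "E J * (\<Sum>ps\<in>?P. b ps * a ps * x) = E J * x" .
  qed
  moreover have "finite ?P" by (rule finite_pairs)
  ultimately show ?thesis using ab unfolding good_def
    by (intro exI[of _ a] exI[of _ b] exI[of _ ?P]) blast
qed

text \<open>
  Conversely \<open>PP\<close> times a symmetrizer is obtained from the symmetrizer by an idempotent left
  multiplication.
\<close>

theorem PP_sfac_summand:
  assumes "sum_list ms + sum_list ns = r"
  defines "p \<equiv> PP True (sum_list ms)" and "x \<equiv> sfac 0 (ms @ ns)"
  obtains e c where "e = p * c" "e = c * p" "e * x = p * x * c" "e * p = p"
proof -
  let ?a = "sum_list ms"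
  have a: "?a \<le> r" using assms by simp
  obtain c where c: "c \<in> Z" "eps ?a {..<?a} = PP True ?a * c"
    using eps_in_PP[of ?a "{..<?a}" True] a by auto
  let ?e = "eps ?a {..<?a}"
  have pZ: "p \<in> Z" unfolding p_def using a by simp
  have "?e * x = x * ?e"
    unfolding x_def
  proof (rule sfac_commute_inner)
    fix i assume i: "i \<in> inner 0 (ms @ ns)"
    have n: "Suc i < r" "Suc i \<noteq> ?a"
      using inner_bounds[OF i] inner_split[OF i] assms by auto
    show "?e * g i = g i * ?e"
    proof (cases "?a \<le> i")
      case True
      then show ?thesis using n by (intro g_eps[symmetric]) auto
    next
      case False
      then show ?thesis using n a by (intro g_eps_same[symmetric]) auto
    qed
  qed
  also have "\<dots> = x * p * c" unfolding c p_def by (simp add: mult.assoc)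
  also have "x * p = p * x" unfolding x_def p_def using assms by (intro PP_sfac[symmetric]) auto
  finally have "?e * x = p * x * c" .
  moreover have "?e * p = p" using PP_eps[of ?a "{..<?a}" True] a pZ unfolding p_def by (simp add: Z.commute)
  moreover have "?e = p * c" unfolding c p_def ..
  moreover have "?e = c * p" unfolding c using c(1) pZ unfolding p_def by (rule Z.commute[rotated])
  ultimately show ?thesis using that by blast
qed

end

section \<open>Morita equivalence of full corners\<close>

lemma finsum_hom:
  assumes M: "abelian_group M" and N: "abelian_group N"
    and h: "\<And>x. x \<in> carrier M \<Longrightarrow> h x \<in> carrier N"
      "\<And>x y. x \<in> carrier M \<Longrightarrow> y \<in> carrier M \<Longrightarrow> h (x \<oplus>\<^bsub>M\<^esub> y) = h x \<oplus>\<^bsub>N\<^esub> h y"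
    and f: "finite K" "\<And>k. k \<in> K \<Longrightarrow> f k \<in> carrier M"
  shows "h (finsum M f K) = finsum N (\<lambda>k. h (f k)) K"
proof -
  interpret M: abelian_group M by (rule M)
  interpret N: abelian_group N by (rule N)
  have z: "h \<zero>\<^bsub>M\<^esub> = \<zero>\<^bsub>N\<^esub>"
    using h(2)[of "\<zero>\<^bsub>M\<^esub>" "\<zero>\<^bsub>M\<^esub>"] h(1)[of "\<zero>\<^bsub>M\<^esub>"]
    by (metis M.l_zero M.zero_closed N.add.r_cancel_one)
  show ?thesis using f
  proof (induction K rule: finite_induct)
    case (insert k K)
    then have "finsum M f (insert k K) = f k \<oplus>\<^bsub>M\<^esub> finsum M f K" by (intro M.finsum_insert) auto
    moreover have "finsum N (\<lambda>k. h (f k)) (insert k K) = h (f k) \<oplus>\<^bsub>N\<^esub> finsum N (\<lambda>k. h (f k)) K"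
      using insert h(1) by (intro N.finsum_insert) auto
    moreover have "finsum M f K \<in> carrier M" using insert by (intro M.finsum_closed) auto
    ultimately show ?case using insert h(2) by simp
  qed (simp add: z)
qed

lemma finsum_swap:
  assumes M: "abelian_group M" and "finite I" "finite K"
    and f: "\<And>i k. i \<in> I \<Longrightarrow> k \<in> K \<Longrightarrow> f i k \<in> carrier M"
  shows "finsum M (\<lambda>i. finsum M (\<lambda>k. f i k) K) I = finsum M (\<lambda>k. finsum M (\<lambda>i. f i k) I) K"
proof -
  interpret M: abelian_group M by (rule M)
  show ?thesis using assms(2) f
  proof (induction I rule: finite_induct)
    case empty
    show ?case by simp
  next
    case (insert i I)
    have "finsum M (\<lambda>i. finsum M (f i) K) (insert i I)
        = finsum M (f i) K \<oplus>\<^bsub>M\<^esub> finsum M (\<lambda>i. finsum M (f i) K) I"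
      using insert by (intro M.finsum_insert) (auto intro!: M.finsum_closed)
    also have "\<dots> = finsum M (f i) K \<oplus>\<^bsub>M\<^esub> finsum M (\<lambda>k. finsum M (\<lambda>i. f i k) I) K"
      using insert by simp
    also have "\<dots> = finsum M (\<lambda>k. f i k \<oplus>\<^bsub>M\<^esub> finsum M (\<lambda>i. f i k) I) K"
      using insert by (intro M.finsum_addf[symmetric]) (auto intro!: M.finsum_closed)
    also have "\<dots> = finsum M (\<lambda>k. finsum M (\<lambda>i. f i k) (insert i I)) K"
      using insert by (intro M.finsum_cong') (auto intro!: M.finsum_closed)
    finally show ?case .
  qed
qed

lemma abelian_groupI':
  assumes "\<And>x y. x \<in> carrier M \<Longrightarrow> y \<in> carrier M \<Longrightarrow> x \<oplus>\<^bsub>M\<^esub> y \<in> carrier M" "\<zero>\<^bsub>M\<^esub> \<in> carrier M"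
    "\<And>x y z. x \<in> carrier M \<Longrightarrow> y \<in> carrier M \<Longrightarrow> z \<in> carrier M \<Longrightarrow> (x \<oplus>\<^bsub>M\<^esub> y) \<oplus>\<^bsub>M\<^esub> z = x \<oplus>\<^bsub>M\<^esub> (y \<oplus>\<^bsub>M\<^esub> z)"
    "\<And>x y. x \<in> carrier M \<Longrightarrow> y \<in> carrier M \<Longrightarrow> x \<oplus>\<^bsub>M\<^esub> y = y \<oplus>\<^bsub>M\<^esub> x"
    "\<And>x. x \<in> carrier M \<Longrightarrow> \<zero>\<^bsub>M\<^esub> \<oplus>\<^bsub>M\<^esub> x = x"
    "\<And>x. x \<in> carrier M \<Longrightarrow> \<exists>y\<in>carrier M. y \<oplus>\<^bsub>M\<^esub> x = \<zero>\<^bsub>M\<^esub>"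
  shows "abelian_group M"
  using assms by (intro abelian_groupI) auto

definition pcorner :: "('a, 'm) ring_scheme \<Rightarrow> 'a \<Rightarrow> 'a \<Rightarrow> 'a set" where
  "pcorner R e f = {a \<in> carrier R. e \<otimes>\<^bsub>R\<^esub> a = a \<and> a \<otimes>\<^bsub>R\<^esub> f = a}"

text \<open>
  \<open>A\<close> is identified with the corner \<open>e R e\<close> by \<open>\<kappa>\<close>, with inverse \<open>\<iota>\<close>; \<open>z c\<close> is the central
  element of \<open>R\<close> by which the scalar \<open>c\<close> acts.
\<close>

locale corner = ring R
  for R :: "('a, 'm) ring_scheme" +
  fixes A :: "('c, 'b) module" and e :: 'a and \<kappa> :: "'a \<Rightarrow> 'b" and \<iota> :: "'b \<Rightarrow> 'a" and z :: "'c \<Rightarrow> 'a"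
  assumes e_closed: "e \<in> carrier R" and e_idem: "e \<otimes>\<^bsub>R\<^esub> e = e"
    and \<kappa>_closed: "a \<in> pcorner R e e \<Longrightarrow> \<kappa> a \<in> carrier A"
    and \<kappa>_add: "a \<in> pcorner R e e \<Longrightarrow> b \<in> pcorner R e e \<Longrightarrow> \<kappa> (a \<oplus>\<^bsub>R\<^esub> b) = \<kappa> a \<oplus>\<^bsub>A\<^esub> \<kappa> b"
    and \<kappa>_mult: "a \<in> pcorner R e e \<Longrightarrow> b \<in> pcorner R e e \<Longrightarrow> \<kappa> (a \<otimes>\<^bsub>R\<^esub> b) = \<kappa> a \<otimes>\<^bsub>A\<^esub> \<kappa> b"
    and \<kappa>_one: "\<kappa> e = \<one>\<^bsub>A\<^esub>"
    and \<iota>_closed: "x \<in> carrier A \<Longrightarrow> \<iota> x \<in> pcorner R e e"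
    and \<kappa>_\<iota>: "x \<in> carrier A \<Longrightarrow> \<kappa> (\<iota> x) = x"
    and \<iota>_\<kappa>: "a \<in> pcorner R e e \<Longrightarrow> \<iota> (\<kappa> a) = a"
    and z_closed: "z c \<in> carrier R" and z_comm: "a \<in> carrier R \<Longrightarrow> z c \<otimes>\<^bsub>R\<^esub> a = a \<otimes>\<^bsub>R\<^esub> z c"
    and smult_closed: "c \<odot>\<^bsub>A\<^esub> \<one>\<^bsub>A\<^esub> \<in> carrier A"
    and \<iota>_smult: "\<iota> (c \<odot>\<^bsub>A\<^esub> \<one>\<^bsub>A\<^esub>) = z c \<otimes>\<^bsub>R\<^esub> e"
begin

lemma pcorner_add: "a \<in> pcorner R f g \<Longrightarrow> b \<in> pcorner R f g \<Longrightarrow> f \<in> carrier R \<Longrightarrow> g \<in> carrier R \<Longrightarrow>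
    a \<oplus>\<^bsub>R\<^esub> b \<in> pcorner R f g"
  unfolding pcorner_def by (auto simp: l_distr r_distr)

lemma pcorner_zero: "f \<in> carrier R \<Longrightarrow> g \<in> carrier R \<Longrightarrow> \<zero>\<^bsub>R\<^esub> \<in> pcorner R f g"
  unfolding pcorner_def by auto

lemma pcorner_mult: "a \<in> pcorner R f g \<Longrightarrow> b \<in> pcorner R g' h \<Longrightarrow> f \<in> carrier R \<Longrightarrow> h \<in> carrier R \<Longrightarrow>
    a \<otimes>\<^bsub>R\<^esub> b \<in> pcorner R f h"
  unfolding pcorner_def by (auto simp: m_assoc[symmetric]) (auto simp: m_assoc)

lemma pcorner_carrier: "a \<in> pcorner R f g \<Longrightarrow> a \<in> carrier R"
  unfolding pcorner_def by auto

lemma e_corner: "e \<in> pcorner R e e"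
  unfolding pcorner_def using e_closed e_idem by auto

lemma pcorner_finsum:
  assumes "finite K" "f \<in> K \<rightarrow> pcorner R a b" "a \<in> carrier R" "b \<in> carrier R"
  shows "finsum R f K \<in> pcorner R a b"
  using assms
proof (induction K rule: finite_induct)
  case (insert k K)
  then have "finsum R f (insert k K) = f k \<oplus>\<^bsub>R\<^esub> finsum R f K"
    by (intro finsum_insert) (auto dest: pcorner_carrier)
  then show ?case using insert by (simp add: pcorner_add)
qed (simp add: pcorner_zero)

lemma \<iota>_add: "b \<in> carrier A \<Longrightarrow> b' \<in> carrier A \<Longrightarrow> \<iota> (b \<oplus>\<^bsub>A\<^esub> b') = \<iota> b \<oplus>\<^bsub>R\<^esub> \<iota> b'"
  by (metis \<kappa>_add \<kappa>_\<iota> \<iota>_\<kappa> \<iota>_closed pcorner_add e_closed)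

lemma \<iota>_mult: "b \<in> carrier A \<Longrightarrow> b' \<in> carrier A \<Longrightarrow> \<iota> (b \<otimes>\<^bsub>A\<^esub> b') = \<iota> b \<otimes>\<^bsub>R\<^esub> \<iota> b'"
  by (metis \<kappa>_mult \<kappa>_\<iota> \<iota>_\<kappa> \<iota>_closed pcorner_mult e_closed)

lemma \<iota>_one: "\<iota> \<one>\<^bsub>A\<^esub> = e"
  by (metis \<iota>_\<kappa> \<kappa>_one e_corner)

text \<open>The right action of the corner on an \<open>A\<close>-module.\<close>

definition act :: "('b, 'u) module \<Rightarrow> 'a \<Rightarrow> 'u \<Rightarrow> 'u" where
  "act M a x = \<kappa> a \<odot>\<^bsub>M\<^esub> x"

context
  fixes M :: "('b, 'u) module"
  assumes M: "right_module A M"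
begin

interpretation M: right_module A M by (rule M)

lemma act_closed: "a \<in> pcorner R e e \<Longrightarrow> x \<in> carrier M \<Longrightarrow> act M a x \<in> carrier M"
  unfolding act_def by (intro M.act_closed \<kappa>_closed)

lemma act_add_left: "a \<in> pcorner R e e \<Longrightarrow> b \<in> pcorner R e e \<Longrightarrow> x \<in> carrier M \<Longrightarrow>
    act M (a \<oplus>\<^bsub>R\<^esub> b) x = act M a x \<oplus>\<^bsub>M\<^esub> act M b x"
  unfolding act_def by (simp add: \<kappa>_add M.act_add_left \<kappa>_closed)

lemma act_add_right: "a \<in> pcorner R e e \<Longrightarrow> x \<in> carrier M \<Longrightarrow> y \<in> carrier M \<Longrightarrow>
    act M a (x \<oplus>\<^bsub>M\<^esub> y) = act M a x \<oplus>\<^bsub>M\<^esub> act M a y"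
  unfolding act_def by (simp add: M.act_add_right \<kappa>_closed)

lemma act_mult: "a \<in> pcorner R e e \<Longrightarrow> b \<in> pcorner R e e \<Longrightarrow> x \<in> carrier M \<Longrightarrow>
    act M b (act M a x) = act M (a \<otimes>\<^bsub>R\<^esub> b) x"
  unfolding act_def by (simp add: \<kappa>_mult M.act_mult \<kappa>_closed)

lemma act_e: "x \<in> carrier M \<Longrightarrow> act M e x = x"
  unfolding act_def by (simp add: \<kappa>_one M.act_one)

lemma M_group: "abelian_group M"
  by (rule M.abelian_group_axioms)

lemma act_finsum_right:
  "a \<in> pcorner R e e \<Longrightarrow> finite K \<Longrightarrow> (\<And>k. k \<in> K \<Longrightarrow> f k \<in> carrier M) \<Longrightarrow>
    act M a (finsum M f K) = finsum M (\<lambda>k. act M a (f k)) K"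
  by (rule finsum_hom[OF M_group M_group]) (auto simp: act_closed act_add_right)

lemma act_finsum_left:
  assumes x: "x \<in> carrier M" and "finite K" "\<And>k. k \<in> K \<Longrightarrow> f k \<in> pcorner R e e"
  shows "act M (finsum R f K) x = finsum M (\<lambda>k. act M (f k) x) K"
  using assms(2,3)
proof (induction K rule: finite_induct)
  case empty
  have "act M \<zero>\<^bsub>R\<^esub> x \<oplus>\<^bsub>M\<^esub> act M \<zero>\<^bsub>R\<^esub> x = act M \<zero>\<^bsub>R\<^esub> x"
    using act_add_left[OF pcorner_zero pcorner_zero x] e_closed by simp
  then have "act M \<zero>\<^bsub>R\<^esub> x = \<zero>\<^bsub>M\<^esub>"
    using act_closed[OF pcorner_zero x] e_closed by (metis M.add.r_cancel_one)
  then show ?case by simp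
next
  case (insert k K)
  then have "finsum R f (insert k K) = f k \<oplus>\<^bsub>R\<^esub> finsum R f K"
    by (intro finsum_insert) (auto dest: pcorner_carrier)
  moreover have "finsum R f K \<in> pcorner R e e" using insert e_closed by (intro pcorner_finsum) auto
  moreover have "finsum M (\<lambda>k. act M (f k) x) (insert k K) = act M (f k) x \<oplus>\<^bsub>M\<^esub> finsum M (\<lambda>k. act M (f k) x) K"
    using insert x by (intro M.finsum_insert) (auto simp: act_closed)
  ultimately show ?case using insert x by (simp add: act_add_left)
qed

end

end

text \<open>An injective encoding of finite families by single elements of the universe.\<close>

lemma infinite_encoding:
  assumes "infinite (UNIV :: 'u set)" "finite K"
  shows "\<exists>enc :: ('k \<Rightarrow> 'u) \<Rightarrow> 'u. inj_on enc (K \<rightarrow>\<^sub>E UNIV)"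
  using assms(2)
proof (induction K rule: finite_induct)
  case empty
  show ?case by (intro exI[of _ "\<lambda>_. undefined"]) (simp add: inj_on_def)
next
  case (insert k K)
  then obtain enc :: "('k \<Rightarrow> 'u) \<Rightarrow> 'u" where enc: "inj_on enc (K \<rightarrow>\<^sub>E UNIV)" by blast
  have "(card_of (UNIV \<times> UNIV :: ('u \<times> 'u) set), card_of (UNIV :: 'u set)) \<in> ordLeq"
    using card_of_Times_same_infinite[OF assms(1)] by (rule ordIso_imp_ordLeq)
  then obtain pr :: "'u \<times> 'u \<Rightarrow> 'u" where pr: "inj pr"
    unfolding card_of_ordLeq[symmetric] by auto
  have "inj_on (\<lambda>f. pr (f k, enc (restrict f K))) (insert k K \<rightarrow>\<^sub>E UNIV)"
  proof (rule inj_onI)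
    fix f g :: "'k \<Rightarrow> 'u"
    assume f: "f \<in> insert k K \<rightarrow>\<^sub>E UNIV" and g: "g \<in> insert k K \<rightarrow>\<^sub>E UNIV"
      and eq: "pr (f k, enc (restrict f K)) = pr (g k, enc (restrict g K))"
    have "f k = g k" and "enc (restrict f K) = enc (restrict g K)"
      using injD[OF pr eq] by simp_all
    moreover have "restrict f K \<in> K \<rightarrow>\<^sub>E UNIV" "restrict g K \<in> K \<rightarrow>\<^sub>E UNIV" by auto
    ultimately have "f k = g k" "restrict f K = restrict g K" using inj_onD[OF enc] by auto
    then have "f x = g x" if "x \<in> insert k K" for x using that by (metis insertE restrict_apply')
    then show "f = g" using f g by (intro PiE_ext) auto
  qed
  then show ?case by blast
qed

text \<open>
  The functor that sends an \<open>A1\<close>-module \<open>M\<close> to \<open>M \<otimes> e1 R e2\<close>. The decomposition of \<open>e2\<close>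
  identifies this tensor product with a summand of a finite power of \<open>M\<close>, namely the set of the
  families fixed by the idempotent matrix with entries \<open>q i \<otimes> p j\<close>.
\<close>

locale corner_functor =
  c1: corner R A1 e1 \<kappa>1 \<iota>1 z + c2: corner R A2 e2 \<kappa>2 \<iota>2 z
  for R :: "('a, 'm) ring_scheme" and A1 :: "('c, 'b) module" and e1 \<kappa>1 \<iota>1 z
    and A2 :: "('c, 'd) module" and e2 \<kappa>2 \<iota>2 +
  fixes I :: "'k set" and p q :: "'k \<Rightarrow> 'a" and enc :: "('k \<Rightarrow> 'u) \<Rightarrow> 'u"
  assumes finite_I: "finite I"
    and p_closed: "i \<in> I \<Longrightarrow> p i \<in> pcorner R e2 e1"
    and q_closed: "i \<in> I \<Longrightarrow> q i \<in> pcorner R e1 e2"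
    and sum_pq: "finsum R (\<lambda>i. p i \<otimes>\<^bsub>R\<^esub> q i) I = e2"
    and inj_enc: "inj_on enc (I \<rightarrow>\<^sub>E UNIV)"
begin

definition mat :: "'k \<Rightarrow> 'a \<Rightarrow> 'k \<Rightarrow> 'a" where
  "mat i a j = q i \<otimes>\<^bsub>R\<^esub> a \<otimes>\<^bsub>R\<^esub> p j"

lemma mat_closed: "i \<in> I \<Longrightarrow> j \<in> I \<Longrightarrow> a \<in> pcorner R e2 e2 \<Longrightarrow> mat i a j \<in> pcorner R e1 e1"
  unfolding mat_def using p_closed q_closed c1.e_closed c2.e_closed
  by (meson c1.pcorner_mult)

lemma sum_mat:
  assumes "i \<in> I" "j \<in> I" "a \<in> pcorner R e2 e2" "b \<in> pcorner R e2 e2"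
  shows "finsum R (\<lambda>k. mat i a k \<otimes>\<^bsub>R\<^esub> mat k b j) I = mat i (a \<otimes>\<^bsub>R\<^esub> b) j"
proof -
  have car: "q i \<in> carrier R" "p j \<in> carrier R" "a \<in> carrier R" "b \<in> carrier R"
    using assms by (auto intro: c1.pcorner_carrier[OF p_closed] c1.pcorner_carrier[OF q_closed]
        c1.pcorner_carrier)
  have car': "p k \<in> carrier R" "q k \<in> carrier R" if "k \<in> I" for k
    using that by (auto intro: c1.pcorner_carrier[OF p_closed] c1.pcorner_carrier[OF q_closed])
  let ?l = "q i \<otimes>\<^bsub>R\<^esub> a" and ?r = "b \<otimes>\<^bsub>R\<^esub> p j"
  have "finsum R (\<lambda>k. mat i a k \<otimes>\<^bsub>R\<^esub> mat k b j) I = finsum R (\<lambda>k. ?l \<otimes>\<^bsub>R\<^esub> (p k \<otimes>\<^bsub>R\<^esub> q k) \<otimes>\<^bsub>R\<^esub> ?r) I"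
    unfolding mat_def using car car' by (intro c1.finsum_cong') (auto simp: c1.m_assoc)
  also have "\<dots> = finsum R (\<lambda>k. ?l \<otimes>\<^bsub>R\<^esub> (p k \<otimes>\<^bsub>R\<^esub> q k)) I \<otimes>\<^bsub>R\<^esub> ?r"
    using car car' finite_I by (intro c1.finsum_ldistr[symmetric]) auto
  also have "finsum R (\<lambda>k. ?l \<otimes>\<^bsub>R\<^esub> (p k \<otimes>\<^bsub>R\<^esub> q k)) I = ?l \<otimes>\<^bsub>R\<^esub> finsum R (\<lambda>k. p k \<otimes>\<^bsub>R\<^esub> q k) I"
    using car car' finite_I by (intro c1.finsum_rdistr[symmetric]) auto
  also have "?l \<otimes>\<^bsub>R\<^esub> finsum R (\<lambda>k. p k \<otimes>\<^bsub>R\<^esub> q k) I \<otimes>\<^bsub>R\<^esub> ?r = mat i (a \<otimes>\<^bsub>R\<^esub> b) j"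
    using assms car c2.e_closed unfolding sum_pq mat_def pcorner_def by (simp add: c1.m_assoc)
  finally show ?thesis .
qed

lemma mat_add: "i \<in> I \<Longrightarrow> j \<in> I \<Longrightarrow> a \<in> pcorner R e2 e2 \<Longrightarrow> b \<in> pcorner R e2 e2 \<Longrightarrow>
    mat i (a \<oplus>\<^bsub>R\<^esub> b) j = mat i a j \<oplus>\<^bsub>R\<^esub> mat i b j"
  unfolding mat_def using p_closed[of j] q_closed[of i]
  by (auto simp: c1.l_distr c1.r_distr dest!: c1.pcorner_carrier)

definition T :: "('b, 'u) module \<Rightarrow> 'a \<Rightarrow> ('k \<Rightarrow> 'u) \<Rightarrow> 'k \<Rightarrow> 'u" where
  "T M a y = (\<lambda>j\<in>I. finsum M (\<lambda>i. c1.act M (mat i a j) (y i)) I)"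

definition S :: "('b, 'u) module \<Rightarrow> ('k \<Rightarrow> 'u) set" where
  "S M = {y \<in> I \<rightarrow>\<^sub>E carrier M. T M e2 y = y}"

definition dec :: "'u \<Rightarrow> 'k \<Rightarrow> 'u" where
  "dec = inv_into (I \<rightarrow>\<^sub>E UNIV) enc"

definition Fo :: "('b, 'u) module \<Rightarrow> ('d, 'u) module" where
  "Fo M = \<lparr>carrier = enc ` S M, monoid.mult = undefined, one = undefined,
     zero = enc (\<lambda>i\<in>I. \<zero>\<^bsub>M\<^esub>), add = (\<lambda>u v. enc (\<lambda>i\<in>I. dec u i \<oplus>\<^bsub>M\<^esub> dec v i)),
     module.smult = (\<lambda>b u. enc (T M (\<iota>2 b) (dec u)))\<rparr>"

definition Fm :: "('b, 'u) module \<Rightarrow> ('b, 'u) module \<Rightarrow> ('u \<Rightarrow> 'u) \<Rightarrow> 'u \<Rightarrow> 'u" where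
  "Fm M N f = (\<lambda>u\<in>carrier (Fo M). enc (\<lambda>i\<in>I. f (dec u i)))"

lemma dec_enc: "y \<in> I \<rightarrow>\<^sub>E X \<Longrightarrow> dec (enc y) = y"
  unfolding dec_def by (rule inv_into_f_f[OF inj_enc]) auto

lemma S_PiE: "y \<in> S M \<Longrightarrow> y \<in> I \<rightarrow>\<^sub>E carrier M"
  unfolding S_def by auto

lemma S_closed: "y \<in> S M \<Longrightarrow> i \<in> I \<Longrightarrow> y i \<in> carrier M"
  unfolding S_def by auto

lemma dec_enc_S: "y \<in> S M \<Longrightarrow> dec (enc y) = y"
  using dec_enc S_PiE by blast

lemma Fo_simps [simp]:
  "carrier (Fo M) = enc ` S M" "\<zero>\<^bsub>Fo M\<^esub> = enc (\<lambda>i\<in>I. \<zero>\<^bsub>M\<^esub>)"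
  "u \<oplus>\<^bsub>Fo M\<^esub> v = enc (\<lambda>i\<in>I. dec u i \<oplus>\<^bsub>M\<^esub> dec v i)"
  "b \<odot>\<^bsub>Fo M\<^esub> u = enc (T M (\<iota>2 b) (dec u))"
  by (simp_all add: Fo_def)

context
  fixes M :: "('b, 'u) module"
  assumes M: "right_module A1 M"
begin

interpretation M: right_module A1 M by (rule M)

lemma T_closed: "a \<in> pcorner R e2 e2 \<Longrightarrow> y \<in> I \<rightarrow>\<^sub>E carrier M \<Longrightarrow> T M a y \<in> I \<rightarrow>\<^sub>E carrier M"
  unfolding T_def by (auto intro!: M.finsum_closed c1.act_closed[OF M] mat_closed)

lemma T_T:
  assumes "a \<in> pcorner R e2 e2" "b \<in> pcorner R e2 e2" "y \<in> I \<rightarrow>\<^sub>E carrier M"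
  shows "T M b (T M a y) = T M (a \<otimes>\<^bsub>R\<^esub> b) y"
proof
  fix j
  show "T M b (T M a y) j = T M (a \<otimes>\<^bsub>R\<^esub> b) y j"
  proof (cases "j \<in> I")
    case j: True
    have y: "y i \<in> carrier M" if "i \<in> I" for i using assms that by auto
    have "T M b (T M a y) j
        = finsum M (\<lambda>k. c1.act M (mat k b j) (finsum M (\<lambda>i. c1.act M (mat i a k) (y i)) I)) I"
      unfolding T_def using j assms y
      by (auto intro!: M.finsum_cong' M.finsum_closed c1.act_closed[OF M] mat_closed)
    also have "\<dots> = finsum M (\<lambda>k. finsum M (\<lambda>i. c1.act M (mat i a k \<otimes>\<^bsub>R\<^esub> mat k b j) (y i)) I) I"
    proof (rule M.finsum_cong'[OF refl])
      fix k assume k: "k \<in> I"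
      have "c1.act M (mat k b j) (finsum M (\<lambda>i. c1.act M (mat i a k) (y i)) I)
          = finsum M (\<lambda>i. c1.act M (mat k b j) (c1.act M (mat i a k) (y i))) I"
        using j k assms y finite_I by (intro c1.act_finsum_right[OF M] mat_closed c1.act_closed[OF M])
      also have "\<dots> = finsum M (\<lambda>i. c1.act M (mat i a k \<otimes>\<^bsub>R\<^esub> mat k b j) (y i)) I"
        using j k assms y
        by (intro M.finsum_cong') (auto intro!: c1.act_mult[OF M] c1.act_closed[OF M] mat_closed c1.pcorner_mult c1.e_closed)
      finally show "c1.act M (mat k b j) (finsum M (\<lambda>i. c1.act M (mat i a k) (y i)) I)
          = finsum M (\<lambda>i. c1.act M (mat i a k \<otimes>\<^bsub>R\<^esub> mat k b j) (y i)) I" .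
    qed (use j assms y in \<open>auto intro!: M.finsum_closed c1.act_closed[OF M] mat_closed c1.pcorner_mult c1.e_closed\<close>)
    also have "\<dots> = finsum M (\<lambda>i. finsum M (\<lambda>k. c1.act M (mat i a k \<otimes>\<^bsub>R\<^esub> mat k b j) (y i)) I) I"
      using j assms y finite_I
      by (intro finsum_swap) (auto intro!: M.abelian_group_axioms c1.act_closed[OF M] mat_closed c1.pcorner_mult c1.e_closed)
    also have "\<dots> = finsum M (\<lambda>i. c1.act M (mat i (a \<otimes>\<^bsub>R\<^esub> b) j) (y i)) I"
    proof (rule M.finsum_cong'[OF refl])
      fix i assume i: "i \<in> I"
      have "finsum M (\<lambda>k. c1.act M (mat i a k \<otimes>\<^bsub>R\<^esub> mat k b j) (y i)) I
          = c1.act M (finsum R (\<lambda>k. mat i a k \<otimes>\<^bsub>R\<^esub> mat k b j) I) (y i)"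
        using i j assms y finite_I
        by (intro c1.act_finsum_left[OF M, symmetric]) (auto intro!: mat_closed c1.pcorner_mult c1.e_closed)
      then show "finsum M (\<lambda>k. c1.act M (mat i a k \<otimes>\<^bsub>R\<^esub> mat k b j) (y i)) I = c1.act M (mat i (a \<otimes>\<^bsub>R\<^esub> b) j) (y i)"
        using sum_mat i j assms by simp
    qed (use j assms y in \<open>auto intro!: c1.act_closed[OF M] mat_closed c1.pcorner_mult c2.e_closed\<close>)
    finally show ?thesis using j by (simp add: T_def)
  qed (simp add: T_def)
qed

lemma T_S: "a \<in> pcorner R e2 e2 \<Longrightarrow> y \<in> I \<rightarrow>\<^sub>E carrier M \<Longrightarrow> T M a y \<in> S M"
  unfolding S_def using T_closed T_T[of a e2 y] c2.e_corner by (auto simp: pcorner_def)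

lemma T_add_right:
  assumes "a \<in> pcorner R e2 e2" "y \<in> I \<rightarrow>\<^sub>E carrier M" "y' \<in> I \<rightarrow>\<^sub>E carrier M"
  shows "T M a (\<lambda>i\<in>I. y i \<oplus>\<^bsub>M\<^esub> y' i) = (\<lambda>i\<in>I. T M a y i \<oplus>\<^bsub>M\<^esub> T M a y' i)"
proof
  fix j
  show "T M a (\<lambda>i\<in>I. y i \<oplus>\<^bsub>M\<^esub> y' i) j = (\<lambda>i\<in>I. T M a y i \<oplus>\<^bsub>M\<^esub> T M a y' i) j"
  proof (cases "j \<in> I")
    case j: True
    have y: "y i \<in> carrier M" "y' i \<in> carrier M" if "i \<in> I" for i using assms that by auto
    have m: "mat i a j \<in> pcorner R e1 e1" if "i \<in> I" for i using that j assms by (intro mat_closed)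
    have "T M a (\<lambda>i\<in>I. y i \<oplus>\<^bsub>M\<^esub> y' i) j
        = finsum M (\<lambda>i. c1.act M (mat i a j) (y i) \<oplus>\<^bsub>M\<^esub> c1.act M (mat i a j) (y' i)) I"
      unfolding T_def using j y m
      by (auto intro!: M.finsum_cong' c1.act_closed[OF M] simp: c1.act_add_right[OF M])
    also have "\<dots> = T M a y j \<oplus>\<^bsub>M\<^esub> T M a y' j"
      unfolding T_def using j y m by (auto intro!: M.finsum_addf c1.act_closed[OF M])
    finally show ?thesis using j by simp
  qed (simp add: T_def)
qed

lemma T_add_left:
  assumes "a \<in> pcorner R e2 e2" "b \<in> pcorner R e2 e2" "y \<in> I \<rightarrow>\<^sub>E carrier M"
  shows "T M (a \<oplus>\<^bsub>R\<^esub> b) y = (\<lambda>i\<in>I. T M a y i \<oplus>\<^bsub>M\<^esub> T M b y i)"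
proof
  fix j
  show "T M (a \<oplus>\<^bsub>R\<^esub> b) y j = (\<lambda>i\<in>I. T M a y i \<oplus>\<^bsub>M\<^esub> T M b y i) j"
  proof (cases "j \<in> I")
    case j: True
    have y: "y i \<in> carrier M" if "i \<in> I" for i using assms that by auto
    have m: "mat i a j \<in> pcorner R e1 e1" "mat i b j \<in> pcorner R e1 e1" if "i \<in> I" for i
      using that j assms by (auto intro!: mat_closed)
    have "T M (a \<oplus>\<^bsub>R\<^esub> b) y j
        = finsum M (\<lambda>i. c1.act M (mat i a j) (y i) \<oplus>\<^bsub>M\<^esub> c1.act M (mat i b j) (y i)) I"
      unfolding T_def using j y m assms
      by (auto intro!: M.finsum_cong' M.add.m_closed c1.act_closed[OF M] simp: mat_add c1.act_add_left[OF M])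
    also have "\<dots> = T M a y j \<oplus>\<^bsub>M\<^esub> T M b y j"
      unfolding T_def using j y m by (auto intro!: M.finsum_addf c1.act_closed[OF M])
    finally show ?thesis using j by simp
  qed (simp add: T_def)
qed

lemma S_add: "y \<in> S M \<Longrightarrow> y' \<in> S M \<Longrightarrow> (\<lambda>i\<in>I. y i \<oplus>\<^bsub>M\<^esub> y' i) \<in> S M"
  using T_add_right[OF c2.e_corner, of y y'] unfolding S_def by auto

lemma T_zero_left: "y \<in> I \<rightarrow>\<^sub>E carrier M \<Longrightarrow> T M \<zero>\<^bsub>R\<^esub> y = (\<lambda>i\<in>I. \<zero>\<^bsub>M\<^esub>)"
proof
  fix j assume y: "y \<in> I \<rightarrow>\<^sub>E carrier M"
  have z: "\<zero>\<^bsub>R\<^esub> \<in> pcorner R e2 e2" using c2.e_closed by (intro c2.pcorner_zero)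
  have "T M \<zero>\<^bsub>R\<^esub> y j = \<zero>\<^bsub>M\<^esub>" if j: "j \<in> I"
  proof -
    have "T M \<zero>\<^bsub>R\<^esub> y j \<oplus>\<^bsub>M\<^esub> T M \<zero>\<^bsub>R\<^esub> y j = T M \<zero>\<^bsub>R\<^esub> y j"
      using fun_cong[OF T_add_left[OF z z y], of j] j by simp
    moreover have "T M \<zero>\<^bsub>R\<^esub> y j \<in> carrier M" using T_closed[OF z y] j by auto
    ultimately show ?thesis by (metis M.add.r_cancel_one)
  qed
  then show "T M \<zero>\<^bsub>R\<^esub> y j = (\<lambda>i\<in>I. \<zero>\<^bsub>M\<^esub>) j" by (auto simp: T_def)
qed

lemma S_zero: "(\<lambda>i\<in>I. \<zero>\<^bsub>M\<^esub>) \<in> S M"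
proof -
  have z: "\<zero>\<^bsub>R\<^esub> \<in> pcorner R e2 e2" using c2.e_closed by (intro c2.pcorner_zero)
  have "T M \<zero>\<^bsub>R\<^esub> (\<lambda>i\<in>I. \<zero>\<^bsub>M\<^esub>) \<in> S M" by (rule T_S[OF z]) auto
  moreover have "T M \<zero>\<^bsub>R\<^esub> (\<lambda>i\<in>I. \<zero>\<^bsub>M\<^esub>) = (\<lambda>i\<in>I. \<zero>\<^bsub>M\<^esub>)" by (rule T_zero_left) auto
  ultimately show ?thesis by simp
qed

lemma right_module_Fo: "right_module A2 (Fo M)"
proof -
  have "abelian_group (Fo M)"
  proof (rule abelian_groupI')
    fix u assume "u \<in> carrier (Fo M)"
    then obtain x where x: "x \<in> S M" "u = enc x" by auto
    let ?n = "\<ominus>\<^bsub>R\<^esub> e2"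
    have n: "?n \<in> pcorner R e2 e2"
      using c2.e_closed c2.e_idem unfolding pcorner_def by (auto simp: c1.l_minus c1.r_minus)
    have xP: "x \<in> I \<rightarrow>\<^sub>E carrier M" "T M e2 x = x" using x unfolding S_def by auto
    have inv: "(\<lambda>i\<in>I. T M ?n x i \<oplus>\<^bsub>M\<^esub> x i) = (\<lambda>i\<in>I. \<zero>\<^bsub>M\<^esub>)"
      using T_add_left[OF n c2.e_corner xP(1)] T_zero_left[OF xP(1)] c2.e_closed xP(2)
      by (simp add: c1.l_neg)
    show "\<exists>y\<in>carrier (Fo M). y \<oplus>\<^bsub>Fo M\<^esub> u = \<zero>\<^bsub>Fo M\<^esub>"
      using x inv T_S[OF n xP(1)] by (intro bexI[of _ "enc (T M ?n x)"]) (auto simp: dec_enc_S)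
    have "(\<lambda>i\<in>I. (\<lambda>i\<in>I. \<zero>\<^bsub>M\<^esub>) i \<oplus>\<^bsub>M\<^esub> x i) = x"
      by (rule PiE_ext[OF _ xP(1)]) (use PiE_mem[OF xP(1)] in auto)
    then show "\<zero>\<^bsub>Fo M\<^esub> \<oplus>\<^bsub>Fo M\<^esub> u = u"
      using x dec_enc_S[OF S_zero] by (simp only: Fo_simps dec_enc_S)
    fix v assume "v \<in> carrier (Fo M)"
    then obtain y where y: "y \<in> S M" "v = enc y" by auto
    show "u \<oplus>\<^bsub>Fo M\<^esub> v \<in> carrier (Fo M)" using x y by (auto simp: dec_enc_S S_add)
    show "u \<oplus>\<^bsub>Fo M\<^esub> v = v \<oplus>\<^bsub>Fo M\<^esub> u"
      using x y by (auto simp: dec_enc_S intro!: arg_cong[of _ _ enc] restrict_ext M.a_comm S_closed)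
    fix w assume "w \<in> carrier (Fo M)"
    then obtain x' where w: "x' \<in> S M" "w = enc x'" by auto
    show "u \<oplus>\<^bsub>Fo M\<^esub> v \<oplus>\<^bsub>Fo M\<^esub> w = u \<oplus>\<^bsub>Fo M\<^esub> (v \<oplus>\<^bsub>Fo M\<^esub> w)"
      using x y w dec_enc_S[OF S_add[OF x(1) y(1)]] dec_enc_S[OF S_add[OF y(1) w(1)]]
      by (auto simp: dec_enc_S intro!: arg_cong[of _ _ enc] restrict_ext M.a_assoc S_closed)
  qed (use S_zero in simp)
  then show ?thesis
  proof (rule right_module.intro, unfold_locales)
    fix a u assume a: "a \<in> carrier A2" and "u \<in> carrier (Fo M)"
    then obtain x where x: "x \<in> S M" "u = enc x" by auto
    have xP: "x \<in> I \<rightarrow>\<^sub>E carrier M" using x S_PiE by blast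
    have ia: "\<iota>2 a \<in> pcorner R e2 e2" using a by (rule c2.\<iota>_closed)
    show "a \<odot>\<^bsub>Fo M\<^esub> u \<in> carrier (Fo M)" using x ia xP by (auto simp: dec_enc_S intro: T_S)
    { fix b assume b: "b \<in> carrier A2"
      have ib: "\<iota>2 b \<in> pcorner R e2 e2" using b by (rule c2.\<iota>_closed)
      show "(a \<oplus>\<^bsub>A2\<^esub> b) \<odot>\<^bsub>Fo M\<^esub> u = a \<odot>\<^bsub>Fo M\<^esub> u \<oplus>\<^bsub>Fo M\<^esub> b \<odot>\<^bsub>Fo M\<^esub> u"
        using x xP a b ia ib dec_enc_S[OF T_S[OF ia xP]] dec_enc_S[OF T_S[OF ib xP]]
        by (simp add: dec_enc_S T_add_left c2.\<iota>_add)
      show "(a \<otimes>\<^bsub>A2\<^esub> b) \<odot>\<^bsub>Fo M\<^esub> u = b \<odot>\<^bsub>Fo M\<^esub> (a \<odot>\<^bsub>Fo M\<^esub> u)"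
        using x xP a b ia ib dec_enc_S[OF T_S[OF ia xP]] by (simp add: dec_enc_S T_T c2.\<iota>_mult) }
    fix v assume "v \<in> carrier (Fo M)"
    then obtain y where y: "y \<in> S M" "v = enc y" by auto
    show "a \<odot>\<^bsub>Fo M\<^esub> (u \<oplus>\<^bsub>Fo M\<^esub> v) = a \<odot>\<^bsub>Fo M\<^esub> u \<oplus>\<^bsub>Fo M\<^esub> a \<odot>\<^bsub>Fo M\<^esub> v"
      using x y xP S_PiE[OF y(1)] ia dec_enc_S[OF S_add[OF x(1) y(1)]]
        dec_enc_S[OF T_S[OF ia xP]] dec_enc_S[OF T_S[OF ia S_PiE[OF y(1)]]]
      by (simp add: dec_enc_S T_add_right)
  next
    fix u assume "u \<in> carrier (Fo M)"
    then obtain x where x: "x \<in> S M" "u = enc x" by auto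
    then show "\<one>\<^bsub>A2\<^esub> \<odot>\<^bsub>Fo M\<^esub> u = u" by (simp add: dec_enc_S c2.\<iota>_one) (simp add: S_def)
  qed
qed

lemma dec_closed: "u \<in> carrier (Fo M) \<Longrightarrow> i \<in> I \<Longrightarrow> dec u i \<in> carrier M"
  by (auto simp: dec_enc_S S_closed)

lemma dec_S: "u \<in> carrier (Fo M) \<Longrightarrow> dec u \<in> S M"
  by (auto simp: dec_enc_S)

lemma Fo_eqI: "u \<in> carrier (Fo M) \<Longrightarrow> v \<in> carrier (Fo M) \<Longrightarrow> (\<And>i. i \<in> I \<Longrightarrow> dec u i = dec v i) \<Longrightarrow> u = v"
proof -
  assume u: "u \<in> carrier (Fo M)" and v: "v \<in> carrier (Fo M)" and "\<And>i. i \<in> I \<Longrightarrow> dec u i = dec v i"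
  then have "dec u = dec v" using dec_S S_PiE by (metis PiE_ext)
  then show "u = v" using u v by (auto simp: dec_enc_S)
qed

lemma dec_finsum:
  assumes "finite K" "\<And>k. k \<in> K \<Longrightarrow> f k \<in> carrier (Fo M)" "i \<in> I"
  shows "dec (finsum (Fo M) f K) i = finsum M (\<lambda>k. dec (f k) i) K"
proof (rule finsum_hom)
  show "abelian_group (Fo M)" using right_module_Fo by (simp add: right_module_def)
  show "abelian_group M" by (rule M.abelian_group_axioms)
  fix u v assume "u \<in> carrier (Fo M)" "v \<in> carrier (Fo M)"
  then obtain x y where xy: "x \<in> S M" "u = enc x" "y \<in> S M" "v = enc y" by auto
  then show "dec (u \<oplus>\<^bsub>Fo M\<^esub> v) i = dec u i \<oplus>\<^bsub>M\<^esub> dec v i"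
    using dec_enc_S[OF S_add[OF xy(1) xy(3)]] assms(3) by (simp add: dec_enc_S)
qed (use assms dec_closed in auto)

end

end

lemma rmod_homD:
  assumes "f \<in> rmod_hom A M N"
  shows "f \<in> carrier M \<rightarrow>\<^sub>E carrier N" "x \<in> carrier M \<Longrightarrow> f x \<in> carrier N"
    "x \<in> carrier M \<Longrightarrow> y \<in> carrier M \<Longrightarrow> f (x \<oplus>\<^bsub>M\<^esub> y) = f x \<oplus>\<^bsub>N\<^esub> f y"
    "a \<in> carrier A \<Longrightarrow> x \<in> carrier M \<Longrightarrow> f (a \<odot>\<^bsub>M\<^esub> x) = a \<odot>\<^bsub>N\<^esub> f x"
  using assms unfolding rmod_hom_def by auto

context corner_functor
begin

lemma T_natural:
  assumes M: "right_module A1 M" and N: "right_module A1 N" and f: "f \<in> rmod_hom A1 M N"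
    and a: "a \<in> pcorner R e2 e2" and y: "y \<in> I \<rightarrow>\<^sub>E carrier M"
  shows "T N a (\<lambda>i\<in>I. f (y i)) = (\<lambda>i\<in>I. f (T M a y i))"
proof
  interpret M: right_module A1 M by (rule M)
  interpret N: right_module A1 N by (rule N)
  fix j
  show "T N a (\<lambda>i\<in>I. f (y i)) j = (\<lambda>i\<in>I. f (T M a y i)) j"
  proof (cases "j \<in> I")
    case j: True
    have yi: "y i \<in> carrier M" if "i \<in> I" for i using y that by auto
    have m: "mat i a j \<in> pcorner R e1 e1" if "i \<in> I" for i using that j a by (intro mat_closed)
    have "f (T M a y j) = finsum N (\<lambda>i. f (c1.act M (mat i a j) (y i))) I"
      unfolding T_def using j yi m finite_I rmod_homD[OF f]
      by simp (rule finsum_hom, auto intro!: M.abelian_group_axioms N.abelian_group_axioms c1.act_closed[OF M])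
    also have "\<dots> = finsum N (\<lambda>i. c1.act N (mat i a j) ((\<lambda>i\<in>I. f (y i)) i)) I"
    proof (rule N.finsum_cong'[OF refl])
      show "(\<lambda>i. c1.act N (mat i a j) ((\<lambda>i\<in>I. f (y i)) i)) \<in> I \<rightarrow> carrier N"
        using yi m rmod_homD(2)[OF f] by (auto intro!: c1.act_closed[OF N])
      fix i assume "i \<in> I"
      then show "f (c1.act M (mat i a j) (y i)) = c1.act N (mat i a j) ((\<lambda>i\<in>I. f (y i)) i)"
        using yi m rmod_homD(4)[OF f] by (simp add: c1.act_def c1.\<kappa>_closed)
    qed
    also have "\<dots> = T N a (\<lambda>i\<in>I. f (y i)) j"
      unfolding T_def using j by simp
    finally show ?thesis using j by simp
  qed (simp add: T_def)
qed

lemma Fm_closed: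
  assumes M: "right_module A1 M" and N: "right_module A1 N" and f: "f \<in> rmod_hom A1 M N" and y: "y \<in> S M"
  shows "(\<lambda>i\<in>I. f (y i)) \<in> S N" "Fm M N f (enc y) = enc (\<lambda>i\<in>I. f (y i))"
proof -
  show "(\<lambda>i\<in>I. f (y i)) \<in> S N"
    using T_natural[OF M N f c2.e_corner S_PiE[OF y]] y rmod_homD[OF f] unfolding S_def by auto
  show "Fm M N f (enc y) = enc (\<lambda>i\<in>I. f (y i))"
    using y unfolding Fm_def by (simp add: dec_enc_S)
qed

lemma T_scalar:
  assumes M: "right_module A1 M" and y: "y \<in> S M" and j: "j \<in> I"
  shows "T M (\<iota>2 (c \<odot>\<^bsub>A2\<^esub> \<one>\<^bsub>A2\<^esub>)) y j = (c \<odot>\<^bsub>A1\<^esub> \<one>\<^bsub>A1\<^esub>) \<odot>\<^bsub>M\<^esub> y j"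
proof -
  interpret M: right_module A1 M by (rule M)
  have zz: "z c \<otimes>\<^bsub>R\<^esub> e1 \<in> pcorner R e1 e1" "z c \<otimes>\<^bsub>R\<^esub> e2 \<in> pcorner R e2 e2"
    using c1.\<iota>_closed[OF c1.smult_closed] c2.\<iota>_closed[OF c2.smult_closed]
    unfolding c1.\<iota>_smult c2.\<iota>_smult by auto
  have yi: "y i \<in> carrier M" if "i \<in> I" for i using y that S_closed by blast
  have m: "mat i (z c \<otimes>\<^bsub>R\<^esub> e2) j = mat i e2 j \<otimes>\<^bsub>R\<^esub> (z c \<otimes>\<^bsub>R\<^esub> e1)" if i: "i \<in> I" for i
  proof -
    have car: "q i \<in> carrier R" "p j \<in> carrier R" "z c \<in> carrier R" "p j \<otimes>\<^bsub>R\<^esub> e1 = p j"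
      using i j p_closed[of j] q_closed[of i] c1.z_closed unfolding pcorner_def by auto
    have "mat i (z c \<otimes>\<^bsub>R\<^esub> e2) j = q i \<otimes>\<^bsub>R\<^esub> (z c \<otimes>\<^bsub>R\<^esub> (e2 \<otimes>\<^bsub>R\<^esub> p j))"
      unfolding mat_def using car c2.e_closed by (simp add: c1.m_assoc)
    also have "z c \<otimes>\<^bsub>R\<^esub> (e2 \<otimes>\<^bsub>R\<^esub> p j) = (e2 \<otimes>\<^bsub>R\<^esub> (p j \<otimes>\<^bsub>R\<^esub> e1)) \<otimes>\<^bsub>R\<^esub> z c"
      using car c2.e_closed by (simp add: c1.z_comm)
    also have "\<dots> = e2 \<otimes>\<^bsub>R\<^esub> p j \<otimes>\<^bsub>R\<^esub> (z c \<otimes>\<^bsub>R\<^esub> e1)"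
    proof -
      have "z c \<otimes>\<^bsub>R\<^esub> e1 = e1 \<otimes>\<^bsub>R\<^esub> z c" by (rule c1.z_comm[OF c1.e_closed])
      then show ?thesis using car(1-3) c2.e_closed c1.e_closed by (simp only: c1.m_assoc c1.m_closed)
    qed
    finally show ?thesis
      unfolding mat_def using car c1.e_closed c2.e_closed by (simp add: c1.m_assoc)
  qed
  have "T M (\<iota>2 (c \<odot>\<^bsub>A2\<^esub> \<one>\<^bsub>A2\<^esub>)) y j = finsum M (\<lambda>i. c1.act M (z c \<otimes>\<^bsub>R\<^esub> e1) (c1.act M (mat i e2 j) (y i))) I"
    unfolding T_def c2.\<iota>_smult using j yi zz
    by (auto intro!: M.finsum_cong' c1.act_closed[OF M] mat_closed c2.e_corner
        simp: m c1.act_mult[OF M mat_closed[OF _ j c2.e_corner]])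
  also have "\<dots> = c1.act M (z c \<otimes>\<^bsub>R\<^esub> e1) (finsum M (\<lambda>i. c1.act M (mat i e2 j) (y i)) I)"
    using j yi zz finite_I
    by (intro c1.act_finsum_right[OF M, symmetric]) (auto intro!: c1.act_closed[OF M] mat_closed c2.e_corner)
  also have "finsum M (\<lambda>i. c1.act M (mat i e2 j) (y i)) I = T M e2 y j" using j by (simp add: T_def)
  also have "T M e2 y = y" using y by (simp add: S_def)
  also have "c1.act M (z c \<otimes>\<^bsub>R\<^esub> e1) (y j) = (c \<odot>\<^bsub>A1\<^esub> \<one>\<^bsub>A1\<^esub>) \<odot>\<^bsub>M\<^esub> y j"
    unfolding c1.\<iota>_smult[symmetric] c1.act_def by (simp add: c1.\<kappa>_\<iota> c1.smult_closed)
  finally show ?thesis .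
qed

theorem linear_functor_Fo: "linear_functor A1 A2 Fo Fm"
proof (rule linear_functor.intro)
  fix M :: "('b, 'u) module" assume M: "right_module A1 M"
  then show "right_module A2 (Fo M)" by (rule right_module_Fo)
  show "Fm M M (hom_id M) = hom_id (Fo M)"
  proof
    fix u
    show "Fm M M (hom_id M) u = hom_id (Fo M) u"
    proof (cases "u \<in> carrier (Fo M)")
      case True
      then obtain y where y: "y \<in> S M" "u = enc y" by auto
      have "(\<lambda>i\<in>I. hom_id M (y i)) = y"
        by (rule PiE_ext[OF _ S_PiE[OF y(1)]]) (use S_closed[OF y(1)] in \<open>auto simp: hom_id_def\<close>)
      then show ?thesis using y unfolding Fm_def by (simp add: dec_enc_S) (simp add: hom_id_def)
    qed (simp add: Fm_def hom_id_def)
  qed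
next
  fix M N :: "('b, 'u) module" and f
  assume M: "right_module A1 M" and N: "right_module A1 N" and f: "f \<in> rmod_hom A1 M N"
  interpret M: right_module A1 M by (rule M)
  interpret N: right_module A1 N by (rule N)
  note fc = Fm_closed[OF M N f]
  have ic: "(\<lambda>i\<in>I. f (y i)) = (\<lambda>i\<in>I. f (y i))" for y ..
  show "Fm M N f \<in> rmod_hom A2 (Fo M) (Fo N)"
    unfolding rmod_hom_def
  proof (intro CollectI conjI ballI)
    show "Fm M N f \<in> carrier (Fo M) \<rightarrow>\<^sub>E carrier (Fo N)"
      using fc unfolding Fm_def by (auto simp: dec_enc_S)
    fix u assume "u \<in> carrier (Fo M)"
    then obtain x where x: "x \<in> S M" "u = enc x" by auto
    { fix v assume "v \<in> carrier (Fo M)"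
      then obtain y where y: "y \<in> S M" "v = enc y" by auto
      have "(\<lambda>i\<in>I. f ((\<lambda>i\<in>I. x i \<oplus>\<^bsub>M\<^esub> y i) i)) = (\<lambda>i\<in>I. f (x i) \<oplus>\<^bsub>N\<^esub> f (y i))"
        using rmod_homD(3)[OF f] S_closed[OF x(1)] S_closed[OF y(1)] by auto
      then show "Fm M N f (u \<oplus>\<^bsub>Fo M\<^esub> v) = Fm M N f u \<oplus>\<^bsub>Fo N\<^esub> Fm M N f v"
        using x y fc(2)[OF S_add[OF M x(1) y(1)]] fc[OF x(1)] fc[OF y(1)]
        by (auto simp: dec_enc_S intro!: arg_cong[of _ _ enc]) }
    fix a assume a: "a \<in> carrier A2"
    have ia: "\<iota>2 a \<in> pcorner R e2 e2" using a by (rule c2.\<iota>_closed)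
    show "Fm M N f (a \<odot>\<^bsub>Fo M\<^esub> u) = a \<odot>\<^bsub>Fo N\<^esub> Fm M N f u"
      using x fc[OF x(1)] fc(2)[OF T_S[OF M ia S_PiE[OF x(1)]]] T_natural[OF M N f ia S_PiE[OF x(1)]]
        dec_enc_S[OF fc(1)[OF x(1)]]
      by (simp add: dec_enc_S[OF x(1)])
  qed
  { fix c
    show "Fm M N (hom_smult A1 M N c f) = hom_smult A2 (Fo M) (Fo N) c (Fm M N f)"
    proof
      fix u
      show "Fm M N (hom_smult A1 M N c f) u = hom_smult A2 (Fo M) (Fo N) c (Fm M N f) u"
      proof (cases "u \<in> carrier (Fo M)")
        case True
        then obtain x where x: "x \<in> S M" "u = enc x" by auto
        have "T N (\<iota>2 (c \<odot>\<^bsub>A2\<^esub> \<one>\<^bsub>A2\<^esub>)) (\<lambda>i\<in>I. f (x i)) = (\<lambda>i\<in>I. hom_smult A1 M N c f (x i))"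
          using T_scalar[OF N fc(1)[OF x(1)]] S_closed[OF x(1)]
          by (auto simp: hom_smult_def T_def[of N] fun_eq_iff)
        then show ?thesis using True x fc[OF x(1)] dec_enc_S[OF fc(1)[OF x(1)]]
          by (simp add: hom_smult_def[of A2] Fm_def[of M N "hom_smult A1 M N c f"] dec_enc_S[OF x(1)])
      qed (simp add: Fm_def hom_smult_def)
    qed }
  { fix h assume h: "h \<in> rmod_hom A1 M N"
    note hc = Fm_closed[OF M N h]
    show "Fm M N (hom_add M N f h) = hom_add (Fo M) (Fo N) (Fm M N f) (Fm M N h)"
    proof
      fix u
      show "Fm M N (hom_add M N f h) u = hom_add (Fo M) (Fo N) (Fm M N f) (Fm M N h) u"
      proof (cases "u \<in> carrier (Fo M)")
        case True
        then obtain x where x: "x \<in> S M" "u = enc x" by auto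
        have "(\<lambda>i\<in>I. hom_add M N f h (x i)) = (\<lambda>i\<in>I. f (x i) \<oplus>\<^bsub>N\<^esub> h (x i))"
          using S_closed[OF x(1)] by (auto simp: hom_add_def)
        then show ?thesis
          using True x fc[OF x(1)] hc[OF x(1)] dec_enc_S[OF fc(1)[OF x(1)]] dec_enc_S[OF hc(1)[OF x(1)]]
          by (auto simp: hom_add_def[of "Fo M"] Fm_def[of M N "hom_add M N f h"] dec_enc_S[OF x(1)]
              intro!: arg_cong[of _ _ enc])
      qed (simp add: Fm_def hom_add_def)
    qed }
  fix P :: "('b, 'u) module" and h
  assume P: "right_module A1 P" and h: "h \<in> rmod_hom A1 N P"
  show "Fm M P (compose (carrier M) h f) = compose (carrier (Fo M)) (Fm N P h) (Fm M N f)"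
  proof
    fix u
    show "Fm M P (compose (carrier M) h f) u = compose (carrier (Fo M)) (Fm N P h) (Fm M N f) u"
    proof (cases "u \<in> carrier (Fo M)")
      case True
      then obtain x where x: "x \<in> S M" "u = enc x" by auto
      have "(\<lambda>i\<in>I. compose (carrier M) h f (x i)) = (\<lambda>i\<in>I. h ((\<lambda>i\<in>I. f (x i)) i))"
        using S_closed[OF x(1)] by (auto simp: compose_def)
      moreover have "compose (carrier (Fo M)) (Fm N P h) (Fm M N f) u = Fm N P h (Fm M N f u)"
        using True by (rule compose_eq)
      ultimately show ?thesis
        using True x fc[OF x(1)] Fm_closed(2)[OF N P h fc(1)[OF x(1)]]
        by (simp add: Fm_def[of M P] dec_enc_S[OF x(1)])
    qed (simp add: Fm_def compose_def)
  qed
qed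

end

locale corner_pair =
  F: corner_functor R A1 e1 \<kappa>1 \<iota>1 z A2 e2 \<kappa>2 \<iota>2 I p q enc +
  G: corner_functor R A2 e2 \<kappa>2 \<iota>2 z A1 e1 \<kappa>1 \<iota>1 I' p' q' enc'
  for R :: "('a, 'm) ring_scheme" and A1 :: "('c, 'b) module" and e1 \<kappa>1 \<iota>1 z
    and A2 :: "('c, 'd) module" and e2 \<kappa>2 \<iota>2 and I :: "'k set" and p q and enc :: "('k \<Rightarrow> 'u) \<Rightarrow> 'u"
    and I' :: "'l set" and p' q' and enc' :: "('l \<Rightarrow> 'u) \<Rightarrow> 'u"
begin

text \<open>The element of \<open>M \<otimes> e1 R e2\<close> that is the tensor of \<open>x\<close> and \<open>a\<close>.\<close>

definition W :: "('b, 'u) module \<Rightarrow> 'a \<Rightarrow> 'u \<Rightarrow> 'k \<Rightarrow> 'u" where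
  "W M a x = (\<lambda>i\<in>I. F.c1.act M (a \<otimes>\<^bsub>R\<^esub> p i) x)"

definition unit :: "('b, 'u) module \<Rightarrow> 'u \<Rightarrow> 'u" where
  "unit M = (\<lambda>x\<in>carrier M. enc' (\<lambda>k\<in>I'. enc (W M (p' k) x)))"

lemma ap_closed: "a \<in> pcorner R e1 e2 \<Longrightarrow> i \<in> I \<Longrightarrow> a \<otimes>\<^bsub>R\<^esub> p i \<in> pcorner R e1 e1"
  using F.p_closed F.c1.e_closed by (meson F.c1.pcorner_mult)

lemmas car = F.c1.pcorner_carrier[OF F.p_closed] F.c1.pcorner_carrier[OF F.q_closed]
  F.c1.pcorner_carrier[OF G.p_closed] F.c1.pcorner_carrier[OF G.q_closed] F.c1.pcorner_carrier
  F.c1.e_closed F.c2.e_closed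

context
  fixes M :: "('b, 'u) module"
  assumes M: "right_module A1 M"
begin

interpretation M: right_module A1 M by (rule M)

lemma W_PiE: "a \<in> pcorner R e1 e2 \<Longrightarrow> x \<in> carrier M \<Longrightarrow> W M a x \<in> I \<rightarrow>\<^sub>E carrier M"
  unfolding W_def by (auto intro!: F.c1.act_closed[OF M] ap_closed)

lemma T_W:
  assumes a: "a \<in> pcorner R e1 e2" and b: "b \<in> pcorner R e2 e2" and x: "x \<in> carrier M"
  shows "F.T M b (W M a x) = W M (a \<otimes>\<^bsub>R\<^esub> b) x"
proof
  fix j
  show "F.T M b (W M a x) j = W M (a \<otimes>\<^bsub>R\<^esub> b) x j"
  proof (cases "j \<in> I")
    case j: True
    let ?f = "\<lambda>i. a \<otimes>\<^bsub>R\<^esub> p i \<otimes>\<^bsub>R\<^esub> F.mat i b j"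
    have fc: "?f i \<in> pcorner R e1 e1" if "i \<in> I" for i
      using that j a b by (intro F.c1.pcorner_mult[OF ap_closed F.mat_closed F.c1.e_closed F.c1.e_closed])
    have "F.T M b (W M a x) j = finsum M (\<lambda>i. F.c1.act M (?f i) x) I"
      unfolding F.T_def W_def using j a b x fc
      by (auto intro!: M.finsum_cong' F.c1.act_closed[OF M] simp: F.c1.act_mult[OF M] ap_closed F.mat_closed)
    also have "\<dots> = F.c1.act M (finsum R ?f I) x"
      using x fc F.finite_I by (intro F.c1.act_finsum_left[OF M, symmetric]) auto
    also have "finsum R ?f I = a \<otimes>\<^bsub>R\<^esub> b \<otimes>\<^bsub>R\<^esub> p j"
    proof -
      have c: "a \<in> carrier R" "b \<in> carrier R" "p j \<in> carrier R" using a b j car by auto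
      have "finsum R ?f I = finsum R (\<lambda>i. a \<otimes>\<^bsub>R\<^esub> (p i \<otimes>\<^bsub>R\<^esub> q i) \<otimes>\<^bsub>R\<^esub> (b \<otimes>\<^bsub>R\<^esub> p j)) I"
        unfolding F.mat_def using c by (intro F.c1.finsum_cong') (auto simp: F.c1.m_assoc car)
      also have "\<dots> = finsum R (\<lambda>i. a \<otimes>\<^bsub>R\<^esub> (p i \<otimes>\<^bsub>R\<^esub> q i)) I \<otimes>\<^bsub>R\<^esub> (b \<otimes>\<^bsub>R\<^esub> p j)"
        using c F.finite_I by (intro F.c1.finsum_ldistr[symmetric]) (auto simp: car)
      also have "finsum R (\<lambda>i. a \<otimes>\<^bsub>R\<^esub> (p i \<otimes>\<^bsub>R\<^esub> q i)) I = a \<otimes>\<^bsub>R\<^esub> e2"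
        unfolding F.sum_pq[symmetric] using c F.finite_I
        by (intro F.c1.finsum_rdistr[symmetric]) (auto simp: car)
      also have "a \<otimes>\<^bsub>R\<^esub> e2 = a" using a unfolding pcorner_def by auto
      finally show ?thesis using c by (simp add: F.c1.m_assoc)
    qed
    also have "F.c1.act M (a \<otimes>\<^bsub>R\<^esub> b \<otimes>\<^bsub>R\<^esub> p j) x = W M (a \<otimes>\<^bsub>R\<^esub> b) x j"
      using j by (simp add: W_def)
    finally show ?thesis .
  qed (simp add: F.T_def W_def)
qed

lemma W_S: "a \<in> pcorner R e1 e2 \<Longrightarrow> x \<in> carrier M \<Longrightarrow> W M a x \<in> F.S M"
  using W_PiE T_W[OF _ F.c2.e_corner] unfolding F.S_def by (auto simp: pcorner_def)

lemma W_add_right: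
  assumes "a \<in> pcorner R e1 e2" "x \<in> carrier M" "y \<in> carrier M"
  shows "enc (W M a (x \<oplus>\<^bsub>M\<^esub> y)) = enc (W M a x) \<oplus>\<^bsub>F.Fo M\<^esub> enc (W M a y)"
proof -
  have "W M a (x \<oplus>\<^bsub>M\<^esub> y) = (\<lambda>i\<in>I. W M a x i \<oplus>\<^bsub>M\<^esub> W M a y i)"
    using assms by (auto simp: W_def F.c1.act_add_right[OF M] ap_closed)
  then show ?thesis using assms by (simp add: F.dec_enc_S[OF W_S])
qed

lemma W_add_left:
  assumes "a \<in> pcorner R e1 e2" "b \<in> pcorner R e1 e2" "x \<in> carrier M"
  shows "enc (W M (a \<oplus>\<^bsub>R\<^esub> b) x) = enc (W M a x) \<oplus>\<^bsub>F.Fo M\<^esub> enc (W M b x)"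
proof -
  have "(a \<oplus>\<^bsub>R\<^esub> b) \<otimes>\<^bsub>R\<^esub> p i = a \<otimes>\<^bsub>R\<^esub> p i \<oplus>\<^bsub>R\<^esub> b \<otimes>\<^bsub>R\<^esub> p i" if "i \<in> I" for i
    using that assms by (intro F.c1.l_distr) (auto intro: car)
  then have "W M (a \<oplus>\<^bsub>R\<^esub> b) x = (\<lambda>i\<in>I. W M a x i \<oplus>\<^bsub>M\<^esub> W M b x i)"
    using assms by (auto simp: W_def F.c1.act_add_left[OF M] ap_closed)
  then show ?thesis using assms by (simp add: F.dec_enc_S[OF W_S])
qed

lemma W_finsum:
  assumes x: "x \<in> carrier M" and "finite K" "\<And>k. k \<in> K \<Longrightarrow> f k \<in> pcorner R e1 e2"
  shows "enc (W M (finsum R f K) x) = finsum (F.Fo M) (\<lambda>k. enc (W M (f k) x)) K"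
  using assms(2-)
proof (induction K rule: finite_induct)
  case empty
  interpret FM: right_module A2 "F.Fo M" by (rule F.right_module_Fo[OF M])
  have z: "\<zero>\<^bsub>R\<^esub> \<in> pcorner R e1 e2" by (intro F.c1.pcorner_zero) (auto intro: car)
  let ?u = "enc (W M \<zero>\<^bsub>R\<^esub> x)"
  have "?u \<oplus>\<^bsub>F.Fo M\<^esub> ?u = ?u" using W_add_left[OF z z x] by simp
  moreover have "?u \<in> carrier (F.Fo M)" using W_S[OF z x] by simp
  ultimately have "?u = \<zero>\<^bsub>F.Fo M\<^esub>" by (metis FM.add.r_cancel_one)
  then show ?case by (simp del: F.Fo_simps)
next
  case (insert k K)
  interpret FM: right_module A2 "F.Fo M" by (rule F.right_module_Fo[OF M])
  have c: "enc (W M (f l) x) \<in> carrier (F.Fo M)" if "l \<in> insert k K" for l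
    using insert.prems that x W_S by simp
  have "finsum R f (insert k K) = f k \<oplus>\<^bsub>R\<^esub> finsum R f K"
    using insert by (intro F.c1.finsum_insert) (auto intro: car)
  moreover have "finsum R f K \<in> pcorner R e1 e2"
    using insert by (intro F.c1.pcorner_finsum) (auto intro: car)
  ultimately show ?case
    using insert c x by (simp add: W_add_left FM.finsum_insert del: F.Fo_simps)
qed

lemma pair_closed: "i \<in> I \<Longrightarrow> k \<in> I' \<Longrightarrow> q i \<otimes>\<^bsub>R\<^esub> q' k \<in> pcorner R e1 e1"
  using F.c1.pcorner_mult[OF F.q_closed G.q_closed F.c1.e_closed F.c1.e_closed] .

lemma mat'_closed: "k \<in> I' \<Longrightarrow> l \<in> I' \<Longrightarrow> a \<in> pcorner R e1 e1 \<Longrightarrow> G.mat k a l \<in> pcorner R e2 e2"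
  by (rule G.mat_closed)

lemma act_Fo:
  "b \<in> pcorner R e2 e2 \<Longrightarrow> y \<in> F.S M \<Longrightarrow> F.c2.act (F.Fo M) b (enc y) = enc (F.T M b y)"
  unfolding F.c2.act_def by (simp add: F.c2.\<iota>_\<kappa> F.dec_enc_S)

text \<open>Associativity of the tensor product, in the form in which the unit is equivariant.\<close>

lemma T'_W:
  assumes a: "a \<in> pcorner R e1 e1" and x: "x \<in> carrier M"
  shows "G.T (F.Fo M) a (\<lambda>k\<in>I'. enc (W M (p' k) x)) = (\<lambda>l\<in>I'. enc (W M (a \<otimes>\<^bsub>R\<^esub> p' l) x))"
proof
  interpret FM: right_module A2 "F.Fo M" by (rule F.right_module_Fo[OF M])
  fix l
  show "G.T (F.Fo M) a (\<lambda>k\<in>I'. enc (W M (p' k) x)) l = (\<lambda>l\<in>I'. enc (W M (a \<otimes>\<^bsub>R\<^esub> p' l) x)) l"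
  proof (cases "l \<in> I'")
    case l: True
    have m: "G.mat k a l \<in> pcorner R e2 e2" if "k \<in> I'" for k using that l a by (rule mat'_closed)
    have pm: "p' k \<otimes>\<^bsub>R\<^esub> G.mat k a l \<in> pcorner R e1 e2" if "k \<in> I'" for k
      using F.c1.pcorner_mult[OF G.p_closed[OF that] m[OF that] F.c1.e_closed F.c2.e_closed] .
    have "G.T (F.Fo M) a (\<lambda>k\<in>I'. enc (W M (p' k) x)) l
        = finsum (F.Fo M) (\<lambda>k. F.c2.act (F.Fo M) (G.mat k a l) ((\<lambda>k\<in>I'. enc (W M (p' k) x)) k)) I'"
      using l by (simp add: G.T_def)
    also have "\<dots> = finsum (F.Fo M) (\<lambda>k. enc (W M (p' k \<otimes>\<^bsub>R\<^esub> G.mat k a l) x)) I'"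
    proof (rule FM.finsum_cong'[OF refl])
      show "(\<lambda>k. enc (W M (p' k \<otimes>\<^bsub>R\<^esub> G.mat k a l) x)) \<in> I' \<rightarrow> carrier (F.Fo M)"
        using W_S[OF pm x] by simp
      fix k assume k: "k \<in> I'"
      show "F.c2.act (F.Fo M) (G.mat k a l) ((\<lambda>k\<in>I'. enc (W M (p' k) x)) k) = enc (W M (p' k \<otimes>\<^bsub>R\<^esub> G.mat k a l) x)"
        using k act_Fo[OF m[OF k] W_S[OF G.p_closed[OF k] x]] T_W[OF G.p_closed[OF k] m[OF k] x] by simp
    qed
    also have "\<dots> = enc (W M (finsum R (\<lambda>k. p' k \<otimes>\<^bsub>R\<^esub> G.mat k a l) I') x)"
      using x pm G.finite_I by (intro W_finsum[symmetric])
    also have "finsum R (\<lambda>k. p' k \<otimes>\<^bsub>R\<^esub> G.mat k a l) I' = a \<otimes>\<^bsub>R\<^esub> p' l"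
    proof -
      have c: "a \<in> carrier R" "p' l \<in> carrier R" using a l by (auto intro: car)
      have ck: "p' k \<in> carrier R" "q' k \<in> carrier R" if "k \<in> I'" for k using that by (auto intro: car)
      have "finsum R (\<lambda>k. p' k \<otimes>\<^bsub>R\<^esub> G.mat k a l) I' = finsum R (\<lambda>k. (p' k \<otimes>\<^bsub>R\<^esub> q' k) \<otimes>\<^bsub>R\<^esub> (a \<otimes>\<^bsub>R\<^esub> p' l)) I'"
        unfolding G.mat_def using c ck by (intro F.c1.finsum_cong') (auto simp: F.c1.m_assoc)
      also have "\<dots> = e1 \<otimes>\<^bsub>R\<^esub> (a \<otimes>\<^bsub>R\<^esub> p' l)"
        unfolding G.sum_pq[symmetric] using c ck G.finite_I by (intro F.c1.finsum_ldistr[symmetric]) auto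
      also have "\<dots> = a \<otimes>\<^bsub>R\<^esub> p' l"
        using a c F.c1.e_closed unfolding pcorner_def by (simp add: F.c1.m_assoc[symmetric])
      finally show ?thesis .
    qed
    also have "enc (W M (a \<otimes>\<^bsub>R\<^esub> p' l) x) = (\<lambda>l\<in>I'. enc (W M (a \<otimes>\<^bsub>R\<^esub> p' l) x)) l"
      using l by simp
    finally show ?thesis .
  qed (simp add: G.T_def)
qed

lemma unit_S: "x \<in> carrier M \<Longrightarrow> (\<lambda>k\<in>I'. enc (W M (p' k) x)) \<in> G.S (F.Fo M)"
proof -
  assume x: "x \<in> carrier M"
  have "e1 \<otimes>\<^bsub>R\<^esub> p' l = p' l" if "l \<in> I'" for l using G.p_closed[OF that] unfolding pcorner_def by auto
  then have "(\<lambda>l\<in>I'. enc (W M (e1 \<otimes>\<^bsub>R\<^esub> p' l) x)) = (\<lambda>k\<in>I'. enc (W M (p' k) x))" by auto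
  then have "G.T (F.Fo M) e1 (\<lambda>k\<in>I'. enc (W M (p' k) x)) = (\<lambda>k\<in>I'. enc (W M (p' k) x))"
    using T'_W[OF F.c1.e_corner x] by simp
  moreover have "(\<lambda>k\<in>I'. enc (W M (p' k) x)) \<in> I' \<rightarrow>\<^sub>E carrier (F.Fo M)"
    using W_S[OF G.p_closed x] by auto
  ultimately show ?thesis unfolding G.S_def by blast
qed

lemma contract_W:
  assumes x: "x \<in> carrier M"
  shows "finsum M (\<lambda>k. finsum M (\<lambda>i. F.c1.act M (q i \<otimes>\<^bsub>R\<^esub> q' k) (W M (p' k) x i)) I) I' = x"
proof -
  have ck: "p' k \<in> carrier R" "q' k \<in> carrier R" "p' k \<otimes>\<^bsub>R\<^esub> e2 = p' k" if "k \<in> I'" for k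
    using that G.p_closed[OF that] by (auto intro: car simp: pcorner_def)
  have pq: "p' k \<otimes>\<^bsub>R\<^esub> q' k \<in> pcorner R e1 e1" if "k \<in> I'" for k
    using F.c1.pcorner_mult[OF G.p_closed[OF that] G.q_closed[OF that] F.c1.e_closed F.c1.e_closed] .
  have inner: "finsum M (\<lambda>i. F.c1.act M (q i \<otimes>\<^bsub>R\<^esub> q' k) (W M (p' k) x i)) I = F.c1.act M (p' k \<otimes>\<^bsub>R\<^esub> q' k) x"
    if k: "k \<in> I'" for k
  proof -
    let ?f = "\<lambda>i. (p' k \<otimes>\<^bsub>R\<^esub> p i) \<otimes>\<^bsub>R\<^esub> (q i \<otimes>\<^bsub>R\<^esub> q' k)"
    have fc: "?f i \<in> pcorner R e1 e1" if "i \<in> I" for i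
      using F.c1.pcorner_mult[OF ap_closed[OF G.p_closed[OF k] that] pair_closed[OF that k] F.c1.e_closed F.c1.e_closed] .
    have "finsum M (\<lambda>i. F.c1.act M (q i \<otimes>\<^bsub>R\<^esub> q' k) (W M (p' k) x i)) I = finsum M (\<lambda>i. F.c1.act M (?f i) x) I"
    proof (rule M.finsum_cong'[OF refl])
      show "(\<lambda>i. F.c1.act M (?f i) x) \<in> I \<rightarrow> carrier M" using fc x by (auto intro!: F.c1.act_closed[OF M])
      fix i assume i: "i \<in> I"
      show "F.c1.act M (q i \<otimes>\<^bsub>R\<^esub> q' k) (W M (p' k) x i) = F.c1.act M (?f i) x"
        using i F.c1.act_mult[OF M ap_closed[OF G.p_closed[OF k] i] pair_closed[OF i k] x] by (simp add: W_def)
    qed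
    also have "\<dots> = F.c1.act M (finsum R ?f I) x"
      using x fc F.finite_I by (intro F.c1.act_finsum_left[OF M, symmetric]) auto
    also have "finsum R ?f I = p' k \<otimes>\<^bsub>R\<^esub> q' k"
    proof -
      have ci: "p i \<in> carrier R" "q i \<in> carrier R" if "i \<in> I" for i using that by (auto intro: car)
      have "finsum R ?f I = finsum R (\<lambda>i. p' k \<otimes>\<^bsub>R\<^esub> (p i \<otimes>\<^bsub>R\<^esub> q i) \<otimes>\<^bsub>R\<^esub> q' k) I"
        using ck[OF k] ci by (intro F.c1.finsum_cong') (auto simp: F.c1.m_assoc)
      also have "\<dots> = finsum R (\<lambda>i. p' k \<otimes>\<^bsub>R\<^esub> (p i \<otimes>\<^bsub>R\<^esub> q i)) I \<otimes>\<^bsub>R\<^esub> q' k"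
        using ck[OF k] ci F.finite_I by (intro F.c1.finsum_ldistr[symmetric]) auto
      also have "finsum R (\<lambda>i. p' k \<otimes>\<^bsub>R\<^esub> (p i \<otimes>\<^bsub>R\<^esub> q i)) I = p' k \<otimes>\<^bsub>R\<^esub> e2"
        unfolding F.sum_pq[symmetric] using ck[OF k] ci F.finite_I by (intro F.c1.finsum_rdistr[symmetric]) auto
      finally show ?thesis using ck[OF k] by simp
    qed
    finally show ?thesis .
  qed
  have "finsum M (\<lambda>k. finsum M (\<lambda>i. F.c1.act M (q i \<otimes>\<^bsub>R\<^esub> q' k) (W M (p' k) x i)) I) I'
      = finsum M (\<lambda>k. F.c1.act M (p' k \<otimes>\<^bsub>R\<^esub> q' k) x) I'"
    using inner pq x by (intro M.finsum_cong') (auto intro!: F.c1.act_closed[OF M])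
  also have "\<dots> = F.c1.act M (finsum R (\<lambda>k. p' k \<otimes>\<^bsub>R\<^esub> q' k) I') x"
    using x pq G.finite_I by (intro F.c1.act_finsum_left[OF M, symmetric]) auto
  finally show ?thesis unfolding G.sum_pq using F.c1.act_e[OF M x] by simp
qed

lemma W_contract:
  assumes v: "v \<in> G.S (F.Fo M)" and l: "l \<in> I'"
  defines "x \<equiv> finsum M (\<lambda>k. finsum M (\<lambda>i. F.c1.act M (q i \<otimes>\<^bsub>R\<^esub> q' k) (F.dec (v k) i)) I) I'"
  shows "x \<in> carrier M" "enc (W M (p' l) x) = v l"
proof -
  have vk: "v k \<in> carrier (F.Fo M)" if "k \<in> I'" for k using v that G.S_closed by blast
  have d: "F.dec (v k) i \<in> carrier M" if "k \<in> I'" "i \<in> I" for k i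
    using F.dec_closed[OF M vk] that by blast
  have s: "finsum M (\<lambda>i. F.c1.act M (q i \<otimes>\<^bsub>R\<^esub> q' k) (F.dec (v k) i)) I \<in> carrier M" if "k \<in> I'" for k
    using that d by (auto intro!: M.finsum_closed F.c1.act_closed[OF M] pair_closed)
  show x: "x \<in> carrier M" unfolding x_def using s by (auto intro!: M.finsum_closed)
  have m: "G.mat k e1 l \<in> pcorner R e2 e2" if "k \<in> I'" for k
    using that l F.c1.e_corner by (rule mat'_closed)
  have Tv: "G.T (F.Fo M) e1 v = v" using v unfolding G.S_def by auto
  have vl: "v l \<in> carrier (F.Fo M)" using vk l by blast
  have WS: "W M (p' l) x \<in> F.S M" using W_S[OF G.p_closed[OF l] x] .
  have "enc (W M (p' l) x) \<in> carrier (F.Fo M)" using WS by simp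
  then show "enc (W M (p' l) x) = v l"
  proof (rule F.Fo_eqI[OF M _ vl])
    fix j assume j: "j \<in> I"
    have pp: "p' l \<otimes>\<^bsub>R\<^esub> p j \<in> pcorner R e1 e1" using G.p_closed[OF l] j by (rule ap_closed)
    have "F.dec (enc (W M (p' l) x)) j = F.c1.act M (p' l \<otimes>\<^bsub>R\<^esub> p j) x"
      using j by (simp add: F.dec_enc_S[OF WS]) (simp add: W_def)
    also have "\<dots> = finsum M (\<lambda>k. F.c1.act M (p' l \<otimes>\<^bsub>R\<^esub> p j) (finsum M (\<lambda>i. F.c1.act M (q i \<otimes>\<^bsub>R\<^esub> q' k) (F.dec (v k) i)) I)) I'"
      unfolding x_def using pp s G.finite_I by (intro F.c1.act_finsum_right[OF M])
    also have "\<dots> = finsum M (\<lambda>k. F.dec (F.c2.act (F.Fo M) (G.mat k e1 l) (v k)) j) I'"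
    proof (rule M.finsum_cong'[OF refl])
      have "F.c2.act (F.Fo M) (G.mat k e1 l) (v k) \<in> carrier (F.Fo M)" if "k \<in> I'" for k
        using F.c2.act_closed[OF F.right_module_Fo[OF M] m[OF that] vk[OF that]] .
      then show "(\<lambda>k. F.dec (F.c2.act (F.Fo M) (G.mat k e1 l) (v k)) j) \<in> I' \<rightarrow> carrier M"
        using F.dec_closed[OF M _ j] by blast
      fix k assume k: "k \<in> I'"
      have dk: "F.dec (v k) \<in> F.S M" using F.dec_S[OF M vk[OF k]] .
      have ev: "enc (F.dec (v k)) = v k" using vk[OF k] by (auto simp: F.dec_enc_S)
      have "F.dec (F.c2.act (F.Fo M) (G.mat k e1 l) (v k)) j = F.T M (G.mat k e1 l) (F.dec (v k)) j"
        using act_Fo[OF m[OF k] dk] F.dec_enc_S[OF F.T_S[OF M m[OF k] F.S_PiE[OF dk]]] ev by simp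
      also have "\<dots> = finsum M (\<lambda>i. F.c1.act M (F.mat i (G.mat k e1 l) j) (F.dec (v k) i)) I"
        using j by (simp add: F.T_def)
      also have "\<dots> = finsum M (\<lambda>i. F.c1.act M (p' l \<otimes>\<^bsub>R\<^esub> p j) (F.c1.act M (q i \<otimes>\<^bsub>R\<^esub> q' k) (F.dec (v k) i))) I"
      proof (rule M.finsum_cong'[OF refl])
        show "(\<lambda>i. F.c1.act M (p' l \<otimes>\<^bsub>R\<^esub> p j) (F.c1.act M (q i \<otimes>\<^bsub>R\<^esub> q' k) (F.dec (v k) i))) \<in> I \<rightarrow> carrier M"
          using k d pp by (auto intro!: F.c1.act_closed[OF M] pair_closed)
        fix i assume i: "i \<in> I"
        have c: "q i \<in> carrier R" "p j \<in> carrier R" "q' k \<in> carrier R" "p' l \<in> carrier R"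
          using i j k l by (auto intro: car)
        have e: "e1 \<otimes>\<^bsub>R\<^esub> p' l = p' l" using G.p_closed[OF l] unfolding pcorner_def by auto
        have "F.mat i (G.mat k e1 l) j = (q i \<otimes>\<^bsub>R\<^esub> q' k) \<otimes>\<^bsub>R\<^esub> ((e1 \<otimes>\<^bsub>R\<^esub> p' l) \<otimes>\<^bsub>R\<^esub> p j)"
          unfolding F.mat_def G.mat_def using c F.c1.e_closed by (simp only: F.c1.m_assoc F.c1.m_closed)
        then have "F.mat i (G.mat k e1 l) j = (q i \<otimes>\<^bsub>R\<^esub> q' k) \<otimes>\<^bsub>R\<^esub> (p' l \<otimes>\<^bsub>R\<^esub> p j)" unfolding e .
        then show "F.c1.act M (F.mat i (G.mat k e1 l) j) (F.dec (v k) i)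
            = F.c1.act M (p' l \<otimes>\<^bsub>R\<^esub> p j) (F.c1.act M (q i \<otimes>\<^bsub>R\<^esub> q' k) (F.dec (v k) i))"
          using F.c1.act_mult[OF M pair_closed[OF i k] pp d[OF k i]] by simp
      qed
      also have "\<dots> = F.c1.act M (p' l \<otimes>\<^bsub>R\<^esub> p j) (finsum M (\<lambda>i. F.c1.act M (q i \<otimes>\<^bsub>R\<^esub> q' k) (F.dec (v k) i)) I)"
        using pp d k F.finite_I
        by (intro F.c1.act_finsum_right[OF M, symmetric]) (auto intro!: F.c1.act_closed[OF M] pair_closed)
      finally show "F.c1.act M (p' l \<otimes>\<^bsub>R\<^esub> p j) (finsum M (\<lambda>i. F.c1.act M (q i \<otimes>\<^bsub>R\<^esub> q' k) (F.dec (v k) i)) I)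
          = F.dec (F.c2.act (F.Fo M) (G.mat k e1 l) (v k)) j" by (rule sym)
    qed
    also have "\<dots> = F.dec (finsum (F.Fo M) (\<lambda>k. F.c2.act (F.Fo M) (G.mat k e1 l) (v k)) I') j"
      using G.finite_I j F.c2.act_closed[OF F.right_module_Fo[OF M] m vk] by (intro F.dec_finsum[OF M, symmetric])
    also have "finsum (F.Fo M) (\<lambda>k. F.c2.act (F.Fo M) (G.mat k e1 l) (v k)) I' = G.T (F.Fo M) e1 v l"
      using l by (simp add: G.T_def)
    finally show "F.dec (enc (W M (p' l) x)) j = F.dec (v l) j" unfolding Tv .
  qed
qed

lemma unit_iso: "unit M \<in> rmod_iso A1 M (G.Fo (F.Fo M))"
proof -
  note FM = F.right_module_Fo[OF M]
  have unit: "unit M x = enc' (\<lambda>k\<in>I'. enc (W M (p' k) x))" if "x \<in> carrier M" for x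
    using that by (simp add: unit_def)
  have "unit M \<in> rmod_hom A1 M (G.Fo (F.Fo M))"
    unfolding rmod_hom_def
  proof (intro CollectI conjI ballI)
    show "unit M \<in> carrier M \<rightarrow>\<^sub>E carrier (G.Fo (F.Fo M))"
      unfolding unit_def using unit_S by auto
    fix x assume x: "x \<in> carrier M"
    { fix y assume y: "y \<in> carrier M"
      have "(\<lambda>k\<in>I'. enc (W M (p' k) (x \<oplus>\<^bsub>M\<^esub> y)))
          = (\<lambda>k\<in>I'. (\<lambda>k\<in>I'. enc (W M (p' k) x)) k \<oplus>\<^bsub>F.Fo M\<^esub> (\<lambda>k\<in>I'. enc (W M (p' k) y)) k)"
        using W_add_right[OF G.p_closed x y] by auto
      then show "unit M (x \<oplus>\<^bsub>M\<^esub> y) = unit M x \<oplus>\<^bsub>G.Fo (F.Fo M)\<^esub> unit M y"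
        using x y by (simp only: unit G.Fo_simps G.dec_enc_S[OF unit_S] M.a_closed) }
    fix a assume a: "a \<in> carrier A1"
    have ia: "\<iota>1 a \<in> pcorner R e1 e1" using a by (rule F.c1.\<iota>_closed)
    have ax: "a \<odot>\<^bsub>M\<^esub> x = F.c1.act M (\<iota>1 a) x" unfolding F.c1.act_def using a by (simp add: F.c1.\<kappa>_\<iota>)
    have "W M (p' k) (a \<odot>\<^bsub>M\<^esub> x) = W M (\<iota>1 a \<otimes>\<^bsub>R\<^esub> p' k) x" if k: "k \<in> I'" for k
    proof -
      have "F.c1.act M (p' k \<otimes>\<^bsub>R\<^esub> p i) (F.c1.act M (\<iota>1 a) x) = F.c1.act M (\<iota>1 a \<otimes>\<^bsub>R\<^esub> p' k \<otimes>\<^bsub>R\<^esub> p i) x" if i: "i \<in> I" for i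
      proof -
        have "\<iota>1 a \<in> carrier R" "p' k \<in> carrier R" "p i \<in> carrier R" using ia k i by (auto intro: car)
        then show ?thesis
          using F.c1.act_mult[OF M ia ap_closed[OF G.p_closed[OF k] i] x] by (simp add: F.c1.m_assoc)
      qed
      then show ?thesis unfolding W_def ax by auto
    qed
    then have eq: "(\<lambda>k\<in>I'. enc (W M (p' k) (a \<odot>\<^bsub>M\<^esub> x))) = (\<lambda>l\<in>I'. enc (W M (\<iota>1 a \<otimes>\<^bsub>R\<^esub> p' l) x))"
      by auto
    have "unit M (a \<odot>\<^bsub>M\<^esub> x) = enc' (\<lambda>k\<in>I'. enc (W M (p' k) (a \<odot>\<^bsub>M\<^esub> x)))"
      by (rule unit[OF M.act_closed[OF a x]])
    also have "\<dots> = enc' (G.T (F.Fo M) (\<iota>1 a) (\<lambda>k\<in>I'. enc (W M (p' k) x)))"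
      unfolding eq T'_W[OF ia x] ..
    also have "\<dots> = a \<odot>\<^bsub>G.Fo (F.Fo M)\<^esub> unit M x"
      unfolding unit[OF x] G.Fo_simps(4) G.dec_enc_S[OF unit_S[OF x]] ..
    finally show "unit M (a \<odot>\<^bsub>M\<^esub> x) = a \<odot>\<^bsub>G.Fo (F.Fo M)\<^esub> unit M x" .
  qed
  moreover have "bij_betw (unit M) (carrier M) (carrier (G.Fo (F.Fo M)))"
  proof (rule bij_betw_imageI)
    show "inj_on (unit M) (carrier M)"
    proof (rule inj_onI)
      fix x y assume x: "x \<in> carrier M" and y: "y \<in> carrier M" and "unit M x = unit M y"
      then have "G.dec (unit M x) = G.dec (unit M y)" by (simp only:)
      then have eq: "(\<lambda>k\<in>I'. enc (W M (p' k) x)) = (\<lambda>k\<in>I'. enc (W M (p' k) y))"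
        unfolding unit[OF x] unit[OF y] G.dec_enc_S[OF unit_S[OF x]] G.dec_enc_S[OF unit_S[OF y]] .
      have *: "enc (W M (p' k) x) = enc (W M (p' k) y)" if "k \<in> I'" for k
        using fun_cong[OF eq, of k] that by (simp only: restrict_apply')
      have "W M (p' k) x = W M (p' k) y" if "k \<in> I'" for k
      proof -
        have "F.dec (enc (W M (p' k) x)) = F.dec (enc (W M (p' k) y))" using * that by simp
        then show ?thesis
          unfolding F.dec_enc_S[OF W_S[OF G.p_closed[OF that] x]] F.dec_enc_S[OF W_S[OF G.p_closed[OF that] y]] .
      qed
      then have "finsum M (\<lambda>k. finsum M (\<lambda>i. F.c1.act M (q i \<otimes>\<^bsub>R\<^esub> q' k) (W M (p' k) x i)) I) I'
          = finsum M (\<lambda>k. finsum M (\<lambda>i. F.c1.act M (q i \<otimes>\<^bsub>R\<^esub> q' k) (W M (p' k) y i)) I) I'"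
        using W_PiE[OF G.p_closed y]
        by (intro M.finsum_cong') (auto intro!: M.finsum_closed F.c1.act_closed[OF M] pair_closed)
      then show "x = y" using contract_W[OF x] contract_W[OF y] by simp
    qed
    show "unit M ` carrier M = carrier (G.Fo (F.Fo M))"
    proof
      show "unit M ` carrier M \<subseteq> carrier (G.Fo (F.Fo M))" using unit unit_S by auto
      show "carrier (G.Fo (F.Fo M)) \<subseteq> unit M ` carrier M"
      proof
        fix u assume "u \<in> carrier (G.Fo (F.Fo M))"
        then obtain v where v: "v \<in> G.S (F.Fo M)" "u = enc' v" by auto
        let ?x = "finsum M (\<lambda>k. finsum M (\<lambda>i. F.c1.act M (q i \<otimes>\<^bsub>R\<^esub> q' k) (F.dec (v k) i)) I) I'"
        show "u \<in> unit M ` carrier M"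
        proof (cases "I' = {}")
          case True
          have z: "\<zero>\<^bsub>M\<^esub> \<in> carrier M" by simp
          have "v = (\<lambda>k\<in>I'. enc (W M (p' k) \<zero>\<^bsub>M\<^esub>))" using G.S_PiE[OF v(1)] True by auto
          then have "u = unit M \<zero>\<^bsub>M\<^esub>" unfolding unit[OF z] v(2) by (rule arg_cong)
          then show ?thesis using z by (rule image_eqI)
        next
          case False
          then obtain l where l: "l \<in> I'" by blast
          have x: "?x \<in> carrier M" using W_contract(1)[OF v(1) l] .
          have "(\<lambda>k\<in>I'. enc (W M (p' k) ?x)) = v"
            by (rule PiE_ext[OF _ G.S_PiE[OF v(1)]]) (use W_contract(2)[OF v(1)] G.S_closed[OF v(1)] in auto)
          then have "u = unit M ?x" unfolding unit[OF x] v(2) by (simp only:)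
          then show ?thesis using x by (rule image_eqI)
        qed
      qed
    qed
  qed
  ultimately show ?thesis unfolding rmod_iso_def by blast
qed

end

theorem unit_nat_iso:
  "nat_iso_from_id A1 (G.Fo \<circ> F.Fo) (\<lambda>M N f. G.Fm (F.Fo M) (F.Fo N) (F.Fm M N f)) unit"
  unfolding nat_iso_from_id_def
proof (intro conjI allI impI ballI)
  fix M :: "('b, 'u) module" assume M: "right_module A1 M"
  then show "unit M \<in> rmod_iso A1 M ((G.Fo \<circ> F.Fo) M)" using unit_iso by simp
  fix N :: "('b, 'u) module" and f assume N: "right_module A1 N" and f: "f \<in> rmod_hom A1 M N"
  note FM = F.right_module_Fo[OF M] and FN = F.right_module_Fo[OF N]
  have Ff: "F.Fm M N f \<in> rmod_hom A2 (F.Fo M) (F.Fo N)"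
    using F.linear_functor_Fo M N f unfolding linear_functor_def by blast
  show "compose (carrier M) (unit N) f
      = compose (carrier M) (G.Fm (F.Fo M) (F.Fo N) (F.Fm M N f)) (unit M)"
  proof
    fix x
    show "compose (carrier M) (unit N) f x
      = compose (carrier M) (G.Fm (F.Fo M) (F.Fo N) (F.Fm M N f)) (unit M) x"
    proof (cases "x \<in> carrier M")
      case x: True
      have fx: "f x \<in> carrier N" using rmod_homD(2)[OF f x] .
      have "W N a (f x) = (\<lambda>i\<in>I. f (W M a x i))" if a: "a \<in> pcorner R e1 e2" for a
        using ap_closed[OF a] x rmod_homD(4)[OF f] by (auto simp: W_def F.c1.act_def F.c1.\<kappa>_closed)
      then have "(\<lambda>k\<in>I'. enc (W N (p' k) (f x))) = (\<lambda>k\<in>I'. F.Fm M N f ((\<lambda>k\<in>I'. enc (W M (p' k) x)) k))"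
        using F.Fm_closed(2)[OF M N f W_S[OF M G.p_closed x]] G.p_closed by auto
      then show ?thesis
        using x fx G.Fm_closed(2)[OF FM FN Ff unit_S[OF M x]] by (simp add: compose_eq unit_def)
    qed (simp add: compose_def)
  qed
qed

end

theorem full_corners_morita:
  fixes I :: "'k set" and I' :: "'l set"
  assumes c1: "corner R A1 e1 \<kappa>1 \<iota>1 z" and c2: "corner R A2 e2 \<kappa>2 \<iota>2 z"
    and I: "finite I" "\<And>i. i \<in> I \<Longrightarrow> p i \<in> pcorner R e2 e1" "\<And>i. i \<in> I \<Longrightarrow> q i \<in> pcorner R e1 e2"
      "finsum R (\<lambda>i. p i \<otimes>\<^bsub>R\<^esub> q i) I = e2"
    and I': "finite I'" "\<And>i. i \<in> I' \<Longrightarrow> p' i \<in> pcorner R e1 e2" "\<And>i. i \<in> I' \<Longrightarrow> q' i \<in> pcorner R e2 e1"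
      "finsum R (\<lambda>i. p' i \<otimes>\<^bsub>R\<^esub> q' i) I' = e1"
    and inf: "infinite (UNIV :: 'u set)"
  shows "morita_equivalent TYPE('u) A1 A2"
proof -
  obtain enc :: "('k \<Rightarrow> 'u) \<Rightarrow> 'u" where enc: "inj_on enc (I \<rightarrow>\<^sub>E UNIV)"
    using infinite_encoding[OF inf I(1)] by blast
  obtain enc' :: "('l \<Rightarrow> 'u) \<Rightarrow> 'u" where enc': "inj_on enc' (I' \<rightarrow>\<^sub>E UNIV)"
    using infinite_encoding[OF inf I'(1)] by blast
  have F: "corner_functor R A1 e1 \<kappa>1 \<iota>1 z A2 e2 \<kappa>2 \<iota>2 I p q enc"
    using c1 c2 I enc by (intro corner_functor.intro corner_functor_axioms.intro)
  have G: "corner_functor R A2 e2 \<kappa>2 \<iota>2 z A1 e1 \<kappa>1 \<iota>1 I' p' q' enc'"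
    using c1 c2 I' enc' by (intro corner_functor.intro corner_functor_axioms.intro)
  interpret FG: corner_pair R A1 e1 \<kappa>1 \<iota>1 z A2 e2 \<kappa>2 \<iota>2 I p q enc I' p' q' enc'
    using F G by (rule corner_pair.intro)
  interpret GF: corner_pair R A2 e2 \<kappa>2 \<iota>2 z A1 e1 \<kappa>1 \<iota>1 I' p' q' enc' I p q enc
    using G F by (rule corner_pair.intro)
  show ?thesis
    unfolding morita_equivalent_def
    using FG.F.linear_functor_Fo FG.G.linear_functor_Fo FG.unit_nat_iso GF.unit_nat_iso by blast
qed

section \<open>Endomorphism algebras of sums of right ideals\<close>

text \<open>
  \<open>x H\<close> is a direct summand of a finite direct sum of ideals \<open>y H\<close> with \<open>y \<in> Y\<close>, the morphisms
  being left multiplications.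
\<close>

definition summand :: "'h::{ring,monoid_mult} \<Rightarrow> 'h set \<Rightarrow> bool" where
  "summand x Y \<longleftrightarrow> (\<exists>ts. (\<forall>(y, a, b)\<in>set ts. y \<in> Y \<and> (\<exists>c. a * x = y * c) \<and> (\<exists>c. b * y = x * c)) \<and>
     (\<Sum>(y, a, b)\<leftarrow>ts. b * a * x) = x)"

lemma summandI:
  assumes "finite K" "\<And>k. k \<in> K \<Longrightarrow> y k \<in> Y" "\<And>k. k \<in> K \<Longrightarrow> \<exists>c. a k * x = y k * c"
    "\<And>k. k \<in> K \<Longrightarrow> \<exists>c. b k * y k = x * c" "(\<Sum>k\<in>K. b k * a k * x) = x"
  shows "summand x Y"
proof -
  obtain ks where ks: "set ks = K" "distinct ks" using finite_distinct_list[OF assms(1)] by blast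
  have "(\<Sum>(y, a, b)\<leftarrow>map (\<lambda>k. (y k, a k, b k)) ks. b * a * x) = (\<Sum>k\<leftarrow>ks. b k * a k * x)"
    by (simp add: comp_def)
  also have "\<dots> = x" using assms(5) ks by (simp add: sum_list_distinct_conv_sum_set)
  finally show ?thesis unfolding summand_def using assms(2-4) ks(1)
    by (intro exI[of _ "map (\<lambda>k. (y k, a k, b k)) ks"]) auto
qed

lemma summand_refl: "x \<in> Y \<Longrightarrow> summand x Y"
  by (rule summandI[of "{()}" "\<lambda>_. x" Y "\<lambda>_. 1" _ "\<lambda>_. 1"]) (auto intro: exI[of _ 1])

lemma summand_trans:
  assumes ax: "a * x = w * c" and bw: "b * w = x * d" and x: "b * a * x = x" and w: "summand w Y"
  shows "summand x Y"
proof -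
  obtain ts where ts: "\<forall>(y, a, b)\<in>set ts. y \<in> Y \<and> (\<exists>c. a * w = y * c) \<and> (\<exists>c. b * y = w * c)"
    "(\<Sum>(y, a, b)\<leftarrow>ts. b * a * w) = w" using w unfolding summand_def by blast
  let ?us = "map (\<lambda>(y, a', b'). (y, a' * a, b * b')) ts"
  have "(\<Sum>(y, a', b')\<leftarrow>?us. b' * a' * x) = b * (\<Sum>(y, a', b')\<leftarrow>ts. b' * a' * w) * c"
  proof -
    have "b * b' * (a' * a) * x = b * (b' * a' * w) * c" for a' b'
      using arg_cong[OF ax, of "\<lambda>v. b * b' * a' * v"] by (simp add: mult.assoc)
    then have *: "b * snd (snd t) * (fst (snd t) * a) * x = b * (snd (snd t) * fst (snd t) * w) * c" for t :: "'a \<times> 'a \<times> 'a" .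
    have "(\<Sum>(y, a', b')\<leftarrow>?us. b' * a' * x) = (\<Sum>t\<leftarrow>ts. b * snd (snd t) * (fst (snd t) * a) * x)"
      by (simp add: comp_def case_prod_beta)
    also have "\<dots> = (\<Sum>(y, a', b')\<leftarrow>ts. b * (b' * a' * w) * c)"
      unfolding case_prod_beta using * by simp
    also have "\<dots> = b * (\<Sum>(y, a', b')\<leftarrow>ts. b' * a' * w) * c"
      by (induction ts) (auto simp: distrib_left distrib_right)
    finally show ?thesis .
  qed
  also have "\<dots> = x" unfolding ts(2) using ax x by (simp add: mult.assoc)
  finally have "(\<Sum>(y, a', b')\<leftarrow>?us. b' * a' * x) = x" .
  moreover have "\<forall>(y, a', b')\<in>set ?us. y \<in> Y \<and> (\<exists>c. a' * x = y * c) \<and> (\<exists>c. b' * y = x * c)"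
  proof clarsimp
    fix y a' b' assume "(y, a', b') \<in> set ts"
    then obtain c' d' where y: "y \<in> Y" "a' * w = y * c'" "b' * y = w * d'" using ts(1) by blast
    have "a' * a * x = y * (c' * c)" using ax y(2) by (simp add: mult.assoc) (simp flip: mult.assoc)
    moreover have "b * b' * y = x * (d * d')" using bw y(3) by (simp add: mult.assoc) (simp flip: mult.assoc)
    ultimately show "y \<in> Y \<and> (\<exists>c. a' * a * x = y * c) \<and> (\<exists>c. b * b' * y = x * c)" using y by blast
  qed
  ultimately show ?thesis unfolding summand_def by blast
qed

locale ideal_sums =
  fixes sc :: "'c \<Rightarrow> 'h::{ring,monoid_mult} \<Rightarrow> 'h" and x :: "'i \<Rightarrow> 'h" and J :: "'i set"
  assumes sc_left: "sc c a * b = sc c (a * b)" and sc_right: "a * sc c b = sc c (a * b)"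
    and finite_J: "finite J"
begin

declare restrict_apply [simp del] restrict_apply' [simp] restrict_cong [cong] Int_absorb1 [simp]

abbreviation DS :: "'i set \<Rightarrow> ('h, 'i \<Rightarrow> 'h) module" where
  "DS K \<equiv> fin_direct_sum K (\<lambda>i. principal_right_ideal (x i))"

abbreviation EA :: "'i set \<Rightarrow> ('c, ('i \<Rightarrow> 'h) \<Rightarrow> 'i \<Rightarrow> 'h) module" where
  "EA K \<equiv> End_algebra (algebra_of sc) (DS K)"

lemma DS_carrier: "carrier (DS K) = (\<Pi>\<^sub>E i\<in>K. range (\<lambda>h. x i * h))"
  by (simp add: fin_direct_sum_def principal_right_ideal_def)

lemma DS_add: "y \<oplus>\<^bsub>DS K\<^esub> y' = (\<lambda>i\<in>K. y i + y' i)"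
  by (simp add: fin_direct_sum_def principal_right_ideal_def)

lemma DS_zero: "\<zero>\<^bsub>DS K\<^esub> = (\<lambda>i\<in>K. 0)"
  by (simp add: fin_direct_sum_def principal_right_ideal_def)

lemma DS_smult: "a \<odot>\<^bsub>DS K\<^esub> y = (\<lambda>i\<in>K. y i * a)"
  by (simp add: fin_direct_sum_def principal_right_ideal_def)

lemma ideal_add: "u \<in> range (\<lambda>h. x i * h) \<Longrightarrow> v \<in> range (\<lambda>h. x i * h) \<Longrightarrow> u + v \<in> range (\<lambda>h. x i * h)"
  by (auto simp flip: distrib_left)

lemma ideal_minus: "u \<in> range (\<lambda>h. x i * h) \<Longrightarrow> - u \<in> range (\<lambda>h. x i * h)"
  by (metis (no_types, lifting) mult_minus_right imageE rangeI)

lemma ideal_mult: "u \<in> range (\<lambda>h. x i * h) \<Longrightarrow> u * a \<in> range (\<lambda>h. x i * h)"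
  by (metis (no_types, lifting) mult.assoc imageE rangeI)

lemma ideal_zero: "0 \<in> range (\<lambda>h. x i * h)"
  by (metis mult_zero_right rangeI)

definition hom_set :: "'i set \<Rightarrow> (('i \<Rightarrow> 'h) \<Rightarrow> 'i \<Rightarrow> 'h) set" where
  "hom_set K = {f \<in> carrier (DS K) \<rightarrow>\<^sub>E carrier (DS K).
     (\<forall>y\<in>carrier (DS K). \<forall>y'\<in>carrier (DS K). f (\<lambda>i\<in>K. y i + y' i) = (\<lambda>i\<in>K. f y i + f y' i)) \<and>
     (\<forall>a. \<forall>y\<in>carrier (DS K). f (\<lambda>i\<in>K. y i * a) = (\<lambda>i\<in>K. f y i * a))}"

lemma EA_simps [simp]:
  "carrier (EA K) = hom_set K"
  "f \<otimes>\<^bsub>EA K\<^esub> g = compose (carrier (DS K)) f g"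
  "\<one>\<^bsub>EA K\<^esub> = (\<lambda>y\<in>carrier (DS K). y)"
  "f \<oplus>\<^bsub>EA K\<^esub> g = (\<lambda>y\<in>carrier (DS K). \<lambda>i\<in>K. f y i + g y i)"
  "\<zero>\<^bsub>EA K\<^esub> = (\<lambda>y\<in>carrier (DS K). \<lambda>i\<in>K. 0)"
  "c \<odot>\<^bsub>EA K\<^esub> f = (\<lambda>y\<in>carrier (DS K). \<lambda>i\<in>K. f y i * sc c 1)"
  by (simp_all add: End_algebra_def hom_set_def rmod_hom_def DS_add DS_smult DS_zero hom_id_def
      hom_add_def hom_zero_def hom_smult_def algebra_of_def)

lemma homD:
  assumes "f \<in> hom_set K"
  shows "f \<in> carrier (DS K) \<rightarrow>\<^sub>E carrier (DS K)" "y \<in> carrier (DS K) \<Longrightarrow> f y \<in> carrier (DS K)"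
    "y \<in> carrier (DS K) \<Longrightarrow> y' \<in> carrier (DS K) \<Longrightarrow> f (\<lambda>i\<in>K. y i + y' i) = (\<lambda>i\<in>K. f y i + f y' i)"
    "y \<in> carrier (DS K) \<Longrightarrow> f (\<lambda>i\<in>K. y i * a) = (\<lambda>i\<in>K. f y i * a)"
  using assms unfolding hom_set_def by auto

lemma homI:
  assumes "\<And>y. y \<in> carrier (DS K) \<Longrightarrow> F y \<in> carrier (DS K)"
    "\<And>y y'. y \<in> carrier (DS K) \<Longrightarrow> y' \<in> carrier (DS K) \<Longrightarrow> F (\<lambda>i\<in>K. y i + y' i) = (\<lambda>i\<in>K. F y i + F y' i)"
    "\<And>y a. y \<in> carrier (DS K) \<Longrightarrow> F (\<lambda>i\<in>K. y i * a) = (\<lambda>i\<in>K. F y i * a)"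
  shows "(\<lambda>y\<in>carrier (DS K). F y) \<in> hom_set K"
proof -
  have "(\<lambda>i\<in>K. y i + y' i) \<in> carrier (DS K)" "(\<lambda>i\<in>K. y i * a) \<in> carrier (DS K)"
    if "y \<in> carrier (DS K)" "y' \<in> carrier (DS K)" for y y' a
    using that unfolding DS_carrier by (auto intro!: ideal_add ideal_mult simp: PiE_iff simp del: image_iff)
  then show ?thesis using assms unfolding hom_set_def by auto
qed

lemma DS_closed:
  "y \<in> carrier (DS K) \<Longrightarrow> y' \<in> carrier (DS K) \<Longrightarrow> (\<lambda>i\<in>K. y i + y' i) \<in> carrier (DS K)"
  "y \<in> carrier (DS K) \<Longrightarrow> (\<lambda>i\<in>K. y i * a) \<in> carrier (DS K)"
  "y \<in> carrier (DS K) \<Longrightarrow> (\<lambda>i\<in>K. - y i) \<in> carrier (DS K)"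
  "(\<lambda>i\<in>K. 0) \<in> carrier (DS K)"
  unfolding DS_carrier
  by (auto intro!: ideal_add ideal_mult ideal_minus ideal_zero simp: PiE_iff simp del: image_iff)

lemma DS_ext: "y \<in> carrier (DS K) \<Longrightarrow> restrict y K = y"
  unfolding DS_carrier by (rule PiE_restrict)

lemma hom_ext:
  assumes "f \<in> hom_set K" "g \<in> hom_set K" "\<And>y i. y \<in> carrier (DS K) \<Longrightarrow> i \<in> K \<Longrightarrow> f y i = g y i"
  shows "f = g"
proof (rule PiE_ext[OF homD(1)[OF assms(1)] homD(1)[OF assms(2)]])
  fix y assume y: "y \<in> carrier (DS K)"
  then have "f y \<in> carrier (DS K)" "g y \<in> carrier (DS K)" using homD(2) assms(1,2) by blast+
  then show "f y = g y" using assms(3)[OF y] unfolding DS_carrier by (rule PiE_ext)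
qed

lemma add_hom: "f \<in> hom_set K \<Longrightarrow> g \<in> hom_set K \<Longrightarrow> (\<lambda>y\<in>carrier (DS K). \<lambda>i\<in>K. f y i + g y i) \<in> hom_set K"
  by (rule homI) (auto simp: DS_closed homD(2-4) distrib_right add_ac)

lemma compose_hom: "f \<in> hom_set K \<Longrightarrow> g \<in> hom_set K \<Longrightarrow> compose (carrier (DS K)) f g \<in> hom_set K"
  unfolding compose_def by (rule homI) (auto simp: homD(2-4))

lemma zero_hom: "(\<lambda>y\<in>carrier (DS K). \<lambda>i\<in>K. 0) \<in> hom_set K"
  by (rule homI) (auto simp: DS_closed)

lemma one_hom: "(\<lambda>y\<in>carrier (DS K). y) \<in> hom_set K"
  by (rule homI) (auto simp: DS_closed)

lemma minus_hom: "f \<in> hom_set K \<Longrightarrow> (\<lambda>y\<in>carrier (DS K). \<lambda>i\<in>K. - f y i) \<in> hom_set K"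
  by (rule homI) (auto simp: DS_closed homD(2-4))

lemma ring_EA: "ring (EA K)"
proof (rule ringI)
  show "abelian_group (EA K)"
  proof (rule abelian_groupI')
    fix f assume f: "f \<in> carrier (EA K)"
    then show "\<exists>g\<in>carrier (EA K). g \<oplus>\<^bsub>EA K\<^esub> f = \<zero>\<^bsub>EA K\<^esub>"
      by (intro bexI[of _ "\<lambda>y\<in>carrier (DS K). \<lambda>i\<in>K. - f y i"]) (auto intro: minus_hom)
    have f': "f \<in> hom_set K" using f by simp
    have "\<zero>\<^bsub>EA K\<^esub> \<oplus>\<^bsub>EA K\<^esub> f \<in> hom_set K" using add_hom[OF zero_hom f'] by simp
    then show "\<zero>\<^bsub>EA K\<^esub> \<oplus>\<^bsub>EA K\<^esub> f = f" using f' by (rule hom_ext) simp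
  next
    fix f g h assume "f \<in> carrier (EA K)" "g \<in> carrier (EA K)" "h \<in> carrier (EA K)"
    then show "f \<oplus>\<^bsub>EA K\<^esub> g \<oplus>\<^bsub>EA K\<^esub> h = f \<oplus>\<^bsub>EA K\<^esub> (g \<oplus>\<^bsub>EA K\<^esub> h)"
      by (auto simp: add.assoc cong: restrict_cong)
  qed (auto simp: add_hom zero_hom add.commute)
  show "monoid (EA K)"
  proof (rule monoidI)
    fix f g h assume "f \<in> carrier (EA K)" "g \<in> carrier (EA K)" "h \<in> carrier (EA K)"
    then show "f \<otimes>\<^bsub>EA K\<^esub> g \<otimes>\<^bsub>EA K\<^esub> h = f \<otimes>\<^bsub>EA K\<^esub> (g \<otimes>\<^bsub>EA K\<^esub> h)"
      by (auto simp: compose_def homD(2))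
  next
    fix f assume f: "f \<in> carrier (EA K)"
    then have f': "f \<in> carrier (DS K) \<rightarrow>\<^sub>E carrier (DS K)" using homD(1) by simp
    show "\<one>\<^bsub>EA K\<^esub> \<otimes>\<^bsub>EA K\<^esub> f = f" using f' by (auto simp: compose_def PiE_iff extensional_def)
    show "f \<otimes>\<^bsub>EA K\<^esub> \<one>\<^bsub>EA K\<^esub> = f" using f' by (auto simp: compose_def PiE_iff extensional_def)
  qed (auto simp: compose_hom one_hom)
  fix f g h assume "f \<in> carrier (EA K)" "g \<in> carrier (EA K)" "h \<in> carrier (EA K)"
  then have f: "f \<in> hom_set K" and g: "g \<in> hom_set K" and h: "h \<in> hom_set K" by auto
  have gy: "g y \<in> carrier (DS K)" "f y \<in> carrier (DS K)" "h y \<in> carrier (DS K)" if "y \<in> carrier (DS K)" for y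
    using that homD(2) f g h by blast+
  show "(f \<oplus>\<^bsub>EA K\<^esub> g) \<otimes>\<^bsub>EA K\<^esub> h = f \<otimes>\<^bsub>EA K\<^esub> h \<oplus>\<^bsub>EA K\<^esub> g \<otimes>\<^bsub>EA K\<^esub> h"
    by (auto simp: compose_def gy)
  show "h \<otimes>\<^bsub>EA K\<^esub> (f \<oplus>\<^bsub>EA K\<^esub> g) = h \<otimes>\<^bsub>EA K\<^esub> f \<oplus>\<^bsub>EA K\<^esub> h \<otimes>\<^bsub>EA K\<^esub> g"
    using homD(3)[OF h gy(2) gy(1)] by (auto simp: compose_def DS_closed gy)
qed

lemma finsum_EA:
  assumes "finite L" "\<And>l. l \<in> L \<Longrightarrow> f l \<in> hom_set K" "y \<in> carrier (DS K)" "i \<in> K"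
  shows "finsum (EA K) f L y i = (\<Sum>l\<in>L. f l y i)"
proof -
  interpret ring "EA K" by (rule ring_EA)
  show ?thesis using assms(1,2)
  proof (induction L rule: finite_induct)
    case empty
    then show ?case using assms(3,4) by simp
  next
    case (insert l L)
    then have "finsum (EA K) f (insert l L) = f l \<oplus>\<^bsub>EA K\<^esub> finsum (EA K) f L"
      by (intro finsum_insert) auto
    then show ?case using insert assms(3,4) by simp
  qed
qed

text \<open>The endomorphism algebra of a subsum is a corner.\<close>

definition ext0 :: "'i set \<Rightarrow> ('i \<Rightarrow> 'h) \<Rightarrow> 'i \<Rightarrow> 'h" where
  "ext0 K y = (\<lambda>i\<in>J. if i \<in> K then y i else 0)"

definition proj :: "'i set \<Rightarrow> ('i \<Rightarrow> 'h) \<Rightarrow> 'i \<Rightarrow> 'h" where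
  "proj K = (\<lambda>y\<in>carrier (DS J). ext0 K y)"

definition compress :: "'i set \<Rightarrow> (('i \<Rightarrow> 'h) \<Rightarrow> 'i \<Rightarrow> 'h) \<Rightarrow> ('i \<Rightarrow> 'h) \<Rightarrow> 'i \<Rightarrow> 'h" where
  "compress K f = (\<lambda>y\<in>carrier (DS K). restrict (f (ext0 K y)) K)"

definition extend :: "'i set \<Rightarrow> (('i \<Rightarrow> 'h) \<Rightarrow> 'i \<Rightarrow> 'h) \<Rightarrow> ('i \<Rightarrow> 'h) \<Rightarrow> 'i \<Rightarrow> 'h" where
  "extend K f = (\<lambda>y\<in>carrier (DS J). ext0 K (f (restrict y K)))"

definition scalar :: "'c \<Rightarrow> ('i \<Rightarrow> 'h) \<Rightarrow> 'i \<Rightarrow> 'h" where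
  "scalar c = (\<lambda>y\<in>carrier (DS J). \<lambda>i\<in>J. y i * sc c 1)"

lemma ext0_closed: "K \<subseteq> J \<Longrightarrow> y \<in> carrier (DS K) \<Longrightarrow> ext0 K y \<in> carrier (DS J)"
  unfolding DS_carrier ext0_def by (auto simp: PiE_iff ideal_zero simp del: image_iff)

lemma ext0_closed': "y \<in> carrier (DS J) \<Longrightarrow> ext0 K y \<in> carrier (DS J)"
  unfolding DS_carrier ext0_def by (auto simp: PiE_iff ideal_zero simp del: image_iff)

lemma restrict_closed: "K \<subseteq> J \<Longrightarrow> y \<in> carrier (DS J) \<Longrightarrow> restrict y K \<in> carrier (DS K)"
  unfolding DS_carrier by (auto simp: PiE_iff)

lemma ext0_add: "K \<subseteq> J \<Longrightarrow> ext0 K (\<lambda>i\<in>K. y i + y' i) = (\<lambda>i\<in>J. ext0 K y i + ext0 K y' i)"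
  "K \<subseteq> J \<Longrightarrow> ext0 K (\<lambda>i\<in>K. y i * a) = (\<lambda>i\<in>J. ext0 K y i * a)"
  "ext0 K (\<lambda>i\<in>J. y i + y' i) = (\<lambda>i\<in>J. ext0 K y i + ext0 K y' i)"
  "ext0 K (\<lambda>i\<in>J. y i * a) = (\<lambda>i\<in>J. ext0 K y i * a)"
  by (auto simp: ext0_def fun_eq_iff restrict_apply)

lemma restrict_add: "K \<subseteq> J \<Longrightarrow> restrict (\<lambda>i\<in>J. y i + y' i) K = (\<lambda>i\<in>K. restrict y K i + restrict y' K i)"
  "K \<subseteq> J \<Longrightarrow> restrict (\<lambda>i\<in>J. y i * a) K = (\<lambda>i\<in>K. restrict y K i * a)"
  by (auto simp: fun_eq_iff restrict_apply)

lemma proj_hom: "proj K \<in> hom_set J"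
  unfolding proj_def by (rule homI) (auto simp: ext0_closed' ext0_add)

lemma compress_hom: "K \<subseteq> J \<Longrightarrow> f \<in> hom_set J \<Longrightarrow> compress K f \<in> hom_set K"
  unfolding compress_def
  by (rule homI) (auto simp: ext0_closed restrict_closed ext0_add restrict_add homD)

lemma extend_hom:
  assumes K: "K \<subseteq> J" and f: "f \<in> hom_set K"
  shows "extend K f \<in> hom_set J"
  unfolding extend_def
proof (rule homI)
  fix y y' a assume y: "y \<in> carrier (DS J)" and y': "y' \<in> carrier (DS J)"
  note r = restrict_closed[OF K y] restrict_closed[OF K y']
  show "ext0 K (f (restrict y K)) \<in> carrier (DS J)" using K f r by (simp add: ext0_closed homD(2))
  show "ext0 K (f (restrict (\<lambda>i\<in>J. y i + y' i) K)) =
      (\<lambda>i\<in>J. ext0 K (f (restrict y K)) i + ext0 K (f (restrict y' K)) i)"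
    unfolding restrict_add(1)[OF K] homD(3)[OF f r] ext0_add(1)[OF K] ..
  show "ext0 K (f (restrict (\<lambda>i\<in>J. y i * a) K)) = (\<lambda>i\<in>J. ext0 K (f (restrict y K)) i * a)"
    unfolding restrict_add(2)[OF K] homD(4)[OF f r(1)] ext0_add(2)[OF K] ..
qed

lemma ext0_restrict: "K \<subseteq> J \<Longrightarrow> restrict (ext0 K y) K = restrict y K" "ext0 K (restrict y K) = ext0 K y"
  "ext0 K (ext0 K y) = ext0 K y"
  by (auto simp: ext0_def fun_eq_iff restrict_apply)

lemma sc_central: "sc c 1 * a = a * sc c 1"
  by (simp add: sc_left sc_right)

lemma scalar_hom: "scalar c \<in> hom_set J"
  unfolding scalar_def
  by (rule homI) (auto simp: DS_closed distrib_right mult.assoc sc_central)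

lemma pcornerD:
  assumes "f \<in> pcorner (EA J) (proj K) (proj L)"
  shows "f \<in> hom_set J" "y \<in> carrier (DS J) \<Longrightarrow> ext0 K (f y) = f y" "y \<in> carrier (DS J) \<Longrightarrow> f (ext0 L y) = f y"
proof -
  show f: "f \<in> hom_set J" using assms unfolding pcorner_def by simp
  assume y: "y \<in> carrier (DS J)"
  have 1: "compose (carrier (DS J)) (proj K) f = f" and 2: "compose (carrier (DS J)) f (proj L) = f"
    using assms unfolding pcorner_def by auto
  show "ext0 K (f y) = f y" using fun_cong[OF 1, of y] y homD(2)[OF f y] by (simp add: compose_def proj_def)
  show "f (ext0 L y) = f y" using fun_cong[OF 2, of y] y by (simp add: compose_def proj_def)
qed

lemma pcornerI:
  assumes f: "f \<in> hom_set J" and "\<And>y. y \<in> carrier (DS J) \<Longrightarrow> ext0 K (f y) = f y"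
    "\<And>y. y \<in> carrier (DS J) \<Longrightarrow> f (ext0 L y) = f y"
  shows "f \<in> pcorner (EA J) (proj K) (proj L)"
proof -
  have "compose (carrier (DS J)) (proj K) f = f"
    by (rule hom_ext[OF compose_hom[OF proj_hom f] f]) (use assms homD(2)[OF f] in \<open>simp add: compose_def proj_def\<close>)
  moreover have "compose (carrier (DS J)) f (proj L) = f"
    by (rule hom_ext[OF compose_hom[OF f proj_hom] f]) (use assms in \<open>simp add: compose_def proj_def\<close>)
  ultimately show ?thesis using f unfolding pcorner_def by simp
qed

lemma corner_EA:
  assumes K: "K \<subseteq> J"
  shows "corner (EA J) (EA K) (proj K) (compress K) (extend K) scalar"
proof (intro corner.intro corner_axioms.intro ring_EA)
  show "proj K \<in> carrier (EA J)" using proj_hom by simp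
  show "proj K \<otimes>\<^bsub>EA J\<^esub> proj K = proj K"
    using compose_hom[OF proj_hom proj_hom] proj_hom
    by (intro hom_ext[of _ J]) (auto simp: compose_def proj_def ext0_closed' ext0_restrict)
  show "compress K f \<in> carrier (EA K)" if "f \<in> pcorner (EA J) (proj K) (proj K)" for f
    using compress_hom[OF K pcornerD(1)[OF that]] by simp
  show "compress K (f \<oplus>\<^bsub>EA J\<^esub> g) = compress K f \<oplus>\<^bsub>EA K\<^esub> compress K g" for f g
    using K by (auto simp: compress_def ext0_closed)
  show "compress K (f \<otimes>\<^bsub>EA J\<^esub> g) = compress K f \<otimes>\<^bsub>EA K\<^esub> compress K g"
    if f: "f \<in> pcorner (EA J) (proj K) (proj K)" and g: "g \<in> pcorner (EA J) (proj K) (proj K)" for f g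
    using K pcornerD[OF f] pcornerD[OF g] homD(2)[OF pcornerD(1)[OF g]]
    by (auto simp: compress_def compose_def ext0_closed restrict_closed ext0_restrict)
  show "compress K (proj K) = \<one>\<^bsub>EA K\<^esub>"
    using K by (auto simp: compress_def proj_def ext0_closed ext0_restrict DS_ext)
  show "extend K f \<in> pcorner (EA J) (proj K) (proj K)" if "f \<in> carrier (EA K)" for f
    using K that extend_hom[of K f]
    by (intro pcornerI) (auto simp: extend_def ext0_closed' ext0_restrict)
  show "compress K (extend K f) = f" if "f \<in> carrier (EA K)" for f
  proof (rule hom_ext[of _ K])
    show f: "f \<in> hom_set K" using that by simp
    show "compress K (extend K f) \<in> hom_set K" using K f by (intro compress_hom extend_hom)
    show "compress K (extend K f) y i = f y i" if "y \<in> carrier (DS K)" "i \<in> K" for y i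
      using K that by (simp add: compress_def extend_def ext0_closed ext0_restrict DS_ext)
  qed
  show "extend K (compress K f) = f" if f: "f \<in> pcorner (EA J) (proj K) (proj K)" for f
  proof (rule hom_ext[of _ J])
    show f': "f \<in> hom_set J" by (rule pcornerD(1)[OF f])
    show "extend K (compress K f) \<in> hom_set J" using K f' by (intro extend_hom compress_hom)
    show "extend K (compress K f) y i = f y i" if "y \<in> carrier (DS J)" "i \<in> J" for y i
      using K that pcornerD[OF f] by (simp add: compress_def extend_def restrict_closed ext0_restrict)
  qed
  show "scalar c \<in> carrier (EA J)" for c using scalar_hom by simp
  show "scalar c \<otimes>\<^bsub>EA J\<^esub> f = f \<otimes>\<^bsub>EA J\<^esub> scalar c" if "f \<in> carrier (EA J)" for c f
    using that homD[of f J] by (auto simp: scalar_def compose_def DS_closed)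
  show sm: "c \<odot>\<^bsub>EA K\<^esub> \<one>\<^bsub>EA K\<^esub> \<in> carrier (EA K)" for c
    by simp (rule homI, auto simp: DS_closed distrib_right mult.assoc sc_central)
  show "extend K (c \<odot>\<^bsub>EA K\<^esub> \<one>\<^bsub>EA K\<^esub>) = scalar c \<otimes>\<^bsub>EA J\<^esub> proj K" for c
  proof (rule hom_ext[of _ J])
    show "extend K (c \<odot>\<^bsub>EA K\<^esub> \<one>\<^bsub>EA K\<^esub>) \<in> hom_set J" using extend_hom[OF K] sm by simp
    show "scalar c \<otimes>\<^bsub>EA J\<^esub> proj K \<in> hom_set J" using compose_hom scalar_hom proj_hom by simp
  qed (use K in \<open>auto simp: extend_def scalar_def proj_def compose_def restrict_closed ext0_closed'\<close>, auto simp: ext0_def)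
qed

text \<open>The matrices with a single non-zero entry.\<close>

definition entry :: "'i \<Rightarrow> 'i \<Rightarrow> 'h \<Rightarrow> ('i \<Rightarrow> 'h) \<Rightarrow> 'i \<Rightarrow> 'h" where
  "entry j i a = (\<lambda>y\<in>carrier (DS J). \<lambda>l\<in>J. if l = j then a * y i else 0)"

lemma entry_hom:
  assumes "i \<in> J" "\<exists>c. a * x i = x j * c"
  shows "entry j i a \<in> hom_set J"
  unfolding entry_def
proof (rule homI)
  fix y assume y: "y \<in> carrier (DS J)"
  then obtain h where h: "y i = x i * h" using assms(1) unfolding DS_carrier by (auto simp: PiE_iff)
  obtain c where "a * x i = x j * c" using assms(2) by blast
  then have "a * y i = x j * (c * h)" unfolding h by (simp flip: mult.assoc)
  then show "(\<lambda>l\<in>J. if l = j then a * y i else 0) \<in> carrier (DS J)"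
    unfolding DS_carrier using ideal_zero by auto
qed (use assms in \<open>auto intro!: restrict_ext simp: distrib_left mult.assoc\<close>)

lemma entry_pcorner:
  assumes "i \<in> J" "j \<in> J" "\<exists>c. a * x i = x j * c" "j \<in> K" "i \<in> L"
  shows "entry j i a \<in> pcorner (EA J) (proj K) (proj L)"
proof (rule pcornerI)
  show "entry j i a \<in> hom_set J" using entry_hom[OF assms(1,3)] .
  fix y assume y: "y \<in> carrier (DS J)"
  show "ext0 K (entry j i a y) = entry j i a y"
    using y assms(4) by (auto simp: entry_def ext0_def intro!: restrict_ext)
  have "ext0 L y i = y i" using assms(1,5) by (simp add: ext0_def)
  then show "entry j i a (ext0 L y) = entry j i a y"
    using y ext0_closed'[OF y] by (simp add: entry_def cong: if_cong)
qed

lemma summand_decomposition: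
  assumes K: "K \<subseteq> J" "L \<subseteq> J" and s: "\<And>i. i \<in> L \<Longrightarrow> summand (x i) (x ` K)"
  obtains I :: "('i \<times> nat) set" and p q where "finite I"
    "\<And>k. k \<in> I \<Longrightarrow> p k \<in> pcorner (EA J) (proj L) (proj K)" "\<And>k. k \<in> I \<Longrightarrow> q k \<in> pcorner (EA J) (proj K) (proj L)"
    "finsum (EA J) (\<lambda>k. p k \<otimes>\<^bsub>EA J\<^esub> q k) I = proj L"
proof -
  interpret E: ring "EA J" by (rule ring_EA)
  define good where "good i us \<longleftrightarrow> (\<forall>(y, a, b)\<in>set us. y \<in> x ` K \<and> (\<exists>c. a * x i = y * c) \<and> (\<exists>c. b * y = x i * c)) \<and>
     (\<Sum>(y, a, b)\<leftarrow>us. b * a * x i) = x i" for i us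
  have "\<forall>i\<in>L. \<exists>us. good i us" using s unfolding summand_def good_def by blast
  from bchoice[OF this] obtain ts where ts: "\<And>i. i \<in> L \<Longrightarrow> good i (ts i)" by blast
  define I where "I = Sigma L (\<lambda>i. {..<length (ts i)})"
  have fL: "finite L" using K finite_J finite_subset by blast
  then have fI: "finite I" unfolding I_def by auto
  define jj where "jj = (\<lambda>(i, k). SOME j. j \<in> K \<and> x j = fst (ts i ! k))"
  define aa bb where "aa = (\<lambda>(i, k). fst (snd (ts i ! k)))" and "bb = (\<lambda>(i, k). snd (snd (ts i ! k)))"
  have mem: "fst k \<in> L" "jj k \<in> K" "\<exists>c. aa k * x (fst k) = x (jj k) * c" "\<exists>c. bb k * x (jj k) = x (fst k) * c"
    if kI: "k \<in> I" for k
  proof -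
    obtain i m where k: "k = (i, m)" "i \<in> L" "m < length (ts i)" using kI unfolding I_def by auto
    have "ts i ! m \<in> set (ts i)" using k by simp
    then have t: "fst (ts i ! m) \<in> x ` K" "\<exists>c. fst (snd (ts i ! m)) * x i = fst (ts i ! m) * c"
      "\<exists>c. snd (snd (ts i ! m)) * fst (ts i ! m) = x i * c" using ts[OF k(2)] unfolding good_def by (auto simp: case_prod_beta)
    have "\<exists>j. j \<in> K \<and> x j = fst (ts i ! m)" using t(1) by auto
    then have j: "jj k \<in> K \<and> x (jj k) = fst (ts i ! m)" unfolding jj_def k by simp (rule someI_ex)
    show "fst k \<in> L" "jj k \<in> K" "\<exists>c. aa k * x (fst k) = x (jj k) * c" "\<exists>c. bb k * x (jj k) = x (fst k) * c"
      using k t j by (auto simp: aa_def bb_def)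
  qed
  define p where "p k = entry (fst k) (jj k) (bb k)" for k
  define q where "q k = entry (jj k) (fst k) (aa k)" for k
  have p: "p k \<in> pcorner (EA J) (proj L) (proj K)" and q: "q k \<in> pcorner (EA J) (proj K) (proj L)" if "k \<in> I" for k
    unfolding p_def q_def using mem[OF that] K by (auto intro!: entry_pcorner)
  have pq: "p k \<in> hom_set J" "q k \<in> hom_set J" if "k \<in> I" for k
    using p[OF that] q[OF that] unfolding pcorner_def by auto
  have "finsum (EA J) (\<lambda>k. p k \<otimes>\<^bsub>EA J\<^esub> q k) I = proj L"
  proof (rule hom_ext[of _ J])
    have "finsum (EA J) (\<lambda>k. p k \<otimes>\<^bsub>EA J\<^esub> q k) I \<in> carrier (EA J)"
      by (rule E.finsum_closed) (auto intro: compose_hom pq)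
    then show "finsum (EA J) (\<lambda>k. p k \<otimes>\<^bsub>EA J\<^esub> q k) I \<in> hom_set J" by simp
    show "proj L \<in> hom_set J" by (rule proj_hom)
    fix y l assume y: "y \<in> carrier (DS J)" and l: "l \<in> J"
    have pqy: "(p k \<otimes>\<^bsub>EA J\<^esub> q k) y l = (if l = fst k then bb k * (aa k * y l) else 0)" if k: "k \<in> I" for k
    proof -
      have "jj k \<in> J" "fst k \<in> J" using mem[OF k] K by auto
      then show ?thesis using y l homD(2)[OF pq(2)[OF k] y] by (simp add: compose_def) (simp add: p_def q_def entry_def)
    qed
    have "finsum (EA J) (\<lambda>k. p k \<otimes>\<^bsub>EA J\<^esub> q k) I y l = (\<Sum>k\<in>I. if l = fst k then bb k * (aa k * y l) else 0)"
      using finsum_EA[OF fI _ y l, of "\<lambda>k. p k \<otimes>\<^bsub>EA J\<^esub> q k"] compose_hom pq pqy by simp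
    also have "\<dots> = (\<Sum>i\<in>L. \<Sum>m<length (ts i). if l = i then bb (i, m) * (aa (i, m) * y l) else 0)"
      unfolding I_def using fL by (subst sum.Sigma) (simp_all add: case_prod_beta cong: if_cong)
    also have "\<dots> = (\<Sum>i\<in>L. if i = l then (\<Sum>m<length (ts i). bb (i, m) * (aa (i, m) * y l)) else 0)"
      by (intro sum.cong) auto
    also have "\<dots> = (if l \<in> L then (\<Sum>m<length (ts l). bb (l, m) * (aa (l, m) * y l)) else 0)"
      using fL by simp
    also have "\<dots> = (if l \<in> L then y l else 0)"
    proof (cases "l \<in> L")
      case True
      obtain h where h: "y l = x l * h" using y l unfolding DS_carrier by (auto simp: PiE_iff)
      have "(\<Sum>m<length (ts l). bb (l, m) * (aa (l, m) * y l)) = (\<Sum>m<length (ts l). bb (l, m) * aa (l, m) * x l) * h"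
        unfolding h by (simp add: sum_distrib_right mult.assoc)
      also have "(\<Sum>m<length (ts l). bb (l, m) * aa (l, m) * x l) = (\<Sum>(y, a, b)\<leftarrow>ts l. b * a * x l)"
        by (simp add: sum_list_sum_nth case_prod_beta aa_def bb_def lessThan_atLeast0)
      also have "\<dots> = x l" using ts[OF True] unfolding good_def by blast
      finally show ?thesis using True h by simp
    qed simp
    also have "\<dots> = proj L y l" using y l by (simp add: proj_def ext0_def)
    finally show "finsum (EA J) (\<lambda>k. p k \<otimes>\<^bsub>EA J\<^esub> q k) I y l = proj L y l" .
  qed
  with fI p q show ?thesis by (rule that)
qed

theorem morita_End:
  assumes K: "K \<subseteq> J" "L \<subseteq> J"
    and "\<And>i. i \<in> L \<Longrightarrow> summand (x i) (x ` K)" "\<And>i. i \<in> K \<Longrightarrow> summand (x i) (x ` L)"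
    and inf: "infinite (UNIV :: 'u set)"
  shows "morita_equivalent TYPE('u) (EA K) (EA L)"
proof -
  obtain I :: "('i \<times> nat) set" and p q where I: "finite I"
    "\<And>k. k \<in> I \<Longrightarrow> p k \<in> pcorner (EA J) (proj L) (proj K)" "\<And>k. k \<in> I \<Longrightarrow> q k \<in> pcorner (EA J) (proj K) (proj L)"
    "finsum (EA J) (\<lambda>k. p k \<otimes>\<^bsub>EA J\<^esub> q k) I = proj L"
    by (rule summand_decomposition[OF K assms(3)], assumption, rule that)
  obtain I' :: "('i \<times> nat) set" and p' q' where I': "finite I'"
    "\<And>k. k \<in> I' \<Longrightarrow> p' k \<in> pcorner (EA J) (proj K) (proj L)" "\<And>k. k \<in> I' \<Longrightarrow> q' k \<in> pcorner (EA J) (proj L) (proj K)"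
    "finsum (EA J) (\<lambda>k. p' k \<otimes>\<^bsub>EA J\<^esub> q' k) I' = proj K"
    by (rule summand_decomposition[OF K(2,1) assms(4)], assumption, rule that)
  show ?thesis
    by (rule full_corners_morita[OF corner_EA[OF K(1)] corner_EA[OF K(2)] I I' inf])
qed

end

abbreviation ap :: "int perm \<Rightarrow> int \<Rightarrow> int" where "ap \<equiv> Perm.apply"

definition pos :: "int perm \<Rightarrow> int \<Rightarrow> int" where "pos w = ap (inverse w)"

lemma ap_mult: "ap (v * w) z = ap v (ap w z)"
  by (simp add: apply_times)

lemma ap_pos [simp]: "ap w (pos w z) = z" and pos_ap [simp]: "pos w (ap w z) = z"
  by (simp_all add: pos_def flip: ap_mult)

lemma pos_mult: "pos (v * w) z = pos w (pos v z)"
  by (metis ap_mult ap_pos pos_ap)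

lemma pos_one [simp]: "pos 1 z = z"
  using pos_ap[of 1 z] by simp

lemma pos_eq: "ap w z = y \<Longrightarrow> pos w y = z"
  using pos_ap by blast

lemma pos_inject: "pos w x = pos w y \<longleftrightarrow> x = y"
  by (metis ap_pos)

definition sgn_swap :: "int \<Rightarrow> int \<Rightarrow> int \<Rightarrow> int" where
  "sgn_swap x y z = (if z = x then y else if z = y then x else if z = - x then - y else if z = - y then - x else z)"

lemma ap_gen_s: "0 < i \<Longrightarrow> ap (gen_s i) z = sgn_swap (int i) (int i + 1) z"
  by (auto simp: gen_s_def apply_times Perm.swap.rep_eq Transposition.transpose_def sgn_swap_def)

lemma ap_gen_s0: "ap (gen_s 0) z = (if \<bar>z\<bar> = 1 then - z else z)"
  by (auto simp: gen_s_def Perm.swap.rep_eq Transposition.transpose_def)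

lemma gen_s0_sq: "gen_s 0 * gen_s 0 = 1"
  by (rule perm_eqI) (auto simp: ap_mult ap_gen_s0)

definition gen_u :: "int perm" where "gen_u = gen_s 0 * gen_s 1 * gen_s 0"

lemma ap_gen_u: "ap gen_u z = sgn_swap (-1) 2 z"
  by (auto simp: gen_u_def ap_mult ap_gen_s ap_gen_s0 sgn_swap_def)

lemma gens_D_alt: "gens_D r = insert gen_u (gens_A r)"
  by (simp add: gens_D_def gen_u_def)

text \<open>The simple reflection \<open>s\<close> with the simple root that it negates, given as a pair of letters.\<close>

definition simple_refl :: "nat \<Rightarrow> int perm \<Rightarrow> int \<Rightarrow> int \<Rightarrow> bool" where
  "simple_refl r s x y \<longleftrightarrow> s \<in> gens_D r \<and> (\<forall>z. ap s z = sgn_swap x y z) \<and>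
     (x = -1 \<and> y = 2 \<or> 0 < x \<and> y = x + 1) \<and> y \<le> int r"

lemma simple_gen_s: "0 < i \<Longrightarrow> i < r \<Longrightarrow> simple_refl r (gen_s i) (int i) (int i + 1)"
  by (auto simp: simple_refl_def gens_D_alt gens_A_def ap_gen_s)

lemma simple_gen_u: "2 \<le> r \<Longrightarrow> simple_refl r gen_u (-1) 2"
  by (auto simp: simple_refl_def gens_D_alt ap_gen_u)

lemma simple_exists:
  assumes "2 \<le> r" "s \<in> gens_D r"
  obtains x y where "simple_refl r s x y"
proof (cases "s = gen_u")
  case True
  then show ?thesis using that simple_gen_u assms(1) by blast
next
  case False
  then obtain i where "s = gen_s i" "1 \<le> i" "i < r" using assms(2) unfolding gens_D_alt gens_A_def by auto
  then show ?thesis using that simple_gen_s[of i r] by auto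
qed

lemma sgn_swap_invol: "simple_refl r s x y \<Longrightarrow> sgn_swap x y (sgn_swap x y z) = z"
  unfolding simple_refl_def by (auto simp: sgn_swap_def)

lemma simple_ap: "simple_refl r s x y \<Longrightarrow> ap s z = sgn_swap x y z"
  by (simp add: simple_refl_def)

lemma simple_sq: "simple_refl r s x y \<Longrightarrow> s * s = 1"
  by (rule perm_eqI) (simp add: ap_mult sgn_swap_invol simple_ap)

lemma simple_pos: "simple_refl r s x y \<Longrightarrow> pos s z = sgn_swap x y z"
  by (rule pos_eq) (simp add: simple_ap sgn_swap_invol)

text \<open>A simple reflection preserves the order of any two letters but those of its own root.\<close>

lemma sgn_swap_order:
  assumes "simple_refl r s x y" "p < q" "p \<noteq> - q" "p \<noteq> 0" "q \<noteq> 0"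
  shows "sgn_swap x y q < sgn_swap x y p \<longleftrightarrow> p = x \<and> q = y \<or> p = - y \<and> q = - x"
proof -
  have "x = -1 \<and> y = 2 \<or> 0 < x \<and> y = x + 1" using assms(1) by (simp add: simple_refl_def)
  then show ?thesis using assms(2-) unfolding sgn_swap_def by (smt (verit))
qed

definition letters :: "nat \<Rightarrow> int set" where "letters r = {z. z \<noteq> 0 \<and> \<bar>z\<bar> \<le> int r}"

definition signed :: "nat \<Rightarrow> int perm \<Rightarrow> bool" where
  "signed r w \<longleftrightarrow> (\<forall>z. ap w (- z) = - ap w z) \<and> (\<forall>z. z \<notin> letters r \<longrightarrow> ap w z = z)"

lemma signed_letters: "signed r w \<Longrightarrow> ap w z \<in> letters r \<longleftrightarrow> z \<in> letters r"
  unfolding signed_def by (metis apply_inj)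

lemma signed_pos: "signed r w \<Longrightarrow> pos w z \<in> letters r \<longleftrightarrow> z \<in> letters r"
  using signed_letters[of r w "pos w z"] by simp

lemma signed_neg: "signed r w \<Longrightarrow> ap w (- z) = - ap w z"
  by (simp add: signed_def)

lemma signed_pos_neg: "signed r w \<Longrightarrow> pos w (- z) = - pos w z"
  by (rule pos_eq) (simp add: signed_neg)

lemma signed_one: "signed r 1"
  by (simp add: signed_def)

lemma signed_mult: "signed r v \<Longrightarrow> signed r w \<Longrightarrow> signed r (v * w)"
  unfolding signed_def by (simp add: ap_mult)

lemma simple_signed: "simple_refl r s x y \<Longrightarrow> signed r s"
  unfolding simple_refl_def signed_def letters_def by (auto simp: sgn_swap_def)

text \<open>Every positive root which \<open>w\<close> makes negative is counted twice, as \<open>(a, b)\<close> and as \<open>(- b, - a)\<close>.\<close>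

definition invs :: "nat \<Rightarrow> int perm \<Rightarrow> (int \<times> int) set" where
  "invs r w = {(a, b). a \<in> letters r \<and> b \<in> letters r \<and> a < b \<and> a \<noteq> - b \<and> ap w b < ap w a}"

lemma finite_invs: "finite (invs r w)"
proof (rule finite_subset)
  show "invs r w \<subseteq> {- int r..int r} \<times> {- int r..int r}"
    by (auto simp: invs_def letters_def)
qed simp

lemma card_invs_up:
  assumes w: "signed r w" and s: "simple_refl r s x y" and up: "pos w x < pos w y"
  shows "card (invs r (s * w)) = card (invs r w) + 2"
proof -
  let ?a = "pos w x" and ?b = "pos w y"
  have xy: "x = -1 \<and> y = 2 \<or> 0 < x \<and> y = x + 1" "y \<le> int r" using s by (auto simp: simple_refl_def)
  have xl: "x \<in> letters r" "y \<in> letters r" using xy by (auto simp: letters_def)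
  have neg: "pos w (- x) = - ?a" "pos w (- y) = - ?b" using signed_pos_neg[OF w] by auto
  have ab: "?a \<noteq> - ?b" using xy by (auto simp: pos_inject simp flip: neg(2))
  have root: "ap w b = x' \<longleftrightarrow> b = pos w x'" for b x' by auto
  have eq: "invs r (s * w) = invs r w \<union> {(?a, ?b), (- ?b, - ?a)}"
  proof -
    have "(a, b) \<in> invs r (s * w) \<longleftrightarrow> (a, b) \<in> invs r w \<union> {(?a, ?b), (- ?b, - ?a)}" for a b
    proof (cases "a \<in> letters r \<and> b \<in> letters r \<and> a < b \<and> a \<noteq> - b")
      case False
      have "- ?a \<in> letters r" "- ?b \<in> letters r" "?a \<in> letters r" "?b \<in> letters r"
        using signed_pos[OF w] xl by (auto simp: letters_def simp flip: neg)
      then show ?thesis using False up ab by (auto simp: invs_def)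
    next
      case True
      let ?p = "ap w a" and ?q = "ap w b"
      have l: "?p \<in> letters r" "?q \<in> letters r" using True signed_letters[OF w] by auto
      have ne: "?p \<noteq> ?q" "?p \<noteq> - ?q" using True by (auto simp: apply_inj simp flip: signed_neg[OF w])
      have inv: "(a, b) \<in> invs r (s * w) \<longleftrightarrow> sgn_swap x y ?q < sgn_swap x y ?p"
        using True by (simp add: invs_def ap_mult simple_ap[OF s])
      have inv': "(a, b) \<in> invs r w \<longleftrightarrow> ?q < ?p" using True by (simp add: invs_def)
      have inj: "sgn_swap x y ?q \<noteq> sgn_swap x y ?p" using ne(1) sgn_swap_invol[OF s] by metis
      have r1: "(a, b) = (?a, ?b) \<longleftrightarrow> ?p = x \<and> ?q = y" "(a, b) = (- ?b, - ?a) \<longleftrightarrow> ?p = - y \<and> ?q = - x"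
        using root[of a] root[of b] neg by auto
      show ?thesis
      proof (cases "?p < ?q")
        case lt: True
        then show ?thesis unfolding Un_iff insert_iff inv inv' r1
          using sgn_swap_order[OF s lt ne(2)] l by (auto simp: letters_def)
      next
        case False
        then have lt: "?q < ?p" using ne by simp
        have "\<not> (?q = x \<and> ?p = y)" using up root[of a y] root[of b x] True by auto
        moreover have "\<not> (?q = - y \<and> ?p = - x)" using up root[of a "- x"] root[of b "- y"] True neg by auto
        ultimately have "\<not> sgn_swap x y ?p < sgn_swap x y ?q"
          using sgn_swap_order[OF s lt] ne(2) l by (auto simp: letters_def)
        then show ?thesis unfolding Un_iff inv inv' using lt inj by auto
      qed
    qed
    then show ?thesis by auto
  qed
  have "(?a, ?b) \<notin> invs r w" "(- ?b, - ?a) \<notin> invs r w"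
    using xy by (auto simp: invs_def signed_neg[OF w])
  moreover have "(?a, ?b) \<noteq> (- ?b, - ?a)" using ab by auto
  ultimately show ?thesis unfolding eq using finite_invs[of r w] by simp
qed

lemma simple_pos_swap:
  assumes "simple_refl r s x y"
  shows "pos (s * w) x = pos w y" "pos (s * w) y = pos w x"
  by (auto simp: pos_mult simple_pos[OF assms] sgn_swap_def)

lemma card_invs_step:
  assumes w: "signed r w" and s: "simple_refl r s x y"
  shows "card (invs r (s * w)) \<le> card (invs r w) + 2"
proof (cases "pos w x < pos w y")
  case True
  then show ?thesis using card_invs_up[OF w s] by simp
next
  case False
  have "pos w x \<noteq> pos w y" using s by (auto simp: simple_refl_def pos_inject)
  then have "card (invs r (s * (s * w))) = card (invs r (s * w)) + 2"
    using False simple_pos_swap[OF s, of w]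
    by (intro card_invs_up[OF signed_mult[OF simple_signed[OF s] w] s]) simp
  then show ?thesis by (simp add: simple_sq[OF s] flip: mult.assoc)
qed

section \<open>Reduced words\<close>

lemma generated_one: "1 \<in> generated S"
  unfolding generated_def by (rule image_eqI[of _ _ "[]"]) auto

lemma generated_mult: "v \<in> generated S \<Longrightarrow> w \<in> generated S \<Longrightarrow> v * w \<in> generated S"
  unfolding generated_def
proof (elim imageE)
  fix us vs assume "us \<in> lists S" "vs \<in> lists S" "v = prod_list us" "w = prod_list vs"
  then show "v * w \<in> prod_list ` lists S"
    by (intro image_eqI[of _ _ "us @ vs"]) auto
qed

lemma generated_gen: "s \<in> S \<Longrightarrow> s \<in> generated S"
  unfolding generated_def by (rule image_eqI[of _ _ "[s]"]) auto

lemma word_length_le: "ws \<in> lists S \<Longrightarrow> word_length S (prod_list ws) \<le> length ws"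
  unfolding word_length_def by (rule Least_le) blast

lemma word_length_attained:
  assumes "w \<in> generated S"
  obtains ws where "ws \<in> lists S" "length ws = word_length S w" "prod_list ws = w"
proof -
  have "\<exists>n. \<exists>ws\<in>lists S. length ws = n \<and> prod_list ws = w" using assms unfolding generated_def by auto
  from LeastI_ex[OF this] show ?thesis using that unfolding word_length_def by blast
qed

lemma word_invs:
  assumes "2 \<le> r" "ws \<in> lists (gens_D r)"
  shows "signed r (prod_list ws) \<and> card (invs r (prod_list ws)) \<le> 2 * length ws"
  using assms(2)
proof (induction ws)
  case Nil
  have "invs r 1 = {}" by (auto simp: invs_def)
  then show ?case by (simp add: signed_one)
next
  case (Cons s ws)
  then obtain x y where s: "simple_refl r s x y" using simple_exists[OF assms(1)] by auto
  then show ?case using Cons card_invs_step[of r "prod_list ws" s x y] simple_signed[OF s]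
    by (auto intro: signed_mult)
qed

lemma invs_word_length:
  assumes "2 \<le> r" "w \<in> generated (gens_D r)"
  shows "card (invs r w) \<le> 2 * word_length (gens_D r) w"
  using word_length_attained[OF assms(2)] word_invs[OF assms(1)] by metis

definition exact :: "nat \<Rightarrow> int perm \<Rightarrow> bool" where
  "exact r w \<longleftrightarrow> w \<in> generated (gens_D r) \<and> signed r w \<and> 2 * word_length (gens_D r) w = card (invs r w)"

lemma exact_one: "exact r 1"
proof -
  have "invs r 1 = {}" by (auto simp: invs_def)
  then show ?thesis using word_length_le[of "[]" "gens_D r"] by (simp add: exact_def generated_one signed_one)
qed

lemma exact_step:
  assumes r: "2 \<le> r" and w: "exact r w" and s: "simple_refl r s x y" and up: "pos w x < pos w y"
  shows "exact r (s * w)" "word_length (gens_D r) w < word_length (gens_D r) (s * w)"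
proof -
  have sw: "signed r w" "w \<in> generated (gens_D r)" and l: "2 * word_length (gens_D r) w = card (invs r w)"
    using w by (auto simp: exact_def)
  have sD: "s \<in> gens_D r" using s by (simp add: simple_refl_def)
  obtain ws where ws: "ws \<in> lists (gens_D r)" "length ws = word_length (gens_D r) w" "prod_list ws = w"
    using word_length_attained[OF sw(2)] by blast
  have g: "s * w \<in> generated (gens_D r)" using sD sw(2) generated_gen generated_mult by blast
  have "word_length (gens_D r) (s * w) \<le> Suc (word_length (gens_D r) w)"
    using word_length_le[of "s # ws" "gens_D r"] ws sD by simp
  moreover have "card (invs r (s * w)) \<le> 2 * word_length (gens_D r) (s * w)"
    by (rule invs_word_length[OF r g])
  moreover note card_invs_up[OF sw(1) s up] l
  ultimately show "exact r (s * w)" "word_length (gens_D r) w < word_length (gens_D r) (s * w)"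
    using g signed_mult[OF simple_signed[OF s] sw(1)] by (auto simp: exact_def)
qed

lemma simple_braid:
  assumes s: "simple_refl r s x y" and t: "simple_refl r t y z"
  shows "s * t * s = t * s * t"
proof (rule perm_eqI)
  fix a
  have "x = -1 \<and> y = 2 \<and> z = 3 \<or> 0 < x \<and> y = x + 1 \<and> z = x + 2"
    using s t by (auto simp: simple_refl_def)
  then have d: "x \<noteq> y" "x \<noteq> z" "y \<noteq> z" "x \<noteq> - y" "x \<noteq> - z" "y \<noteq> - z" "x \<noteq> 0" "y \<noteq> 0" "z \<noteq> 0"
    "y \<noteq> - x" "z \<noteq> - x" "z \<noteq> - y" "- x \<noteq> y" "- x \<noteq> z" "- y \<noteq> x" "- y \<noteq> z" "- z \<noteq> x" "- z \<noteq> y"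
    by auto
  consider "a = x" | "a = y" | "a = z" | "a = - x" | "a = - y" | "a = - z"
    | "a \<noteq> x" "a \<noteq> y" "a \<noteq> z" "a \<noteq> - x" "a \<noteq> - y" "a \<noteq> - z" by blast
  then show "ap (s * t * s) a = ap (t * s * t) a"
    unfolding ap_mult simple_ap[OF s] simple_ap[OF t]
    by cases (simp_all add: sgn_swap_def d d(1-3)[symmetric])
qed

lemma simple_less: "simple_refl r s x y \<Longrightarrow> x < y"
  by (auto simp: simple_refl_def)

definition inc :: "int perm \<Rightarrow> int set \<Rightarrow> bool" where
  "inc w A \<longleftrightarrow> (\<forall>x\<in>A. \<forall>y\<in>A. x < y \<longrightarrow> pos w x < pos w y)"

lemma ap_refl_t: "0 < i \<Longrightarrow> ap (refl_t i) z = (if \<bar>z\<bar> = int i then - z else z)"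
proof (induction i arbitrary: z rule: refl_t.induct)
  case (3 i)
  have "ap (refl_t (Suc (Suc i))) z = sgn_swap (int (Suc i)) (int (Suc i) + 1)
      (ap (refl_t (Suc i)) (sgn_swap (int (Suc i)) (int (Suc i) + 1) z))"
    by (simp add: ap_mult ap_gen_s)
  then show ?case using 3 by (auto simp: sgn_swap_def)
qed (auto simp: ap_gen_s0)

lemma ap_elt_u: "2 \<le> i \<Longrightarrow> ap (elt_u i) z = (if \<bar>z\<bar> = 1 \<or> \<bar>z\<bar> = int i then - z else z)"
  by (auto simp: elt_u_def ap_mult ap_refl_t ap_gen_s0)

lemma pos_elt_u: "2 \<le> i \<Longrightarrow> pos (elt_u i) z = (if \<bar>z\<bar> = 1 \<or> \<bar>z\<bar> = int i then - z else z)"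
  by (rule pos_eq) (simp add: ap_elt_u)

lemma elt_u_Suc: "2 \<le> i \<Longrightarrow> elt_u (Suc i) = gen_s i * elt_u i * gen_s i"
proof -
  assume i: "2 \<le> i"
  then have "gen_s 0 * gen_s i = gen_s i * gen_s 0"
    by (intro perm_eqI) (auto simp: ap_mult ap_gen_s ap_gen_s0 sgn_swap_def)
  then have "gen_s 0 * (gen_s i * w) = gen_s i * (gen_s 0 * w)" for w by (simp flip: mult.assoc)
  moreover obtain j where "i = Suc j" using i by (cases i) auto
  ultimately show ?thesis by (simp add: elt_u_def mult.assoc)
qed

lemma elt_u_2: "elt_u 2 = gen_u * gen_s 1"
  by (simp add: elt_u_def gen_u_def mult.assoc numeral_2_eq_2)

fun cyc :: "nat \<Rightarrow> nat \<Rightarrow> int perm" where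
  "cyc b 0 = 1"
| "cyc b (Suc i) = cyc b i * gen_s (b - i)"

lemma ap_cyc:
  assumes "i \<le> b" "0 < z"
  shows "ap (cyc b i) z = (if z = int b + 1 - int i then int b + 1
    else if int b + 1 - int i < z \<and> z \<le> int b + 1 then z - 1 else z)"
  using assms
proof (induction i arbitrary: z)
  case (Suc i)
  have "0 < sgn_swap (int (b - i)) (int (b - i) + 1) z" using Suc.prems by (auto simp: sgn_swap_def)
  moreover have "ap (gen_s (b - i)) z = sgn_swap (int (b - i)) (int (b - i) + 1) z"
    using Suc.prems by (intro ap_gen_s) simp
  ultimately show ?case using Suc by (simp add: ap_mult) (auto simp: sgn_swap_def)
qed auto

lemma gen_in_A: "0 < i \<Longrightarrow> i < r \<Longrightarrow> gen_s i \<in> gens_A r"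
  by (auto simp: gens_A_def)

lemma A_odd: "w \<in> generated (gens_A r) \<Longrightarrow> ap w (- z) = - ap w z"
proof -
  assume "w \<in> generated (gens_A r)"
  then obtain ws where ws: "ws \<in> lists (gens_A r)" "w = prod_list ws" unfolding generated_def by auto
  show "ap w (- z) = - ap w z"
    unfolding ws(2) using ws(1)
  proof (induction ws)
    case (Cons s ws)
    then obtain i where "s = gen_s i" "0 < i" by (auto simp: gens_A_def)
    then have "ap s (- v) = - ap s v" for v by (auto simp: ap_gen_s sgn_swap_def)
    then show ?case using Cons by (simp add: ap_mult)
  qed simp
qed

lemma A_fix: "w \<in> generated (gens_A r) \<Longrightarrow> z = 0 \<or> int r < \<bar>z\<bar> \<Longrightarrow> ap w z = z"
proof -
  assume "w \<in> generated (gens_A r)" and z: "z = 0 \<or> int r < \<bar>z\<bar>"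
  then obtain ws where ws: "ws \<in> lists (gens_A r)" "w = prod_list ws" unfolding generated_def by auto
  show "ap w z = z"
    unfolding ws(2) using ws(1)
  proof (induction ws)
    case (Cons s ws)
    then obtain i where "s = gen_s i" "0 < i" "i < r" by (auto simp: gens_A_def)
    then have "ap s z = z" using z by (auto simp: ap_gen_s sgn_swap_def)
    then show ?case using Cons by (simp add: ap_mult)
  qed simp
qed

lemma cyc_in_A: "i \<le> b \<Longrightarrow> b < r \<Longrightarrow> cyc b i \<in> generated (gens_A r)"
  by (induction i) (auto intro: generated_one intro!: generated_mult[OF _ generated_gen[OF gen_in_A]])

text \<open>The symmetric group on the letters from \<open>k + 1\<close> to \<open>k + m\<close>, built up by coset representatives.\<close>

fun sym_grp :: "nat \<Rightarrow> nat \<Rightarrow> int perm set" where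
  "sym_grp k 0 = {1}"
| "sym_grp k (Suc m) = (\<lambda>(v, i). v * cyc (k + m) i) ` (sym_grp k m \<times> {..m})"

fun young_grp :: "nat \<Rightarrow> nat list \<Rightarrow> int perm set" where
  "young_grp k [] = {1}"
| "young_grp k (m # ms) = (\<lambda>(v, w). v * w) ` (sym_grp k m \<times> young_grp (k + m) ms)"

lemma sym_grp_A: "v \<in> sym_grp k m \<Longrightarrow> k + m \<le> r \<Longrightarrow> v \<in> generated (gens_A r)"
  by (induction m arbitrary: v) (auto intro!: generated_one generated_mult cyc_in_A)

lemma sym_grp_fix: "v \<in> sym_grp k m \<Longrightarrow> 0 < z \<Longrightarrow> z \<le> int k \<or> int (k + m) < z \<Longrightarrow> ap v z = z"
  by (induction m arbitrary: v) (auto simp: ap_mult ap_cyc)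

lemma A_pos:
  assumes "w \<in> generated (gens_A r)" "0 < z"
  shows "0 < ap w z"
proof -
  obtain ws where ws: "ws \<in> lists (gens_A r)" "w = prod_list ws" using assms(1) unfolding generated_def by auto
  show ?thesis unfolding ws(2) using ws(1)
  proof (induction ws)
    case (Cons s ws)
    then obtain i where "s = gen_s i" "0 < i" by (auto simp: gens_A_def)
    then have "0 < v \<Longrightarrow> 0 < ap s v" for v by (auto simp: ap_gen_s sgn_swap_def)
    then show ?case using Cons by (simp add: ap_mult)
  qed (use assms in simp)
qed

lemma sym_grp_block:
  assumes "v \<in> sym_grp k m"
  shows "ap v ` {int k <.. int (k + m)} = {int k <.. int (k + m)}"
proof (rule card_subset_eq)
  have v: "v \<in> generated (gens_A (k + m))" using sym_grp_A[OF assms] by simp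
  show "ap v ` {int k <.. int (k + m)} \<subseteq> {int k <.. int (k + m)}"
  proof clarify
    fix z assume z: "z \<in> {int k <.. int (k + m)}"
    have "ap v (ap v z) = ap v z" if "ap v z \<notin> {int k <.. int (k + m)}"
      using sym_grp_fix[OF assms, of "ap v z"] A_pos[OF v, of z] z that by auto
    then have "ap v z = z" if "ap v z \<notin> {int k <.. int (k + m)}" using that by (simp add: apply_inj)
    then show "ap v z \<in> {int k <.. int (k + m)}" using z by fastforce
  qed
  show "card (ap v ` {int k <.. int (k + m)}) = card {int k <.. int (k + m)}"
    by (rule card_image) (simp add: inj_on_def apply_inj)
qed simp

lemma finite_sym_grp: "finite (sym_grp k m)"
  by (induction m) auto

lemma finite_young_grp: "finite (young_grp k ms)"
  by (induction ms arbitrary: k) (auto simp: finite_sym_grp)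

lemma sym_grp_inj: "inj_on (\<lambda>(v, i). v * cyc (k + m) i) (sym_grp k m \<times> {..m})"
proof (rule inj_onI, clarsimp)
  fix v i v' i' assume v: "v \<in> sym_grp k m" "v' \<in> sym_grp k m" and i: "i \<le> m" "i' \<le> m"
    and eq: "v * cyc (k + m) i = v' * cyc (k + m) i'"
  let ?b = "int (k + m) + 1"
  have "pos (v * cyc (k + m) j) ?b = ?b - int j" if "v \<in> sym_grp k m" "j \<le> m" for v j
    using that sym_grp_fix[OF that(1), of ?b] by (intro pos_eq) (simp add: ap_mult ap_cyc)
  from this[OF v(1) i(1)] this[OF v(2) i(2)] have "i = i'" unfolding eq by simp
  then show "v = v' \<and> i = i'" using eq by (simp add: perm.right_cancel)
qed

lemma young_grp_fix: "w \<in> young_grp k ms \<Longrightarrow> 0 < z \<Longrightarrow> z \<le> int k \<or> int (k + sum_list ms) < z \<Longrightarrow> ap w z = z"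
  by (induction ms arbitrary: k w) (auto simp: ap_mult sym_grp_fix)

lemma young_grp_A: "w \<in> young_grp k ms \<Longrightarrow> k + sum_list ms \<le> r \<Longrightarrow> w \<in> generated (gens_A r)"
proof (induction ms arbitrary: k w)
  case (Cons m ms)
  then obtain v u where w: "w = v * u" "v \<in> sym_grp k m" "u \<in> young_grp (k + m) ms" by auto
  then show ?case using Cons sym_grp_A[OF w(2), of r] by (auto intro: generated_mult)
qed (auto intro: generated_one)

lemma A_eqI:
  assumes "v \<in> generated (gens_A r)" "w \<in> generated (gens_A r)" "\<And>z. 0 < z \<Longrightarrow> ap v z = ap w z"
  shows "v = w"
proof (rule perm_eqI)
  fix z :: int
  consider "0 < z" | "z = 0" | "0 < - z" by (cases z "0 :: int" rule: linorder_cases) auto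
  then show "ap v z = ap w z"
    using assms(3) A_fix[OF assms(1)] A_fix[OF assms(2)] A_odd[OF assms(1), of "- z"] A_odd[OF assms(2), of "- z"]
    by cases auto
qed

lemma young_grp_inj: "inj_on (\<lambda>(v, w). v * w) (sym_grp k m \<times> young_grp (k + m) ms)"
proof (rule inj_onI, clarsimp)
  fix v w v' w' assume v: "v \<in> sym_grp k m" "v' \<in> sym_grp k m"
    and w: "w \<in> young_grp (k + m) ms" "w' \<in> young_grp (k + m) ms" and eq: "v * w = v' * w'"
  have "v = v'"
  proof (rule A_eqI)
    show "v \<in> generated (gens_A (k + m))" "v' \<in> generated (gens_A (k + m))" using v sym_grp_A by auto
    fix z :: int assume z: "0 < z"
    show "ap v z = ap v' z"
    proof (cases "z \<le> int (k + m)")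
      case True
      have "ap v z = ap (v * w) z" using young_grp_fix[OF w(1) z] True by (simp add: ap_mult)
      also have "\<dots> = ap v' z" using young_grp_fix[OF w(2) z] True by (simp add: ap_mult eq)
      finally show ?thesis .
    next
      case False
      then show ?thesis using sym_grp_fix[OF v(1) z] sym_grp_fix[OF v(2) z] by simp
    qed
  qed
  then show "v = v' \<and> w = w'" using eq by (simp add: perm.left_cancel)
qed

text \<open>Every permutation of the letters \<open>k + 1, \<dots>, k + m\<close> occurs.\<close>

lemma sym_grp_full:
  assumes "inj_on F {int k <.. int (k + m)}" "F ` {int k <.. int (k + m)} = {int k <.. int (k + m)}"
  shows "\<exists>v\<in>sym_grp k m. \<forall>z\<in>{int k <.. int (k + m)}. ap v z = F z"
  using assms
proof (induction m arbitrary: F)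
  case (Suc m)
  let ?I = "{int k <.. int (k + m)}" and ?J = "{int k <.. int (k + Suc m)}" and ?b = "int (k + m) + 1"
  have J: "?J = insert ?b ?I" "?b \<notin> ?I" by auto
  have "?b \<in> F ` ?J" unfolding Suc.prems(2) by simp
  then obtain j where j: "j \<in> ?J" "F j = ?b" by auto
  define i where "i = nat (?b - j)"
  have i: "i \<le> m" "j = ?b - int i" using j by (auto simp: i_def)
  define c where "c = cyc (k + m) i"
  have c: "ap c z = (if z = j then ?b else if j < z \<and> z \<le> ?b then z - 1 else z)" if "0 < z" for z
    unfolding c_def using i that by (subst ap_cyc) auto
  have cJ: "ap c ` ?J = ?J"
  proof (rule card_subset_eq)
    show "ap c ` ?J \<subseteq> ?J" using j by (auto simp: c)
    show "card (ap c ` ?J) = card ?J" by (rule card_image) (simp add: inj_on_def apply_inj)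
  qed simp
  have pJ: "pos c z \<in> ?J" if z: "z \<in> ?J" for z
  proof -
    have "z \<in> ap c ` ?J" using z by (simp only: cJ)
    then show ?thesis by (elim imageE) (simp only: pos_ap)
  qed
  have cj: "pos c ?b = j" using c[of j] j by (intro pos_eq) simp
  let ?F = "\<lambda>z. F (pos c z)"
  have inj: "inj_on ?F ?J"
  proof (rule inj_onI)
    fix y z assume "y \<in> ?J" "z \<in> ?J" "F (pos c y) = F (pos c z)"
    then have "pos c y = pos c z" using inj_onD[OF Suc.prems(1)] pJ by blast
    then show "y = z" by (simp only: pos_inject)
  qed
  have sub: "?F ` ?J \<subseteq> ?J" using pJ Suc.prems(2) by blast
  have FJ: "?F ` ?J = ?J" by (rule card_subset_eq[OF _ sub card_image[OF inj]]) simp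
  have I: "?I = ?J - {?b}" by auto
  have Fb: "?F ?b = ?b" using cj j by simp
  have "?F ` ?I = ?F ` ?J - ?F ` {?b}"
    unfolding I by (rule inj_on_image_set_diff[OF inj]) auto
  also have "\<dots> = ?I" unfolding FJ I using Fb by simp
  finally have "?F ` ?I = ?I" .
  moreover have "inj_on ?F ?I" by (rule inj_on_subset[OF inj]) auto
  ultimately obtain v where v: "v \<in> sym_grp k m" "\<And>z. z \<in> ?I \<Longrightarrow> ap v z = ?F z" using Suc.IH[of ?F] by blast
  have vb: "ap v ?b = ?F ?b" using sym_grp_fix[OF v(1), of ?b] cj j by simp
  have "ap (v * c) z = F z" if z: "z \<in> ?J" for z
  proof -
    have "ap c z \<in> ?J" using z cJ by blast
    then have "ap c z = ?b \<or> ap c z \<in> ?I" by auto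
    then have "ap v (ap c z) = ?F (ap c z)" by (elim disjE) (simp only: vb, rule v(2))
    then show ?thesis by (simp add: ap_mult)
  qed
  moreover have "v * c \<in> sym_grp k (Suc m)" using v(1) i by (auto simp: c_def)
  ultimately show ?case by blast
qed auto

definition seg :: "nat \<Rightarrow> nat list \<Rightarrow> nat \<Rightarrow> int set" where
  "seg k ms j = {int (k + sum_list (take j ms)) <.. int (k + sum_list (take (Suc j) ms))}"

lemma seg_simps: "seg k (m # ms) 0 = {int k <.. int (k + m)}" "seg k (m # ms) (Suc j) = seg (k + m) ms j"
  by (simp_all add: seg_def add_ac)

lemma young_grp_seg: "w \<in> young_grp k ms \<Longrightarrow> j < length ms \<Longrightarrow> ap w ` seg k ms j = seg k ms j"
proof (induction ms arbitrary: k w j)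
  case (Cons m ms)
  then obtain v u where w: "w = v * u" "v \<in> sym_grp k m" "u \<in> young_grp (k + m) ms" by auto
  have im: "ap w ` A = ap v ` ap u ` A" for A unfolding w(1) by (auto simp: ap_mult image_image)
  show ?case
  proof (cases j)
    case 0
    have "ap u ` {int k <.. int (k + m)} = {int k <.. int (k + m)}"
      using young_grp_fix[OF w(3)] by (intro image_cong[of _ _ _ "\<lambda>z. z", simplified]) auto
    then show ?thesis unfolding 0 seg_simps im using sym_grp_block[OF w(2)] by simp
  next
    case (Suc i)
    have "ap v ` seg (k + m) ms i = seg (k + m) ms i"
      using sym_grp_fix[OF w(2)] by (intro image_cong[of _ _ _ "\<lambda>z. z", simplified]) (auto simp: seg_def)
    then show ?thesis unfolding Suc seg_simps im using Cons.IH[OF w(3), of i] Cons.prems Suc by simp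
  qed
qed simp

lemma young_grp_full:
  assumes "w \<in> generated (gens_A r)" "k + sum_list ms = r"
    "\<And>z. 0 < z \<Longrightarrow> z \<le> int k \<Longrightarrow> ap w z = z"
    "\<And>j. j < length ms \<Longrightarrow> ap w ` seg k ms j = seg k ms j"
  shows "w \<in> young_grp k ms"
  using assms
proof (induction ms arbitrary: k w)
  case Nil
  have "ap w z = ap 1 z" if "0 < z" for z
    using Nil A_fix[OF Nil.prems(1), of z] that by (cases "z \<le> int r") auto
  then have "w = 1" using A_eqI[OF Nil.prems(1) generated_one] by blast
  then show ?case by simp
next
  case (Cons m ms)
  let ?I = "{int k <.. int (k + m)}"
  have wI: "ap w ` ?I = ?I" using Cons.prems(4)[of 0] by (simp add: seg_simps)
  obtain v where v: "v \<in> sym_grp k m" "\<And>z. z \<in> ?I \<Longrightarrow> ap v z = ap w z"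
    using sym_grp_full[of "ap w" k m] wI by (auto simp: inj_on_def apply_inj)
  have le: "k + m \<le> r" using Cons.prems(2) by simp
  have vA: "v \<in> generated (gens_A r)" by (rule sym_grp_A[OF v(1) le])
  have inv: "inverse u \<in> generated (gens_A r)" if u: "u \<in> generated (gens_A r)" for u
  proof -
    obtain us where us: "us \<in> lists (gens_A r)" "u = prod_list us" using u unfolding generated_def by auto
    show ?thesis unfolding us(2) using us(1)
    proof (induction us)
      case (Cons s us)
      then obtain i where s: "s = gen_s i" "0 < i" "i < r" by (auto simp: gens_A_def)
      then have "s * s = 1" using simple_sq[OF simple_gen_s] by blast
      then have "inverse s = s" by (metis perm.inverse_unique)
      then show ?case using Cons by (auto intro!: generated_mult[OF _ generated_gen])
    qed (simp add: generated_one)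
  qed
  have pv: "ap (inverse v) z = z" if "0 < z" "z \<le> int k \<or> int (k + m) < z" for z
    using sym_grp_fix[OF v(1) that] pos_eq[of v z z] by (simp add: pos_def)
  have "inverse v * w \<in> young_grp (k + m) ms"
  proof (rule Cons.IH)
    show "inverse v * w \<in> generated (gens_A r)" using inv[OF vA] Cons.prems(1) by (rule generated_mult)
    show "k + m + sum_list ms = r" using Cons.prems(2) by simp
    show "ap (inverse v * w) z = z" if z: "0 < z" "z \<le> int (k + m)" for z
    proof (cases "z \<le> int k")
      case True
      then show ?thesis using Cons.prems(3) z pv by (simp add: ap_mult)
    next
      case False
      then have "ap w z = ap v z" using v(2) z by simp
      then show ?thesis using pos_ap[of v z] by (simp add: ap_mult pos_def)
    qed
    show "ap (inverse v * w) ` seg (k + m) ms j = seg (k + m) ms j" if j: "j < length ms" for j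
    proof -
      have "ap w ` seg (k + m) ms j = seg (k + m) ms j" using Cons.prems(4)[of "Suc j"] j by (simp add: seg_simps)
      moreover have "ap (inverse v) ` seg (k + m) ms j = seg (k + m) ms j"
        using pv by (intro image_cong[of _ _ _ "\<lambda>z. z", simplified]) (auto simp: seg_def)
      moreover have "ap (inverse v * w) ` A = ap (inverse v) ` ap w ` A" for A
        by (auto simp: ap_mult image_image)
      ultimately show ?thesis by simp
    qed
  qed
  then have "v * (inverse v * w) \<in> young_grp k (m # ms)" using v(1) by auto
  then show ?case by (simp flip: mult.assoc)
qed

theorem young_eq:
  assumes r: "sum_list ms = r"
  shows "young r ms = young_grp 0 ms"
proof (intro subset_antisym subsetI)
  fix w
  have b: "block ms j = seg 0 ms j" for j by (simp add: block_def seg_def)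
  show "w \<in> young_grp 0 ms" if "w \<in> young r ms"
    using that r by (intro young_grp_full) (auto simp: young_def b)
  show "w \<in> young r ms" if "w \<in> young_grp 0 ms"
    using that r young_grp_seg[OF that] young_grp_A[OF that, of r] by (auto simp: young_def b)
qed

locale std_basis =
  fixes r :: nat and Q Qi :: "'h::{ring,monoid_mult}" and T :: "int perm \<Rightarrow> 'h"
  assumes rank: "2 \<le> r"
    and Qi_Q: "Qi * Q = 1" and Q_Qi: "Q * Qi = 1" and Q_central: "Q * h = h * Q"
    and T_one: "T 1 = 1"
    and T_mult: "s \<in> gens_D r \<Longrightarrow> w \<in> generated (gens_D r) \<Longrightarrow>
      word_length (gens_D r) w < word_length (gens_D r) (s * w) \<Longrightarrow> T s * T w = T (s * w)"
    and T_sq: "s \<in> gens_D r \<Longrightarrow> T s * T s = (Q - 1) * T s + Q"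
begin

lemma T_step:
  assumes "exact r w" "simple_refl r s x y" "pos w x < pos w y"
  shows "exact r (s * w)" "T (s * w) = T s * T w"
  using exact_step[OF rank assms] T_mult[of s w] assms by (auto simp: exact_def simple_refl_def)

lemma T_step_one: "simple_refl r s x y \<Longrightarrow> exact r s"
  using T_step(1)[OF exact_one, of s x y] simple_less by simp

lemma T_braid:
  assumes s: "simple_refl r s x y" and t: "simple_refl r t y z"
  shows "T s * T t * T s = T t * T s * T t"
proof -
  have xyz: "x = -1 \<and> y = 2 \<and> z = 3 \<or> 0 < x \<and> y = x + 1 \<and> z = x + 2"
    using s t by (auto simp: simple_refl_def)
  note p = pos_mult simple_pos[OF s] simple_pos[OF t] sgn_swap_def
  note es = T_step_one[OF s] and et = T_step_one[OF t]
  have "T (t * s) = T t * T s" "exact r (t * s)" using T_step[OF es t] xyz by (auto simp: p)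
  moreover have "T (s * (t * s)) = T s * T (t * s)"
    using T_step(2)[OF \<open>exact r (t * s)\<close> s] xyz by (auto simp: p)
  moreover have "T (s * t) = T s * T t" "exact r (s * t)" using T_step[OF et s] xyz by (auto simp: p)
  moreover have "T (t * (s * t)) = T t * T (s * t)"
    using T_step(2)[OF \<open>exact r (s * t)\<close> t] xyz by (auto simp: p)
  moreover have "s * (t * s) = t * (s * t)" using simple_braid[OF s t] by (simp add: mult.assoc)
  ultimately show ?thesis by (simp add: mult.assoc)
qed

lemma T_commute:
  assumes s: "simple_refl r s x y" and t: "simple_refl r t x' y'" and c: "s * t = t * s"
    and "sgn_swap x y x' < sgn_swap x y y'" "sgn_swap x' y' x < sgn_swap x' y' y"
  shows "T s * T t = T t * T s"
  using T_step(2)[OF T_step_one[OF s] t] T_step(2)[OF T_step_one[OF t] s] assms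
  by (simp add: simple_pos[OF s] simple_pos[OF t])

abbreviation S :: "nat \<Rightarrow> 'h" where "S i \<equiv> T (gen_s i)"

lemma S_braid:
  assumes "0 < i" "Suc i < r"
  shows "S i * S (Suc i) * S i = S (Suc i) * S i * S (Suc i)"
proof -
  have "simple_refl r (gen_s (Suc i)) (int i + 1) (int i + 2)"
    using simple_gen_s[of "Suc i" r] assms by (simp add: ac_simps)
  then show ?thesis using T_braid[OF simple_gen_s[of i r]] assms by auto
qed

lemma S_far:
  assumes "0 < i" "Suc i < j" "j < r"
  shows "S i * S j = S j * S i"
proof (rule T_commute[OF simple_gen_s simple_gen_s])
  show "gen_s i * gen_s j = gen_s j * gen_s i"
    using assms by (intro perm_eqI) (auto simp: ap_mult ap_gen_s sgn_swap_def)
qed (use assms in \<open>auto simp: sgn_swap_def\<close>)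

sublocale hecke_A r Q Qi "\<lambda>i. S (Suc i)"
proof
  show "S (Suc i) * S (Suc i) = (Q - 1) * S (Suc i) + Q" if "i + 1 < r" for i
    using that by (intro T_sq) (auto simp: gens_D_def gens_A_def)
  show "S (Suc i) * S (Suc (i + 1)) * S (Suc i) = S (Suc (i + 1)) * S (Suc i) * S (Suc (i + 1))"
    if "i + 2 < r" for i using S_braid[of "Suc i"] that by simp
  show "S (Suc i) * S (Suc j) = S (Suc j) * S (Suc i)" if "i + 1 < j" "j + 1 < r" for i j
    using S_far[of "Suc i" "Suc j"] that by simp
qed (rule Qi_Q Q_Qi Q_central)+

abbreviation U :: 'h where "U \<equiv> T gen_u"

lemma U_S1: "U * S 1 = S 1 * U"
proof (rule T_commute[OF simple_gen_u simple_gen_s])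
  show "gen_u * gen_s 1 = gen_s 1 * gen_u"
    by (rule perm_eqI) (auto simp: ap_mult ap_gen_s ap_gen_u sgn_swap_def)
qed (use rank in \<open>auto simp: sgn_swap_def\<close>)

lemma T_elt_u_mult:
  assumes "2 \<le> i" "i \<le> r" "exact r w" "inc w {1..int i}" "0 < pos w 1"
  shows "exact r (elt_u i * w) \<and> T (elt_u i * w) = T (elt_u i) * T w \<and>
    (\<forall>j. 2 \<le> j \<longrightarrow> Suc j = i \<longrightarrow> T (elt_u i) = S j * T (elt_u j) * S j) \<and> (i = 2 \<longrightarrow> T (elt_u i) = U * S 1)"
  using assms
proof (induction i arbitrary: w rule: nat_induct_at_least)
  case base
  have s: "simple_refl r (gen_s 1) 1 2" using simple_gen_s[of 1 r] rank by simp
  have u: "simple_refl r gen_u (-1) 2" using simple_gen_u rank by simp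
  have *: "exact r (gen_u * (gen_s 1 * v)) \<and> T (gen_u * (gen_s 1 * v)) = U * S 1 * T v"
    if v: "exact r v" "inc v {1..int 2}" "0 < pos v 1" for v
  proof -
    have lt: "pos v 1 < pos v 2" using v(2) by (simp add: inc_def)
    have n: "pos v (- z) = - pos v z" for z using v(1) by (auto simp: exact_def signed_pos_neg)
    note 1 = T_step[OF v(1) s lt]
    have "pos (gen_s 1 * v) (- 1) < pos (gen_s 1 * v) 2"
      using v(3) lt n[of 2] by (simp add: pos_mult simple_pos[OF s] sgn_swap_def del: One_nat_def)
    note T_step[OF 1(1) u this]
    then show ?thesis using 1 by (simp add: mult.assoc)
  qed
  have "T (elt_u 2) = U * S 1" using *[of 1] exact_one by (simp add: elt_u_2 inc_def T_one)
  then show ?case using *[OF base.prems(2-)] by (simp add: elt_u_2 mult.assoc)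
next
  case (Suc i)
  have s: "simple_refl r (gen_s i) (int i) (int i + 1)" using simple_gen_s[of i r] Suc by simp
  have *: "exact r (elt_u (Suc i) * v) \<and> T (elt_u (Suc i) * v) = S i * T (elt_u i) * S i * T v"
    if v: "exact r v" "inc v {1..int (Suc i)}" "0 < pos v 1" for v
  proof -
    have lt: "pos v x < pos v y" if "1 \<le> x" "x < y" "y \<le> int i + 1" for x y
      using v(2) that by (simp add: inc_def)
    have n: "pos v (- z) = - pos v z" for z using v(1) by (auto simp: exact_def signed_pos_neg)
    have p: "0 < pos v z" if "1 \<le> z" "z \<le> int i + 1" for z
      using lt[of 1 z] v(3) that by (cases "z = 1") auto
    let ?v = "gen_s i * v"
    note 1 = T_step[OF v(1) s lt[of "int i" "int i + 1"]]
    have pv: "pos ?v z = pos v (sgn_swap (int i) (int i + 1) z)" for z by (simp add: pos_mult simple_pos[OF s])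
    have "inc ?v {1..int i}" unfolding inc_def
    proof (intro ballI impI)
      fix x y assume "x \<in> {1..int i}" "y \<in> {1..int i}" "x < y"
      then show "pos ?v x < pos ?v y" unfolding pv sgn_swap_def using lt[of x y] lt[of x "int i + 1"] by auto
    qed
    moreover have "0 < pos ?v 1" unfolding pv using Suc.hyps p[of 1] by (simp add: sgn_swap_def)
    moreover have "exact r ?v" using 1(1) Suc.hyps by simp
    ultimately have 2: "exact r (elt_u i * ?v)" "T (elt_u i * ?v) = T (elt_u i) * T ?v"
      using Suc.IH[of ?v] Suc.prems(1) by auto
    have "pos (elt_u i * ?v) (int i) = - pos v (int i + 1)" "pos (elt_u i * ?v) (int i + 1) = pos v (int i)"
      using Suc.hyps n[of "int i + 1"] by (auto simp: pos_mult[of "elt_u i"] pos_elt_u pv sgn_swap_def)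
    then have "pos (elt_u i * ?v) (int i) < pos (elt_u i * ?v) (int i + 1)"
      using p[of "int i"] p[of "int i + 1"] Suc.hyps by simp
    note 3 = T_step[OF 2(1) s this]
    have "gen_s i * (elt_u i * ?v) = elt_u (Suc i) * v" using elt_u_Suc[OF Suc.hyps] by (simp add: mult.assoc)
    then show ?thesis using 1(2) 2(2) 3 Suc.hyps by (simp add: mult.assoc)
  qed
  have "T (elt_u (Suc i)) = S i * T (elt_u i) * S i" using *[of 1] exact_one by (simp add: inc_def T_one)
  then show ?case using *[OF Suc.prems(2-)] Suc.hyps by auto
qed

lemma T_elt_u:
  shows "T (elt_u 2) = U * S 1"
    and "2 \<le> i \<Longrightarrow> i < r \<Longrightarrow> T (elt_u (Suc i)) = S i * T (elt_u i) * S i"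
  using T_elt_u_mult[of 2 1] T_elt_u_mult[of "Suc i" 1] exact_one rank by (auto simp: inc_def)

lemma T_cyc:
  assumes "i \<le> b" "b < r" "exact r w" "inc w {int b + 1 - int i..int b + 1}"
  shows "exact r (cyc b i * w) \<and> T (cyc b i * w) = dw b i * T w"
  using assms
proof (induction i arbitrary: w)
  case (Suc i)
  have eq: "int (b - i) = int b - int i" using Suc.prems(1) by simp
  have s: "simple_refl r (gen_s (b - i)) (int b - int i) (int b - int i + 1)"
    using simple_gen_s[of "b - i" r] Suc.prems(1,2) unfolding eq by simp
  let ?w = "gen_s (b - i) * w"
  have lt: "pos w x < pos w y" if "int b - int i \<le> x" "x < y" "y \<le> int b + 1" for x y
    using Suc.prems(4) that by (simp add: inc_def)
  have 1: "exact r ?w" "T ?w = S (b - i) * T w"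
    using T_step[OF Suc.prems(3) s] lt[of "int b - int i" "int b - int i + 1"] by auto
  have "inc ?w {int b + 1 - int i..int b + 1}" unfolding inc_def
  proof (intro ballI impI)
    fix x y assume xy: "x \<in> {int b + 1 - int i..int b + 1}" "y \<in> {int b + 1 - int i..int b + 1}" "x < y"
    have "pos ?w x = pos w (if x = int b - int i + 1 then int b - int i else x)"
      "pos ?w y = pos w y"
      using xy Suc.prems(1) by (auto simp: pos_mult simple_pos[OF s] sgn_swap_def)
    then show "pos ?w x < pos ?w y" using lt[of "int b - int i" y] lt[of x y] xy by auto
  qed
  then have "exact r (cyc b i * ?w) \<and> T (cyc b i * ?w) = dw b i * T ?w"
    using Suc.IH[OF _ Suc.prems(2) 1(1)] Suc.prems(1) by simp
  moreover have "Suc (b - Suc i) = b - i" using Suc.prems(1) by simp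
  ultimately show ?case using 1(2) by (simp add: mult.assoc)
qed simp

lemma inc_cyc:
  assumes "i \<le> m" "inc w {int k + 1..int k + 1 + int m}"
  shows "inc (cyc (k + m) i * w) {int k + 1..int k + int m}"
proof -
  have "pos (cyc (k + m) i) z = (if z < int (k + m) + 1 - int i then z else z + 1)"
    if "z \<in> {int k + 1..int k + int m}" for z
    using that assms(1) by (intro pos_eq, subst ap_cyc) auto
  then show ?thesis using assms by (auto simp: inc_def pos_mult)
qed

lemma T_sym_grp:
  assumes "v \<in> sym_grp k m" "k + m \<le> r" "exact r w" "inc w {int k + 1..int k + int m}"
  shows "exact r (v * w) \<and> T (v * w) = T v * T w"
  using assms
proof (induction m arbitrary: v w)
  case 0
  then show ?case by (simp add: T_one)
next
  case (Suc m)
  obtain v' i where v: "v = v' * cyc (k + m) i" "v' \<in> sym_grp k m" "i \<le> m" using Suc.prems(1) by auto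
  have *: "exact r (v * u) \<and> T (v * u) = T v' * dw (k + m) i * T u"
    if u: "exact r u" "inc u {int k + 1..int k + 1 + int m}" for u
  proof -
    have "inc u {int (k + m) + 1 - int i..int (k + m) + 1}"
      using u(2) v(3) by (auto simp: inc_def)
    then have c: "exact r (cyc (k + m) i * u)" "T (cyc (k + m) i * u) = dw (k + m) i * T u"
      using T_cyc[of i "k + m" u] v(3) Suc.prems(2) u(1) by auto
    have "exact r (v' * (cyc (k + m) i * u)) \<and> T (v' * (cyc (k + m) i * u)) = T v' * T (cyc (k + m) i * u)"
      using Suc.IH[OF v(2) _ c(1) inc_cyc[OF v(3) u(2)]] Suc.prems(2) by simp
    then show ?thesis using c(2) v(1) by (simp add: mult.assoc)
  qed
  have "T v = T v' * dw (k + m) i" using *[of 1] exact_one by (simp add: inc_def T_one)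
  then show ?case using *[of w] Suc.prems(3,4) by (simp add: algebra_simps)
qed

lemma sum_sym_grp: "k + m \<le> r \<Longrightarrow> (\<Sum>v\<in>sym_grp k m. T v) = symz k m"
proof (induction m)
  case (Suc m)
  have "T (v * cyc (k + m) i) = T v * dw (k + m) i" if v: "v \<in> sym_grp k m" "i \<le> m" for v i
  proof -
    have c: "exact r (cyc (k + m) i)" "T (cyc (k + m) i) = dw (k + m) i"
      using T_cyc[of i "k + m" 1] v(2) Suc.prems exact_one by (auto simp: inc_def T_one)
    have "inc (cyc (k + m) i * 1) {int k + 1..int k + int m}"
      by (rule inc_cyc[OF v(2)]) (simp add: inc_def)
    then show ?thesis using T_sym_grp[OF v(1) _ c(1)] Suc.prems c(2) by simp
  qed
  then have "(\<Sum>v\<in>sym_grp k (Suc m). T v) = (\<Sum>(v, i)\<in>sym_grp k m \<times> {..m}. T v * dw (k + m) i)"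
    by (simp only: sym_grp.simps sum.reindex[OF sym_grp_inj] comp_def) (auto intro!: sum.cong)
  also have "\<dots> = (\<Sum>v\<in>sym_grp k m. T v) * Zd k m"
    by (simp add: Zd_def sum_product sum.cartesian_product finite_sym_grp)
  finally show ?case using Suc by simp
qed (simp add: T_one)

lemma exact_young_grp:
  "w \<in> young_grp k ms \<Longrightarrow> k + sum_list ms \<le> r \<Longrightarrow> exact r w"
proof (induction ms arbitrary: k w)
  case (Cons m ms)
  then obtain v u where w: "w = v * u" "v \<in> sym_grp k m" "u \<in> young_grp (k + m) ms" by auto
  have "pos u z = z" if "z \<in> {int k + 1..int k + int m}" for z
    using young_grp_fix[OF w(3), of z] that by (intro pos_eq) auto
  then have "inc u {int k + 1..int k + int m}" by (simp add: inc_def)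
  then show ?case using T_sym_grp[OF w(2) _ Cons.IH[OF w(3)]] Cons.prems w(1) by simp
qed (simp add: exact_one)

lemma sum_young_grp: "k + sum_list ms \<le> r \<Longrightarrow> (\<Sum>w\<in>young_grp k ms. T w) = sfac k ms"
proof (induction ms arbitrary: k)
  case (Cons m ms)
  have "T (v * u) = T v * T u" if "v \<in> sym_grp k m" "u \<in> young_grp (k + m) ms" for v u
  proof -
    have "pos u z = z" if "z \<in> {int k + 1..int k + int m}" for z
      using young_grp_fix[OF \<open>u \<in> young_grp (k + m) ms\<close>, of z] that by (intro pos_eq) auto
    then have "inc u {int k + 1..int k + int m}" by (simp add: inc_def)
    then show ?thesis using T_sym_grp[OF that(1)] exact_young_grp[OF that(2)] Cons.prems by simp
  qed
  then have "(\<Sum>w\<in>young_grp k (m # ms). T w) = (\<Sum>(v, u)\<in>sym_grp k m \<times> young_grp (k + m) ms. T v * T u)"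
    by (simp only: young_grp.simps sum.reindex[OF young_grp_inj] comp_def) (auto intro!: sum.cong)
  also have "\<dots> = (\<Sum>v\<in>sym_grp k m. T v) * (\<Sum>u\<in>young_grp (k + m) ms. T u)"
    by (simp add: sum_product sum.cartesian_product finite_sym_grp finite_young_grp)
  finally show ?case using Cons sum_sym_grp[of k m] by simp
qed (simp add: T_one)

theorem sum_young: "sum_list ms = r \<Longrightarrow> (\<Sum>w\<in>young r ms. T w) = sfac 0 ms"
  using sum_young_grp[of 0 ms] young_eq[of ms r] by simp

end

section \<open>The flip\<close>

lemma flip_mult: "flip_D (v * w) = flip_D v * flip_D w"
  by (simp add: flip_D_def mult.assoc) (simp add: gen_s0_sq flip: mult.assoc)

lemma flip_flip: "flip_D (flip_D w) = w"
  by (simp add: flip_D_def mult.assoc gen_s0_sq) (simp add: gen_s0_sq flip: mult.assoc)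

lemma flip_one: "flip_D 1 = 1"
  by (simp add: flip_D_def gen_s0_sq)

lemma flip_gen_s: "2 \<le> i \<Longrightarrow> flip_D (gen_s i) = gen_s i"
  by (rule perm_eqI) (auto simp: flip_D_def ap_mult ap_gen_s ap_gen_s0 sgn_swap_def)

lemma flip_gen_s1: "flip_D (gen_s 1) = gen_u"
  by (simp add: flip_D_def gen_u_def)

lemma flip_gen_u: "flip_D gen_u = gen_s 1"
  by (metis flip_flip flip_gen_s1)

lemma flip_gens: "2 \<le> r \<Longrightarrow> s \<in> gens_D r \<Longrightarrow> flip_D s \<in> gens_D r"
proof -
  assume r: "2 \<le> r" and s: "s \<in> gens_D r"
  consider "s = gen_u" | i where "s = gen_s i" "1 \<le> i" "i < r"
    using s unfolding gens_D_alt gens_A_def by auto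
  then show ?thesis
  proof cases
    case 1
    then show ?thesis using r gen_in_A[of 1 r] by (simp add: flip_gen_u gens_D_alt)
  next
    case 2
    then show ?thesis using flip_gen_s[of i] gen_in_A[of i r] by (cases "i = 1") (auto simp: flip_gen_s1[unfolded One_nat_def] gens_D_alt)
  qed
qed

lemma flip_prod_list: "flip_D (prod_list ws) = prod_list (map flip_D ws)"
  by (induction ws) (auto simp: flip_one flip_mult)

lemma flip_words: "2 \<le> r \<Longrightarrow> ws \<in> lists (gens_D r) \<Longrightarrow> map flip_D ws \<in> lists (gens_D r)"
  using flip_gens by auto

lemma flip_generated: "2 \<le> r \<Longrightarrow> w \<in> generated (gens_D r) \<Longrightarrow> flip_D w \<in> generated (gens_D r)"
  unfolding generated_def using flip_words[of r] by (elim imageE) (simp only: flip_prod_list image_eqI)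

lemma flip_word_length:
  assumes "2 \<le> r" "w \<in> generated (gens_D r)"
  shows "word_length (gens_D r) (flip_D w) = word_length (gens_D r) w"
proof -
  have le: "word_length (gens_D r) (flip_D v) \<le> word_length (gens_D r) v" if v: "v \<in> generated (gens_D r)" for v
  proof -
    obtain ws where "ws \<in> lists (gens_D r)" "length ws = word_length (gens_D r) v" "prod_list ws = v"
      by (rule word_length_attained[OF v])
    then show ?thesis using word_length_le[OF flip_words[OF assms(1)], of ws] by (simp add: flip_prod_list[symmetric])
  qed
  show ?thesis using le[OF assms(2)] le[OF flip_generated[OF assms]] by (simp add: flip_flip)
qed

lemma (in std_basis) flipped: "std_basis r Q Qi (\<lambda>w. T (flip_D w))"
proof
  fix s w assume s: "s \<in> gens_D r" and w: "w \<in> generated (gens_D r)"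
    and "word_length (gens_D r) w < word_length (gens_D r) (s * w)"
  moreover have "s * w \<in> generated (gens_D r)" using s w generated_gen generated_mult by blast
  ultimately show "T (flip_D s) * T (flip_D w) = T (flip_D (s * w))"
    using flip_gens[OF rank s] flip_generated[OF rank w] flip_word_length[OF rank]
    by (simp add: T_mult flip_mult[symmetric])
qed (auto simp: rank Qi_Q Q_Qi Q_central T_one flip_one intro!: T_sq flip_gens)

lemma inj_flip: "inj_on flip_D A"
  by (metis flip_flip inj_onI)

section \<open>Two by two matrices\<close>

datatype 'a mat2 = Mat2 (m11: 'a) (m12: 'a) (m21: 'a) (m22: 'a)

instantiation mat2 :: ("{ring,monoid_mult}") "{ring,monoid_mult}"
begin

definition "0 = Mat2 0 0 0 0"
definition "1 = Mat2 1 0 0 1"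
definition "X + Y = Mat2 (m11 X + m11 Y) (m12 X + m12 Y) (m21 X + m21 Y) (m22 X + m22 Y)"
definition "X - Y = Mat2 (m11 X - m11 Y) (m12 X - m12 Y) (m21 X - m21 Y) (m22 X - m22 Y)"
definition "- X = Mat2 (- m11 X) (- m12 X) (- m21 X) (- m22 X)"
definition "X * Y = Mat2 (m11 X * m11 Y + m12 X * m21 Y) (m11 X * m12 Y + m12 X * m22 Y)
   (m21 X * m11 Y + m22 X * m21 Y) (m21 X * m12 Y + m22 X * m22 Y)"

instance
  by standard (simp_all add: zero_mat2_def one_mat2_def plus_mat2_def minus_mat2_def uminus_mat2_def
      times_mat2_def algebra_simps)

end

lemmas mat2_simps = zero_mat2_def one_mat2_def plus_mat2_def minus_mat2_def uminus_mat2_def times_mat2_def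

lemma m_mult:
  "m11 (X * Y) = m11 X * m11 Y + m12 X * m21 Y" "m12 (X * Y) = m11 X * m12 Y + m12 X * m22 Y"
  "m21 (X * Y) = m21 X * m11 Y + m22 X * m21 Y" "m22 (X * Y) = m21 X * m12 Y + m22 X * m22 Y"
  by (simp_all add: times_mat2_def)

lemma m_sum:
  "m11 (sum f A) = (\<Sum>i\<in>A. m11 (f i))" "m12 (sum f A) = (\<Sum>i\<in>A. m12 (f i))"
  "m21 (sum f A) = (\<Sum>i\<in>A. m21 (f i))" "m22 (sum f A) = (\<Sum>i\<in>A. m22 (f i))"
  by (induction A rule: infinite_finite_induct) (simp_all add: mat2_simps)

definition diag :: "'a::{ring,monoid_mult} \<Rightarrow> 'a \<Rightarrow> 'a mat2" where "diag a b = Mat2 a 0 0 b"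

lemma diag_mult: "diag a b * diag c d = diag (a * c) (b * d)"
  by (simp add: diag_def mat2_simps)

lemma diag_one: "diag 1 1 = 1"
  by (simp add: diag_def mat2_simps)

lemma diag_sum: "(\<Sum>i\<in>A. diag (f i) (h i)) = diag (sum f A) (sum h A)"
  by (rule mat2.expand) (simp add: m_sum diag_def)

lemma diag_power: "diag a b ^ n = diag (a ^ n) (b ^ n)"
  by (induction n) (simp_all add: diag_one diag_mult)

definition swap2 :: "'a::{ring,monoid_mult} mat2" where "swap2 = Mat2 0 1 1 0"

text \<open>A matrix fixed by the permutation of its rows and of its columns, up to the sign \<open>s\<close>.\<close>

definition const2 :: "bool \<Rightarrow> 'a::{ring,monoid_mult} \<Rightarrow> 'a mat2" where
  "const2 s y = (if s then Mat2 y y y y else Mat2 y (- y) (- y) y)"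

definition signed_by :: "bool \<Rightarrow> 'a::ring \<Rightarrow> 'a" where
  "signed_by s x = (if s then x else - x)"

locale std_basis_units = std_basis r Q Qi T
  for r :: nat and Q Qi :: "'h::{ring,monoid_mult}" and T :: "int perm \<Rightarrow> 'h" +
  assumes units: "j < r \<Longrightarrow> is_unit_elt (1 + Q ^ j)"
begin

interpretation F: std_basis r Q Qi "\<lambda>w. T (flip_D w)" by (rule flipped)

definition gm :: "nat \<Rightarrow> 'h mat2" where "gm i = diag (S (Suc i)) (T (flip_D (gen_s (Suc i))))"

lemma gm_0: "gm 0 = diag (S 1) U"
  using flip_gen_s1 by (simp add: gm_def)

lemma gm_Suc: "gm (Suc i) = diag (S (Suc (Suc i))) (S (Suc (Suc i)))"
  by (simp add: gm_def flip_gen_s)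

interpretation B: hecke_B r "diag Q Q" "diag Qi Qi" gm swap2
proof
  show "diag Qi Qi * diag Q Q = 1" "diag Q Q * diag Qi Qi = 1"
    by (simp_all add: diag_mult Qi_Q Q_Qi diag_one)
  show "diag Q Q * gm i = gm i * diag Q Q" for i
    unfolding gm_def diag_mult using Q_central by metis
  show "gm i * gm i = (diag Q Q - 1) * gm i + diag Q Q" if "i + 1 < r" for i
    using quad[OF that] F.quad[OF that] by (simp add: gm_def diag_mult) (simp add: diag_def mat2_simps)
  show "gm i * gm (i + 1) * gm i = gm (i + 1) * gm i * gm (i + 1)" if "i + 2 < r" for i
    using braid[OF that] F.braid[OF that] by (simp add: gm_def diag_mult)
  show "gm i * gm j = gm j * gm i" if "i + 1 < j" "j + 1 < r" for i j
    using far[OF that] F.far[OF that] by (simp add: gm_def diag_mult)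
  show "0 < r" using rank by simp
  show "diag Q Q * swap2 = swap2 * diag Q Q" by (simp add: diag_def swap2_def mat2_simps)
  show "swap2 * swap2 = (1 :: 'h mat2)" by (simp add: swap2_def mat2_simps)
  show "swap2 * gm i = gm i * swap2" if "0 < i" for i
    using that gm_Suc[of "i - 1"] by (simp add: diag_def swap2_def mat2_simps)
  show "swap2 * gm 0 * swap2 * gm 0 = gm 0 * swap2 * gm 0 * swap2"
    unfolding gm_0 using U_S1 by (simp add: diag_def swap2_def mat2_simps)
  show "is_unit_elt (1 + diag Q Q ^ j)" if j: "j < r" for j
  proof -
    obtain y where "y * (1 + Q ^ j) = 1" "(1 + Q ^ j) * y = 1"
      using units[OF j] unfolding is_unit_elt_def by blast
    then have "diag y y * (1 + diag Q Q ^ j) = 1 \<and> (1 + diag Q Q ^ j) * diag y y = 1"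
      unfolding diag_power by (simp add: diag_def mat2_simps)
    then show ?thesis unfolding is_unit_elt_def by blast
  qed
qed

lemma B_dw: "B.dw b i = diag (dw b i) (F.dw b i)"
proof (induction i)
  case (Suc i)
  show ?case unfolding B.dw.simps(2) Suc.IH gm_def[of "b - Suc i"] diag_mult dw.simps(2) F.dw.simps(2) ..
qed (simp add: diag_one)

lemma B_symz: "B.symz k m = diag (symz k m) (F.symz k m)"
  by (induction m) (simp_all add: diag_one diag_mult B.Zd_def Zd_def F.Zd_def B_dw diag_sum)

lemma B_sfac: "B.sfac k ms = diag (sfac k ms) (F.sfac k ms)"
  by (induction ms arbitrary: k) (simp_all add: diag_one diag_mult B_symz)

definition piQ :: "nat \<Rightarrow> 'h" where
  "piQ a = (\<Prod>i\<leftarrow>[2..<Suc a]. Q ^ (i - 1) + T (elt_u i))"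

lemma piQ_Suc: "0 < a \<Longrightarrow> piQ (Suc a) = piQ a * (Q ^ a + T (elt_u (Suc a)))"
  by (cases a) (auto simp: piQ_def)

lemma Qi_central: "Qi * h = h * Qi"
proof -
  have "Qi * h = Qi * (h * Q) * Qi" by (simp add: mult.assoc Q_Qi)
  also have "\<dots> = Qi * (Q * h) * Qi" by (simp only: Q_central)
  also have "\<dots> = h * Qi" by (simp only: mult.assoc[symmetric] Qi_Q mult_1_left)
  finally show ?thesis .
qed

lemma Qi_power_central: "Qi ^ n * h = h * Qi ^ n"
  by (induction n) (simp_all add: mult.assoc, metis Qi_central mult.assoc)

lemma Q_power_central: "Q ^ n * h = h * Q ^ n"
  by (induction n) (simp_all add: mult.assoc, metis Q_central mult.assoc)

lemma Q_Qi_power: "Q ^ n * Qi ^ n = 1" "Qi ^ n * Q ^ n = 1"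
proof -
  show 1: "Q ^ n * Qi ^ n = 1"
  proof (induction n)
    case (Suc n)
    have "Q ^ Suc n * Qi ^ Suc n = Q * (Q ^ n * Qi ^ n) * Qi"
      by (simp only: power_Suc power_Suc2[of Qi] mult.assoc) (simp only: power_commutes)
    then show ?case using Suc Q_Qi by simp
  qed simp
  show "Qi ^ n * Q ^ n = 1" using 1 Q_power_central by metis
qed

text \<open>The Jucys--Murphy elements of the algebra of type B are the reflections \<open>t\<^sub>i\<close> up to a power of
  \<open>q\<close>; after multiplication with \<open>t\<^sub>1\<close> they become the elements \<open>u\<^sub>i\<close>.\<close>

lemma B_JM:
  assumes "Suc n < r"
  shows "B.JM (Suc n) = Mat2 0 (Qi ^ Suc n * T (elt_u (Suc (Suc n)))) (Qi ^ Suc n * T (elt_u (Suc (Suc n)))) 0"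
  using assms
proof (induction n)
  case 0
  have "T (elt_u (Suc (Suc 0))) = U * S 1" using T_elt_u(1) by (simp add: numeral_2_eq_2)
  then show ?case using U_S1 by (simp add: gm_0) (simp add: diag_def swap2_def mat2_simps)
next
  case (Suc n)
  let ?t = "T (elt_u (Suc (Suc n)))" and ?s = "S (Suc (Suc n))"
  have t: "T (elt_u (Suc (Suc (Suc n)))) = ?s * ?t * ?s" using T_elt_u(2)[of "Suc (Suc n)"] Suc.prems by simp
  have "?s * (Qi ^ Suc n * ?t) * ?s = Qi ^ Suc n * (?s * ?t * ?s)"
    using Qi_power_central[of "Suc n" ?s] by (simp only: mult.assoc[symmetric])
  then have "Qi * (?s * (Qi ^ Suc n * ?t) * ?s) = Qi ^ Suc (Suc n) * T (elt_u (Suc (Suc (Suc n))))"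
    unfolding t by (simp add: mult.assoc)
  moreover have "B.JM (Suc n) = Mat2 0 (Qi ^ Suc n * ?t) (Qi ^ Suc n * ?t) 0" using Suc by simp
  ultimately show ?case unfolding B.JM.simps(2)[of "Suc n"] gm_Suc
    by (simp only: diag_def times_mat2_def mat2.sel) simp
qed

lemma B_PP:
  assumes "0 < a" "a \<le> r"
  shows "\<exists>N. B.PP s a = const2 s (Qi ^ N * piQ a)"
  using assms
proof (induction a)
  case (Suc a)
  show ?case
  proof (cases "a = 0")
    case True
    have "B.PP s 1 = 1 + B.sg s swap2" by (simp add: B.PP_def)
    also have "\<dots> = const2 s 1" by (simp add: B.sg_def const2_def swap2_def mat2_simps)
    finally have "B.PP s 1 = const2 s 1" .
    then show ?thesis using True by (intro exI[of _ 0]) (simp add: piQ_def)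
  next
    case False
    then obtain N where N: "B.PP s a = const2 s (Qi ^ N * piQ a)" using Suc by auto
    let ?u = "T (elt_u (Suc a))" and ?y = "Qi ^ N * piQ a"
    have "B.JM a = Mat2 0 (Qi ^ a * ?u) (Qi ^ a * ?u) 0" using B_JM[of "a - 1"] False Suc.prems by simp
    then have "B.PP s (Suc a) = const2 s (?y * (1 + Qi ^ a * ?u))"
      unfolding B.PP_Suc N by (simp add: B.sg_def const2_def mat2_simps algebra_simps)
    also have "1 + Qi ^ a * ?u = Qi ^ a * (Q ^ a + ?u)" using Q_Qi_power by (simp add: distrib_left)
    also have "?y * (Qi ^ a * (Q ^ a + ?u)) = Qi ^ N * (piQ a * Qi ^ a) * (Q ^ a + ?u)" by (simp only: mult.assoc)
    also have "\<dots> = Qi ^ (N + a) * piQ (Suc a)"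
      unfolding Qi_power_central[of a "piQ a", symmetric] using False by (simp add: piQ_Suc power_add mult.assoc)
    finally show ?thesis by blast
  qed
qed simp

lemma const2_diag:
  "const2 s p * diag x y = diag x' y' * const2 s p \<longleftrightarrow> p * x = x' * p \<and> p * y = x' * p \<and> p * x = y' * p \<and> p * y = y' * p"
  by (auto simp: const2_def diag_def mat2_simps)

lemma pi_commute:
  assumes "sum_list ms + sum_list ns = r" "0 < sum_list ms" "B.PP s (sum_list ms) = const2 s p"
  shows "p * F.sfac 0 (ms @ ns) = p * sfac 0 (ms @ ns)" "sfac 0 (ms @ ns) * p = p * sfac 0 (ms @ ns)"
  using B.PP_sfac[of ms ns s] assms(1) unfolding assms(3) B_sfac const2_diag by auto

definition xQ :: "nat list \<Rightarrow> nat list \<Rightarrow> 'h" where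
  "xQ ms ns = piQ (sum_list ms) * sfac 0 (ms @ ns)"

lemma PP_sfac_matrix:
  assumes "sum_list ms + sum_list ns = r" "0 < sum_list ms"
  obtains N where "B.PP s (sum_list ms) = const2 s (Qi ^ N * piQ (sum_list ms))"
    "B.PP s (sum_list ms) * B.sfac 0 (ms @ ns) = const2 s (Qi ^ N * xQ ms ns)"
proof -
  obtain N where N: "B.PP s (sum_list ms) = const2 s (Qi ^ N * piQ (sum_list ms))"
    using B_PP[of "sum_list ms" s] assms by auto
  moreover have "B.PP s (sum_list ms) * B.sfac 0 (ms @ ns) = const2 s (Qi ^ N * xQ ms ns)"
    using pi_commute(1)[OF assms N] unfolding N B_sfac
    by (simp add: const2_def diag_def mat2_simps xQ_def mult.assoc)
  ultimately show ?thesis by (rule that)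
qed

lemma unit_multiple:
  assumes "c * d = 1" "\<And>h. d * h = h * d" "\<exists>e. a * x = (c * y) * e" "\<exists>e. b * (c * y) = x * (e :: 'h)"
  shows "\<exists>e. a * x = y * e" "\<exists>e. b * y = x * e"
proof -
  have c: "c * h = h * c" for h
  proof -
    have "c * h = c * h * (d * c)" using assms(1,2) by (metis mult_1_right)
    also have "\<dots> = h * c"
      by (metis assms(1,2) mult.assoc mult_1_left)
    finally show ?thesis .
  qed
  obtain e where "a * x = c * y * e" using assms(3) by blast
  then have "a * x = y * (c * e)" using c[of y] by (simp add: mult.assoc)
  then show "\<exists>e. a * x = y * e" by blast
  obtain e where e: "b * (c * y) = x * e" using assms(4) by blast
  have "b * y = b * (c * d * y)" using assms(1) by simp
  also have "\<dots> = b * (c * y) * d" using assms(2)[of y] by (simp only: mult.assoc)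
  also have "\<dots> = x * (e * d)" unfolding e by (simp only: mult.assoc)
  finally show "\<exists>e. b * y = x * e" by blast
qed

definition majority_set :: "'h set" where
  "majority_set = {xQ ms ns | ms ns. length ms = r \<and> length ns = r \<and> sum_list ms + sum_list ns = r \<and>
     sum_list ns \<le> sum_list ms}"

theorem summand_majority:
  assumes ms: "sum_list ms = r" "length ms = r"
  shows "summand (sfac 0 ms) majority_set" "summand (F.sfac 0 ms) majority_set"
proof -
  let ?x = "sfac 0 ms" and ?x' = "F.sfac 0 ms" and ?X = "B.sfac 0 ms"
  have X: "m11 ?X = ?x" "m12 ?X = 0" "m21 ?X = 0" "m22 ?X = ?x'" by (simp_all add: B_sfac diag_def)
  obtain a b and P :: "(nat \<times> nat) list set" where P: "finite P" "(\<Sum>ps\<in>P. b ps * a ps * ?X) = ?X"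
    and q: "\<forall>ps\<in>P. \<exists>s qs. totals qs = ms \<and> sum_list (map snd qs) \<le> sum_list (map fst qs) \<and>
      (\<exists>c. a ps * ?X = B.PP s (sum_list (map fst qs)) * B.sfac 0 (map fst qs @ map snd qs) * c) \<and>
      (\<exists>c. b ps * (B.PP s (sum_list (map fst qs)) * B.sfac 0 (map fst qs @ map snd qs)) = ?X * c)"
    using B.sfac_majority[OF ms(1)] by blast
  have "\<exists>s y. y \<in> majority_set \<and>
      (\<exists>c. m11 (a ps) * ?x = y * c) \<and> (\<exists>c. (m11 (b ps) + signed_by s (m12 (b ps))) * y = ?x * c) \<and>
      (\<exists>c. m22 (a ps) * ?x' = y * c) \<and> (\<exists>c. (m22 (b ps) + signed_by s (m21 (b ps))) * y = ?x' * c) \<and>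
      m21 (a ps) * ?x = signed_by s (m11 (a ps) * ?x) \<and> m12 (a ps) * ?x' = signed_by s (m22 (a ps) * ?x')" if ps: "ps \<in> P" for ps
  proof -
    from bspec[OF q ps] obtain s qs c d where qs: "totals qs = ms" "sum_list (map snd qs) \<le> sum_list (map fst qs)"
      and c: "a ps * ?X = B.PP s (sum_list (map fst qs)) * B.sfac 0 (map fst qs @ map snd qs) * c"
      and d: "b ps * (B.PP s (sum_list (map fst qs)) * B.sfac 0 (map fst qs @ map snd qs)) = ?X * d" by blast
    have r: "sum_list (map fst qs) + sum_list (map snd qs) = r" using B.sum_il(3)[of qs] qs(1) ms by simp
    have "0 < sum_list (map fst qs)" using r qs(2) rank by linarith
    from PP_sfac_matrix[OF r this, of s] obtain N where
      N: "B.PP s (sum_list (map fst qs)) * B.sfac 0 (map fst qs @ map snd qs) =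
        const2 s (Qi ^ N * xQ (map fst qs) (map snd qs))" by metis
    define y where "y = xQ (map fst qs) (map snd qs)"
    define z where "z = Qi ^ N * y"
    have c: "a ps * ?X = const2 s z * c" and d: "b ps * const2 s z = ?X * d"
      using c d unfolding N z_def y_def by auto
    have len: "length qs = r" using arg_cong[OF qs(1), of length] ms(2) by simp
    have y: "y \<in> majority_set" unfolding majority_set_def y_def
      by (intro CollectI exI[of _ "map fst qs"] exI[of _ "map snd qs"]) (use r qs(2) len in simp)
    note cc = arg_cong[OF c, of m11] arg_cong[OF c, of m12] arg_cong[OF c, of m21] arg_cong[OF c, of m22]
    note dd = arg_cong[OF d, of m11] arg_cong[OF d, of m22]
    have 1: "m11 (a ps) * ?x = z * (m11 c + signed_by s (m21 c))" "m22 (a ps) * ?x' = z * (m22 c + signed_by s (m12 c))"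
      "(m11 (b ps) + signed_by s (m12 (b ps))) * z = ?x * m11 d" "(m22 (b ps) + signed_by s (m21 (b ps))) * z = ?x' * m22 d"
      "m21 (a ps) * ?x = signed_by s (m11 (a ps) * ?x)" "m12 (a ps) * ?x' = signed_by s (m22 (a ps) * ?x')"
      using cc dd by (simp_all add: m_mult X const2_def signed_by_def algebra_simps split: if_splits)
    have Qc: "\<And>h. Q ^ N * h = h * Q ^ N" by (rule Q_power_central)
    have "(\<exists>e. m11 (a ps) * ?x = y * e)" "(\<exists>e. (m11 (b ps) + signed_by s (m12 (b ps))) * y = ?x * e)"
      "(\<exists>e. m22 (a ps) * ?x' = y * e)" "(\<exists>e. (m22 (b ps) + signed_by s (m21 (b ps))) * y = ?x' * e)"
      using unit_multiple[OF Q_Qi_power(2) Qc, of "m11 (a ps)" ?x y "m11 (b ps) + signed_by s (m12 (b ps))"]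
        unit_multiple[OF Q_Qi_power(2) Qc, of "m22 (a ps)" ?x' y "m22 (b ps) + signed_by s (m21 (b ps))"]
        1 unfolding z_def by blast+
    then show ?thesis using y 1(5,6) by blast
  qed
  then obtain s y where sy: "\<And>ps. ps \<in> P \<Longrightarrow> y ps \<in> majority_set \<and>
      (\<exists>c. m11 (a ps) * ?x = y ps * c) \<and> (\<exists>c. (m11 (b ps) + signed_by (s ps) (m12 (b ps))) * y ps = ?x * c) \<and>
      (\<exists>c. m22 (a ps) * ?x' = y ps * c) \<and> (\<exists>c. (m22 (b ps) + signed_by (s ps) (m21 (b ps))) * y ps = ?x' * c) \<and>
      m21 (a ps) * ?x = signed_by (s ps) (m11 (a ps) * ?x) \<and> m12 (a ps) * ?x' = signed_by (s ps) (m22 (a ps) * ?x')"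
    by metis
  note PP = arg_cong[OF P(2), of m11] arg_cong[OF P(2), of m22]
  show "summand ?x majority_set"
  proof (rule summandI[OF P(1), of y _ "\<lambda>ps. m11 (a ps)" _ "\<lambda>ps. m11 (b ps) + signed_by (s ps) (m12 (b ps))"])
    have "(m11 (b ps) + signed_by (s ps) (m12 (b ps))) * m11 (a ps) * ?x = m11 (b ps * a ps * ?X)" if "ps \<in> P" for ps
    proof -
      have "m21 (a ps) * ?x = signed_by (s ps) (m11 (a ps) * ?x)" using sy[OF that] by blast
      then show ?thesis by (simp add: m_mult X distrib_right mult.assoc signed_by_def)
    qed
    then show "(\<Sum>ps\<in>P. (m11 (b ps) + signed_by (s ps) (m12 (b ps))) * m11 (a ps) * ?x) = ?x"
      using PP(1) by (simp add: m_sum X)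
  qed (use sy in blast)+
  show "summand ?x' majority_set"
  proof (rule summandI[OF P(1), of y _ "\<lambda>ps. m22 (a ps)" _ "\<lambda>ps. m22 (b ps) + signed_by (s ps) (m21 (b ps))"])
    have "(m22 (b ps) + signed_by (s ps) (m21 (b ps))) * m22 (a ps) * ?x' = m22 (b ps * a ps * ?X)" if "ps \<in> P" for ps
    proof -
      have "m12 (a ps) * ?x' = signed_by (s ps) (m22 (a ps) * ?x')" using sy[OF that] by blast
      then show ?thesis by (simp add: m_mult X distrib_right mult.assoc signed_by_def)
    qed
    then show "(\<Sum>ps\<in>P. (m22 (b ps) + signed_by (s ps) (m21 (b ps))) * m22 (a ps) * ?x') = ?x'"
      using PP(2) by (simp add: m_sum X)
  qed (use sy in blast)+
qed

theorem summand_pi: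
  assumes "sum_list ms + sum_list ns = r"
  shows "\<exists>a b c d. a * xQ ms ns = sfac 0 (ms @ ns) * c \<and> b * sfac 0 (ms @ ns) = xQ ms ns * d \<and>
    b * a * xQ ms ns = xQ ms ns"
proof (cases "sum_list ms = 0")
  case True
  then have "xQ ms ns = sfac 0 (ms @ ns)" unfolding xQ_def True by (simp add: piQ_def)
  then show ?thesis by (intro exI[of _ 1]) simp
next
  case False
  then have pos: "0 < sum_list ms" by (rule neq0_conv[THEN iffD1])
  let ?x = "sfac 0 (ms @ ns)" and ?a = "sum_list ms"
  obtain N where N: "B.PP True ?a = const2 True (Qi ^ N * piQ ?a)"
    "B.PP True ?a * B.sfac 0 (ms @ ns) = const2 True (Qi ^ N * xQ ms ns)"
    by (rule PP_sfac_matrix[OF assms pos])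
  define p where "p = Qi ^ N * piQ ?a"
  define y where "y = Qi ^ N * xQ ms ns"
  have px: "p * ?x = y" "?x * p = y"
    using pi_commute(2)[OF assms pos N(1)] by (simp_all add: p_def y_def xQ_def mult.assoc)
  obtain e c where e: "e = B.PP True ?a * c" "e = c * B.PP True ?a"
    "e * B.sfac 0 (ms @ ns) = B.PP True ?a * B.sfac 0 (ms @ ns) * c" "e * B.PP True ?a = B.PP True ?a"
    by (rule B.PP_sfac_summand[OF assms])
  note e = e[unfolded N(2), unfolded N(1), folded p_def y_def]
  let ?e = "m11 e"
  have m: "m12 e = ?e" using arg_cong[OF e(2), of m11] arg_cong[OF e(2), of m12] by (simp add: m_mult const2_def)
  have ep: "(?e + ?e) * p = p" using arg_cong[OF e(4), of m11] m by (simp add: m_mult const2_def distrib_right)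
  have ex: "?e * ?x = y * (m11 c + m21 c)"
    using arg_cong[OF e(3), of m11] by (simp add: m_mult const2_def B_sfac diag_def distrib_left)
  have xy: "xQ ms ns = Q ^ N * y" "y = Qi ^ N * xQ ms ns"
    using Q_Qi_power(1)[of N] by (simp_all add: y_def flip: mult.assoc)
  have "1 * xQ ms ns = ?x * (p * Q ^ N)" using xy(1) px(2) Q_power_central[of N y] by (simp flip: mult.assoc)
  moreover have "(?e + ?e) * ?x = xQ ms ns * (Qi ^ N * ((m11 c + m21 c) + (m11 c + m21 c)))"
    using ex xy(2) Qi_power_central[of N "xQ ms ns"] by (simp add: distrib_right distrib_left flip: mult.assoc)
  moreover have "(?e + ?e) * 1 * xQ ms ns = xQ ms ns"
  proof -
    have "(?e + ?e) * y = y" using ep px(1) by (metis mult.assoc)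
    moreover have "xQ ms ns = y * Q ^ N" using xy(1) Q_power_central by simp
    ultimately show ?thesis by (simp flip: mult.assoc)
  qed
  ultimately show ?thesis by blast
qed

end

section \<open>Units of the coefficient ring\<close>

lemma gpoly_nonzero: "gpoly r \<noteq> 0"
proof -
  have "poly (gpoly r) 1 \<noteq> 0" by (simp add: gpoly_def poly_prod)
  then show ?thesis by auto
qed

lemma to_fract_in_Zloc: "to_fract p \<in> Zloc r"
  unfolding Zloc_def by (rule CollectI, rule exI[of _ p], rule exI[of _ 0], rule exI[of _ 0]) simp

lemma Zloc_inverse:
  assumes "p dvd qv ^ m * gpoly r ^ n"
  obtains x where "x \<in> Zloc r" "x * to_fract p = 1"
proof -
  let ?d = "qv ^ m * gpoly r ^ n"
  obtain e where e: "?d = p * e" using assms by blast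
  have "?d \<noteq> 0" using gpoly_nonzero[of r] by simp
  then have "to_fract ?d \<noteq> 0" by (simp only: to_fract_eq_0_iff not_False_eq_True)
  moreover have "to_fract e * to_fract p = to_fract ?d" unfolding e by (simp add: mult.commute)
  ultimately have "to_fract e / to_fract ?d * to_fract p = 1" by (metis divide_self_if times_divide_eq_left)
  moreover have "to_fract e / to_fract ?d \<in> Zloc r" unfolding Zloc_def by blast
  ultimately show ?thesis using that by blast
qed

lemma Zloc_algebra_units:
  assumes \<phi>: "Zloc_algebra r \<phi>" and q: "q = \<phi> (to_fract qv)"
  shows "\<exists>y. y * q = 1" and "j < r \<Longrightarrow> \<exists>y. y * (1 + q ^ j) = 1"
proof -
  have one: "\<phi> 1 = 1" and add: "\<phi> (x + y) = \<phi> x + \<phi> y" and mult: "\<phi> (x * y) = \<phi> x * \<phi> y"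
    if "x \<in> Zloc r" "y \<in> Zloc r" for x y
    using \<phi> that unfolding Zloc_algebra_def by blast+
  have one: "\<phi> 1 = 1" using \<phi> unfolding Zloc_algebra_def by blast
  have inv: "\<exists>y. y * \<phi> (to_fract p) = 1" if p: "p dvd qv ^ m * gpoly r ^ n" for p m n
  proof -
    obtain x where "x \<in> Zloc r" "x * to_fract p = 1" by (rule Zloc_inverse[OF p])
    then have "\<phi> x * \<phi> (to_fract p) = 1" using mult[OF _ to_fract_in_Zloc] one by metis
    then show ?thesis by blast
  qed
  show "\<exists>y. y * q = 1" using inv[of qv 1 0] by (simp add: q)
  have pow: "\<phi> (to_fract (qv ^ i)) = q ^ i" for i
  proof (induction i)
    case (Suc i)
    have "\<phi> (to_fract (qv ^ Suc i)) = \<phi> (to_fract qv * to_fract (qv ^ i))" by (simp only: power_Suc to_fract_mult)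
    then show ?case using Suc mult[OF to_fract_in_Zloc to_fract_in_Zloc] by (simp add: q)
  qed (simp add: one)
  assume j: "j < r"
  have "(1 + qv ^ j) dvd gpoly r"
  proof (cases "j = 0")
    case True
    then show ?thesis by (simp add: gpoly_def)
  next
    case False
    then have "(qv ^ j + 1) dvd (\<Prod>j = 1..r - 1. qv ^ j + 1)" using j by (intro dvd_prodI) auto
    then show ?thesis unfolding gpoly_def by (simp only: add.commute[of 1] dvd_mult)
  qed
  then obtain y where "y * \<phi> (to_fract (1 + qv ^ j)) = 1" using inv[of "1 + qv ^ j" 0 1] by auto
  moreover have "\<phi> (to_fract (1 + qv ^ j)) = 1 + q ^ j"
    using add[OF to_fract_in_Zloc to_fract_in_Zloc, of 1 "qv ^ j"] pow[of j] pow[of 0] by simp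
  ultimately show "\<exists>y. y * (1 + q ^ j) = 1" by auto
qed

section \<open>The equivalences\<close>

lemma finite_Pi2: "finite (Pi2 r)"
proof (rule finite_subset)
  let ?L = "{l :: nat list. set l \<subseteq> {..r} \<and> length l = r}"
  show "Pi2 r \<subseteq> ?L \<times> ?L"
    unfolding Pi2_def compositions_def by (auto dest: member_le_sum_list)
  show "finite (?L \<times> ?L)" by (intro finite_cartesian_product finite_lists_length_eq) auto
qed

lemma finite_Ix25: "finite (Ix25 r)"
  unfolding Ix25_def Pi1B_def using finite_Pi2[of r] by simp

text \<open>The parts of a composition of \<open>r\<close> that are not zero, followed by zeros up to length \<open>r\<close>.\<close>

definition squeeze :: "nat \<Rightarrow> nat list \<Rightarrow> nat list" where
  "squeeze r ms = filter (\<lambda>m. m \<noteq> 0) ms @ replicate (r - length (filter (\<lambda>m. m \<noteq> 0) ms)) 0"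

lemma sum_list_filter: "sum_list (filter (\<lambda>m. m \<noteq> 0) ms) = sum_list (ms :: nat list)"
  by (induction ms) auto

lemma squeeze:
  assumes "sum_list ms = r"
  shows "sum_list (squeeze r ms) = r" "length (squeeze r ms) = r"
proof -
  have "length (filter (\<lambda>m. m \<noteq> 0) ms) \<le> sum_list ms" by (induction ms) auto
  then show "sum_list (squeeze r ms) = r" "length (squeeze r ms) = r"
    using assms sum_list_filter[of ms] by (simp_all add: squeeze_def sum_list_replicate)
qed

lemma (in hecke_A) sfac_squeeze: "sfac k (squeeze n ms) = sfac k ms"
  unfolding squeeze_def by (rule sfac_filter)

lemma (in hecke_A) sfac_zeros: "sfac k (replicate n 0 @ ms) = sfac k ms"
  using sfac_filter[of k "replicate n 0 @ ms" 0] sfac_filter[of k ms 0] by simp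

lemma hecke_algebra_std_basis:
  assumes r: "2 \<le> r" and H: "hecke_algebra (gens_D r) q sc T" and qi: "qi * q = 1"
    and u: "\<And>j. j < r \<Longrightarrow> \<exists>y. y * (1 + q ^ j) = 1"
  shows "std_basis_units r (sc q 1) (sc qi 1) T" "sc q 1 ^ n = sc (q ^ n) 1"
proof -
  interpret H: hecke_algebra "gens_D r" q sc T by (rule H)
  show pow: "sc q 1 ^ n = sc (q ^ n) 1" for n
    by (induction n) (simp_all add: H.sc_one H.sc_mult_left H.sc_sc)
  have inv: "sc a 1 * sc b 1 = 1" "sc b 1 * sc a 1 = 1" if "a * b = 1" for a b
    using that by (simp_all add: H.sc_mult_left H.sc_sc H.sc_one mult.commute)
  show "std_basis_units r (sc q 1) (sc qi 1) T"
  proof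
    show "2 \<le> r" by (rule r)
    show "sc qi 1 * sc q 1 = 1" "sc q 1 * sc qi 1 = 1" using inv[OF qi] by auto
    show "sc q 1 * h = h * sc q 1" for h by (simp add: H.sc_mult_left H.sc_mult_right)
    show "T 1 = 1" by (rule H.T_one)
    show "T s * T w = T (s * w)" if "s \<in> gens_D r" "w \<in> generated (gens_D r)"
      "word_length (gens_D r) w < word_length (gens_D r) (s * w)" for s w using that by (rule H.T_mult)
    show "T s * T s = (sc q 1 - 1) * T s + sc q 1" if "s \<in> gens_D r" for s
    proof -
      have "sc (q - 1) (T s) + sc 1 (T s) = sc q (T s)" by (simp flip: H.sc_add_left)
      then have "sc (q - 1) (T s) = sc q (T s) - T s" by (simp add: H.sc_one eq_diff_eq)
      then show ?thesis using H.T_square[OF that] by (simp add: left_diff_distrib H.sc_mult_left)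
    qed
    show "is_unit_elt (1 + sc q 1 ^ j)" if j: "j < r" for j
    proof -
      obtain y where "y * (1 + q ^ j) = 1" using u[OF j] by blast
      moreover have "1 + sc q 1 ^ j = sc (1 + q ^ j) 1" by (simp add: pow H.sc_add_left H.sc_one)
      ultimately show ?thesis using inv[of y "1 + q ^ j"] unfolding is_unit_elt_def by auto
    qed
  qed
qed

theorem theorem3p7:
  fixes r :: nat
    and \<phi> :: "int poly fract \<Rightarrow> 'c::{comm_ring,comm_monoid_mult}"
    and q :: 'c
    and sc :: "'c \<Rightarrow> 'h::{ring,monoid_mult} \<Rightarrow> 'h"
    and T :: "int perm \<Rightarrow> 'h"
  assumes "r \<ge> 4"
    and "Zloc_algebra r \<phi>"
    and "q = \<phi> (to_fract qv)"
    and "hecke_algebra (gens_D r) q sc T"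
    and "infinite (UNIV :: 'u set)"
  shows "morita_equivalent TYPE('u) (q_schur (Ix25 r) r q sc T) (q_schur (Ix15 r) r q sc T) \<and>
         morita_equivalent TYPE('u) (q_schur (Ix1D r) r q sc T) (q_schur (Ix15 r) r q sc T)"
proof -
  interpret H: hecke_algebra "gens_D r" q sc T by (rule assms(4))
  obtain qi where qi: "qi * q = 1" using Zloc_algebra_units(1)[OF assms(2,3)] by blast
  have r: "2 \<le> r" using assms(1) by simp
  note std = hecke_algebra_std_basis[OF r assms(4) qi Zloc_algebra_units(2)[OF assms(2,3)]]
  interpret D: std_basis_units r "sc q 1" "sc qi 1" T by (rule std(1))
  interpret F: std_basis r "sc q 1" "sc qi 1" "\<lambda>w. T (flip_D w)" by (rule D.flipped)
  let ?x = "x_elt r q sc T"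
  have pi: "pi_elt q sc T a = D.piQ a" for a
    unfolding pi_elt_def D.piQ_def by (simp add: std(2))
  have xl: "?x (Inl (ms, ns)) = D.xQ ms ns" if "sum_list ms + sum_list ns = r" for ms ns
    using that D.sum_young[of "ms @ ns"] by (simp add: pi D.xQ_def)
  have xr: "?x (Inr (ms, ns)) = F.sfac 0 (ms @ ns)" if "sum_list ms + sum_list ns = r" for ms ns
    using that F.sum_young[of "ms @ ns"] by (simp add: sum.reindex[OF inj_flip] comp_def)
  have in_Pi2: "(ms, ns) \<in> Pi2 r \<longleftrightarrow> length ms = r \<and> length ns = r \<and> sum_list ms + sum_list ns = r" for ms ns
    by (auto simp: Pi2_def compositions_def)
  have maj: "D.majority_set \<subseteq> ?x ` Ix15 r"
  proof
    fix y assume "y \<in> D.majority_set"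
    then obtain ms ns where y: "y = D.xQ ms ns" and l: "length ms = r" "length ns = r"
      "sum_list ms + sum_list ns = r" "sum_list ns \<le> sum_list ms" unfolding D.majority_set_def by blast
    have "Inl (ms, ns) \<in> Ix15 r" using l by (simp add: Ix15_def in_Pi2)
    then show "y \<in> ?x ` Ix15 r" using y xl[OF l(3)] by (metis image_eqI)
  qed
  have mono: "summand x Y \<Longrightarrow> Y \<subseteq> Y' \<Longrightarrow> summand x Y'" for x :: 'h and Y Y'
    unfolding summand_def by fast
  have young: "summand (D.sfac 0 ms) (?x ` Ix15 r) \<and> summand (F.sfac 0 ms) (?x ` Ix15 r)"
    if "sum_list ms = r" for ms
    using mono[OF D.summand_majority(1)[OF squeeze[OF that]] maj] mono[OF D.summand_majority(2)[OF squeeze[OF that]] maj]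
    by (simp add: D.sfac_squeeze F.sfac_squeeze)
  have young': "summand (D.sfac 0 ms) (?x ` Ix1D r)" if ms: "sum_list ms = r" for ms
  proof (rule summand_refl)
    let ?bc = "(replicate r (0 :: nat), squeeze r ms)"
    have "?bc \<in> Pi1B r" using squeeze[OF ms] by (simp add: Pi1B_def in_Pi2 sum_list_replicate)
    then have "Inl ?bc \<in> Ix1D r" by (simp add: Ix1D_def)
    moreover have "?x (Inl ?bc) = D.sfac 0 ms"
      using squeeze[OF ms] by (subst xl) (simp_all add: D.xQ_def D.piQ_def sum_list_replicate D.sfac_zeros D.sfac_squeeze)
    ultimately show "D.sfac 0 ms \<in> ?x ` Ix1D r" by (metis image_eqI)
  qed
  have from_young: "summand (?x (Inl (ms, ns))) Y"
    if "(ms, ns) \<in> Pi2 r" "summand (D.sfac 0 (ms @ ns)) Y" for ms ns Y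
  proof -
    have s: "sum_list ms + sum_list ns = r" using that(1) in_Pi2 by blast
    obtain a b c d where "a * D.xQ ms ns = D.sfac 0 (ms @ ns) * c" "b * D.sfac 0 (ms @ ns) = D.xQ ms ns * d"
      "b * a * D.xQ ms ns = D.xQ ms ns" using D.summand_pi[OF s] by blast
    then show ?thesis unfolding xl[OF s] using that(2) by (rule summand_trans)
  qed
  have Ix25: "summand (?x \<kappa>) (?x ` Ix15 r) \<and> summand (?x \<kappa>) (?x ` Ix1D r)" if \<kappa>: "\<kappa> \<in> Ix25 r" for \<kappa>
  proof (cases \<kappa>)
    case (Inl bc)
    obtain ms ns where bc: "bc = (ms, ns)" by (cases bc)
    have l: "(ms, ns) \<in> Pi2 r" using \<kappa> Inl bc by (auto simp: Ix25_def)
    then have "sum_list (ms @ ns) = r" using in_Pi2 by simp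
    then show ?thesis unfolding Inl bc using from_young[OF l] young young' by blast
  next
    case (Inr bc)
    obtain ms ns where bc: "bc = (ms, ns)" by (cases bc)
    have l: "(ms, ns) \<in> Pi1B r" using \<kappa> Inr bc by (auto simp: Ix25_def)
    then have s: "sum_list ms + sum_list ns = r" using in_Pi2 by (simp add: Pi1B_def)
    have "Inr (ms, ns) \<in> Ix1D r" using l by (simp add: Ix1D_def)
    then have "summand (?x \<kappa>) (?x ` Ix1D r)" unfolding Inr bc by (intro summand_refl imageI)
    then show ?thesis unfolding Inr bc using young[of "ms @ ns"] s xr[OF s] by simp
  qed
  have sub: "Ix15 r \<subseteq> Ix25 r" "Ix1D r \<subseteq> Ix25 r"
    by (auto simp: Ix15_def Ix25_def Ix1D_def Pi1B_def)
  interpret I: ideal_sums sc ?x "Ix25 r"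
    by unfold_locales (simp_all add: H.sc_mult_left H.sc_mult_right finite_Ix25)
  show ?thesis unfolding q_schur_def
  proof
    show "morita_equivalent TYPE('u) (I.EA (Ix25 r)) (I.EA (Ix15 r))"
      using Ix25 sub(1) by (intro I.morita_End assms(5)) (auto intro: summand_refl)
    show "morita_equivalent TYPE('u) (I.EA (Ix1D r)) (I.EA (Ix15 r))"
      using Ix25 sub by (intro I.morita_End assms(5)) auto
  qed
qed

end
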